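(* Let $\mathbf k$ be a field of characteristic $0$ and $n>1$. Let $$\Omega=\Omega(z,z^* )=\frac{\sum_{\nu=1}^n(-1)^{\nu-1}z^*_\nu\,dz^*_1\wedge\cdots\wedge\widehat{dz^*_\nu}\wedge\cdots\wedge dz^*_n}{(zz^* )^n}\in A^{n-1}_{[n]}$$ be the Martinelli-Bochner form. (a) The class of $\Omega$ in $H^{n-1}(A^\bullet_{[n]})=H^{n-1}(\mathbb A^n-\{0\},\mathcal O)$ is a generator of the 1-dimensional subspace spanned by $z_1^{-1}\cdots z_n^{-1}$, of weight $(-1,\dots,-1)$ under the coordinate torus. (b) The top degree part $A^{n-1}_{[n]}$ contains precisely one 1-dimensional irreducible representation of $GL_n$, which is $\Sigma^{-1,\dots,-1}(V)=\Lambda^n(V^* )$. This subspace is spanned by $\Omega(z,z^* )$. (c) Every element of $H^{n-1}(A^\bullet_{[n]})$ can be represented as the class of a "multipole" $P(\partial_{z_1},\dots,\partial_{z_n})\,\Omega(z,z^* )$ for a unique polynomial $P(y_1,\dots,y_n)\in\mathbf k[y_1,\dots,y_n]$.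
   Context: $z_1,\dots,z_n$ are coordinates on $\mathbb A^n$, $z_1^*,\dots,z_n^*$ dual coordinates, $zz^*=\sum z_\nu z^*_\nu$; $V$ is the span of $z_1,\dots,z_n$ and $GL_n=GL(V)$ (the $z^*_\nu$ transform as the dual basis). $A_{[n]}^m$ is the space of forms $\sum f_{i_1,\dots,i_m}(z,z^* )\,dz^*_{i_1}\cdots dz^*_{i_m}$ with $f_{i_1,\dots,i_m}\in\mathbf k[z,z^*][(zz^* )^{-1}]$, of total degree $0$ in $(z^*,dz^* )$ and annihilated by contraction with $\sum z_\nu^*\partial/\partial z_\nu^*$. With $\bar\partial=\sum dz^*_\nu\,\partial/\partial z^*_\nu$, $A_{[n]}^\bullet$ is a commutative dg-algebra model of $R\Gamma(\mathbb A^n-\{0\},\mathcal O)$. The operators $\partial_{z_\nu}=\partial/\partial z_\nu$ act on coefficients. By the Čech computation with the covering $\{z_i\ne0\}$, for $n>1$ one has $H^{n-1}(\mathbb A^n-\{0\},\mathcal O)=z_1^{-1}\cdots z_n^{-1}\mathbf k[z_1^{-1},\dots,z_n^{-1}]$. $\Sigma^\alpha(V)$ is the irreducible representation of $GL(V)$ with highest weight $\alpha$. *)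

theory Defs
  imports
    "HOL-Library.Poly_Mapping"
    "HOL-Library.Function_Algebras"
    "HOL-Computational_Algebra.Fraction_Field"
    "HOL-Analysis.Determinants"
begin

text \<open>
  The coordinates are indexed by a finite linearly ordered type \<^typ>\<open>'n\<close>, so \<open>n = CARD('n)\<close> and the
  order is the order of the indices \<open>1, \<dots>, n\<close>. All rings of functions are realised inside the
  field of rational functions in the \<open>z\<^sub>\<nu>\<close> (\<open>Z \<nu>\<close>) and the \<open>z\<^sup>*\<^sub>\<nu>\<close> (\<open>Zs \<nu>\<close>).
\<close>

section \<open>Rational functions in the variables z and z*\<close>

datatype 'n var = Z 'n | Zs 'n

text \<open>The order on variables only serves to make polynomials an integral domain.\<close>

instantiation var :: (linorder) linorder
begin

fun less_eq_var :: "'a var \<Rightarrow> 'a var \<Rightarrow> bool" where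
  "Z i \<le> Z j \<longleftrightarrow> i \<le> j"
| "Z i \<le> Zs j \<longleftrightarrow> True"
| "Zs i \<le> Z j \<longleftrightarrow> False"
| "Zs i \<le> Zs j \<longleftrightarrow> i \<le> j"

definition less_var :: "'a var \<Rightarrow> 'a var \<Rightarrow> bool" where
  "x < y \<longleftrightarrow> x \<le> y \<and> \<not> y \<le> (x::'a var)"

instance
proof
  fix x y z :: "'a var"
  show "x < y \<longleftrightarrow> x \<le> y \<and> \<not> y \<le> x" by (rule less_var_def)
  show "x \<le> x" by (cases x) auto
  show "x \<le> y \<Longrightarrow> y \<le> z \<Longrightarrow> x \<le> z" by (cases x; cases y; cases z) auto
  show "x \<le> y \<Longrightarrow> y \<le> x \<Longrightarrow> x = y" by (cases x; cases y) auto
  show "x \<le> y \<or> y \<le> x" by (cases x; cases y) auto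
qed

end

type_synonym ('v, 'k) mpol = "('v \<Rightarrow>\<^sub>0 nat) \<Rightarrow>\<^sub>0 'k"
type_synonym ('n, 'k) ratfun = "('n var, 'k) mpol fract"

definition pvar :: "'v \<Rightarrow> ('v, 'k::comm_ring_1) mpol" where
  "pvar v = Poly_Mapping.single (Poly_Mapping.single v 1) 1"

definition of_mpol :: "('n::linorder var, 'k::idom) mpol \<Rightarrow> ('n, 'k) ratfun" where
  "of_mpol p = Fraction_Field.Fract p 1"

definition const :: "'k::idom \<Rightarrow> ('n::linorder, 'k) ratfun" where
  "const c = of_mpol (Poly_Mapping.single 0 c)"

definition zvar :: "'n::linorder \<Rightarrow> ('n, 'k::idom) ratfun" where
  "zvar i = of_mpol (pvar (Z i))"

definition zsvar :: "'n::linorder \<Rightarrow> ('n, 'k::idom) ratfun" where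
  "zsvar i = of_mpol (pvar (Zs i))"

definition zzs :: "('n::{finite,linorder}, 'k::idom) ratfun" where
  "zzs = (\<Sum>i\<in>UNIV. zvar i * zsvar i)"

subsection \<open>Partial derivatives\<close>

definition pderiv_mpol :: "'v \<Rightarrow> ('v, 'k::comm_ring_1) mpol \<Rightarrow> ('v, 'k) mpol" where
  "pderiv_mpol v p = (\<Sum>m\<in>Poly_Mapping.keys p.
     Poly_Mapping.single (m - Poly_Mapping.single v 1)
       (of_nat (Poly_Mapping.lookup m v) * Poly_Mapping.lookup p m))"

lemma pderiv_mpol_superset:
  assumes "finite S" "Poly_Mapping.keys p \<subseteq> S"
  shows "pderiv_mpol v p = (\<Sum>m\<in>S.
     Poly_Mapping.single (m - Poly_Mapping.single v 1)
       (of_nat (Poly_Mapping.lookup m v) * Poly_Mapping.lookup p m))"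
  unfolding pderiv_mpol_def using assms
  by (intro sum.mono_neutral_left) (auto simp: in_keys_iff)

lemma pderiv_mpol_add: "pderiv_mpol v (p + q) = pderiv_mpol v p + pderiv_mpol v q"
proof -
  let ?S = "Poly_Mapping.keys p \<union> Poly_Mapping.keys q"
  have "Poly_Mapping.keys (p + q) \<subseteq> ?S" by (rule Poly_Mapping.keys_add)
  then show ?thesis
    by (simp add: pderiv_mpol_superset[of ?S] lookup_add distrib_left single_add sum.distrib)
qed

lemma pderiv_mpol_single:
  "pderiv_mpol v (Poly_Mapping.single m c) =
     Poly_Mapping.single (m - Poly_Mapping.single v 1) (of_nat (Poly_Mapping.lookup m v) * c)"
  by (cases "c = 0") (simp_all add: pderiv_mpol_def)

lemma mpol_induct [case_names zero single add]:
  fixes p :: "('v, 'k::comm_ring_1) mpol"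
  assumes "P 0" "\<And>m c. P (Poly_Mapping.single m c)" "\<And>p q. P p \<Longrightarrow> P q \<Longrightarrow> P (p + q)"
  shows "P p"
proof (induction p rule: update_induct)
  case const
  show ?case by (rule assms(1))
next
  case (update p m c)
  have "Poly_Mapping.update m c p = Poly_Mapping.single m c + p"
    using update by (intro poly_mapping_eqI)
      (auto simp: lookup_update lookup_add lookup_single when_def in_keys_iff)
  then show ?case using assms update by auto
qed

lemma pderiv_mpol_0 [simp]: "pderiv_mpol v 0 = 0"
  by (simp add: pderiv_mpol_def)

lemma pderiv_mpol_mult_single:
  fixes c d :: "'k::comm_ring_1"
  shows "pderiv_mpol v (Poly_Mapping.single m c * Poly_Mapping.single l d) =
    pderiv_mpol v (Poly_Mapping.single m c) * Poly_Mapping.single l d +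
    Poly_Mapping.single m c * pderiv_mpol v (Poly_Mapping.single l d)"
proof -
  let ?e = "Poly_Mapping.single v (1::nat)"
  have eq: "a + b - ?e = a - ?e + b" if "Poly_Mapping.lookup a v \<noteq> 0" for a b :: "'a \<Rightarrow>\<^sub>0 nat"
    using that by (intro poly_mapping_eqI)
      (auto simp: lookup_add lookup_minus lookup_single when_def)
  have 1: "Poly_Mapping.single (m + l - ?e) (c * (of_nat (Poly_Mapping.lookup m v) * d)) =
      Poly_Mapping.single (m - ?e + l) (c * (of_nat (Poly_Mapping.lookup m v) * d))"
    by (cases "Poly_Mapping.lookup m v = 0") (simp_all add: eq del: One_nat_def)
  have 2: "Poly_Mapping.single (m + l - ?e) (c * (of_nat (Poly_Mapping.lookup l v) * d)) =
      Poly_Mapping.single (m + (l - ?e)) (c * (of_nat (Poly_Mapping.lookup l v) * d))"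
    using eq[of l m] by (cases "Poly_Mapping.lookup l v = 0") (simp_all add: add.commute del: One_nat_def)
  show ?thesis
    using 1 2 by (simp add: pderiv_mpol_single mult_single lookup_add ring_distribs single_add
        mult.assoc mult.left_commute)
qed

lemma pderiv_mpol_mult: "pderiv_mpol v (p * q) = pderiv_mpol v p * q + p * pderiv_mpol v q"
proof (induction p rule: mpol_induct)
  case (single m c)
  show ?case
  proof (induction q rule: mpol_induct)
    case (single l d)
    show ?case by (rule pderiv_mpol_mult_single)
  qed (simp_all add: pderiv_mpol_add ring_distribs)
qed (simp_all add: pderiv_mpol_add ring_distribs)

lift_definition pd :: "'n var \<Rightarrow> ('n::linorder, 'k::idom) ratfun \<Rightarrow> ('n, 'k) ratfun"
  is "\<lambda>v x. (pderiv_mpol v (fst x) * snd x - fst x * pderiv_mpol v (snd x), snd x * snd x)"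
proof -
  fix v :: "'n var" and x y :: "('n var, 'k) mpol \<times> ('n var, 'k) mpol"
  assume "fractrel x y"
  moreover obtain a b c d where xy: "x = (a, b)" "y = (c, d)" by (cases x, cases y)
  ultimately have nz: "b \<noteq> 0" "d \<noteq> 0" and eq: "a * d = c * b" by auto
  let ?D = "pderiv_mpol v"
  have D: "?D a * d + a * ?D d = ?D c * b + c * ?D b"
    using arg_cong[OF eq, of ?D] by (simp add: pderiv_mpol_mult)
  have "(?D a * b - a * ?D b) * (d * d) - (?D c * d - c * ?D d) * (b * b)
    = b * d * (?D a * d + a * ?D d - ?D c * b - c * ?D b)
      - (a * d - c * b) * (b * ?D d + d * ?D b)"
    by (simp add: algebra_simps)
  also have "\<dots> = 0" using D eq by (simp add: algebra_simps)
  finally show "fractrel (?D (fst x) * snd x - fst x * ?D (snd x), snd x * snd x)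
      (?D (fst y) * snd y - fst y * ?D (snd y), snd y * snd y)"
    using nz by (simp add: xy)
qed

subsection \<open>Rings of functions\<close>

definition zs_homogeneous :: "nat \<Rightarrow> ('n::finite var, 'k::comm_ring_1) mpol \<Rightarrow> bool" where
  "zs_homogeneous e p \<longleftrightarrow>
     (\<forall>m\<in>Poly_Mapping.keys p. (\<Sum>i\<in>UNIV. Poly_Mapping.lookup m (Zs i)) = e)"

text \<open>
  \<open>coeffs I d\<close> is the part of degree \<open>d\<close> in \<open>z\<^sup>*\<close> of the localisation of
  \<open>k[z,z\<^sup>*][(zz\<^sup>*)\<^sup>-\<^sup>1]\<close> at the \<open>z\<^sub>i\<close>, \<open>i \<in> I\<close>.
\<close>

definition coeffs :: "'n::{finite,linorder} set \<Rightarrow> int \<Rightarrow> ('n, 'k::idom) ratfun set" where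
  "coeffs I d = {of_mpol p / (zzs ^ N * (\<Prod>i\<in>I. zvar i) ^ M) | p N M e.
     zs_homogeneous e p \<and> int e = int N + d}"

text \<open>Regular functions on \<open>{z\<^sub>i \<noteq> 0 for all i \<in> I}\<close> in affine space, i.e. \<open>k[z][z\<^sub>i\<^sup>-\<^sup>1, i \<in> I]\<close>.\<close>

definition regular :: "'n::{finite,linorder} set \<Rightarrow> ('n, 'k::idom) ratfun set" where
  "regular I = {of_mpol p / (\<Prod>i\<in>I. zvar i) ^ M | p M. zs_homogeneous 0 p}"

section \<open>Differential forms in the dz*\<close>

text \<open>\<open>\<omega> J\<close> is the coefficient of the product of the \<open>dz\<^sup>*\<^sub>j\<close>, \<open>j \<in> J\<close>, taken in increasing order.\<close>

type_synonym ('n, 'k) form = "'n set \<Rightarrow> ('n, 'k) ratfun"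

definition scale :: "'k::idom \<Rightarrow> ('n::linorder, 'k) form \<Rightarrow> ('n, 'k) form" where
  "scale c \<omega> = (\<lambda>J. const c * \<omega> J)"

lemma const_simps:
  "const (a + b) = const a + const b" "const (a * b) = const a * const b" "const 1 = 1"
  by (simp_all add: const_def of_mpol_def single_add mult_single One_fract_def)

global_interpretation form: vector_space "scale :: 'k::field \<Rightarrow> ('n::linorder, 'k) form \<Rightarrow> _"
  by standard (auto simp: scale_def fun_eq_iff const_simps algebra_simps)

definition dzs :: "'n set \<Rightarrow> ('n::linorder, 'k::idom) form" where
  "dzs J = (\<lambda>I. if I = J then 1 else 0)"

definition wedge :: "('n::linorder, 'k::idom) form \<Rightarrow> ('n, 'k) form \<Rightarrow> ('n, 'k) form" where
  "wedge \<alpha> \<beta> = (\<lambda>J. \<Sum>I\<in>Pow J.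
     (-1) ^ card {(a, b). a \<in> I \<and> b \<in> J - I \<and> b < a} * (\<alpha> I * \<beta> (J - I)))"

definition dbar :: "('n::{finite,linorder}, 'k::idom) form \<Rightarrow> ('n, 'k) form" where
  "dbar \<omega> = (\<Sum>\<nu>\<in>UNIV. wedge (dzs {\<nu>}) (\<lambda>J. pd (Zs \<nu>) (\<omega> J)))"

text \<open>Contraction with the vector field \<open>\<Sum> z\<^sup>*\<^sub>\<nu> \<partial>/\<partial>z\<^sup>*\<^sub>\<nu>\<close>.\<close>

definition contraction :: "('n::{finite,linorder}, 'k::idom) form \<Rightarrow> ('n, 'k) form" where
  "contraction \<omega> = (\<lambda>J. \<Sum>\<nu>\<in>-J. (-1) ^ card {j\<in>J. j < \<nu>} * (zsvar \<nu> * \<omega> (insert \<nu> J)))"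

text \<open>
  \<open>A_loc I m\<close> is the localisation of \<open>A\<^sup>m\<close> (\<open>A_forms m\<close>) at the \<open>z\<^sub>i\<close>, \<open>i \<in> I\<close>. Total degree 0 in
  \<open>(z\<^sup>*, dz\<^sup>*)\<close> means that the coefficients of an \<open>m\<close>-form have degree \<open>-m\<close> in \<open>z\<^sup>*\<close>.
\<close>

definition A_loc :: "'n::{finite,linorder} set \<Rightarrow> nat \<Rightarrow> ('n, 'k::idom) form set" where
  "A_loc I m = {\<omega>. (\<forall>J. card J = m \<longrightarrow> \<omega> J \<in> coeffs I (- int m)) \<and>
     (\<forall>J. card J \<noteq> m \<longrightarrow> \<omega> J = 0) \<and> contraction \<omega> = 0}"

abbreviation A_forms :: "nat \<Rightarrow> ('n::{finite,linorder}, 'k::idom) form set" where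
  "A_forms m \<equiv> A_loc {} m"

definition Omega :: "('n::{finite,linorder}, 'k::idom) form" where
  "Omega = (\<Sum>\<nu>\<in>UNIV. (\<lambda>J.
     (-1) ^ card {i. i < \<nu>} * zsvar \<nu> / zzs ^ CARD('n) * dzs (- {\<nu>}) J))"

text \<open>The operator \<open>P(\<partial>\<^sub>z)\<close>, acting on coefficients.\<close>

definition pd_monomial ::
    "('n \<Rightarrow>\<^sub>0 nat) \<Rightarrow> ('n::{finite,linorder}, 'k::idom) ratfun \<Rightarrow> ('n, 'k) ratfun" where
  "pd_monomial m f = foldr (\<lambda>i. pd (Z i) ^^ Poly_Mapping.lookup m i) (sorted_list_of_set UNIV) f"

definition diff_op ::
    "('n, 'k) mpol \<Rightarrow> ('n::{finite,linorder}, 'k::idom) form \<Rightarrow> ('n, 'k) form" where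
  "diff_op P \<omega> = (\<lambda>J. \<Sum>m\<in>Poly_Mapping.keys P.
     const (Poly_Mapping.lookup P m) * pd_monomial m (\<omega> J))"

section \<open>Cohomology\<close>

text \<open>Cohomology groups are sets of cosets of the subspace of coboundaries.\<close>

definition coset :: "'a::plus set \<Rightarrow> 'a \<Rightarrow> 'a set" where
  "coset B x = (+) x ` B"

fun coboundaries :: "('a::zero \<Rightarrow> 'a) \<Rightarrow> (nat \<Rightarrow> 'a set) \<Rightarrow> nat \<Rightarrow> 'a set" where
  "coboundaries d C 0 = {0}"
| "coboundaries d C (Suc m) = d ` C m"

definition cocycles :: "('a::zero \<Rightarrow> 'a) \<Rightarrow> (nat \<Rightarrow> 'a set) \<Rightarrow> nat \<Rightarrow> 'a set" where
  "cocycles d C m = {x \<in> C m. d x = 0}"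

definition cohomology :: "('a::{zero,plus} \<Rightarrow> 'a) \<Rightarrow> (nat \<Rightarrow> 'a set) \<Rightarrow> nat \<Rightarrow> 'a set set" where
  "cohomology d C m = coset (coboundaries d C m) ` cocycles d C m"

abbreviation A_class :: "nat \<Rightarrow> ('n::{finite,linorder}, 'k::idom) form \<Rightarrow> ('n, 'k) form set" where
  "A_class m \<equiv> coset (coboundaries dbar A_forms m)"

subsection \<open>The \v{C}ech complex of the covering by the sets where a coordinate is nonzero\<close>

text \<open>
  A cochain assigns to each \<open>I\<close> a section over \<open>{z\<^sub>i \<noteq> 0 for all i \<in> I}\<close>; in degree \<open>p\<close> it is
  supported on the \<open>I\<close> with \<open>p + 1\<close> elements.
\<close>

definition cech_d :: "('n::{finite,linorder} set \<Rightarrow> 'a::ab_group_add) \<Rightarrow> 'n set \<Rightarrow> 'a" where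
  "cech_d f = (\<lambda>I. \<Sum>i\<in>I. if even (card {j\<in>I. j < i}) then f (I - {i}) else - f (I - {i}))"

definition cech :: "nat \<Rightarrow> ('n::{finite,linorder} set \<Rightarrow> ('n, 'k::idom) ratfun) set" where
  "cech p = {f. \<forall>I. if card I = Suc p then f I \<in> regular I else f I = 0}"

abbreviation cech_class ::
    "nat \<Rightarrow> ('n::{finite,linorder} set \<Rightarrow> ('n, 'k::idom) ratfun) \<Rightarrow>
     ('n set \<Rightarrow> ('n, 'k) ratfun) set" where
  "cech_class p \<equiv> coset (coboundaries cech_d cech p)"

text \<open>The cochain \<open>c z\<^sub>1\<^sup>-\<^sup>1 \<dots> z\<^sub>n\<^sup>-\<^sup>1\<close> of degree \<open>n - 1\<close>.\<close>

definition inv_z_cochain :: "'k \<Rightarrow> 'n::{finite,linorder} set \<Rightarrow> ('n, 'k::idom) ratfun" where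
  "inv_z_cochain c = (\<lambda>I. if I = UNIV then const c * (\<Prod>i\<in>UNIV. inverse (zvar i)) else 0)"

subsection \<open>The identification of the cohomology of A with \v{C}ech cohomology\<close>

text \<open>
  The total complex of the \v{C}ech complex with coefficients in \<open>A\<close> receives quasi-isomorphisms
  from \<open>A\<close> (restriction to the open sets) and from the \v{C}ech complex of regular functions
  (inclusion as 0-forms). Classes are identified when their images agree.
\<close>

definition tot :: "nat \<Rightarrow> ('n::{finite,linorder} set \<Rightarrow> ('n, 'k::idom) form) set" where
  "tot m = {c. \<forall>I. if I \<noteq> {} \<and> card I \<le> Suc m then c I \<in> A_loc I (Suc m - card I) else c I = 0}"

definition tot_d ::
    "('n::{finite,linorder} set \<Rightarrow> ('n, 'k::idom) form) \<Rightarrow> 'n set \<Rightarrow> ('n, 'k) form" where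
  "tot_d c = cech_d c + (\<lambda>I. if odd (card I) then dbar (c I) else - dbar (c I))"

definition of_A :: "('n::{finite,linorder}, 'k::idom) form \<Rightarrow> 'n set \<Rightarrow> ('n, 'k) form" where
  "of_A \<omega> = (\<lambda>I. if card I = 1 then \<omega> else 0)"

definition of_cech ::
    "('n::{finite,linorder} set \<Rightarrow> ('n, 'k::idom) ratfun) \<Rightarrow> 'n set \<Rightarrow> ('n, 'k) form" where
  "of_cech f = (\<lambda>I J. if J = {} then f I else 0)"

definition comparison ::
    "nat \<Rightarrow> ('n::{finite,linorder}, 'k::idom) form set \<Rightarrow> ('n set \<Rightarrow> ('n, 'k) ratfun) set" where
  "comparison m h = {f \<in> cocycles cech_d cech m.
     \<exists>\<omega>\<in>h. of_A \<omega> - of_cech f \<in> coboundaries tot_d tot m}"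

section \<open>The action of the general linear group\<close>

type_synonym ('k, 'n) sqmat = "'k^'n^'n"

text \<open>
  \<open>g\<close> acts on the span \<open>V\<close> of the \<open>z\<^sub>j\<close> by \<open>z\<^sub>j \<mapsto> \<Sum>\<^sub>i g\<^sub>i\<^sub>j z\<^sub>i\<close>, and on the \<open>z\<^sup>*\<^sub>j\<close> and the \<open>dz\<^sup>*\<^sub>j\<close>
  as on the dual basis of the dual space of \<open>V\<close>.
\<close>

definition gl_var ::
    "('k, 'n) sqmat \<Rightarrow> 'n::{finite,linorder} var \<Rightarrow> ('n, 'k::field) ratfun" where
  "gl_var g v = (case v of
      Z j \<Rightarrow> \<Sum>i\<in>UNIV. const (g $ i $ j) * zvar i
    | Zs j \<Rightarrow> \<Sum>i\<in>UNIV. const (matrix_inv g $ j $ i) * zsvar i)"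

definition gl_mpol ::
    "('k, 'n) sqmat \<Rightarrow> ('n var, 'k) mpol \<Rightarrow> ('n::{finite,linorder}, 'k::field) ratfun" where
  "gl_mpol g p = (\<Sum>m\<in>Poly_Mapping.keys p. const (Poly_Mapping.lookup p m) *
     (\<Prod>v\<in>Poly_Mapping.keys m. gl_var g v ^ Poly_Mapping.lookup m v))"

text \<open>
  For invertible \<open>g\<close> the substitution \<open>gl_mpol g\<close> is injective, so it extends to fractions and the
  value below does not depend on the representation \<open>p/q\<close>.
\<close>

definition gl_fun ::
    "('k, 'n) sqmat \<Rightarrow> ('n::{finite,linorder}, 'k::field) ratfun \<Rightarrow> ('n, 'k) ratfun" where
  "gl_fun g f = (THE y. \<forall>p q. q \<noteq> 0 \<longrightarrow> f = Fraction_Field.Fract p q \<longrightarrow>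
     y = gl_mpol g p / gl_mpol g q)"

definition gl_dzs :: "('k, 'n) sqmat \<Rightarrow> 'n \<Rightarrow> ('n::{finite,linorder}, 'k::field) form" where
  "gl_dzs g j = (\<Sum>i\<in>UNIV. scale (matrix_inv g $ j $ i) (dzs {i}))"

definition gl_form ::
    "('k, 'n) sqmat \<Rightarrow> ('n::{finite,linorder}, 'k::field) form \<Rightarrow> ('n, 'k) form" where
  "gl_form g \<omega> = (\<Sum>I\<in>UNIV. (\<lambda>J. gl_fun g (\<omega> I) *
     foldr wedge (map (gl_dzs g) (sorted_list_of_set I)) (dzs {}) J))"

definition torus :: "('n::finite \<Rightarrow> 'k) \<Rightarrow> ('k::field, 'n) sqmat" where
  "torus t = (\<chi> i j. if i = j then t i else 0)"

definition unipotent_upper :: "('k::field, 'n::{finite,linorder}) sqmat \<Rightarrow> bool" where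
  "unipotent_upper u \<longleftrightarrow> (\<forall>i. u $ i $ i = 1) \<and> (\<forall>i j. j < i \<longrightarrow> u $ i $ j = 0)"

definition gl_subrep :: "('n::{finite,linorder}, 'k::field) form set \<Rightarrow> bool" where
  "gl_subrep W \<longleftrightarrow> form.subspace W \<and> (\<forall>g \<omega>. invertible g \<longrightarrow> \<omega> \<in> W \<longrightarrow> gl_form g \<omega> \<in> W)"

definition gl_irreducible :: "('n::{finite,linorder}, 'k::field) form set \<Rightarrow> bool" where
  "gl_irreducible W \<longleftrightarrow> gl_subrep W \<and> W \<noteq> {0} \<and>
     (\<forall>U. gl_subrep U \<longrightarrow> U \<subseteq> W \<longrightarrow> U = {0} \<or> U = W)"

text \<open>\<open>W\<close> is a copy of \<open>\<Sigma>\<^sup>\<alpha>(V)\<close>.\<close>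

definition is_Sigma :: "('n \<Rightarrow> int) \<Rightarrow> ('n::{finite,linorder}, 'k::field) form set \<Rightarrow> bool" where
  "is_Sigma \<alpha> W \<longleftrightarrow> gl_irreducible W \<and>
     (\<exists>\<omega>\<in>W. \<omega> \<noteq> 0 \<and> (\<forall>u. unipotent_upper u \<longrightarrow> gl_form u \<omega> = \<omega>) \<and>
       (\<forall>t. (\<forall>i. t i \<noteq> 0) \<longrightarrow> gl_form (torus t) \<omega> = scale (\<Prod>i\<in>UNIV. t i powi \<alpha> i) \<omega>))"

definition gl_isomorphic ::
    "('n::{finite,linorder}, 'k::field) form set \<Rightarrow> ('n, 'k) form set \<Rightarrow> bool" where
  "gl_isomorphic W W' \<longleftrightarrow> (\<exists>\<phi>. bij_betw \<phi> W W' \<and>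
     (\<forall>x\<in>W. \<forall>y\<in>W. \<phi> (x + y) = \<phi> x + \<phi> y) \<and>
     (\<forall>c. \<forall>x\<in>W. \<phi> (scale c x) = scale c (\<phi> x)) \<and>
     (\<forall>g. \<forall>x\<in>W. invertible g \<longrightarrow> \<phi> (gl_form g x) = gl_form g (\<phi> x)))"

text \<open>
  The constant-coefficient 1-forms are a copy of the dual space of \<open>V\<close>, so its top exterior power is
  the space of constant-coefficient \<open>n\<close>-forms.
\<close>

definition top_ext_dual :: "('n::{finite,linorder}, 'k::field) form set" where
  "top_ext_dual = form.span {dzs UNIV}"

end

theory Submission
  imports "HOL-Computational_Algebra.Polynomial" Defs
begin

text \<open>
  Contraction is exact, so forms of top degree are \<open>f \<tau>\<close>, where \<open>\<tau>\<close> is the contraction of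
  \<open>dz\<^sup>*\<^sub>1 \<dots> dz\<^sup>*\<^sub>n\<close> and \<open>f\<close> has degree \<open>-n\<close> in \<open>z\<^sup>*\<close>; \<open>\<Omega>\<close> is \<open>(zz\<^sup>*)\<^sup>-\<^sup>n \<tau>\<close>, and \<open>f \<tau>\<close> is exact exactly
  when \<open>f\<close> is a divergence \<open>\<Sum> \<partial>g\<^sub>i/\<partial>z\<^sup>*\<^sub>i\<close>. Modulo divergences, \<open>z\<^sub>i p/(zz\<^sup>*)\<^sup>K\<^sup>+\<^sup>1\<close> is a multiple of
  \<open>(\<partial>p/\<partial>z\<^sup>*\<^sub>i)/(zz\<^sup>*)\<^sup>K\<close>, so all \<open>z\<^sub>i\<close> can be removed from numerators, and a monomial in \<open>z\<^sup>*\<close> over the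
  appropriate power of \<open>zz\<^sup>*\<close> is a derivative of \<open>(zz\<^sup>*)\<^sup>-\<^sup>n\<close>. A residue functional that kills divergences
  shows that \<open>P(\<partial>\<^sub>z) (zz\<^sup>*)\<^sup>-\<^sup>n\<close> is a divergence only for \<open>P = 0\<close>. This proves (c).

  An explicit cochain of the total complex compares \<open>\<Omega>\<close> with a nonzero multiple of
  \<open>z\<^sub>1\<^sup>-\<^sup>1 \<dots> z\<^sub>n\<^sup>-\<^sup>1\<close>. Applying the \<open>P(\<partial>\<^sub>z)\<close> compares all classes on both sides. A form compared with zero is
  exact because the \v{C}ech complexes with coefficients in \<open>A\<close> are exact, by a partition of unity.

  For (b), a stable line in top degree is spanned by \<open>p/(zz\<^sup>*)\<^sup>N \<tau>\<close> with \<open>p\<close> semi-invariant. The group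
  acts on the pairs \<open>(z, z\<^sup>*)\<close> with generic orbits the level sets of \<open>zz\<^sup>*\<close>, so \<open>p\<close> is a multiple of a power
  of \<open>zz\<^sup>*\<close>.
\<close>

section \<open>Rational functions and their derivatives\<close>

text \<open>Two anticommutators control the forms. Contraction against exterior multiplication by
  \<open>dbar\<close> of \<open>zzs\<close> gives multiplication by the invertible function
  \<open>zzs\<close>; contraction against \<open>dbar\<close> gives the Lie derivative along the
  Euler field, which is zero in total degree 0. Hence \<open>dbar\<close> can be computed on
  primitives under the contraction.

  The residue is defined on numerators and must not depend on the denominator. It does so only by a
  factor: multiplying a numerator of degree e in the starred variables by \<open>zzs\<close>
  multiplies the residue by e + n, nonzero in characteristic 0.

  The comparison is a relation closed under differences; it induces an isomorphism of quotients once
  it projects onto both sides and both kernels consist of coboundaries. The kernel among cochains is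
  not computed directly: a cochain related to 0 is a multipole up to a coboundary, and the
  uniqueness of P, known for forms, forces P = 0.

  The hypothesis n > 1 makes degree n - 2 meaningful, keeps the divisor in the removal of the
  unstarred variables positive, and provides a torus element that fixes a representative of a
  generic orbit.\<close>

lemma of_mpol_simps [simp]:
  "of_mpol 0 = 0" "of_mpol 1 = 1"
  "of_mpol (p + q) = of_mpol p + of_mpol q" "of_mpol (p - q) = of_mpol p - of_mpol q"
  "of_mpol (- p) = - of_mpol p" "of_mpol (p * q) = of_mpol p * of_mpol q"
  by (simp_all add: of_mpol_def Zero_fract_def One_fract_def)

lemma of_mpol_sum: "of_mpol (sum f A) = (\<Sum>x\<in>A. of_mpol (f x))"
  by (induction A rule: infinite_finite_induct) simp_all

lemma of_mpol_prod: "of_mpol (prod f A) = (\<Prod>x\<in>A. of_mpol (f x))"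
  by (induction A rule: infinite_finite_induct) simp_all

lemma of_mpol_power [simp]: "of_mpol (p ^ n) = of_mpol p ^ n"
  by (induction n) simp_all

lemma of_mpol_eq_iff [simp]: "of_mpol p = of_mpol q \<longleftrightarrow> p = q"
  by (simp add: of_mpol_def eq_fract)

lemma of_mpol_eq_0_iff [simp]: "of_mpol p = 0 \<longleftrightarrow> p = 0"
  by (metis of_mpol_eq_iff of_mpol_simps(1))

lemma Fract_conv_of_mpol: "Fraction_Field.Fract p q = of_mpol p / of_mpol q"
  by (simp add: of_mpol_def)

lemma ratfun_cases:
  obtains p q where "f = of_mpol p / of_mpol q" "q \<noteq> 0"
  by (cases f) (auto simp: Fract_conv_of_mpol)

lemma const_0 [simp]: "const 0 = 0"
  by (simp add: const_def)

lemma const_1 [simp]: "const 1 = 1"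
  by (simp add: const_simps)

lemma const_add: "const (a + b) = const a + const b"
  by (simp add: const_simps)

lemma const_mult: "const (a * b) = const a * const b"
  by (simp add: const_simps)

lemma const_minus [simp]: "const (- a) = - const a"
  by (simp add: const_def single_uminus)

lemma const_eq_iff [simp]: "const a = const b \<longleftrightarrow> a = b"
  by (auto simp: const_def dest: arg_cong[of _ _ "\<lambda>p. Poly_Mapping.lookup p 0"])

lemma const_eq_0_iff [simp]: "const a = 0 \<longleftrightarrow> a = 0"
  by (metis const_eq_iff const_0)

lemma const_power: "const (a ^ n) = const a ^ n"
  by (induction n) (simp_all add: const_mult)

lemma const_prod: "const (prod f A) = (\<Prod>x\<in>A. const (f x))"
  by (induction A rule: infinite_finite_induct) (simp_all add: const_mult)

lemma const_sum: "const (sum f A) = (\<Sum>x\<in>A. const (f x))"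
  by (induction A rule: infinite_finite_induct) (simp_all add: const_add)

lemma const_of_nat: "const (of_nat n) = of_nat n"
  by (induction n) (simp_all add: const_add)

lemma const_inverse: "const (inverse a) = inverse (const (a::'k::field))"
proof (cases "a = 0")
  case False
  then have "const a * const (inverse a) = 1" by (simp flip: const_mult)
  then show ?thesis by (metis inverse_unique)
qed simp

lemma const_divide: "const (a / b) = const a / const (b::'k::field)"
  by (simp add: divide_inverse const_mult const_inverse)

text \<open>The polynomial behind \<open>zzs\<close>: degrees, residues and evaluation are defined
  for polynomials only.\<close>

definition zzp :: "('n::finite var, 'k::comm_ring_1) mpol" where
  "zzp = (\<Sum>i\<in>UNIV. pvar (Z i) * pvar (Zs i))"

lemma zzs_conv: "zzs = of_mpol zzp"
  by (simp add: zzs_def zzp_def of_mpol_sum zvar_def zsvar_def)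

lemma pvar_nonzero [simp]: "pvar v \<noteq> (0 :: ('v, 'k::comm_ring_1) mpol)"
  by (metis pvar_def lookup_single_eq lookup_zero one_neq_zero)

lemma zvar_nonzero [simp]: "zvar i \<noteq> 0"
  by (simp add: zvar_def)

lemma zsvar_nonzero [simp]: "zsvar i \<noteq> 0"
  by (simp add: zsvar_def)

text \<open>No two summands share a monomial, so the coefficient of the product of
  \<open>Z i\<close> and \<open>Zs i\<close> is 1.\<close>

lemma zzp_nonzero [simp]: "(zzp :: ('n::finite var, 'k::comm_ring_1) mpol) \<noteq> 0"
proof -
  obtain i :: 'n where True by blast
  let ?e = "\<lambda>j::'n. Poly_Mapping.single (Z j) 1 + Poly_Mapping.single (Zs j) (1::nat)"
  have *: "?e j = ?e i \<longleftrightarrow> j = i" for j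
  proof
    assume "?e j = ?e i"
    then have "Poly_Mapping.lookup (?e j) (Z j) = Poly_Mapping.lookup (?e i) (Z j)" by simp
    then show "j = i" by (auto simp: lookup_add lookup_single when_def split: if_splits)
  qed simp
  have "Poly_Mapping.lookup (zzp :: ('n var, 'k) mpol) (?e i) = (\<Sum>j\<in>UNIV. if j = i then 1 else 0)"
    unfolding zzp_def lookup_sum
    by (intro sum.cong refl)
       (use * in \<open>simp add: pvar_def mult_single lookup_single when_def\<close>)
  then have "Poly_Mapping.lookup (zzp :: ('n var, 'k) mpol) (?e i) = 1" by simp
  then show ?thesis by (metis lookup_zero one_neq_zero)
qed

lemma zzs_nonzero [simp]: "zzs \<noteq> 0"
  by (simp add: zzs_conv)

lemma pderiv_mpol_pvar: "pderiv_mpol v (pvar w) = (if v = w then 1 else 0)"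
  by (simp add: pvar_def pderiv_mpol_single lookup_single when_def)

lemma pderiv_mpol_commute: "pderiv_mpol v (pderiv_mpol w p) = pderiv_mpol w (pderiv_mpol v p)"
proof (induction p rule: mpol_induct)
  case (single m c)
  show ?case
  proof (cases "v = w")
    case False
    have "m - Poly_Mapping.single w (1::nat) - Poly_Mapping.single v 1 =
        m - Poly_Mapping.single v 1 - Poly_Mapping.single w 1"
      by (intro poly_mapping_eqI) (simp add: lookup_minus)
    with False show ?thesis
      by (simp add: pderiv_mpol_single lookup_minus lookup_single when_def mult.left_commute)
  qed simp
qed (simp_all add: pderiv_mpol_add)

text \<open>Opens the lifted definition of \<open>pd\<close> once; sums and products of fractions
  are differentiated through this formula.\<close>

lemma pd_quotient:
  assumes "q \<noteq> 0"
  shows "pd v (of_mpol p / of_mpol q) =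
    of_mpol (pderiv_mpol v p * q - p * pderiv_mpol v q) / of_mpol (q * q)"
proof -
  have Fract: "Fraction_Field.Fract a b = abs_fract (a, b)" if "b \<noteq> 0" for a b :: "('a var, 'b) mpol"
    using that by (simp add: Fraction_Field.Fract_def)
  have "pd v (abs_fract (p, q)) = abs_fract (pderiv_mpol v p * q - p * pderiv_mpol v q, q * q)"
    using assms by (subst pd.abs_eq) (simp_all only: fractrel_def fst_conv snd_conv simp_thms)
  then show ?thesis using assms Fract[of q p] Fract[of "q * q"]
    by (simp only: Fract_conv_of_mpol no_zero_divisors not_False_eq_True simp_thms)
qed

lemma pd_of_mpol: "pd v (of_mpol p) = of_mpol (pderiv_mpol v p)"
proof -
  have "pderiv_mpol v (1 :: ('a var, 'b) mpol) = 0"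
    using pderiv_mpol_single[of v 0 "1::'b"] by simp
  then show ?thesis using pd_quotient[of 1 v p] by simp
qed

lemma pd_add: "pd v (f + g) = pd v f + pd v g"
proof -
  obtain p q where f: "f = of_mpol p / of_mpol q" "q \<noteq> 0" by (rule ratfun_cases)
  obtain r s where g: "g = of_mpol r / of_mpol s" "s \<noteq> 0" by (rule ratfun_cases)
  have fg: "f + g = of_mpol (p * s + r * q) / of_mpol (q * s)" using f g by (simp add: field_simps)
  have "q * s \<noteq> 0" using f g by simp
  then show ?thesis
    unfolding fg pd_quotient[OF \<open>q * s \<noteq> 0\<close>] unfolding f(1) g(1) pd_quotient[OF f(2)] pd_quotient[OF g(2)]
    using f(2) g(2) by (simp add: pderiv_mpol_add pderiv_mpol_mult divide_simps) (simp add: algebra_simps)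
qed

lemma pd_mult: "pd v (f * g) = pd v f * g + f * pd v g"
proof -
  obtain p q where f: "f = of_mpol p / of_mpol q" "q \<noteq> 0" by (rule ratfun_cases)
  obtain r s where g: "g = of_mpol r / of_mpol s" "s \<noteq> 0" by (rule ratfun_cases)
  have fg: "f * g = of_mpol (p * r) / of_mpol (q * s)" using f g by (simp add: field_simps)
  have "q * s \<noteq> 0" using f g by simp
  then show ?thesis
    unfolding fg pd_quotient[OF \<open>q * s \<noteq> 0\<close>] unfolding f(1) g(1) pd_quotient[OF f(2)] pd_quotient[OF g(2)]
    using f(2) g(2) by (simp add: pderiv_mpol_add pderiv_mpol_mult divide_simps) (simp add: algebra_simps)
qed

lemma pd_0 [simp]: "pd v 0 = 0"
  by (metis add_cancel_right_right add_0 pd_add)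

lemma pd_minus: "pd v (- f) = - pd v f"
  using pd_add[of v f "- f"] by (simp add: eq_neg_iff_add_eq_0 add.commute)

lemma pd_diff: "pd v (f - g) = pd v f - pd v g"
  using pd_add[of v f "- g"] by (simp add: pd_minus)

lemma pd_sum: "pd v (sum f A) = (\<Sum>x\<in>A. pd v (f x))"
  by (induction A rule: infinite_finite_induct) (simp_all add: pd_add)

lemma pd_const [simp]: "pd v (const c) = 0"
  by (simp add: const_def pd_of_mpol pderiv_mpol_single)

lemma pd_const_mult: "pd v (const c * f) = const c * pd v f"
  by (simp add: pd_mult)

lemma pd_zvar: "pd (Z i) (zvar j) = (if i = j then 1 else 0)" "pd (Zs i) (zvar j) = 0"
  by (simp_all add: zvar_def pd_of_mpol pderiv_mpol_pvar)

lemma pd_zsvar: "pd (Zs i) (zsvar j) = (if i = j then 1 else 0)" "pd (Z i) (zsvar j) = 0"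
  by (simp_all add: zsvar_def pd_of_mpol pderiv_mpol_pvar)

lemma pd_zzs: "pd (Zs i) zzs = zvar i" "pd (Z i) zzs = zsvar i"
  by (simp_all add: zzs_def pd_sum pd_mult pd_zvar pd_zsvar if_distrib[of "\<lambda>x. x * _"]
      if_distrib[of "\<lambda>x. _ * x"] sum.delta cong: if_cong)

lemma pd_1 [simp]: "pd v 1 = 0"
  using pd_const[of v 1] by simp

lemma pd_inverse: "pd v (inverse f) = - pd v f / f ^ 2"
proof (cases "f = 0")
  case False
  then have "pd v f * inverse f + f * pd v (inverse f) = 0"
    using pd_mult[of v f "inverse f"] by simp
  then show ?thesis using False by (simp add: field_simps power2_eq_square eq_neg_iff_add_eq_0)
qed simp

lemma pd_power_Suc: "pd v (f ^ Suc n) = of_nat (Suc n) * f ^ n * pd v f"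
  by (induction n) (simp_all add: pd_mult algebra_simps)

lemma pd_inverse_power:
  assumes "f \<noteq> 0"
  shows "pd v (inverse f ^ n) = - of_nat n * pd v f * inverse f ^ Suc n"
proof (cases n)
  case (Suc k)
  then show ?thesis using assms
    by (simp add: pd_power_Suc pd_inverse divide_inverse power2_eq_square del: power_Suc)
       (simp add: algebra_simps)
qed simp

text \<open>The commutator of two derivations is again a derivation. It vanishes on polynomials,
  hence on a fraction: apply it to the product of the fraction with its denominator.\<close>

lemma pd_commute: "pd v (pd w f) = pd w (pd v f)"
proof -
  define C where "C f = pd v (pd w f) - pd w (pd v f)" for f :: "('a, 'b) ratfun"
  obtain p q where f: "f = of_mpol p / of_mpol q" "q \<noteq> 0" by (rule ratfun_cases)
  have "C (of_mpol r) = 0" for r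
    by (simp add: C_def pd_of_mpol pderiv_mpol_commute)
  moreover have "C (f * g) = C f * g + f * C g" for f g
    by (simp add: C_def pd_mult pd_add algebra_simps)
  moreover have "f * of_mpol q = of_mpol p" using f by simp
  ultimately have "C f * of_mpol q = 0" by (metis add.right_neutral mult_zero_right)
  with f show ?thesis by (simp add: C_def)
qed

section \<open>Exterior and interior multiplication\<close>

text \<open>The sign acts on any abelian group, so that the same operators serve differential forms
  and Cech cochains, whose values may themselves be forms.\<close>

definition sgn_before :: "'n::linorder \<Rightarrow> 'n set \<Rightarrow> 'a::ab_group_add \<Rightarrow> 'a" where
  "sgn_before i J x = (if even (card {j\<in>J. j < i}) then x else - x)"

text \<open>On forms this is exterior multiplication by the i-th starred differential; on cochains
  it is the summand of the Cech differential that deletes the index i.\<close>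

definition ext :: "'n::linorder \<Rightarrow> ('n set \<Rightarrow> 'a::ab_group_add) \<Rightarrow> 'n set \<Rightarrow> 'a" where
  "ext i \<omega> = (\<lambda>J. if i \<in> J then sgn_before i J (\<omega> (J - {i})) else 0)"

text \<open>On forms this is contraction with the i-th coordinate field; on cochains it is the
  homotopy that inserts the index i.\<close>

definition intr :: "'n::linorder \<Rightarrow> ('n set \<Rightarrow> 'a::ab_group_add) \<Rightarrow> 'n set \<Rightarrow> 'a" where
  "intr i \<omega> = (\<lambda>J. if i \<in> J then 0 else sgn_before i J (\<omega> (insert i J)))"

lemma sgn_before_simps [simp]:
  "sgn_before i J 0 = 0" "sgn_before i J (x + y) = sgn_before i J x + sgn_before i J y"
  "sgn_before i J (- x) = - sgn_before i J x"
  "sgn_before i J (x - y) = sgn_before i J x - sgn_before i J y"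
  "sgn_before i J (sgn_before i J x) = x"
  by (simp_all add: sgn_before_def)

lemma sgn_before_mult:
  "sgn_before i J (x * y) = x * sgn_before i J (y :: 'a::ring)"
  by (simp add: sgn_before_def)

lemma sgn_before_Diff_insert [simp]:
  "sgn_before i (J - {i}) x = sgn_before i J x" "sgn_before i (insert i J) x = sgn_before i J x"
proof -
  have "{j \<in> J - {i}. j < i} = {j \<in> J. j < i}" "{j \<in> insert i J. j < i} = {j \<in> J. j < i}" by auto
  then show "sgn_before i (J - {i}) x = sgn_before i J x" "sgn_before i (insert i J) x = sgn_before i J x"
    by (simp_all add: sgn_before_def)
qed

lemma sgn_before_commute: "sgn_before i J (sgn_before j K x) = sgn_before j K (sgn_before i J x)"
  by (simp add: sgn_before_def)

lemma sgn_before_insert: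
  fixes J :: "'n::{finite,linorder} set"
  assumes "i \<notin> J" "i \<noteq> j"
  shows "sgn_before j (insert i J) x = (if i < j then - sgn_before j J x else sgn_before j J x)"
proof (cases "i < j")
  case True
  then have "{k \<in> insert i J. k < j} = insert i {k \<in> J. k < j}" by auto
  then show ?thesis using True assms by (simp add: sgn_before_def)
next
  case False
  then have "{k \<in> insert i J. k < j} = {k \<in> J. k < j}" by auto
  then show ?thesis using False by (simp add: sgn_before_def)
qed

lemma sgn_before_Diff:
  fixes J :: "'n::{finite,linorder} set"
  assumes "i \<in> J" "i \<noteq> j"
  shows "sgn_before j (J - {i}) x = (if i < j then - sgn_before j J x else sgn_before j J x)"
  using sgn_before_insert[of i "J - {i}" j x] assms by (auto simp: insert_absorb split: if_splits)

text \<open>Deleting i before j changes the sign belonging to j exactly if i < j, and conversely;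
  for distinct indices this happens in exactly one of the two orders.\<close>

lemma ext_ext:
  fixes \<omega> :: "'n::{finite,linorder} set \<Rightarrow> 'a::ab_group_add"
  shows "ext i (ext j \<omega>) = - ext j (ext i \<omega>)"
proof
  fix J
  show "ext i (ext j \<omega>) J = (- ext j (ext i \<omega>)) J"
  proof (cases "i \<in> J \<and> j \<in> J \<and> i \<noteq> j")
    case True
    define x where "x = \<omega> (J - {i} - {j})"
    have **: "J - {i} - {j} = J - {j} - {i}" by auto
    have "ext i (ext j \<omega>) J = sgn_before i J (sgn_before j (J - {i}) x)"
      using True by (auto simp: ext_def x_def)
    moreover have "ext j (ext i \<omega>) J = sgn_before j J (sgn_before i (J - {j}) x)"
      using True unfolding x_def ** by (auto simp: ext_def)
    ultimately show ?thesis
      using True by (cases i j rule: linorder_cases)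
        (auto simp: sgn_before_Diff sgn_before_commute[of j J i J])
  qed (auto simp: ext_def)
qed

lemma intr_intr:
  fixes \<omega> :: "'n::{finite,linorder} set \<Rightarrow> 'a::ab_group_add"
  shows "intr i (intr j \<omega>) = - intr j (intr i \<omega>)"
proof
  fix J
  show "intr i (intr j \<omega>) J = (- intr j (intr i \<omega>)) J"
  proof (cases "i \<notin> J \<and> j \<notin> J \<and> i \<noteq> j")
    case True
    define x where "x = \<omega> (insert i (insert j J))"
    have "intr i (intr j \<omega>) J = sgn_before i J (sgn_before j (insert i J) x)"
      using True by (auto simp: intr_def x_def insert_commute)
    moreover have "intr j (intr i \<omega>) J = sgn_before j J (sgn_before i (insert j J) x)"
      using True by (auto simp: intr_def x_def)
    ultimately show ?thesis
      using True by (cases i j rule: linorder_cases)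
        (auto simp: sgn_before_insert sgn_before_commute[of j J i J])
  qed (auto simp: intr_def)
qed

text \<open>The canonical anticommutation relation. The homotopy formulas for the contraction, for
  \<open>dbar\<close> and for the Cech differential are all obtained by summing instances of
  it.\<close>

lemma intr_ext:
  fixes \<omega> :: "'n::{finite,linorder} set \<Rightarrow> 'a::ab_group_add"
  shows "intr i (ext j \<omega>) + ext j (intr i \<omega>) = (if i = j then \<omega> else 0)"
proof
  fix J
  consider "i = j" | "i \<noteq> j" "i \<notin> J" "j \<in> J" | "i \<noteq> j" "i \<in> J \<or> j \<notin> J" by blast
  then show "(intr i (ext j \<omega>) + ext j (intr i \<omega>)) J = (if i = j then \<omega> else 0) J"
  proof cases
    case 1
    then show ?thesis by (simp add: intr_def ext_def insert_absorb)
  next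
    case 2
    define x where "x = \<omega> (insert i (J - {j}))"
    have "intr i (ext j \<omega>) J = sgn_before i J (sgn_before j (insert i J) x)"
      using 2 by (simp add: intr_def ext_def x_def insert_Diff_if)
    moreover have "ext j (intr i \<omega>) J = sgn_before j J (sgn_before i (J - {j}) x)"
      using 2 by (simp add: intr_def ext_def x_def)
    ultimately show ?thesis
      using 2 by (cases i j rule: linorder_cases)
        (auto simp: sgn_before_insert sgn_before_Diff sgn_before_commute[of j J i J])
  next
    case 3
    then show ?thesis by (auto simp: intr_def ext_def)
  qed
qed

lemmas fun_apply = plus_fun_apply zero_fun_apply minus_apply uminus_apply

text \<open>Otherwise the simplifier turns sums of forms into lambda abstractions.\<close>

declare fun_apply [simp del]

section \<open>Operators on forms with rational coefficients\<close>

definition fscale :: "('n::linorder, 'k::idom) ratfun \<Rightarrow> ('n, 'k) form \<Rightarrow> ('n, 'k) form" where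
  "fscale f \<omega> = (\<lambda>J. f * \<omega> J)"

definition fpd :: "'n::linorder var \<Rightarrow> ('n, 'k::idom) form \<Rightarrow> ('n, 'k) form" where
  "fpd v \<omega> = (\<lambda>J. pd v (\<omega> J))"

text \<open>Exterior multiplication by \<open>dbar\<close> of the function
  \<open>zzs\<close>.\<close>

definition theta :: "('n::{finite,linorder}, 'k::idom) form \<Rightarrow> ('n, 'k) form" where
  "theta \<omega> = (\<Sum>i\<in>UNIV. fscale (zvar i) (ext i \<omega>))"

lemma sum_fun_apply: "sum f A x = (\<Sum>a\<in>A. f a x)"
  by (induction A rule: infinite_finite_induct) (simp_all add: fun_apply)

lemma additive_0:
  fixes h :: "'a::ab_group_add \<Rightarrow> 'b::ab_group_add"
  assumes "\<And>x y. h (x + y) = h x + h y"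
  shows "h 0 = 0"
  using assms[of 0 0] by simp

lemma additive_minus:
  fixes h :: "'a::ab_group_add \<Rightarrow> 'b::ab_group_add"
  assumes "\<And>x y. h (x + y) = h x + h y"
  shows "h (- x) = - h x"
  using assms[of x "- x"] additive_0[of h] assms by (simp add: eq_neg_iff_add_eq_0 add.commute)

lemma additive_sum:
  fixes h :: "'a::ab_group_add \<Rightarrow> 'b::ab_group_add"
  assumes "\<And>x y. h (x + y) = h x + h y"
  shows "h (sum f A) = (\<Sum>a\<in>A. h (f a))"
  by (induction A rule: infinite_finite_induct) (simp_all add: assms additive_0)

lemma ext_simps [simp]:
  "ext i 0 = 0" "ext i (- \<omega>) = - ext i \<omega>" "ext i (\<omega> + \<eta>) = ext i \<omega> + ext i \<eta>"
  "ext i (\<omega> - \<eta>) = ext i \<omega> - ext i \<eta>"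
  by (auto simp: ext_def fun_eq_iff fun_apply)

lemma intr_simps [simp]:
  "intr i 0 = 0" "intr i (- \<omega>) = - intr i \<omega>" "intr i (\<omega> + \<eta>) = intr i \<omega> + intr i \<eta>"
  "intr i (\<omega> - \<eta>) = intr i \<omega> - intr i \<eta>"
  by (auto simp: intr_def fun_eq_iff fun_apply)

lemma ext_sum: "ext i (sum f A) = (\<Sum>a\<in>A. ext i (f a))"
  by (rule additive_sum[of "ext i"]) simp

lemma intr_sum: "intr i (sum f A) = (\<Sum>a\<in>A. intr i (f a))"
  by (rule additive_sum[of "intr i"]) simp

lemma fscale_simps [simp]:
  "fscale f 0 = 0" "fscale 0 \<omega> = 0" "fscale 1 \<omega> = \<omega>" "fscale f (- \<omega>) = - fscale f \<omega>"
  "fscale (- f) \<omega> = - fscale f \<omega>" "fscale f (fscale g \<omega>) = fscale (f * g) \<omega>"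
  by (auto simp: fscale_def fun_eq_iff fun_apply)

lemma fscale_distribs:
  "fscale f (\<omega> + \<eta>) = fscale f \<omega> + fscale f \<eta>" "fscale f (\<omega> - \<eta>) = fscale f \<omega> - fscale f \<eta>"
  "fscale (f + g) \<omega> = fscale f \<omega> + fscale g \<omega>" "fscale (f - g) \<omega> = fscale f \<omega> - fscale g \<omega>"
  by (auto simp: fscale_def fun_eq_iff fun_apply algebra_simps)

lemma fscale_sum: "fscale f (sum \<omega> A) = (\<Sum>a\<in>A. fscale f (\<omega> a))"
  by (rule additive_sum[of "fscale f"]) (rule fscale_distribs)

lemma fscale_sum_left: "fscale (sum f A) \<omega> = (\<Sum>a\<in>A. fscale (f a) \<omega>)"
  by (rule additive_sum[of "\<lambda>f. fscale f \<omega>"]) (rule fscale_distribs)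

lemma fpd_simps [simp]:
  "fpd v 0 = 0" "fpd v (- \<omega>) = - fpd v \<omega>" "fpd v (\<omega> + \<eta>) = fpd v \<omega> + fpd v \<eta>"
  "fpd v (\<omega> - \<eta>) = fpd v \<omega> - fpd v \<eta>"
  by (auto simp: fpd_def fun_eq_iff fun_apply pd_add pd_diff pd_minus)

lemma fpd_sum: "fpd v (sum f A) = (\<Sum>a\<in>A. fpd v (f a))"
  by (rule additive_sum[of "fpd v"]) simp

lemma fpd_fscale: "fpd v (fscale f \<omega>) = fscale (pd v f) \<omega> + fscale f (fpd v \<omega>)"
  by (auto simp: fpd_def fscale_def fun_eq_iff fun_apply pd_mult)

lemma fpd_commute: "fpd v (fpd w \<omega>) = fpd w (fpd v \<omega>)"
  by (auto simp: fpd_def pd_commute)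

lemma ext_fscale: "ext i (fscale f \<omega>) = fscale f (ext i \<omega>)"
  by (auto simp: ext_def fscale_def fun_eq_iff fun_apply sgn_before_mult)

lemma intr_fscale: "intr i (fscale f \<omega>) = fscale f (intr i \<omega>)"
  by (auto simp: intr_def fscale_def fun_eq_iff fun_apply sgn_before_mult)

lemma ext_fpd: "ext i (fpd v \<omega>) = fpd v (ext i \<omega>)"
  by (auto simp: ext_def fpd_def fun_eq_iff fun_apply sgn_before_def pd_minus)

lemma intr_fpd: "intr i (fpd v \<omega>) = fpd v (intr i \<omega>)"
  by (auto simp: intr_def fpd_def fun_eq_iff fun_apply sgn_before_def pd_minus)

lemma sgn_before_power: "(-1) ^ card {j\<in>J. j < i} * x = sgn_before i J (x :: 'a::ring_1)"
  by (simp add: sgn_before_def)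

text \<open>Only the subset {i} of J contributes to the product, and its inversions against the rest
  of J are the elements of J below i.\<close>

lemma wedge_dzs_single: "wedge (dzs {i}) \<omega> = ext i (\<omega> :: ('n::{finite,linorder}, 'k::idom) form)"
proof
  fix J
  have "wedge (dzs {i}) \<omega> J = (\<Sum>I\<in>Pow J. if I = {i} then
      (-1) ^ card {(a, b). a \<in> {i} \<and> b \<in> J - {i} \<and> b < a} * \<omega> (J - {i}) else 0)"
    unfolding wedge_def by (intro sum.cong) (auto simp: dzs_def)
  also have "\<dots> = (if i \<in> J then
      (-1) ^ card {(a, b). a \<in> {i} \<and> b \<in> J - {i} \<and> b < a} * \<omega> (J - {i}) else 0)"
    by (simp add: sum.delta')
  also have "card {(a, b). a \<in> {i} \<and> b \<in> J - {i} \<and> b < a} = card {j\<in>J. j < i}"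
    by (rule bij_betw_same_card[of snd]) (auto simp: bij_betw_def inj_on_def image_iff)
  finally show "wedge (dzs {i}) \<omega> J = ext i \<omega> J"
    by (simp add: ext_def sgn_before_power)
qed

section \<open>The differentials and the contraction as sums of elementary operators\<close>

lemma dbar_conv: "dbar \<omega> = (\<Sum>i\<in>UNIV. ext i (fpd (Zs i) \<omega>))"
  by (simp add: dbar_def wedge_dzs_single fpd_def)

lemma contraction_conv: "contraction \<omega> = (\<Sum>i\<in>UNIV. fscale (zsvar i) (intr i \<omega>))"
proof
  fix J
  have "contraction \<omega> J = (\<Sum>i\<in>-J. zsvar i * intr i \<omega> J)"
    unfolding contraction_def
    by (intro sum.cong) (auto simp: intr_def sgn_before_power sgn_before_mult)
  also have "\<dots> = (\<Sum>i\<in>UNIV. zsvar i * intr i \<omega> J)"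
    by (intro sum.mono_neutral_left) (auto simp: intr_def)
  finally show "contraction \<omega> J = (\<Sum>i\<in>UNIV. fscale (zsvar i) (intr i \<omega>)) J"
    by (simp add: sum_fun_apply fscale_def)
qed

text \<open>Puts the Cech differential into the same algebra as the forms: its square vanishes by
  \<open>ext_ext\<close>, and each \<open>intr i\<close> is a contracting homotopy for it by
  \<open>intr_ext\<close>.\<close>

lemma cech_d_conv: "cech_d f = (\<Sum>i\<in>UNIV. ext i f)"
proof
  fix I
  have "cech_d f I = (\<Sum>i\<in>I. ext i f I)"
    by (simp add: cech_d_def ext_def sgn_before_def)
  also have "\<dots> = (\<Sum>i\<in>UNIV. ext i f I)"
    by (intro sum.mono_neutral_left) (auto simp: ext_def)
  finally show "cech_d f I = (\<Sum>i\<in>UNIV. ext i f) I"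
    by (simp add: sum_fun_apply)
qed

lemma cech_d_apply: "cech_d f I = (\<Sum>i\<in>I. sgn_before i I (f (I - {i})))"
  by (simp add: cech_d_def sgn_before_def)

lemma dbar_simps [simp]:
  "dbar 0 = 0" "dbar (- \<omega>) = - dbar \<omega>" "dbar (\<omega> + \<eta>) = dbar \<omega> + dbar \<eta>"
  "dbar (\<omega> - \<eta>) = dbar \<omega> - dbar \<eta>"
  by (simp_all add: dbar_conv sum.distrib sum_subtractf sum_negf)

lemma contraction_simps [simp]:
  "contraction 0 = 0" "contraction (- \<omega>) = - contraction \<omega>"
  "contraction (\<omega> + \<eta>) = contraction \<omega> + contraction \<eta>"
  "contraction (\<omega> - \<eta>) = contraction \<omega> - contraction \<eta>"
  by (simp_all add: contraction_conv sum.distrib sum_subtractf sum_negf fscale_distribs)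

lemma cech_d_simps [simp]:
  "cech_d 0 = 0" "cech_d (- c) = - cech_d c" "cech_d (c + d) = cech_d c + cech_d d"
  "cech_d (c - d) = cech_d c - cech_d d"
  by (simp_all add: cech_d_conv sum.distrib sum_subtractf sum_negf)

lemma contraction_sum: "contraction (sum f A) = (\<Sum>a\<in>A. contraction (f a))"
  by (rule additive_sum[of "contraction"]) simp

lemma dbar_sum: "dbar (sum f A) = (\<Sum>a\<in>A. dbar (f a))"
  by (rule additive_sum[of "dbar"]) simp

lemma contraction_fscale: "contraction (fscale f \<omega>) = fscale f (contraction \<omega>)"
  by (simp add: contraction_conv intr_fscale fscale_sum mult.commute)

lemma dbar_fscale:
  "dbar (fscale f \<omega>) = fscale f (dbar \<omega>) + (\<Sum>i\<in>UNIV. fscale (pd (Zs i) f) (ext i \<omega>))"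
  by (simp add: dbar_conv fpd_fscale ext_fscale fscale_sum sum.distrib add.commute)

lemma contraction_fpd_Z: "contraction (fpd (Z i) \<omega>) = fpd (Z i) (contraction \<omega>)"
  by (simp add: contraction_conv intr_fpd fpd_sum fpd_fscale pd_zsvar)

lemma dbar_fpd: "dbar (fpd v \<omega>) = fpd v (dbar \<omega>)"
  by (simp add: dbar_conv fpd_sum fpd_commute[of _ v] ext_fpd)

text \<open>The terms cancel in pairs. The diagonal is a separate hypothesis because antisymmetry
  does not determine it in a group with 2-torsion.\<close>

lemma sum_antisymmetric:
  fixes F :: "'i \<Rightarrow> 'i \<Rightarrow> 'a::ab_group_add"
  assumes "\<And>i j. F i j = - F j i" "\<And>i. F i i = 0" "finite S"
  shows "(\<Sum>i\<in>S. \<Sum>j\<in>S. F i j) = 0"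
  using assms(3)
proof (induction S rule: finite_induct)
  case (insert a S)
  have "(\<Sum>i\<in>S. F i a) = (\<Sum>i\<in>S. - F a i)" by (intro sum.cong refl assms(1))
  then show ?case using insert assms(2) by (simp add: sum.distrib sum_negf)
qed simp

lemma ext_self [simp]: "ext i (ext i \<omega>) = 0"
  by (auto simp: ext_def fun_eq_iff fun_apply)

lemma intr_self [simp]: "intr i (intr i \<omega>) = 0"
  by (auto simp: intr_def fun_eq_iff fun_apply)

lemma dbar_dbar [simp]: "dbar (dbar \<omega>) = 0"
proof -
  have "dbar (dbar \<omega>) = (\<Sum>i\<in>UNIV. \<Sum>j\<in>UNIV. ext i (ext j (fpd (Zs i) (fpd (Zs j) \<omega>))))"
    by (simp add: dbar_conv fpd_sum ext_sum ext_fpd)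
  also have "\<dots> = 0"
  proof (rule sum_antisymmetric)
    fix i j
    show "ext i (ext j (fpd (Zs i) (fpd (Zs j) \<omega>))) = - ext j (ext i (fpd (Zs j) (fpd (Zs i) \<omega>)))"
      using ext_ext[of i j "fpd (Zs i) (fpd (Zs j) \<omega>)"] by (simp only: fpd_commute[of "Zs i" "Zs j"])
  qed simp_all
  finally show ?thesis .
qed

lemma contraction_contraction [simp]: "contraction (contraction \<omega>) = 0"
proof -
  have "contraction (contraction \<omega>) =
      (\<Sum>i\<in>UNIV. \<Sum>j\<in>UNIV. fscale (zsvar i * zsvar j) (intr i (intr j \<omega>)))"
    by (simp add: contraction_conv intr_sum intr_fscale fscale_sum)
  also have "\<dots> = 0"
  proof (rule sum_antisymmetric)
    fix i j
    show "fscale (zsvar i * zsvar j) (intr i (intr j \<omega>)) =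
        - fscale (zsvar j * zsvar i) (intr j (intr i \<omega>))"
      using intr_intr[of i j \<omega>] by (simp add: mult.commute)
  qed simp_all
  finally show ?thesis .
qed

lemma cech_d_cech_d [simp]: "cech_d (cech_d c) = 0"
proof -
  have "cech_d (cech_d c) = (\<Sum>i\<in>UNIV. \<Sum>j\<in>UNIV. ext i (ext j c))"
    by (simp add: cech_d_conv ext_sum)
  also have "\<dots> = 0"
    by (rule sum_antisymmetric[OF ext_ext]) simp_all
  finally show ?thesis .
qed

text \<open>The Koszul homotopy: the anticommutator of a contraction with an exterior multiplication
  is the pairing of the field with the 1-form, here the sum of all
  \<open>zsvar i * zvar i\<close>.\<close>

lemma theta_contraction: "contraction (theta \<omega>) + theta (contraction \<omega>) = fscale zzs \<omega>"
proof -
  have "contraction (theta \<omega>) + theta (contraction \<omega>) =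
     (\<Sum>i\<in>UNIV. \<Sum>j\<in>UNIV. fscale (zsvar i * zvar j) (intr i (ext j \<omega>))) +
     (\<Sum>i\<in>UNIV. \<Sum>j\<in>UNIV. fscale (zsvar i * zvar j) (ext j (intr i \<omega>)))"
    unfolding theta_def contraction_conv intr_sum ext_sum intr_fscale ext_fscale fscale_sum fscale_simps
    by (intro arg_cong2[where f = "(+)"] refl, subst (2) sum.swap) (simp add: mult.commute)
  also have "\<dots> = (\<Sum>i\<in>UNIV. \<Sum>j\<in>UNIV. fscale (zsvar i * zvar j) (intr i (ext j \<omega>) + ext j (intr i \<omega>)))"
    by (simp only: sum.distrib fscale_distribs)
  also have "\<dots> = (\<Sum>i\<in>UNIV. fscale (zsvar i * zvar i) \<omega>)"
    unfolding intr_ext by (intro sum.cong refl)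
      (simp add: if_distrib[of "fscale _"] cong: if_cong)
  also have "\<dots> = fscale zzs \<omega>"
    by (simp add: zzs_def fscale_sum_left mult.commute)
  finally show ?thesis .
qed

definition euler :: "('n::{finite,linorder}, 'k::idom) ratfun \<Rightarrow> ('n, 'k) ratfun" where
  "euler f = (\<Sum>i\<in>UNIV. zsvar i * pd (Zs i) f)"

text \<open>The number operator: each index of J is contracted and restored once.\<close>

lemma sum_ext_intr:
  fixes \<omega> :: "('n::{finite,linorder}, 'k::idom) form"
  shows "(\<Sum>i\<in>UNIV. ext i (intr i \<omega>)) = (\<lambda>J. of_nat (card J) * \<omega> J)"
proof
  fix J
  have "(\<Sum>i\<in>UNIV. ext i (intr i \<omega>)) J = (\<Sum>i\<in>UNIV. if i \<in> J then \<omega> J else 0)"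
    unfolding sum_fun_apply
    by (intro sum.cong refl) (simp add: ext_def intr_def insert_absorb)
  then show "(\<Sum>i\<in>UNIV. ext i (intr i \<omega>)) J = of_nat (card J) * \<omega> J"
    by (simp add: sum.If_cases)
qed

text \<open>Cartan's formula for the Euler field in the starred variables. The Lie derivative acts
  by \<open>euler\<close> on the coefficients and by 1 on every starred differential.\<close>

lemma dbar_contraction:
  "dbar (contraction \<omega>) + contraction (dbar \<omega>) = (\<lambda>J. euler (\<omega> J) + of_nat (card J) * \<omega> J)"
proof -
  \<comment> \<open>The first sum collects the terms in which \<open>dbar\<close> differentiates the
    coefficient \<open>zsvar i\<close> of the contraction.\<close>
  have 1: "dbar (contraction \<omega>) = (\<Sum>j\<in>UNIV. ext j (intr j \<omega>)) +
     (\<Sum>i\<in>UNIV. \<Sum>j\<in>UNIV. fscale (zsvar i) (ext j (intr i (fpd (Zs j) \<omega>))))"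
  proof -
    have "dbar (contraction \<omega>) = (\<Sum>j\<in>UNIV. \<Sum>i\<in>UNIV. fscale (if i = j then 1 else 0) (ext j (intr i \<omega>)) +
        fscale (zsvar i) (ext j (intr i (fpd (Zs j) \<omega>))))"
      by (simp add: dbar_conv contraction_conv fpd_sum fpd_fscale pd_zsvar ext_sum ext_fscale
          intr_fpd ext_fpd eq_commute)
    also have "\<dots> = (\<Sum>j\<in>UNIV. \<Sum>i\<in>UNIV. (if i = j then ext j (intr i \<omega>) else 0)) +
        (\<Sum>j\<in>UNIV. \<Sum>i\<in>UNIV. fscale (zsvar i) (ext j (intr i (fpd (Zs j) \<omega>))))"
      by (simp only: sum.distrib) (intro arg_cong2[where f = "(+)"] sum.cong refl, auto)
    also have "(\<Sum>j\<in>UNIV. \<Sum>i\<in>UNIV. fscale (zsvar i) (ext j (intr i (fpd (Zs j) \<omega>)))) =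
        (\<Sum>i\<in>UNIV. \<Sum>j\<in>UNIV. fscale (zsvar i) (ext j (intr i (fpd (Zs j) \<omega>))))"
      by (rule sum.swap)
    finally show ?thesis by simp
  qed
  have 2: "contraction (dbar \<omega>) =
     (\<Sum>i\<in>UNIV. \<Sum>j\<in>UNIV. fscale (zsvar i) (intr i (ext j (fpd (Zs j) \<omega>))))"
    by (simp add: dbar_conv contraction_conv intr_sum fscale_sum)
  have "dbar (contraction \<omega>) + contraction (dbar \<omega>) = (\<Sum>j\<in>UNIV. ext j (intr j \<omega>)) +
     (\<Sum>i\<in>UNIV. \<Sum>j\<in>UNIV. fscale (zsvar i) (intr i (ext j (fpd (Zs j) \<omega>)) + ext j (intr i (fpd (Zs j) \<omega>))))"
    unfolding 1 2 fscale_distribs sum.distrib by (simp only: ac_simps)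
  also have "(\<Sum>i\<in>UNIV. \<Sum>j\<in>UNIV. fscale (zsvar i) (intr i (ext j (fpd (Zs j) \<omega>)) + ext j (intr i (fpd (Zs j) \<omega>))))
      = (\<Sum>i\<in>UNIV. fscale (zsvar i) (fpd (Zs i) \<omega>))"
    unfolding intr_ext by (intro sum.cong refl)
      (simp add: if_distrib[of "fscale _"] cong: if_cong)
  finally have "dbar (contraction \<omega>) + contraction (dbar \<omega>) =
      (\<lambda>J. of_nat (card J) * \<omega> J) + (\<Sum>i\<in>UNIV. fscale (zsvar i) (fpd (Zs i) \<omega>))"
    by (simp only: sum_ext_intr)
  then show ?thesis
    by (simp only:) (rule HOL.ext, simp add: fun_apply sum_fun_apply fscale_def fpd_def euler_def)
qed

lemma additive_cech_d:
  fixes h :: "'a::ab_group_add \<Rightarrow> 'b::ab_group_add"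
  assumes "\<And>x y. h (x + y) = h x + h y"
  shows "h (cech_d c I) = cech_d (\<lambda>I. h (c I)) I"
  by (auto simp: cech_d_apply additive_sum[of h, OF assms] sgn_before_def
      additive_minus[of h, OF assms] intro!: sum.cong)

section \<open>The total differential\<close>

lemma tot_d_apply:
  "tot_d c I = cech_d c I + (if odd (card I) then dbar (c I) else - dbar (c I))"
  by (simp add: tot_d_def fun_apply)

lemma tot_d_add: "tot_d (c + d) = tot_d c + tot_d d"
  by (auto simp: fun_eq_iff fun_apply tot_d_apply)

lemma tot_d_diff: "tot_d (c - d) = tot_d c - tot_d d"
  by (auto simp: fun_eq_iff fun_apply tot_d_apply)

lemma tot_d_minus: "tot_d (- c) = - tot_d c"
  by (auto simp: fun_eq_iff fun_apply tot_d_apply)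

lemma tot_d_0 [simp]: "tot_d 0 = 0"
  by (auto simp: fun_eq_iff fun_apply tot_d_apply)

text \<open>Both differentials square to zero. The sign in front of \<open>dbar\<close> alternates
  with the number of indices, which the Cech differential changes by one, so the two mixed terms
  cancel.\<close>

lemma tot_d_tot_d [simp]: "tot_d (tot_d c) = 0"
proof (rule HOL.ext)
  fix I
  define s :: "'a set \<Rightarrow> ('a, 'b) form \<Rightarrow> ('a, 'b) form"
    where "s I x = (if odd (card I) then x else - x)" for I x
  have s_add: "s I (x + y) = s I x + s I y" for x y by (simp add: s_def)
  have s_s: "s I (s I x) = x" for x by (simp add: s_def)
  have tot: "tot_d c = cech_d c + (\<lambda>I. s I (dbar (c I)))" for c by (simp add: tot_d_def s_def)
  have "sgn_before i I (s (I - {i}) x) = - s I (sgn_before i I x)" if "i \<in> I" for i x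
  proof -
    have "odd (card (I - {i})) \<longleftrightarrow> even (card I)" using card.remove[OF _ that] by simp
    then show ?thesis by (simp only: s_def) simp
  qed
  then have "cech_d (\<lambda>I. s I (dbar (c I))) I = - s I (cech_d (\<lambda>I. dbar (c I)) I)"
    by (simp add: cech_d_apply additive_sum[of "s I", OF s_add] sum_negf)
  moreover have "dbar (cech_d c I) = cech_d (\<lambda>I. dbar (c I)) I"
    by (rule additive_cech_d[of dbar]) simp
  moreover have "dbar (s I x) = s I (dbar x)" for x by (simp add: s_def)
  ultimately show "tot_d (tot_d c) I = 0 I"
    unfolding tot by (simp add: fun_apply s_add s_s)
qed

section \<open>The graded rings of coefficients\<close>

definition zpol :: "'n set \<Rightarrow> ('n var, 'k::comm_ring_1) mpol" where
  "zpol I = (\<Prod>i\<in>I. pvar (Z i))"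

lemma mpol_sum_single: "p = (\<Sum>m\<in>Poly_Mapping.keys p. Poly_Mapping.single m (Poly_Mapping.lookup p m))"
  by (rule poly_mapping_eqI) (simp add: lookup_sum lookup_single when_def in_keys_iff)

lemma zs_homogeneous_0 [simp]: "zs_homogeneous e 0"
  by (simp add: zs_homogeneous_def)

lemma zs_homogeneous_single:
  "(\<Sum>i\<in>UNIV. Poly_Mapping.lookup m (Zs i)) = e \<Longrightarrow> zs_homogeneous e (Poly_Mapping.single m c)"
  by (simp add: zs_homogeneous_def)

lemma zs_homogeneous_add:
  "zs_homogeneous e p \<Longrightarrow> zs_homogeneous e q \<Longrightarrow> zs_homogeneous e (p + q)"
  using Poly_Mapping.keys_add[of p q] by (fastforce simp: zs_homogeneous_def)

lemma zs_homogeneous_minus: "zs_homogeneous e p \<Longrightarrow> zs_homogeneous e (- p)"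
  by (simp add: zs_homogeneous_def in_keys_iff)

lemma zs_homogeneous_sum:
  "(\<And>a. a \<in> A \<Longrightarrow> zs_homogeneous e (f a)) \<Longrightarrow> zs_homogeneous e (sum f A)"
  by (induction A rule: infinite_finite_induct) (simp_all add: zs_homogeneous_add)

lemma zs_homogeneous_mult:
  assumes "zs_homogeneous d p" "zs_homogeneous e q"
  shows "zs_homogeneous (d + e) (p * q)"
  unfolding zs_homogeneous_def
proof
  fix m assume "m \<in> Poly_Mapping.keys (p * q)"
  then obtain a b where "m = a + b" "a \<in> Poly_Mapping.keys p" "b \<in> Poly_Mapping.keys q"
    using keys_mult[of p q] by auto
  then show "(\<Sum>i\<in>UNIV. Poly_Mapping.lookup m (Zs i)) = d + e"
    using assms by (simp add: zs_homogeneous_def lookup_add sum.distrib)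
qed

lemma zs_homogeneous_1 [simp]: "zs_homogeneous 0 1"
  by (simp add: zs_homogeneous_def)

lemma zs_homogeneous_pvar: "zs_homogeneous 0 (pvar (Z i))" "zs_homogeneous 1 (pvar (Zs i))"
  by (auto simp: pvar_def lookup_single when_def intro!: zs_homogeneous_single)

lemma zs_homogeneous_zzp: "zs_homogeneous 1 zzp"
  unfolding zzp_def using zs_homogeneous_mult[OF zs_homogeneous_pvar(1) zs_homogeneous_pvar(2)]
  by (intro zs_homogeneous_sum) simp

lemma zs_homogeneous_power: "zs_homogeneous e p \<Longrightarrow> zs_homogeneous (n * e) (p ^ n)"
  by (induction n) (simp_all add: zs_homogeneous_mult)

lemma zs_homogeneous_zpol: "zs_homogeneous 0 (zpol I)"
  unfolding zpol_def
  by (induction I rule: infinite_finite_induct)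
     (auto intro: zs_homogeneous_mult[of 0 _ 0, simplified] zs_homogeneous_pvar)

lemma zs_homogeneous_den: "zs_homogeneous N (zzp ^ N * zpol I ^ M)"
  using zs_homogeneous_mult[OF zs_homogeneous_power[OF zs_homogeneous_zzp] zs_homogeneous_power[OF zs_homogeneous_zpol],
      of N M I] by simp

lemma zs_homogeneous_pderiv_Z:
  assumes "zs_homogeneous e p"
  shows "zs_homogeneous e (pderiv_mpol (Z i) p)"
  unfolding pderiv_mpol_def using assms
  by (intro zs_homogeneous_sum zs_homogeneous_single)
     (simp add: zs_homogeneous_def lookup_minus lookup_single when_def)

text \<open>The truncated difference is harmless for \<open>e = 0\<close>, since the derivative is
  then zero.\<close>

lemma zs_homogeneous_pderiv_Zs:
  assumes "zs_homogeneous e p"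
  shows "zs_homogeneous (e - 1) (pderiv_mpol (Zs i) p)"
  unfolding pderiv_mpol_def
proof (rule zs_homogeneous_sum)
  fix m assume "m \<in> Poly_Mapping.keys p"
  then have e: "(\<Sum>j\<in>UNIV. Poly_Mapping.lookup m (Zs j)) = e"
    using assms by (simp add: zs_homogeneous_def)
  show "zs_homogeneous (e - 1) (Poly_Mapping.single (m - Poly_Mapping.single (Zs i) 1)
      (of_nat (Poly_Mapping.lookup m (Zs i)) * Poly_Mapping.lookup p m))"
  proof (cases "Poly_Mapping.lookup m (Zs i) = 0")
    case False
    have "(\<Sum>j\<in>UNIV. Poly_Mapping.lookup (m - Poly_Mapping.single (Zs i) 1) (Zs j)) =
        (\<Sum>j\<in>UNIV. Poly_Mapping.lookup m (Zs j)) - (\<Sum>j\<in>UNIV. if i = j then 1 else 0)"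
      unfolding lookup_minus using False
      by (subst sum_subtractf_nat[symmetric]) (auto simp: lookup_single when_def intro!: sum.cong)
    then show ?thesis using e by (intro zs_homogeneous_single) simp
  qed simp
qed

lemma zs_homogeneous_pderiv_Zs_0:
  assumes "zs_homogeneous 0 p"
  shows "pderiv_mpol (Zs i) p = 0"
  unfolding pderiv_mpol_def using assms by (intro sum.neutral) (simp add: zs_homogeneous_def)

text \<open>Each monomial is an eigenvector of the Euler operator. Where the derivative truncates an
  exponent, its coefficient is 0.\<close>

lemma euler_mpol:
  fixes p :: "('n::finite var, 'k::comm_ring_1) mpol"
  assumes "zs_homogeneous e p"
  shows "(\<Sum>i\<in>UNIV. pvar (Zs i) * pderiv_mpol (Zs i) p) = of_nat e * p"
proof -
  have tm: "pvar (Zs i) * Poly_Mapping.single (m - Poly_Mapping.single (Zs i) 1)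
      (of_nat (Poly_Mapping.lookup m (Zs i)) * c) =
      of_nat (Poly_Mapping.lookup m (Zs i)) * Poly_Mapping.single m c" for i :: 'n and m and c :: 'k
  proof (cases "Poly_Mapping.lookup m (Zs i) = 0")
    case False
    then have "Poly_Mapping.single (Zs i) 1 + (m - Poly_Mapping.single (Zs i) 1) = m"
      by (intro poly_mapping_eqI) (auto simp: lookup_add lookup_minus lookup_single when_def)
    then show ?thesis by (simp add: pvar_def mult_single flip: single_of_nat)
  qed simp
  have "(\<Sum>i\<in>UNIV. pvar (Zs i) * pderiv_mpol (Zs i) p) =
      (\<Sum>i\<in>UNIV. \<Sum>m\<in>Poly_Mapping.keys p. of_nat (Poly_Mapping.lookup m (Zs i)) *
        Poly_Mapping.single m (Poly_Mapping.lookup p m))"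
    unfolding pderiv_mpol_def sum_distrib_left by (intro sum.cong refl tm)
  also have "\<dots> = (\<Sum>m\<in>Poly_Mapping.keys p. (\<Sum>i\<in>UNIV. of_nat (Poly_Mapping.lookup m (Zs i))) *
        Poly_Mapping.single m (Poly_Mapping.lookup p m))"
    by (subst sum.swap) (simp add: sum_distrib_right)
  also have "\<dots> = (\<Sum>m\<in>Poly_Mapping.keys p. of_nat e * Poly_Mapping.single m (Poly_Mapping.lookup p m))"
    using assms by (intro sum.cong refl) (simp add: zs_homogeneous_def flip: of_nat_sum)
  also have "\<dots> = of_nat e * p"
    by (simp flip: sum_distrib_left mpol_sum_single)
  finally show ?thesis .
qed

lemma of_mpol_zpol: "of_mpol (zpol I) = (\<Prod>i\<in>I. zvar i)"
  by (simp add: zpol_def of_mpol_prod zvar_def)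

lemma zpol_nonzero [simp]: "(zpol I :: ('n::{finite,linorder} var, 'k::idom) mpol) \<noteq> 0"
  by (simp add: zpol_def)

lemma prod_zvar_nonzero [simp]: "(\<Prod>i\<in>I. zvar i :: ('n::{finite,linorder}, 'k::idom) ratfun) \<noteq> 0"
  by simp

lemma coeffsI:
  "zs_homogeneous e p \<Longrightarrow> int e = int N + d \<Longrightarrow>
    of_mpol p / (zzs ^ N * (\<Prod>i\<in>I. zvar i) ^ M) \<in> coeffs I d"
  unfolding coeffs_def by blast

lemma coeffsE:
  assumes "f \<in> coeffs I d"
  obtains p N M e where "f = of_mpol p / (zzs ^ N * (\<Prod>i\<in>I. zvar i) ^ M)"
    "zs_homogeneous e p" "int e = int N + d"
  using assms unfolding coeffs_def by blast

lemma coeffs_of_mpol: "zs_homogeneous e p \<Longrightarrow> of_mpol p \<in> coeffs I (int e)"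
  using coeffsI[of e p 0 "int e" I 0] by simp

lemma coeffs_add:
  assumes "f \<in> coeffs I d" "g \<in> coeffs I d"
  shows "f + g \<in> coeffs I d"
proof -
  obtain p N M e where f: "f = of_mpol p / (zzs ^ N * (\<Prod>i\<in>I. zvar i) ^ M)"
    "zs_homogeneous e p" "int e = int N + d" using assms(1) by (rule coeffsE)
  obtain p' N' M' e' where g: "g = of_mpol p' / (zzs ^ N' * (\<Prod>i\<in>I. zvar i) ^ M')"
    "zs_homogeneous e' p'" "int e' = int N' + d" using assms(2) by (rule coeffsE)
  let ?r = "p * (zzp ^ N' * zpol I ^ M') + p' * (zzp ^ N * zpol I ^ M)"
  have eq: "e' + N = e + N'" using f(3) g(3) by linarith
  have "f + g = of_mpol ?r / (zzs ^ (N + N') * (\<Prod>i\<in>I. zvar i) ^ (M + M'))"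
    unfolding f g by (simp add: zzs_conv of_mpol_zpol[symmetric] power_add divide_simps)
  moreover have "zs_homogeneous (e + N') ?r"
    using zs_homogeneous_mult[OF f(2) zs_homogeneous_den[of N' I M']]
      zs_homogeneous_mult[OF g(2) zs_homogeneous_den[of N I M]] eq
    by (intro zs_homogeneous_add) simp_all
  moreover have "int (e + N') = int (N + N') + d" using f(3) by simp
  ultimately show ?thesis by (simp only: coeffsI)
qed

lemma coeffs_mult:
  assumes "f \<in> coeffs I d" "g \<in> coeffs I d'"
  shows "f * g \<in> coeffs I (d + d')"
proof -
  obtain p N M e where f: "f = of_mpol p / (zzs ^ N * (\<Prod>i\<in>I. zvar i) ^ M)"
    "zs_homogeneous e p" "int e = int N + d" using assms(1) by (rule coeffsE)
  obtain p' N' M' e' where g: "g = of_mpol p' / (zzs ^ N' * (\<Prod>i\<in>I. zvar i) ^ M')"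
    "zs_homogeneous e' p'" "int e' = int N' + d'" using assms(2) by (rule coeffsE)
  have "f * g = of_mpol (p * p') / (zzs ^ (N + N') * (\<Prod>i\<in>I. zvar i) ^ (M + M'))"
    unfolding f g by (simp add: power_add)
  moreover have "int (e + e') = int (N + N') + (d + d')" using f(3) g(3) by simp
  ultimately show ?thesis using zs_homogeneous_mult[OF f(2) g(2)] by (simp only: coeffsI)
qed

lemma coeffs_0 [simp]: "0 \<in> coeffs I d"
proof -
  \<comment> \<open>A numerator has a natural number as degree, so a negative d needs the
    denominator exponent -d even for the zero function.\<close>
  have "int (nat (d + int (nat (- d)))) = int (nat (- d)) + d" by simp
  from coeffsI[OF zs_homogeneous_0 this, of I 0] show ?thesis by simp
qed

lemma coeffs_const [simp]: "const c \<in> coeffs I 0"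
  using coeffs_of_mpol[OF zs_homogeneous_single[of 0 0 c]] by (simp add: const_def)

lemma coeffs_const_mult: "f \<in> coeffs I d \<Longrightarrow> const c * f \<in> coeffs I d"
  using coeffs_mult[OF coeffs_const, of f] by simp

lemma coeffs_minus: "f \<in> coeffs I d \<Longrightarrow> - f \<in> coeffs I d"
  using coeffs_const_mult[of f I d "-1"] by simp

lemma coeffs_diff: "f \<in> coeffs I d \<Longrightarrow> g \<in> coeffs I d \<Longrightarrow> f - g \<in> coeffs I d"
  using coeffs_add[of f I d "- g"] by (simp add: coeffs_minus)

lemma coeffs_sum: "(\<And>a. a \<in> A \<Longrightarrow> f a \<in> coeffs I d) \<Longrightarrow> sum f A \<in> coeffs I d"
  by (induction A rule: infinite_finite_induct) (simp_all add: coeffs_add)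

lemma coeffs_sgn_before: "f \<in> coeffs I d \<Longrightarrow> sgn_before i J f \<in> coeffs I d"
  by (simp add: sgn_before_def coeffs_minus)

lemma coeffs_1 [simp]: "1 \<in> coeffs I 0"
  using coeffs_const[of 1] by simp

lemma coeffs_zvar: "zvar i \<in> coeffs I 0"
  using coeffs_of_mpol[OF zs_homogeneous_pvar(1)] by (simp add: zvar_def)

lemma coeffs_zsvar: "zsvar i \<in> coeffs I 1"
  using coeffs_of_mpol[OF zs_homogeneous_pvar(2)] by (simp add: zsvar_def)

lemma coeffs_inverse_zzs_power: "inverse zzs ^ N \<in> coeffs I (- int N)"
  using coeffsI[of 0 1 N "- int N" I 0] by (simp add: divide_inverse power_inverse)

lemma coeffs_inverse_zvar: "i \<in> I \<Longrightarrow> inverse (zvar i) \<in> coeffs I 0"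
proof -
  assume i: "i \<in> I"
  have eq: "inverse (zvar i) = of_mpol (zpol (I - {i})) / (zzs ^ 0 * (\<Prod>i\<in>I. zvar i) ^ 1)"
    using i by (simp add: of_mpol_zpol prod.remove[of I i] divide_simps)
  show ?thesis unfolding eq by (rule coeffsI[OF zs_homogeneous_zpol]) simp
qed

lemma coeffs_inverse_prod_zvar:
  fixes I I' :: "'n::{finite,linorder} set"
  assumes "I \<subseteq> I'"
  shows "inverse (\<Prod>i\<in>I. zvar i :: ('n, 'k::idom) ratfun) ^ M \<in> coeffs I' 0"
proof -
  have "(\<Prod>i\<in>A. inverse (zvar i :: ('n, 'k) ratfun)) \<in> coeffs I' 0" if "A \<subseteq> I'" for A
    using that by (induction A rule: infinite_finite_induct)
      (auto intro: coeffs_mult[of _ _ 0 _ 0, simplified] coeffs_inverse_zvar)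
  then have "inverse (\<Prod>i\<in>I. zvar i :: ('n, 'k) ratfun) \<in> coeffs I' 0" using assms by (simp add: o_def flip: prod_inversef)
  then show ?thesis by (induction M) (auto intro: coeffs_mult[of _ _ 0 _ 0, simplified])
qed

lemma coeffs_mono: "I \<subseteq> I' \<Longrightarrow> f \<in> coeffs I d \<Longrightarrow> f \<in> coeffs I' d"
proof (elim coeffsE)
  fix p N M e
  assume *: "I \<subseteq> I'" "f = of_mpol p / (zzs ^ N * (\<Prod>i\<in>I. zvar i) ^ M)" "zs_homogeneous e p" "int e = int N + d"
  have "of_mpol p * inverse zzs ^ N * inverse (\<Prod>i\<in>I. zvar i) ^ M \<in> coeffs I' (int e + - int N + 0)"
    using * by (intro coeffs_mult coeffs_of_mpol coeffs_inverse_zzs_power coeffs_inverse_prod_zvar) auto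
  then show ?thesis using * by (simp add: divide_inverse power_inverse mult.assoc)
qed

lemma
  fixes f :: "('n::{finite,linorder}, 'k::idom) ratfun"
  assumes "f \<in> coeffs I d"
  shows coeffs_pd_Z: "pd (Z i) f \<in> coeffs I d"
    and coeffs_pd_Zs: "pd (Zs i) f \<in> coeffs I (d - 1)"
    and euler_coeffs: "euler f = of_int d * f"
proof -
  obtain p N M e where f: "f = of_mpol p / (zzs ^ N * (\<Prod>i\<in>I. zvar i) ^ M)"
    and p: "zs_homogeneous e p" and d: "int e = int N + d" using assms by (rule coeffsE)
  define q :: "('n var, 'k) mpol" where "q = zzp ^ N * zpol I ^ M"
  have q: "zs_homogeneous N q" "q \<noteq> 0" by (simp_all add: q_def zs_homogeneous_den)
  have fq: "f = of_mpol p / of_mpol q" by (simp add: f q_def zzs_conv of_mpol_zpol)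
  have qq: "of_mpol (q * q) = zzs ^ (N + N) * (\<Prod>i\<in>I. zvar i) ^ (M + M)"
    by (simp add: q_def zzs_conv of_mpol_zpol power_add mult.assoc mult.left_commute)
  note pd = pd_quotient[OF q(2), of _ p, folded fq, unfolded qq]
  have "zs_homogeneous (e + N) (pderiv_mpol (Z i) p * q - p * pderiv_mpol (Z i) q)"
    using p q(1) unfolding diff_conv_add_uminus
    by (intro zs_homogeneous_add zs_homogeneous_minus zs_homogeneous_mult zs_homogeneous_pderiv_Z)
  then show "pd (Z i) f \<in> coeffs I d" unfolding pd by (rule coeffsI) (use d in simp)
  let ?r = "pderiv_mpol (Zs i) p * q - p * pderiv_mpol (Zs i) q"
  \<comment> \<open>Degrees are natural numbers, so a numerator or denominator of degree 0 is
    treated separately; its starred derivatives vanish.\<close>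
  show "pd (Zs i) f \<in> coeffs I (d - 1)"
  proof (cases "e + N = 0")
    case True
    then have "?r = 0" using p q(1) by (simp add: zs_homogeneous_pderiv_Zs_0)
    then show ?thesis unfolding pd by simp
  next
    case False
    have "zs_homogeneous (e + N - 1) (pderiv_mpol (Zs i) p * q)"
    proof (cases e)
      case 0
      then show ?thesis using p by (simp add: zs_homogeneous_pderiv_Zs_0)
    next
      case (Suc e')
      then show ?thesis using zs_homogeneous_mult[OF zs_homogeneous_pderiv_Zs[OF p] q(1)] by simp
    qed
    moreover have "zs_homogeneous (e + N - 1) (p * pderiv_mpol (Zs i) q)"
    proof (cases N)
      case 0
      then show ?thesis using q(1) by (simp add: zs_homogeneous_pderiv_Zs_0)
    next
      case (Suc N')
      then show ?thesis using zs_homogeneous_mult[OF p zs_homogeneous_pderiv_Zs[OF q(1)]] by simp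
    qed
    ultimately have "zs_homogeneous (e + N - 1) ?r"
      unfolding diff_conv_add_uminus[of "pderiv_mpol (Zs i) p * q"]
      by (intro zs_homogeneous_add zs_homogeneous_minus)
    then show ?thesis unfolding pd by (rule coeffsI) (use d False in arith)
  qed
  have eul: "euler (of_mpol r) = of_nat k * of_mpol r" if "zs_homogeneous k r" for k and r :: "('n var, 'k) mpol"
  proof -
    have "euler (of_mpol r) = of_mpol (\<Sum>i\<in>UNIV. pvar (Zs i) * pderiv_mpol (Zs i) r)"
      by (simp add: euler_def zsvar_def pd_of_mpol of_mpol_sum)
    also have "\<dots> = of_mpol (of_nat k * r)" using euler_mpol[OF that] by simp
    also have "\<dots> = of_mpol (Poly_Mapping.single 0 (of_nat k)) * of_mpol r"
      by (simp flip: single_of_nat)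
    finally show ?thesis by (simp only: const_def[symmetric] const_of_nat)
  qed
  \<comment> \<open>The Euler operator is a derivation, so its eigenvalue on a quotient is the
    difference of the two degrees.\<close>
  have "f * of_mpol q = of_mpol p" using fq q(2) by simp
  moreover have "euler (f * of_mpol q) = euler f * of_mpol q + f * euler (of_mpol q)"
    by (simp add: euler_def pd_mult algebra_simps sum.distrib sum_distrib_left)
  ultimately have "euler f * of_mpol q + f * (of_nat N * of_mpol q) = of_nat e * (f * of_mpol q)"
    using eul[OF p] eul[OF q(1)] by metis
  then have "(euler f - (of_nat e - of_nat N) * f) * of_mpol q = 0"
    by (simp add: algebra_simps)
  then have "euler f = (of_nat e - of_nat N) * f" using q(2) by simp
  moreover have "(of_nat e - of_nat N :: ('n, 'k) ratfun) = of_int d"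
    using d by (metis add_diff_cancel_left' of_int_diff of_int_of_nat_eq)
  ultimately show "euler f = of_int d * f" by simp
qed

section \<open>The spaces of forms\<close>

lemma A_locI:
  "(\<And>J. card J = m \<Longrightarrow> \<omega> J \<in> coeffs I (- int m)) \<Longrightarrow> (\<And>J. card J \<noteq> m \<Longrightarrow> \<omega> J = 0) \<Longrightarrow>
    contraction \<omega> = 0 \<Longrightarrow> \<omega> \<in> A_loc I m"
  by (simp add: A_loc_def)

lemma A_locD:
  assumes "\<omega> \<in> A_loc I m"
  shows "card J = m \<Longrightarrow> \<omega> J \<in> coeffs I (- int m)" "card J \<noteq> m \<Longrightarrow> \<omega> J = 0" "contraction \<omega> = 0"
  using assms by (auto simp: A_loc_def)

lemma A_loc_coeffs: "\<omega> \<in> A_loc I m \<Longrightarrow> \<omega> J \<in> coeffs I (- int m)"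
  by (cases "card J = m") (simp_all add: A_locD)

lemma A_loc_0 [simp]: "0 \<in> A_loc I m"
  by (rule A_locI) (simp_all add: fun_apply)

lemma A_loc_add: "\<omega> \<in> A_loc I m \<Longrightarrow> \<eta> \<in> A_loc I m \<Longrightarrow> \<omega> + \<eta> \<in> A_loc I m"
  by (rule A_locI) (simp_all add: fun_apply A_locD coeffs_add)

lemma A_loc_minus: "\<omega> \<in> A_loc I m \<Longrightarrow> - \<omega> \<in> A_loc I m"
  by (rule A_locI) (simp_all add: fun_apply A_locD coeffs_minus)

lemma A_loc_diff: "\<omega> \<in> A_loc I m \<Longrightarrow> \<eta> \<in> A_loc I m \<Longrightarrow> \<omega> - \<eta> \<in> A_loc I m"
  by (rule A_locI) (simp_all add: fun_apply A_locD coeffs_diff)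

lemma A_loc_sum: "(\<And>a. a \<in> A \<Longrightarrow> f a \<in> A_loc I m) \<Longrightarrow> sum f A \<in> A_loc I m"
  by (induction A rule: infinite_finite_induct) (simp_all add: A_loc_add)

lemma A_loc_fscale: "f \<in> coeffs I 0 \<Longrightarrow> \<omega> \<in> A_loc I m \<Longrightarrow> fscale f \<omega> \<in> A_loc I m"
  using coeffs_mult[of f I 0]
  by (intro A_locI) (simp_all add: fscale_def A_locD contraction_fscale[unfolded fscale_def] fun_eq_iff fun_apply)

lemma A_loc_fpd: "\<omega> \<in> A_loc I m \<Longrightarrow> fpd (Z i) \<omega> \<in> A_loc I m"
  by (rule A_locI) (simp_all add: A_locD contraction_fpd_Z coeffs_pd_Z, simp_all add: fpd_def A_locD coeffs_pd_Z)

lemma A_loc_mono: "I \<subseteq> I' \<Longrightarrow> \<omega> \<in> A_loc I m \<Longrightarrow> \<omega> \<in> A_loc I' m"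
  by (rule A_locI) (simp_all add: A_locD coeffs_mono)

text \<open>Cartan's formula in total degree 0: the eigenvalue -m of the Euler operator cancels the
  form degree m. The form itself may have nonzero contraction, so the lemma applies to primitives
  under the contraction.\<close>

lemma dbar_contraction_A_loc:
  assumes "\<And>J. card J = m \<Longrightarrow> \<omega> J \<in> coeffs I (- int m)" "\<And>J. card J \<noteq> m \<Longrightarrow> \<omega> J = 0"
  shows "dbar (contraction \<omega>) = - contraction (dbar \<omega>)"
proof -
  have "euler (\<omega> J) + of_nat (card J) * \<omega> J = 0" for J
  proof (cases "card J = m")
    case True
    then show ?thesis using euler_coeffs[OF assms(1)[OF True]] by simp
  next
    case False
    then show ?thesis using assms(2)[of J] by (simp add: euler_def)
  qed
  then have "dbar (contraction \<omega>) + contraction (dbar \<omega>) = 0"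
    by (simp add: dbar_contraction fun_eq_iff fun_apply)
  then show ?thesis by (simp add: eq_neg_iff_add_eq_0)
qed

lemma coeffs_ext:
  "(\<And>J. \<omega> J \<in> coeffs I d) \<Longrightarrow> ext i \<omega> J \<in> coeffs I d"
  by (simp add: ext_def coeffs_sgn_before)

lemma coeffs_intr:
  "(\<And>J. \<omega> J \<in> coeffs I d) \<Longrightarrow> intr i \<omega> J \<in> coeffs I d"
  by (simp add: intr_def coeffs_sgn_before)

lemma ext_degree:
  fixes \<omega> :: "'n::{finite,linorder} set \<Rightarrow> 'a::ab_group_add"
  assumes "\<And>J. card J \<noteq> m \<Longrightarrow> \<omega> J = 0" "card J \<noteq> Suc m"
  shows "ext i \<omega> J = 0"
proof (cases "i \<in> J")
  case True
  then have "card (J - {i}) \<noteq> m" using assms(2) by (metis card.remove finite)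
  then have "\<omega> (J - {i}) = 0" by (rule assms(1))
  then show ?thesis by (simp add: ext_def)
qed (simp add: ext_def)

lemma intr_degree:
  fixes \<omega> :: "'n::{finite,linorder} set \<Rightarrow> 'a::ab_group_add"
  assumes "\<And>J. card J \<noteq> Suc m \<Longrightarrow> \<omega> J = 0" "card J \<noteq> m"
  shows "intr i \<omega> J = 0"
  using assms by (simp add: intr_def)

lemma A_loc_dbar: "\<omega> \<in> A_loc I m \<Longrightarrow> dbar \<omega> \<in> A_loc I (Suc m)"
proof (rule A_locI)
  assume \<omega>: "\<omega> \<in> A_loc I m"
  have "- int (Suc m) = - int m - 1" by simp
  then show "dbar \<omega> J \<in> coeffs I (- int (Suc m))" for J
    unfolding dbar_conv sum_fun_apply using coeffs_pd_Zs[OF A_loc_coeffs[OF \<omega>]]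
    by (simp only:) (intro coeffs_sum coeffs_ext, simp add: fpd_def)
  show "dbar \<omega> J = 0" if "card J \<noteq> Suc m" for J
    unfolding dbar_conv sum_fun_apply using that A_locD(2)[OF \<omega>]
    by (intro sum.neutral ballI ext_degree[of m]) (simp_all add: fpd_def)
  show "contraction (dbar \<omega>) = 0"
    using dbar_contraction_A_loc[of m \<omega> I] A_locD[OF \<omega>] by simp
qed

section \<open>Forms of top degree\<close>

text \<open>Contraction squares to zero; it lowers the form degree by one and multiplies
  coefficients by starred variables, which keeps the total degree 0.\<close>

lemma contraction_A_loc:
  assumes "\<And>J. card J = Suc m \<Longrightarrow> \<eta> J \<in> coeffs I (- int (Suc m))" "\<And>J. card J \<noteq> Suc m \<Longrightarrow> \<eta> J = 0"
  shows "contraction \<eta> \<in> A_loc I m"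
proof (rule A_locI)
  have \<eta>: "\<eta> J \<in> coeffs I (- int (Suc m))" for J
    using assms by (cases "card J = Suc m") simp_all
  have m: "- int m = 1 + - int (Suc m)" by simp
  show "contraction \<eta> J \<in> coeffs I (- int m)" for J
    unfolding contraction_conv sum_fun_apply fscale_def m
    by (intro coeffs_sum coeffs_mult coeffs_zsvar coeffs_intr \<eta>)
  show "contraction \<eta> J = 0" if "card J \<noteq> m" for J
    unfolding contraction_conv sum_fun_apply fscale_def
    using intr_degree[of m \<eta>, OF assms(2) that] by (intro sum.neutral) simp
qed simp

definition tau :: "('n::{finite,linorder}, 'k::idom) form" where
  "tau = contraction (dzs UNIV)"

lemma tau_compl:
  "(tau :: ('n::{finite,linorder}, 'k::idom) form) (- {i}) = sgn_before i UNIV (zsvar i)"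
proof -
  have "(tau :: ('n, 'k) form) (- {i}) = (\<Sum>j\<in>UNIV. if j = i then sgn_before i UNIV (zsvar i) else 0)"
    unfolding tau_def contraction_conv sum_fun_apply fscale_def
  proof (intro sum.cong refl)
    fix j
    have "sgn_before i (- {i}) x = sgn_before i UNIV x" for x :: "('n, 'k) ratfun"
      by (metis Compl_eq_Diff_UNIV sgn_before_Diff_insert(1))
    moreover have "insert i (- {i}) = UNIV" by auto
    ultimately show "zsvar j * intr j (dzs UNIV) (- {i}) =
        (if j = i then sgn_before i UNIV (zsvar i :: ('n, 'k) ratfun) else 0)"
      by (auto simp: intr_def dzs_def sgn_before_def)
  qed
  then show ?thesis by simp
qed

lemma tau_degree: "card J \<noteq> CARD('n) - 1 \<Longrightarrow> (tau :: ('n::{finite,linorder}, 'k::idom) form) J = 0"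
  unfolding tau_def contraction_conv sum_fun_apply fscale_def
proof (intro sum.neutral ballI)
  fix i assume J: "card J \<noteq> CARD('n) - 1"
  have "i \<in> J \<or> insert i J \<noteq> UNIV"
  proof (rule ccontr)
    assume "\<not> (i \<in> J \<or> insert i J \<noteq> UNIV)"
    then have "i \<notin> J" "insert i J = UNIV" by auto
    then have "Suc (card J) = CARD('n)" by (metis card_insert_disjoint finite)
    with J show False by simp
  qed
  then show "zsvar i * intr i (dzs UNIV) J = 0" by (auto simp: intr_def dzs_def)
qed

lemma fscale_tau_eq_0:
  assumes "fscale f tau = 0"
  shows "f = 0"
proof -
  obtain i :: 'a where True by blast
  have "f * tau (- {i}) = 0" using assms by (metis fscale_def zero_fun_apply)
  then show ?thesis by (auto simp: tau_compl sgn_before_def split: if_splits)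
qed

lemma fscale_tau_inj: "fscale f tau = fscale g tau \<Longrightarrow> f = g"
  using fscale_tau_eq_0[of "f - g"] by (simp add: fscale_distribs)

lemma contraction_top: "contraction (fscale f (dzs UNIV)) = fscale f tau"
  by (simp add: contraction_fscale tau_def)

lemma fscale_tau_A_loc:
  fixes f :: "('n::{finite,linorder}, 'k::idom) ratfun"
  assumes "f \<in> coeffs I (- int CARD('n))"
  shows "fscale f tau \<in> A_loc I (CARD('n) - 1)"
  unfolding contraction_top[symmetric]
proof (rule contraction_A_loc)
  have S: "Suc (CARD('n) - 1) = CARD('n)" by simp
  show "fscale f (dzs UNIV) J \<in> coeffs I (- int (Suc (CARD('n) - 1)))" for J
    using assms unfolding S by (simp add: fscale_def dzs_def)
  show "fscale f (dzs UNIV) J = 0" if "card J \<noteq> Suc (CARD('n) - 1)" for J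
    using that unfolding S by (auto simp: fscale_def dzs_def)
qed

lemma Omega_conv:
  "(Omega :: ('n::{finite,linorder}, 'k::idom) form) = fscale (inverse zzs ^ CARD('n)) tau"
proof (rule HOL.ext)
  fix J :: "'n set"
  have J: "(Omega :: ('n, 'k) form) J =
      (\<Sum>i\<in>UNIV. (-1) ^ card {j. j < i} * zsvar i / zzs ^ CARD('n) * dzs (- {i}) J)"
    by (simp add: Omega_def sum_fun_apply)
  show "(Omega :: ('n, 'k) form) J = fscale (inverse zzs ^ CARD('n)) tau J"
  proof (cases "card J = CARD('n) - 1")
    case True
    then have "card (- J) = 1" by (simp add: card_Diff_subset Compl_eq_Diff_UNIV)
    then obtain i where "- J = {i}" by (auto simp: card_1_singleton_iff)
    then have i: "J = - {i}" by auto
    have "Omega J = (\<Sum>j\<in>UNIV. if j = i then (-1) ^ card {j. j < i} * zsvar i / zzs ^ CARD('n) else (0::('n, 'k) ratfun))"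
      unfolding J unfolding i by (intro sum.cong refl) (auto simp: dzs_def)
    also have "\<dots> = fscale (inverse zzs ^ CARD('n)) tau J"
      by (simp add: i fscale_def tau_compl sgn_before_def divide_inverse power_inverse)
    finally show ?thesis .
  next
    case False
    then have "dzs (- {i}) J = (0::('n, 'k) ratfun)" for i
      by (auto simp: dzs_def card_Diff_subset Compl_eq_Diff_UNIV)
    then show ?thesis using tau_degree[OF False, where 'k = 'k] unfolding J by (simp add: fscale_def)
  qed
qed

lemma top_degree_form:
  fixes \<eta> :: "('n::{finite,linorder}, 'k::idom) form"
  assumes "\<And>J. card J \<noteq> CARD('n) \<Longrightarrow> \<eta> J = 0"
  shows "\<eta> = fscale (\<eta> UNIV) (dzs UNIV)"
proof (rule HOL.ext)
  fix J :: "'n set"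
  have "J \<noteq> UNIV \<Longrightarrow> card J \<noteq> CARD('n)" by (metis card_eq_UNIV_imp_eq_UNIV finite)
  then show "\<eta> J = fscale (\<eta> UNIV) (dzs UNIV) J"
    using assms by (cases "J = UNIV") (auto simp: fscale_def dzs_def)
qed

lemma coeffs_theta:
  "(\<And>J. \<omega> J \<in> coeffs I d) \<Longrightarrow> theta \<omega> J \<in> coeffs I d"
  unfolding theta_def sum_fun_apply fscale_def
  by (intro coeffs_sum coeffs_mult[of _ _ 0 _ d, simplified] coeffs_zvar coeffs_ext)

lemma theta_degree:
  "(\<And>J. card J \<noteq> m \<Longrightarrow> \<omega> J = 0) \<Longrightarrow> card J \<noteq> Suc m \<Longrightarrow> theta \<omega> J = 0"
  unfolding theta_def sum_fun_apply fscale_def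
  using ext_degree[of m \<omega> J] by (intro sum.neutral) simp

lemma A_loc_conv_contraction:
  assumes "\<omega> \<in> A_loc I m"
  obtains \<eta> where "\<omega> = contraction \<eta>" "\<And>J. \<eta> J \<in> coeffs I (- int (Suc m))"
    "\<And>J. card J \<noteq> Suc m \<Longrightarrow> \<eta> J = 0"
proof
  \<comment> \<open>The Koszul homotopy divided by \<open>zzs\<close>: on a form killed by the
    contraction it produces a primitive.\<close>
  let ?\<eta> = "fscale (inverse zzs) (theta \<omega>)"
  show "\<omega> = contraction ?\<eta>"
    using theta_contraction[of \<omega>] A_locD(3)[OF assms] by (simp add: contraction_fscale theta_def)
  have m: "- int (Suc m) = - int 1 + - int m" by simp
  show "?\<eta> J \<in> coeffs I (- int (Suc m))" for J
    unfolding fscale_def m using coeffs_inverse_zzs_power[of 1 I]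
    by (intro coeffs_mult coeffs_theta A_loc_coeffs[OF assms]) simp
  show "?\<eta> J = 0" if "card J \<noteq> Suc m" for J
    using theta_degree[OF A_locD(2)[OF assms] that] by (simp add: fscale_def)
qed

lemma A_loc_top:
  fixes \<omega> :: "('n::{finite,linorder}, 'k::idom) form"
  assumes "\<omega> \<in> A_loc I (CARD('n) - 1)"
  obtains f where "f \<in> coeffs I (- int CARD('n))" "\<omega> = fscale f tau"
proof -
  have S: "Suc (CARD('n) - 1) = CARD('n)" by simp
  obtain \<eta> where \<eta>: "\<omega> = contraction \<eta>" "\<And>J. \<eta> J \<in> coeffs I (- int CARD('n))"
    "\<And>J. card J \<noteq> CARD('n) \<Longrightarrow> \<eta> J = 0"
    using A_loc_conv_contraction[OF assms] unfolding S by metis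
  have "\<omega> = fscale (\<eta> UNIV) tau"
    using \<eta>(1) top_degree_form[of \<eta>, OF \<eta>(3)] contraction_top by metis
  then show thesis using that \<eta>(2) by blast
qed

text \<open>Contraction is injective on multiples of \<open>dzs UNIV\<close>, because
  \<open>tau\<close> has nonzero coefficients. Hence every form of degree n - 1 is closed.\<close>

lemma A_loc_card_eq_0:
  fixes \<omega> :: "('n::{finite,linorder}, 'k::idom) form"
  assumes "\<omega> \<in> A_loc I CARD('n)"
  shows "\<omega> = 0"
proof -
  have *: "\<omega> = fscale (\<omega> UNIV) (dzs UNIV)" using A_locD(2)[OF assms] by (rule top_degree_form)
  then have "fscale (\<omega> UNIV) tau = 0" using A_locD(3)[OF assms] contraction_top by metis
  with * show ?thesis using fscale_tau_eq_0 by (metis fscale_simps(2))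
qed

lemma dbar_top:
  fixes \<omega> :: "('n::{finite,linorder}, 'k::idom) form"
  assumes "\<omega> \<in> A_loc I (CARD('n) - 1)"
  shows "dbar \<omega> = 0"
  using A_loc_dbar[OF assms] A_loc_card_eq_0[of "dbar \<omega>" I] by simp

section \<open>Coboundaries of top degree are divergences\<close>

text \<open>A starred derivative lowers the degree by one, so fields of degree 1 - n give functions
  of degree -n, the degree required of multipliers of \<open>tau\<close>.\<close>

definition divergences :: "('n::{finite,linorder}, 'k::idom) ratfun set" where
  "divergences = {\<Sum>i\<in>UNIV. pd (Zs i) (g i) | g. \<forall>i. g i \<in> coeffs {} (1 - int CARD('n))}"

text \<open>A form of degree n - 2 is the contraction of some \<eta> of degree n - 1. Moving
  \<open>dbar\<close> past the contraction leaves the contraction of the top form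
  \<open>dbar\<close> \<eta>, whose coefficient is, up to signs, the divergence of the n
  coefficients of \<eta>.\<close>

lemma dbar_A_forms:
  assumes n: "CARD('n::{finite,linorder}) > 1"
  shows "dbar ` A_forms (CARD('n) - 2) = (\<lambda>f. fscale f tau :: ('n, 'k::idom) form) ` divergences"
proof -
  have S: "Suc (CARD('n) - 2) = CARD('n) - 1" using n by simp
  have S': "- int (CARD('n) - 1) = 1 - int CARD('n)" using n by simp
  have "dbar \<alpha> \<in> (\<lambda>f. fscale f tau) ` divergences" if \<alpha>: "\<alpha> \<in> A_forms (CARD('n) - 2)" for \<alpha> :: "('n, 'k) form"
  proof -
    obtain \<eta> where \<eta>: "\<alpha> = contraction \<eta>" "\<And>J. \<eta> J \<in> coeffs {} (- int (CARD('n) - 1))"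
      "\<And>J. card J \<noteq> CARD('n) - 1 \<Longrightarrow> \<eta> J = 0"
      using A_loc_conv_contraction[OF \<alpha>] unfolding S by metis
    have "dbar \<alpha> = - contraction (dbar \<eta>)"
      unfolding \<eta>(1) by (rule dbar_contraction_A_loc[OF \<eta>(2,3)])
    moreover have "dbar \<eta> = fscale (dbar \<eta> UNIV) (dzs UNIV)"
    proof (rule top_degree_form)
      fix J :: "'n set" assume J: "card J \<noteq> CARD('n)"
      show "dbar \<eta> J = 0" unfolding dbar_conv sum_fun_apply
        using \<eta>(3) J n by (intro sum.neutral ballI ext_degree[of "CARD('n) - 1"]) (simp_all add: fpd_def)
    qed
    ultimately have "dbar \<alpha> = fscale (- dbar \<eta> UNIV) tau"
      by (metis contraction_top fscale_simps(5))
    moreover have "- dbar \<eta> UNIV = (\<Sum>i\<in>UNIV. pd (Zs i) (- sgn_before i UNIV (\<eta> (UNIV - {i}))))"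
      unfolding dbar_conv sum_fun_apply sum_negf[symmetric]
      by (intro sum.cong refl) (simp add: ext_def fpd_def pd_minus sgn_before_def)
    moreover have "- sgn_before i UNIV (\<eta> (UNIV - {i})) \<in> coeffs {} (1 - int CARD('n))" for i
      using \<eta>(2) unfolding S' by (intro coeffs_minus coeffs_sgn_before)
    ultimately have "- dbar \<eta> UNIV \<in> divergences" unfolding divergences_def
      by (intro CollectI exI[of _ "\<lambda>i. - sgn_before i UNIV (\<eta> (UNIV - {i}))"]) simp
    with \<open>dbar \<alpha> = fscale (- dbar \<eta> UNIV) tau\<close> show ?thesis by blast
  qed
  moreover have "fscale f tau \<in> dbar ` A_forms (CARD('n) - 2)" if "f \<in> divergences" for f :: "('n, 'k) ratfun"
  proof -
    obtain g where g: "f = (\<Sum>i\<in>UNIV. pd (Zs i) (g i))" "\<And>i. g i \<in> coeffs {} (1 - int CARD('n))"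
      using \<open>f \<in> divergences\<close> unfolding divergences_def by blast
    \<comment> \<open>The field g contracted with the top form. The minus sign compensates the one
      from anticommuting \<open>dbar\<close> with the contraction.\<close>
    define \<eta> where "\<eta> = - (\<Sum>i\<in>UNIV. intr i (fscale (g i) (dzs UNIV)))"
    have top: "ext i (dzs UNIV) = (0 :: ('n, 'k) form)" for i
    proof (rule HOL.ext)
      fix J :: "'n set"
      have "J - {i} \<noteq> UNIV" by auto
      then show "ext i (dzs UNIV) J = (0 :: ('n, 'k) form) J" by (simp add: ext_def dzs_def fun_apply)
    qed
    have ei: "ext i (intr j (dzs UNIV)) = (if i = j then dzs UNIV else (0 :: ('n, 'k) form))" for i j
      using intr_ext[of j i "dzs UNIV :: ('n, 'k) form"] by (auto simp: top)
    have fd: "fpd v (dzs UNIV) = (0 :: ('n, 'k) form)" for v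
      by (auto simp: fpd_def dzs_def fun_eq_iff fun_apply)
    have "dbar \<eta> = - (\<Sum>i\<in>UNIV. \<Sum>j\<in>UNIV. if j = i then fscale (pd (Zs i) (g i)) (dzs UNIV) else 0)"
      unfolding \<eta>_def dbar_simps dbar_sum
      by (auto simp: dbar_conv intr_fpd[symmetric] fpd_fscale fd intr_fscale ext_fscale ei if_distrib[of "fscale _"]
          intro!: sum.cong cong: if_cong)
    then have "dbar \<eta> = - fscale f (dzs UNIV)" by (simp add: g(1) fscale_sum_left)
    moreover have \<eta>1: "\<eta> J \<in> coeffs {} (- int (CARD('n) - 1))" for J
      unfolding \<eta>_def sum_fun_apply fun_apply S'
      by (intro coeffs_minus coeffs_sum coeffs_intr) (simp add: fscale_def dzs_def g(2))
    moreover have \<eta>2: "\<eta> J = 0" if "card J \<noteq> CARD('n) - 1" for J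
    proof -
      have "intr i (fscale (g i) (dzs UNIV)) J = 0" for i
        using that by (intro intr_degree[of "CARD('n) - 1"]) (auto simp: fscale_def dzs_def)
      then show ?thesis by (simp add: \<eta>_def fun_apply sum_fun_apply)
    qed
    ultimately have "dbar (contraction \<eta>) = fscale f tau"
      using dbar_contraction_A_loc[of "CARD('n) - 1" \<eta> "{}"] by (simp add: contraction_top)
    moreover have "contraction \<eta> \<in> A_forms (CARD('n) - 2)"
      using \<eta>1 \<eta>2 by (intro contraction_A_loc) (simp_all only: S)
    ultimately show ?thesis by (metis image_eqI)
  qed
  ultimately show ?thesis by auto
qed

lemma divergences_0 [simp]: "0 \<in> divergences"
  unfolding divergences_def by (rule CollectI, rule exI[of _ "\<lambda>_. 0"]) simp

lemma divergences_add: "f \<in> divergences \<Longrightarrow> g \<in> divergences \<Longrightarrow> f + g \<in> divergences"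
  unfolding divergences_def
proof safe
  fix f g :: "'a \<Rightarrow> ('a, 'b) ratfun"
  assume "\<forall>i. f i \<in> coeffs {} (1 - int CARD('a))" "\<forall>i. g i \<in> coeffs {} (1 - int CARD('a))"
  then show "\<exists>h. (\<Sum>i\<in>UNIV. pd (Zs i) (f i)) + (\<Sum>i\<in>UNIV. pd (Zs i) (g i)) = (\<Sum>i\<in>UNIV. pd (Zs i) (h i)) \<and>
      (\<forall>i. h i \<in> coeffs {} (1 - int CARD('a)))"
    by (intro exI[of _ "\<lambda>i. f i + g i"]) (simp add: pd_add sum.distrib coeffs_add)
qed

text \<open>A factor free of starred variables passes under the derivatives. It is applied to
  constants and to a monomial in the unstarred variables.\<close>

lemma divergences_mult:
  assumes "f \<in> divergences" "\<And>i. pd (Zs i) h = 0" "h \<in> coeffs {} 0"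
  shows "h * f \<in> divergences"
proof -
  obtain g where g: "f = (\<Sum>i\<in>UNIV. pd (Zs i) (g i))" "\<And>i. g i \<in> coeffs {} (1 - int CARD('a))"
    using assms(1) unfolding divergences_def by blast
  then have "h * f = (\<Sum>i\<in>UNIV. pd (Zs i) (h * g i))" by (simp add: pd_mult assms(2) sum_distrib_left)
  moreover have "h * g i \<in> coeffs {} (1 - int CARD('a))" for i
    using coeffs_mult[OF assms(3) g(2)] by simp
  ultimately show ?thesis unfolding divergences_def
    by (intro CollectI exI[of _ "\<lambda>i. h * g i"]) simp
qed

lemma divergences_pd: "g \<in> coeffs {} (1 - int CARD('n)) \<Longrightarrow>
    pd (Zs i) (g :: ('n::{finite,linorder}, 'k::idom) ratfun) \<in> divergences"
  unfolding divergences_def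
  by (rule CollectI, rule exI[of _ "\<lambda>j. if j = i then g else 0"])
     (auto simp: if_distrib[of "pd _"] cong: if_cong)

section \<open>The residue pairing\<close>

definition balanced :: "('n var \<Rightarrow>\<^sub>0 nat) \<Rightarrow> bool" where
  "balanced m \<longleftrightarrow> (\<forall>i. Poly_Mapping.lookup m (Z i) = Poly_Mapping.lookup m (Zs i))"

definition zs_fact :: "('n::finite var \<Rightarrow>\<^sub>0 nat) \<Rightarrow> 'k::field_char_0" where
  "zs_fact m = (\<Prod>i\<in>UNIV. fact (Poly_Mapping.lookup m (Zs i)))"

text \<open>
  Pairs \<open>z\<^sub>i\<close> with \<open>z\<^sup>*\<^sub>i\<close> so that multiplication by \<open>z\<^sub>i\<close> is adjoint to \<open>\<partial>/\<partial>z\<^sup>*\<^sub>i\<close>. Up to a factor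
  depending on \<open>N\<close>, it sends \<open>p\<close> to the residue of \<open>p/(zz\<^sup>*)\<^sup>N\<close>.
\<close>

definition residue :: "('n::finite var, 'k::field_char_0) mpol \<Rightarrow> 'k" where
  "residue p = (\<Sum>m\<in>Poly_Mapping.keys p. if balanced m then zs_fact m * Poly_Mapping.lookup p m else 0)"

lemma residue_superset:
  assumes "finite S" "Poly_Mapping.keys p \<subseteq> S"
  shows "residue p = (\<Sum>m\<in>S. if balanced m then zs_fact m * Poly_Mapping.lookup p m else 0)"
  unfolding residue_def using assms by (intro sum.mono_neutral_left) (auto simp: in_keys_iff)

lemma residue_single: "residue (Poly_Mapping.single m c) = (if balanced m then zs_fact m * c else 0)"
  by (cases "c = 0") (simp_all add: residue_def)

lemma residue_0 [simp]: "residue 0 = 0"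
  by (simp add: residue_def)

lemma residue_add: "residue (p + q) = residue p + residue q"
proof -
  let ?S = "Poly_Mapping.keys p \<union> Poly_Mapping.keys q"
  have "Poly_Mapping.keys (p + q) \<subseteq> ?S" by (rule Poly_Mapping.keys_add)
  then show ?thesis
    by (simp add: residue_superset[of ?S] flip: sum.distrib)
       (intro sum.cong, auto simp: lookup_add distrib_left)
qed

lemma residue_minus: "residue (- p) = - residue p"
  by (rule additive_minus) (rule residue_add)

lemma residue_diff: "residue (p - q) = residue p - residue q"
  using residue_add[of p "- q"] by (simp add: residue_minus)

lemma residue_sum: "residue (sum f A) = (\<Sum>a\<in>A. residue (f a))"
  by (rule additive_sum) (rule residue_add)

lemma residue_const_mult: "residue (Poly_Mapping.single 0 c * p) = c * residue p"
  by (induction p rule: mpol_induct)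
     (simp_all add: residue_single mult_single residue_add distrib_left)

lemma residue_of_nat_mult: "residue (of_nat k * p) = of_nat k * residue p"
  using residue_const_mult[of "of_nat k" p] by (simp del: residue_const_mult)

text \<open>Checked on a monomial. If \<open>Zs i\<close> does not occur, the derivative is zero and
  the product with \<open>Z i\<close> is unbalanced. Otherwise both sides are balanced together, and
  the exponent brought down by the derivative completes the smaller factorial to the larger
  one.\<close>

lemma residue_pderiv:
  fixes p :: "('n::finite var, 'k::field_char_0) mpol"
  shows "residue (pderiv_mpol (Zs i) p) = residue (pvar (Z i) * p)"
proof (induction p rule: mpol_induct)
  case (single m c)
  let ?m = "m - Poly_Mapping.single (Zs i) 1" and ?l = "Poly_Mapping.single (Z i) 1 + m"
  have l: "balanced ?l \<longleftrightarrow> (\<forall>j. (if j = i then 1 else 0) + Poly_Mapping.lookup m (Z j) = Poly_Mapping.lookup m (Zs j))"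
    by (auto simp: balanced_def lookup_add lookup_single when_def)
  show ?case
  proof (cases "Poly_Mapping.lookup m (Zs i) = 0")
    case True
    then have "\<not> balanced ?l" unfolding l by (metis add_eq_0_iff_both_eq_0 one_neq_zero)
    with True show ?thesis
      by (simp add: pderiv_mpol_single residue_single pvar_def mult_single del: One_nat_def)
  next
    case False
    have "balanced ?m \<longleftrightarrow> (\<forall>j. Poly_Mapping.lookup m (Z j) = Poly_Mapping.lookup m (Zs j) - (if j = i then 1 else 0))"
      by (auto simp: balanced_def lookup_minus lookup_single when_def)
    also have "\<dots> \<longleftrightarrow> balanced ?l"
      unfolding l using False by (intro all_cong1) auto
    finally have bal: "balanced ?m \<longleftrightarrow> balanced ?l" .
    have "zs_fact ?m * of_nat (Poly_Mapping.lookup m (Zs i)) = (zs_fact ?l :: 'k)"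
    proof -
      have "(zs_fact ?m :: 'k) = fact (Poly_Mapping.lookup m (Zs i) - 1) *
          (\<Prod>j\<in>UNIV - {i}. fact (Poly_Mapping.lookup m (Zs j)))"
        unfolding zs_fact_def
        by (subst prod.remove[of _ i]) (auto simp: lookup_minus lookup_single when_def intro!: prod.cong)
      moreover have "(zs_fact ?l :: 'k) = fact (Poly_Mapping.lookup m (Zs i)) *
          (\<Prod>j\<in>UNIV - {i}. fact (Poly_Mapping.lookup m (Zs j)))"
        unfolding zs_fact_def
        by (subst prod.remove[of _ i]) (auto simp: lookup_add lookup_single when_def intro!: prod.cong)
      moreover have "(fact (Poly_Mapping.lookup m (Zs i)) :: 'k) =
          of_nat (Poly_Mapping.lookup m (Zs i)) * fact (Poly_Mapping.lookup m (Zs i) - 1)"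
        using False by (simp add: fact_reduce)
      ultimately show ?thesis by simp
    qed
    with bal show ?thesis
      by (simp add: pderiv_mpol_single residue_single pvar_def mult_single flip: mult.assoc del: One_nat_def)
  qed
qed (simp_all add: pderiv_mpol_add residue_add distrib_left)

text \<open>In every summand of \<open>zzp\<close> the factor \<open>Z i\<close> is traded for the
  derivative in \<open>Zs i\<close>. Differentiating the factor \<open>Zs i\<close> contributes the
  residue itself, n times in all; the remaining terms form the Euler operator, with eigenvalue
  e.\<close>

lemma residue_zzp:
  fixes p :: "('n::finite var, 'k::field_char_0) mpol"
  assumes "zs_homogeneous e p"
  shows "residue (zzp * p) = of_nat (e + CARD('n)) * residue p"
proof -
  have "residue (zzp * p) = (\<Sum>i\<in>UNIV. residue (pvar (Z i) * (pvar (Zs i) * p)))"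
    by (simp add: zzp_def sum_distrib_right residue_sum mult.assoc)
  also have "\<dots> = (\<Sum>i\<in>UNIV. residue p + residue (pvar (Zs i) * pderiv_mpol (Zs i) p))"
    by (simp add: residue_pderiv[symmetric] pderiv_mpol_mult pderiv_mpol_pvar residue_add)
  also have "\<dots> = of_nat CARD('n) * residue p + residue (of_nat e * p)"
    by (simp add: sum.distrib residue_sum[symmetric] euler_mpol[OF assms])
  finally show ?thesis by (simp add: residue_of_nat_mult distrib_right)
qed

text \<open>Measures how the residue of a numerator changes when the fraction is expanded by a power
  of \<open>zzs\<close>. The factor is nonzero in characteristic 0.\<close>

lemma residue_zzp_power:
  fixes p :: "('n::finite var, 'k::field_char_0) mpol"
  assumes "zs_homogeneous e p"
  shows "residue (zzp ^ j * p) = pochhammer (of_nat (e + CARD('n))) j * residue p"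
proof (induction j)
  case (Suc j)
  have "zs_homogeneous (j + e) (zzp ^ j * p)"
    using zs_homogeneous_mult[OF zs_homogeneous_power[OF zs_homogeneous_zzp] assms, of j] by simp
  from residue_zzp[OF this] Suc show ?case
    by (simp add: mult.assoc pochhammer_Suc)
qed simp

text \<open>A fraction can be expanded by any power of \<open>zzs\<close>, so every sufficiently
  large exponent serves as denominator; this gives finitely many functions a common one.\<close>

lemma coeffs_empty_denominator:
  assumes "f \<in> coeffs {} d"
  obtains N0 where "\<And>N. N0 \<le> N \<Longrightarrow> \<exists>p e. zs_homogeneous e p \<and> int e = int N + d \<and> f = of_mpol p / zzs ^ N"
proof -
  obtain p N0 e where f: "f = of_mpol p / zzs ^ N0" "zs_homogeneous e p" "int e = int N0 + d"
    using assms by (elim coeffsE) simp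
  show thesis
  proof (rule that)
    fix N assume "N0 \<le> N"
    then obtain j where N: "N = j + N0" using le_iff_add add.commute by metis
    have "f = of_mpol (zzp ^ j * p) / zzs ^ N" unfolding f N by (simp add: zzs_conv power_add)
    moreover have "zs_homogeneous (j + e) (zzp ^ j * p)"
      using zs_homogeneous_mult[OF zs_homogeneous_power[OF zs_homogeneous_zzp] f(2), of j] by simp
    ultimately show "\<exists>p e. zs_homogeneous e p \<and> int e = int N + d \<and> f = of_mpol p / zzs ^ N"
      using f(3) N by (intro exI[of _ "zzp ^ j * p"] exI[of _ "j + e"]) simp
  qed
qed

text \<open>Over the denominator exponent M, differentiating a fraction with numerator p in
  \<open>Zs i\<close> gives the numerator \<open>zzp\<close> times the derivative of p, minus M
  times \<open>pvar (Z i) * p\<close>. The degrees are such that the first residue is also M times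
  that of \<open>pvar (Z i) * p\<close>, so the two cancel.\<close>

lemma residue_divergence:
  fixes q :: "('n::{finite,linorder} var, 'k::field_char_0) mpol"
  assumes q: "zs_homogeneous e q" and div: "of_mpol q / zzs ^ N \<in> divergences"
  shows "residue q = 0"
proof -
  obtain g where g: "of_mpol q / zzs ^ N = (\<Sum>i\<in>UNIV. pd (Zs i) (g i :: ('n, 'k) ratfun))"
    "\<And>i. g i \<in> coeffs {} (1 - int CARD('n))"
    using div unfolding divergences_def by blast
  have "\<forall>i. \<exists>N0. \<forall>M\<ge>N0. \<exists>p e. zs_homogeneous e p \<and> int e = int M + (1 - int CARD('n)) \<and> g i = of_mpol p / zzs ^ M"
    using g(2) by (metis coeffs_empty_denominator)
  then obtain N0 where N0: "\<And>i M. N0 i \<le> M \<Longrightarrow>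
      \<exists>p e. zs_homogeneous e p \<and> int e = int M + (1 - int CARD('n)) \<and> g i = of_mpol p / zzs ^ M"
    by metis
  \<comment> \<open>A common exponent for all the g i, larger than N as well, so that q is only
    multiplied by a power of \<open>zzp\<close> when numerators are compared.\<close>
  define M where "M = Suc (N + (\<Sum>i\<in>UNIV. N0 i))"
  have "N0 i \<le> M" for i using member_le_sum[of i UNIV N0] by (simp add: M_def)
  then have "\<forall>i. \<exists>p e. zs_homogeneous e p \<and> int e = int M + (1 - int CARD('n)) \<and> g i = of_mpol p / zzs ^ M"
    using N0 by blast
  then obtain p d where pd: "\<And>i. zs_homogeneous (d i) (p i)" "\<And>i. int (d i) = int M + (1 - int CARD('n))"
    "\<And>i. g i = of_mpol (p i) / zzs ^ M" by metis
  \<comment> \<open>This is the factor by which \<open>zzp\<close> multiplies the residue of the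
    derivative of p i. For d i = 0 the derivative vanishes.\<close>
  have d: "d i - 1 + CARD('n) = M" if "d i \<noteq> 0" for i using pd(2)[of i] that by linarith
  define r where "r = (\<Sum>i\<in>UNIV. zzp * pderiv_mpol (Zs i) (p i) - of_nat M * (pvar (Z i) * p i))"
  have "pd (Zs i) (g i) = of_mpol (zzp * pderiv_mpol (Zs i) (p i) - of_nat M * (pvar (Z i) * p i)) / zzs ^ Suc M" for i
  proof -
    have "g i = of_mpol (p i) * inverse zzs ^ M" by (simp add: pd(3) divide_inverse power_inverse)
    then have "pd (Zs i) (g i) = of_mpol (pderiv_mpol (Zs i) (p i)) * inverse zzs ^ M
        + of_mpol (p i) * (- of_nat M * zvar i * inverse zzs ^ Suc M)"
      by (simp add: pd_mult pd_inverse_power pd_of_mpol pd_zzs)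
    moreover have "of_mpol (of_nat M) = (of_nat M :: ('n, 'k) ratfun)" by (induction M) simp_all
    ultimately show ?thesis
      by (simp add: zvar_def zzs_conv divide_inverse power_inverse ring_distribs mult.assoc mult.left_commute)
  qed
  then have "of_mpol q / zzs ^ N = of_mpol r / zzs ^ Suc M"
    unfolding g(1) r_def by (simp add: of_mpol_sum sum_divide_distrib)
  then have "of_mpol q * zzs ^ Suc M = of_mpol r * zzs ^ N"
    by (simp add: frac_eq_eq del: power_Suc)
  moreover have "zzs ^ Suc M = zzs ^ (Suc M - N) * (zzs ^ N :: ('n, 'k) ratfun)"
    unfolding power_add[symmetric] by (simp add: M_def add.commute)
  ultimately have "(of_mpol q * zzs ^ (Suc M - N)) * zzs ^ N = of_mpol r * zzs ^ N"
    by (simp only: mult.assoc)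
  then have "of_mpol q * zzs ^ (Suc M - N) = of_mpol r"
    by (subst (asm) mult_right_cancel) simp_all
  then have "of_mpol (zzp ^ (Suc M - N) * q) = of_mpol r"
    unfolding of_mpol_simps of_mpol_power zzs_conv by (simp only: mult.commute)
  then have "zzp ^ (Suc M - N) * q = r" by (simp only: of_mpol_eq_iff)
  moreover have "residue r = 0"
  proof -
    have "residue (zzp * pderiv_mpol (Zs i) (p i)) = of_nat M * residue (pvar (Z i) * p i)" for i
    proof (cases "d i = 0")
      case True
      then have "pderiv_mpol (Zs i) (p i) = 0" using pd(1)[of i] by (simp add: zs_homogeneous_pderiv_Zs_0)
      then show ?thesis by (simp flip: residue_pderiv)
    next
      case False
      have "d i - 1 + CARD('n) = M" by (rule d[OF False])
      then show ?thesis using residue_zzp[OF zs_homogeneous_pderiv_Zs[OF pd(1)], of i i]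
        by (simp only: residue_pderiv)
    qed
    then show ?thesis by (simp add: r_def residue_sum residue_diff residue_of_nat_mult)
  qed
  ultimately have "pochhammer (of_nat (e + CARD('n))) (Suc M - N) * residue q = 0"
    using residue_zzp_power[OF q] by metis
  moreover have "pochhammer (of_nat (e + CARD('n)) :: 'k) (Suc M - N) \<noteq> 0"
    using pochhammer_pos[of "e + CARD('n)" "Suc M - N"] unfolding pochhammer_of_nat by simp
  ultimately show ?thesis by simp
qed

section \<open>Multipoles\<close>

definition dop :: "('n, 'k) mpol \<Rightarrow> ('n::{finite,linorder}, 'k::idom) ratfun \<Rightarrow> ('n, 'k) ratfun" where
  "dop P f = (\<Sum>m\<in>Poly_Mapping.keys P. const (Poly_Mapping.lookup P m) * pd_monomial m f)"

lemma diff_op_conv: "diff_op P \<omega> = (\<lambda>J. dop P (\<omega> J))"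
  by (simp add: diff_op_def dop_def)

lemma pd_funpow_additive:
  "(pd v ^^ k) (f + g) = (pd v ^^ k) f + (pd v ^^ k) g"
  by (induction k) (simp_all add: pd_add)

lemma pd_funpow_mult:
  "pd v g = 0 \<Longrightarrow> (pd v ^^ k) (f * g) = (pd v ^^ k) f * g"
  by (induction k) (simp_all add: pd_mult)

lemma foldr_pd_induct:
  assumes "P f" "\<And>i f. P f \<Longrightarrow> P (pd (Z i) f)"
  shows "P (foldr (\<lambda>i. pd (Z i) ^^ m i) xs f)"
proof (induction xs)
  case (Cons i xs)
  have "P ((pd (Z i) ^^ k) g)" if "P g" for k g
    using that by (induction k) (simp_all add: assms(2))
  with Cons show ?case by simp
qed (simp add: assms(1))

lemma pd_monomial_add: "pd_monomial m (f + g) = pd_monomial m f + pd_monomial m g"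
proof -
  have "foldr (\<lambda>i. pd (Z i) ^^ Poly_Mapping.lookup m i) xs (f + g) =
      foldr (\<lambda>i. pd (Z i) ^^ Poly_Mapping.lookup m i) xs f + foldr (\<lambda>i. pd (Z i) ^^ Poly_Mapping.lookup m i) xs g" for xs
    by (induction xs) (simp_all add: pd_funpow_additive)
  then show ?thesis by (simp add: pd_monomial_def)
qed

lemma pd_monomial_mult:
  assumes "\<And>i. pd (Z i) g = 0"
  shows "pd_monomial m (f * g) = pd_monomial m f * g"
proof -
  have "foldr (\<lambda>i. pd (Z i) ^^ Poly_Mapping.lookup m i) xs (f * g) =
      foldr (\<lambda>i. pd (Z i) ^^ Poly_Mapping.lookup m i) xs f * g" for xs
    by (induction xs) (simp_all add: pd_funpow_mult assms)
  then show ?thesis by (simp add: pd_monomial_def)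
qed

lemma dop_superset:
  assumes "finite S" "Poly_Mapping.keys P \<subseteq> S"
  shows "dop P f = (\<Sum>m\<in>S. const (Poly_Mapping.lookup P m) * pd_monomial m f)"
  unfolding dop_def using assms by (intro sum.mono_neutral_left) (auto simp: in_keys_iff)

lemma dop_add_left: "dop (P + Q) f = dop P f + dop Q f"
proof -
  let ?S = "Poly_Mapping.keys P \<union> Poly_Mapping.keys Q"
  have "Poly_Mapping.keys (P + Q) \<subseteq> ?S" by (rule Poly_Mapping.keys_add)
  then show ?thesis
    by (simp add: dop_superset[of ?S] lookup_add const_add distrib_right sum.distrib)
qed

lemma dop_0_left [simp]: "dop 0 f = 0"
  by (simp add: dop_def)

lemma dop_diff_left: "dop (P - Q) f = dop P f - dop Q f"
  using dop_add_left[of "P - Q" Q f] by simp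

lemma dop_single: "dop (Poly_Mapping.single m c) f = const c * pd_monomial m f"
  by (cases "c = 0") (simp_all add: dop_def)

lemma dop_add: "dop P (f + g) = dop P f + dop P g"
  by (simp add: dop_def pd_monomial_add distrib_left sum.distrib)

lemma dop_mult:
  assumes "\<And>i. pd (Z i) g = 0"
  shows "dop P (f * g) = dop P f * g"
  by (simp add: dop_def pd_monomial_mult[OF assms] sum_distrib_right mult.assoc)

text \<open>The coefficients of \<open>tau\<close> are signed starred variables, constants for the
  derivatives in the unstarred ones.\<close>

lemma diff_op_fscale_tau: "diff_op P (fscale f tau) = fscale (dop P f) tau"
proof -
  have "fpd (Z i) tau = (0 :: ('a, 'b) form)" for i
  proof -
    have "fpd (Z i) (dzs UNIV) = (0 :: ('a, 'b) form)"
      by (auto simp: fpd_def dzs_def fun_eq_iff fun_apply)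
    then show ?thesis by (simp add: tau_def contraction_fpd_Z[symmetric])
  qed
  then have "pd (Z i) (tau J :: ('a, 'b) ratfun) = 0" for i J by (metis fpd_def zero_fun_apply)
  then show ?thesis by (auto simp: diff_op_conv fscale_def dop_mult)
qed

lemma of_mpol_single:
  fixes m :: "'n::{finite,linorder} var \<Rightarrow>\<^sub>0 nat"
  shows "of_mpol (Poly_Mapping.single m (c :: 'k::idom)) = const c *
    (\<Prod>i\<in>UNIV. zvar i ^ Poly_Mapping.lookup m (Z i)) * (\<Prod>i\<in>UNIV. zsvar i ^ Poly_Mapping.lookup m (Zs i))"
proof (induction m rule: update_induct)
  case const
  then show ?case by (simp add: const_def)
next
  case (update m v k)
  have p: "of_mpol (pvar v) ^ k = (of_mpol (Poly_Mapping.single (Poly_Mapping.single v k) 1) :: ('n, 'k) ratfun)"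
  proof (induction k)
    case (Suc k)
    have "Poly_Mapping.single v (Suc k) = Poly_Mapping.single v 1 + Poly_Mapping.single v k"
      by (simp flip: single_add)
    then have "Poly_Mapping.single (Poly_Mapping.single v (Suc k)) (1::'k) =
        pvar v * Poly_Mapping.single (Poly_Mapping.single v k) 1"
      by (simp add: pvar_def mult_single)
    with Suc show ?case by simp
  qed simp
  have u: "Poly_Mapping.update v k m = Poly_Mapping.single v k + m"
    using update by (intro poly_mapping_eqI)
      (auto simp: lookup_update lookup_add lookup_single when_def in_keys_iff)
  have "Poly_Mapping.single (Poly_Mapping.update v k m) c =
      Poly_Mapping.single (Poly_Mapping.single v k) 1 * Poly_Mapping.single m c"
    by (simp add: u mult_single)
  then have *: "of_mpol (Poly_Mapping.single (Poly_Mapping.update v k m) c) =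
      of_mpol (pvar v) ^ k * of_mpol (Poly_Mapping.single m c)" by (simp add: p)
  have m0: "Poly_Mapping.lookup m v = 0" using update by (simp add: in_keys_iff)
  show ?case
  proof (cases v)
    case (Z j)
    have "(\<Prod>i\<in>UNIV. zvar i ^ Poly_Mapping.lookup (Poly_Mapping.update v k m) (Z i)) =
        zvar j ^ k * (\<Prod>i\<in>UNIV. zvar i ^ Poly_Mapping.lookup m (Z i) :: ('n, 'k) ratfun)"
      using m0 by (subst (1 2) prod.remove[of _ j]) (auto simp: Z lookup_update intro!: prod.cong)
    then show ?thesis unfolding * update.IH by (simp add: Z lookup_update zvar_def mult_ac)
  next
    case (Zs j)
    have "(\<Prod>i\<in>UNIV. zsvar i ^ Poly_Mapping.lookup (Poly_Mapping.update v k m) (Zs i)) =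
        zsvar j ^ k * (\<Prod>i\<in>UNIV. zsvar i ^ Poly_Mapping.lookup m (Zs i) :: ('n, 'k) ratfun)"
      using m0 by (subst (1 2) prod.remove[of _ j]) (auto simp: Zs lookup_update intro!: prod.cong)
    then show ?thesis unfolding * update.IH by (simp add: Zs lookup_update zsvar_def mult_ac)
  qed
qed

text \<open>The constant is the product of -(N + j) over j < k. It is nonzero since N > 0 and the
  characteristic is 0.\<close>

lemma pd_funpow_inverse_zzs:
  fixes c :: "('n::{finite,linorder}, 'k::field_char_0) ratfun"
  assumes "pd (Z i) c = 0" "N > 0"
  shows "\<exists>a::'k. a \<noteq> 0 \<and> (pd (Z i) ^^ k) (c * inverse zzs ^ N) =
    const a * (zsvar i ^ k * c) * inverse zzs ^ (N + k)"
proof (induction k)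
  case (Suc k)
  then obtain a :: 'k where a: "a \<noteq> 0" "(pd (Z i) ^^ k) (c * inverse zzs ^ N) =
    const a * (zsvar i ^ k * c) * inverse zzs ^ (N + k)" by blast
  have "pd (Z i) (zsvar i ^ k) = (0 :: ('n, 'k) ratfun)" by (cases k) (simp_all add: pd_power_Suc pd_zsvar del: power_Suc)
  then have "(pd (Z i) ^^ Suc k) (c * inverse zzs ^ N) =
      const a * (zsvar i ^ k * c) * (- of_nat (N + k) * zsvar i * inverse zzs ^ Suc (N + k))"
    using a(2) by (simp add: pd_mult assms(1) pd_inverse_power pd_zzs del: power_Suc of_nat_add)
  also have "\<dots> = const (- of_nat (N + k) * a) * (zsvar i ^ Suc k * c) * inverse zzs ^ (N + Suc k)"
    by (simp add: const_mult const_of_nat mult_ac del: of_nat_add)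
  finally show ?case using a(1) assms(2) by (intro exI[of _ "- of_nat (N + k) * a"]) (simp del: of_nat_add)
qed (intro exI[of _ 1], simp)

lemma pd_monomial_inverse_zzs:
  assumes "N > 0"
  shows "\<exists>a::'k. a \<noteq> 0 \<and> pd_monomial m (inverse zzs ^ N :: ('n::{finite,linorder}, 'k::field_char_0) ratfun) =
    const a * (\<Prod>i\<in>UNIV. zsvar i ^ Poly_Mapping.lookup m i) * inverse zzs ^ (N + (\<Sum>i\<in>UNIV. Poly_Mapping.lookup m i))"
proof -
  have "\<exists>a::'k. a \<noteq> 0 \<and>
      foldr (\<lambda>i. pd (Z i) ^^ Poly_Mapping.lookup m i) xs (inverse zzs ^ N :: ('n, 'k) ratfun) =
      const a * (\<Prod>i\<in>set xs. zsvar i ^ Poly_Mapping.lookup m i) * inverse zzs ^ (N + (\<Sum>i\<in>set xs. Poly_Mapping.lookup m i))"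
    if "distinct xs" for xs
    using that
  proof (induction xs)
    case (Cons j xs)
    then obtain a :: 'k where a: "a \<noteq> 0" "foldr (\<lambda>i. pd (Z i) ^^ Poly_Mapping.lookup m i) xs (inverse zzs ^ N :: ('n, 'k) ratfun) =
      const a * (\<Prod>i\<in>set xs. zsvar i ^ Poly_Mapping.lookup m i) * inverse zzs ^ (N + (\<Sum>i\<in>set xs. Poly_Mapping.lookup m i))"
      by auto
    \<comment> \<open>The factors produced so far contain no unstarred variable, so the next
      derivatives treat them as constants.\<close>
    define c :: "('n, 'k) ratfun" where "c = const a * (\<Prod>i\<in>set xs. zsvar i ^ Poly_Mapping.lookup m i)"
    have pw: "pd (Z j) (zsvar i ^ k) = (0 :: ('n, 'k) ratfun)" for i k
      by (cases k) (simp_all add: pd_power_Suc pd_zsvar del: power_Suc)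
    have "pd (Z j) (\<Prod>i\<in>A. zsvar i ^ Poly_Mapping.lookup m i) = (0 :: ('n, 'k) ratfun)" for A
      by (induction A rule: infinite_finite_induct) (simp_all add: pd_mult pw)
    then have "pd (Z j) c = 0" by (simp add: c_def pd_mult)
    from pd_funpow_inverse_zzs[OF this, of "N + (\<Sum>i\<in>set xs. Poly_Mapping.lookup m i)" "Poly_Mapping.lookup m j"]
    obtain b :: 'k where b: "b \<noteq> 0" "(pd (Z j) ^^ Poly_Mapping.lookup m j) (c * inverse zzs ^ (N + (\<Sum>i\<in>set xs. Poly_Mapping.lookup m i))) =
      const b * (zsvar j ^ Poly_Mapping.lookup m j * c) * inverse zzs ^ (N + (\<Sum>i\<in>set xs. Poly_Mapping.lookup m i) + Poly_Mapping.lookup m j)"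
      using assms by auto
    show ?case using a b Cons.prems
      by (intro exI[of _ "b * a"]) (simp add: c_def const_mult mult_ac add_ac)
  qed (intro exI[of _ 1], simp)
  from this[of "sorted_list_of_set UNIV"] show ?thesis
    by (simp add: pd_monomial_def)
qed

text \<open>The constant is k! up to sign.\<close>

lemma pd_funpow_inverse_zvar:
  assumes "pd (Z i) c = 0"
  shows "\<exists>a::'k. a \<noteq> 0 \<and> (pd (Z i) ^^ k) (c * inverse (zvar i)) =
    const a * c * inverse (zvar i :: ('n::{finite,linorder}, 'k::field_char_0) ratfun) ^ Suc k"
proof (induction k)
  case (Suc k)
  then obtain a :: 'k where a: "a \<noteq> 0" "(pd (Z i) ^^ k) (c * inverse (zvar i)) =
    const a * c * inverse (zvar i :: ('n, 'k) ratfun) ^ Suc k" by blast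
  have "(pd (Z i) ^^ Suc k) (c * inverse (zvar i)) =
      const a * c * (- of_nat (Suc k) * 1 * inverse (zvar i) ^ Suc (Suc k))"
    using a(2) by (simp add: pd_mult assms(1) pd_inverse_power pd_zvar del: power_Suc of_nat_Suc)
  also have "\<dots> = const (- of_nat (Suc k) * a) * c * inverse (zvar i) ^ Suc (Suc k)"
    by (simp add: const_mult const_of_nat mult_ac del: of_nat_Suc)
  finally show ?case using a(1)
    by (intro exI[of _ "- of_nat (Suc k) * a"]) (simp del: of_nat_Suc)
qed (intro exI[of _ 1], simp)

lemma pd_monomial_inverse_zvar:
  "\<exists>a::'k. a \<noteq> 0 \<and> pd_monomial m (\<Prod>i\<in>UNIV. inverse (zvar i) :: ('n::{finite,linorder}, 'k::field_char_0) ratfun) =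
    const a * (\<Prod>i\<in>UNIV. inverse (zvar i) ^ Suc (Poly_Mapping.lookup m i))"
proof -
  have pw: "pd (Z j) (inverse (zvar i) ^ k) = (0 :: ('n, 'k) ratfun)" if "i \<noteq> j" for i j k
    using that by (simp add: pd_inverse_power pd_zvar)
  have pr: "pd (Z j) (\<Prod>i\<in>A. inverse (zvar i) ^ e i) = (0 :: ('n, 'k) ratfun)" if "j \<notin> A" for A j and e :: "'n \<Rightarrow> nat"
    using that by (induction A rule: infinite_finite_induct) (auto simp: pd_mult pw)
  \<comment> \<open>Variables outside \<open>xs\<close> still have simple poles; the exponent 1
    keeps their product in the form to which \<open>pr\<close> applies.\<close>
  have "\<exists>a::'k. a \<noteq> 0 \<and>
      foldr (\<lambda>i. pd (Z i) ^^ Poly_Mapping.lookup m i) xs (\<Prod>i\<in>UNIV. inverse (zvar i) :: ('n, 'k) ratfun) =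
      const a * (\<Prod>i\<in>set xs. inverse (zvar i) ^ Suc (Poly_Mapping.lookup m i)) * (\<Prod>i\<in>-set xs. inverse (zvar i) ^ 1)"
    if "distinct xs" for xs
    using that
  proof (induction xs)
    case (Cons j xs)
    then obtain a :: 'k where a: "a \<noteq> 0" "foldr (\<lambda>i. pd (Z i) ^^ Poly_Mapping.lookup m i) xs (\<Prod>i\<in>UNIV. inverse (zvar i) :: ('n, 'k) ratfun) =
      const a * (\<Prod>i\<in>set xs. inverse (zvar i) ^ Suc (Poly_Mapping.lookup m i)) * (\<Prod>i\<in>-set xs. inverse (zvar i) ^ 1)"
      by auto
    define c :: "('n, 'k) ratfun" where "c = const a * (\<Prod>i\<in>set xs. inverse (zvar i) ^ Suc (Poly_Mapping.lookup m i)) *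
       (\<Prod>i\<in>-set (j # xs). inverse (zvar i) ^ 1)"
    have "pd (Z j) c = 0" unfolding c_def using Cons.prems
      by (simp only: pd_mult pd_const) (subst pr; (subst pr)?; simp)
    from pd_funpow_inverse_zvar[OF this, of "Poly_Mapping.lookup m j"]
    obtain b :: 'k where b: "b \<noteq> 0" "(pd (Z j) ^^ Poly_Mapping.lookup m j) (c * inverse (zvar j)) =
      const b * c * inverse (zvar j) ^ Suc (Poly_Mapping.lookup m j)" by blast
    have "- set xs = insert j (- set (j # xs))" using Cons.prems by auto
    then have "(\<Prod>i\<in>-set xs. inverse (zvar i) ^ 1 :: ('n, 'k) ratfun) =
        inverse (zvar j) * (\<Prod>i\<in>-set (j # xs). inverse (zvar i) ^ 1)"
      by (simp only:) (subst prod.insert; simp)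
    then have "foldr (\<lambda>i. pd (Z i) ^^ Poly_Mapping.lookup m i) (j # xs) (\<Prod>i\<in>UNIV. inverse (zvar i) :: ('n, 'k) ratfun) =
        (pd (Z j) ^^ Poly_Mapping.lookup m j) (c * inverse (zvar j))"
      using a(2) by (simp add: c_def mult_ac del: power_Suc)
    also have "\<dots> = const (b * a) * (\<Prod>i\<in>set (j # xs). inverse (zvar i) ^ Suc (Poly_Mapping.lookup m i)) *
        (\<Prod>i\<in>-set (j # xs). inverse (zvar i) ^ 1)"
      unfolding b(2) using Cons.prems by (simp add: c_def const_mult mult_ac del: power_Suc)
    finally show ?case using a(1) b(1) by (intro exI[of _ "b * a"]) simp
  qed (intro exI[of _ 1], simp)
  from this[of "sorted_list_of_set UNIV"] show ?thesis
    by (simp add: pd_monomial_def)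
qed

section \<open>Every top class is represented by a unique multipole\<close>

lemma ex_poly_mapping_lookup: "\<exists>m. Poly_Mapping.lookup m = (f :: 'n::finite \<Rightarrow> nat)"
  by (intro exI[of _ "Abs_poly_mapping f"]) simp

text \<open>The functions f for which f times \<open>tau\<close> is a multipole of
  \<open>Omega\<close> plus a coboundary.\<close>

definition multipole_exact :: "('n::{finite,linorder}, 'k::field_char_0) ratfun set" where
  "multipole_exact = {dop P (inverse zzs ^ CARD('n)) + g | P g. g \<in> divergences}"

lemma multipole_exact_0 [simp]: "0 \<in> multipole_exact"
  unfolding multipole_exact_def by (rule CollectI, intro exI[of _ 0]) simp

lemma multipole_exact_add:
  "f \<in> multipole_exact \<Longrightarrow> g \<in> multipole_exact \<Longrightarrow> f + g \<in> multipole_exact"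
proof -
  assume "f \<in> multipole_exact" "g \<in> multipole_exact"
  then obtain P f' Q g' where "f = dop P (inverse zzs ^ CARD('a)) + f'" "f' \<in> divergences"
    "g = dop Q (inverse zzs ^ CARD('a)) + g'" "g' \<in> divergences"
    unfolding multipole_exact_def by blast
  then show ?thesis unfolding multipole_exact_def
    by (intro CollectI exI[of _ "P + Q"] exI[of _ "f' + g'"]) (simp add: dop_add_left divergences_add)
qed

lemma multipole_exact_sum:
  "(\<And>a. a \<in> A \<Longrightarrow> f a \<in> multipole_exact) \<Longrightarrow> sum f A \<in> multipole_exact"
  by (induction A rule: infinite_finite_induct) (simp_all add: multipole_exact_add)

lemma dop_const_mult: "const c * dop P f = dop (Poly_Mapping.single 0 c * P) f"
  by (induction P rule: mpol_induct)
     (simp_all add: dop_single mult_single const_mult dop_add_left distrib_left mult.assoc)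

lemma multipole_exact_const_mult:
  "f \<in> multipole_exact \<Longrightarrow> const c * f \<in> multipole_exact"
proof -
  assume "f \<in> multipole_exact"
  then obtain P g where "f = dop P (inverse zzs ^ CARD('a)) + g" "g \<in> divergences"
    unfolding multipole_exact_def by blast
  then show ?thesis unfolding multipole_exact_def using divergences_mult[of g "const c"]
    by (intro CollectI exI[of _ "Poly_Mapping.single 0 c * P"] exI[of _ "const c * g"])
       (simp add: dop_const_mult distrib_left)
qed

lemma multipole_exact_divergence: "g \<in> divergences \<Longrightarrow> g \<in> multipole_exact"
  unfolding multipole_exact_def by (intro CollectI exI[of _ 0] exI[of _ g]) simp

text \<open>The exponent of \<open>zzs\<close> is forced by the degree -n. Each reduction removes
  one unstarred variable, which drives the induction; a monomial in starred variables alone is a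
  derivative of the n-th inverse power of \<open>zzs\<close> up to a nonzero constant.\<close>

lemma multipole_exact_monomial:
  fixes c :: "'k::field_char_0" and m :: "'n::{finite,linorder} var \<Rightarrow>\<^sub>0 nat"
  assumes n: "CARD('n) > 1"
  shows "of_mpol (Poly_Mapping.single m c) / zzs ^ (CARD('n) + (\<Sum>i\<in>UNIV. Poly_Mapping.lookup m (Zs i))) \<in> multipole_exact"
proof (induction "\<Sum>i\<in>UNIV. Poly_Mapping.lookup m (Z i)" arbitrary: m c rule: less_induct)
  case less
  let ?N = "CARD('n) + (\<Sum>i\<in>UNIV. Poly_Mapping.lookup m (Zs i))"
  show ?case
  proof (cases "\<exists>i. Poly_Mapping.lookup m (Z i) \<noteq> 0")
    case False
    obtain b where b: "Poly_Mapping.lookup b = (\<lambda>i. Poly_Mapping.lookup m (Zs i))"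
      using ex_poly_mapping_lookup by blast
    obtain a :: 'k where a: "a \<noteq> 0" "pd_monomial b (inverse zzs ^ CARD('n) :: ('n, 'k) ratfun) =
      const a * (\<Prod>i\<in>UNIV. zsvar i ^ Poly_Mapping.lookup m (Zs i)) * inverse zzs ^ ?N"
      using pd_monomial_inverse_zzs[of "CARD('n)" b] by (auto simp: b)
    have "of_mpol (Poly_Mapping.single m c) / zzs ^ ?N =
        const (c / a) * pd_monomial b (inverse zzs ^ CARD('n) :: ('n, 'k) ratfun)"
      unfolding a(2) using False a(1) by (simp add: of_mpol_single const_divide power_inverse divide_simps)
    also have "\<dots> = dop (Poly_Mapping.single b (c / a)) (inverse zzs ^ CARD('n)) + 0"
      by (simp add: dop_single)
    finally show ?thesis unfolding multipole_exact_def using divergences_0 by blast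
  next
    case True
    then obtain i where i: "Poly_Mapping.lookup m (Z i) \<noteq> 0" by blast
    define m' where "m' = m - Poly_Mapping.single (Z i) 1"
    have m: "m = Poly_Mapping.single (Z i) 1 + m'" using i
      by (intro poly_mapping_eqI) (auto simp: m'_def lookup_add lookup_minus lookup_single when_def)
    have N: "?N = CARD('n) + (\<Sum>i\<in>UNIV. Poly_Mapping.lookup m' (Zs i))"
      by (simp add: m lookup_add lookup_single when_def)
    define p :: "('n var, 'k) mpol" where "p = Poly_Mapping.single m' c"
    \<comment> \<open>Here n > 1 makes K positive; the reduction divides by K.\<close>
    obtain K where K: "?N = Suc K" "K > 0" using n by (cases ?N) auto
    have p: "of_mpol (Poly_Mapping.single m c) = zvar i * of_mpol p"
      by (simp add: p_def m zvar_def pvar_def mult_single flip: of_mpol_simps(6))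
    have "int (\<Sum>i\<in>UNIV. Poly_Mapping.lookup m' (Zs i)) = int K + (1 - int CARD('n))"
      using K(1) N by linarith
    from coeffsI[OF zs_homogeneous_single[OF refl] this, of c "{}" 0]
    have "of_mpol p / zzs ^ K \<in> coeffs {} (1 - int CARD('n))"
      by (simp add: p_def)
    then have div: "pd (Zs i) (of_mpol p * inverse zzs ^ K) \<in> divergences"
      by (intro divergences_pd) (simp add: divide_inverse power_inverse)
    define X where "X = zvar i * of_mpol p * inverse zzs ^ Suc K"
    have pd: "pd (Zs i) (of_mpol p * inverse zzs ^ K) =
        of_mpol (pderiv_mpol (Zs i) p) * inverse zzs ^ K - of_nat K * X"
      by (simp add: X_def pd_mult pd_inverse_power pd_of_mpol pd_zzs mult_ac)
    have K1: "const (1 / of_nat K) * (of_nat K :: ('n, 'k) ratfun) = 1"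
      using K(2) by (simp add: const_of_nat[symmetric] flip: const_mult)
    have "of_mpol (Poly_Mapping.single m c) / zzs ^ ?N = X"
      unfolding p K(1) X_def by (simp add: divide_inverse power_inverse)
    also have "\<dots> = const (1 / of_nat K) * of_nat K * X" unfolding K1 by simp
    \<comment> \<open>The derivative of p over the K-th power of \<open>zzs\<close>, solved for the
      term that carries the extra factor \<open>zvar i\<close>.\<close>
    finally have eq: "of_mpol (Poly_Mapping.single m c) / zzs ^ ?N = const (1 / of_nat K) *
        (of_mpol (pderiv_mpol (Zs i) p) / zzs ^ K + const (-1) * pd (Zs i) (of_mpol p * inverse zzs ^ K))"
      unfolding pd by (simp add: divide_inverse power_inverse mult.assoc)
    have "of_mpol (pderiv_mpol (Zs i) p) / zzs ^ K \<in> multipole_exact"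
    proof (cases "Poly_Mapping.lookup m' (Zs i) = 0")
      case True
      then show ?thesis by (simp add: p_def pderiv_mpol_single)
    next
      case False
      let ?l = "m' - Poly_Mapping.single (Zs i) 1"
      have "(\<Sum>j\<in>UNIV. Poly_Mapping.lookup ?l (Z j)) = (\<Sum>j\<in>UNIV. Poly_Mapping.lookup m' (Z j))"
        by (simp add: lookup_minus lookup_single when_def)
      also have "\<dots> < (\<Sum>j\<in>UNIV. Poly_Mapping.lookup m (Z j))"
        by (simp add: m lookup_add lookup_single when_def sum.distrib)
      finally have less': "(\<Sum>j\<in>UNIV. Poly_Mapping.lookup ?l (Z j)) < (\<Sum>j\<in>UNIV. Poly_Mapping.lookup m (Z j))" .
      have "m' = Poly_Mapping.single (Zs i) 1 + ?l" using False
        by (intro poly_mapping_eqI) (auto simp: lookup_add lookup_minus lookup_single when_def)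
      then have "(\<Sum>j\<in>UNIV. Poly_Mapping.lookup m' (Zs j)) =
          (\<Sum>j\<in>UNIV. Poly_Mapping.lookup (Poly_Mapping.single (Zs i) 1 + ?l) (Zs j))" by simp
      also have "\<dots> = 1 + (\<Sum>j\<in>UNIV. Poly_Mapping.lookup ?l (Zs j))"
        unfolding lookup_add sum.distrib by (simp add: lookup_single when_def)
      finally have K': "K = CARD('n) + (\<Sum>j\<in>UNIV. Poly_Mapping.lookup ?l (Zs j))" using K(1) N by simp
      show ?thesis using less.hyps[OF less', of "of_nat (Poly_Mapping.lookup m' (Zs i)) * c"]
        unfolding K'[symmetric] by (simp add: p_def pderiv_mpol_single)
    qed
    then show ?thesis unfolding eq
      by (intro multipole_exact_const_mult multipole_exact_add multipole_exact_divergence[OF div])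
  qed
qed

lemma coeffs_multipole_exact:
  fixes f :: "('n::{finite,linorder}, 'k::field_char_0) ratfun"
  assumes n: "CARD('n) > 1" and f: "f \<in> coeffs {} (- int CARD('n))"
  shows "f \<in> multipole_exact"
proof -
  obtain p N e where p: "f = of_mpol p / zzs ^ N" "zs_homogeneous e p" "int e = int N + - int CARD('n)"
    using f by (elim coeffsE) simp
  have "of_mpol p / zzs ^ N = (\<Sum>m\<in>Poly_Mapping.keys p. of_mpol (Poly_Mapping.single m (Poly_Mapping.lookup p m)) / zzs ^ N)"
    by (subst mpol_sum_single) (simp add: of_mpol_sum sum_divide_distrib)
  moreover have "of_mpol (Poly_Mapping.single m (Poly_Mapping.lookup p m)) / zzs ^ N \<in> multipole_exact"
    if "m \<in> Poly_Mapping.keys p" for m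
  proof -
    have "N = CARD('n) + (\<Sum>i\<in>UNIV. Poly_Mapping.lookup m (Zs i))"
      using that p(2,3) by (simp add: zs_homogeneous_def)
    then show ?thesis using multipole_exact_monomial[OF n] by simp
  qed
  ultimately show ?thesis unfolding p(1)
    by (simp only: multipole_exact_sum)
qed

lemma finite_UNIV_var: "finite (UNIV :: 'n::finite var set)"
proof -
  have "UNIV = range Z \<union> range (Zs :: 'n \<Rightarrow> 'n var)" by (metis UNIV_eq_I Un_iff rangeI var.exhaust)
  then show ?thesis by (metis finite_Un finite_imageI finite)
qed

text \<open>Let b be an exponent of P of maximal degree. Multiplying the multipole by the monomial
  with exponents b in the unstarred variables gives a divergence whose residue is a nonzero multiple
  of the coefficient of P at b.\<close>

lemma multipole_unique:
  fixes P :: "('n::{finite,linorder}, 'k::field_char_0) mpol"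
  assumes div: "dop P (inverse zzs ^ CARD('n)) \<in> divergences"
  shows "P = 0"
proof (rule ccontr)
  assume "P \<noteq> 0"
  define deg where "deg m = (\<Sum>i\<in>UNIV. Poly_Mapping.lookup m i)" for m :: "'n \<Rightarrow>\<^sub>0 nat"
  define D where "D = Max (deg ` Poly_Mapping.keys P)"
  have "Poly_Mapping.keys P \<noteq> {}" using \<open>P \<noteq> 0\<close> by (metis poly_mapping_eqI in_keys_iff empty_iff lookup_zero)
  then have "D \<in> deg ` Poly_Mapping.keys P" unfolding D_def by (intro Max_in) auto
  then obtain b where b: "b \<in> Poly_Mapping.keys P" "deg b = D" by auto
  have degle: "deg m \<le> D" if "m \<in> Poly_Mapping.keys P" for m
    unfolding D_def using that by (intro Max_ge) auto
  \<comment> \<open>Unstarred exponents b against starred exponents m: only m = b is balanced, so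
    the residue isolates one term of P.\<close>
  define mon where "mon m = Abs_poly_mapping (\<lambda>v. case v of Z i \<Rightarrow> Poly_Mapping.lookup b i | Zs i \<Rightarrow> Poly_Mapping.lookup m i)"
    for m :: "'n \<Rightarrow>\<^sub>0 nat"
  have "finite {v :: 'n var. X v}" for X by (rule finite_subset[OF _ finite_UNIV_var]) simp
  then have mon: "Poly_Mapping.lookup (mon m) (Z i) = Poly_Mapping.lookup b i"
    "Poly_Mapping.lookup (mon m) (Zs i) = Poly_Mapping.lookup m i" for m i
    by (simp_all add: mon_def)
  have bal: "balanced (mon m) \<longleftrightarrow> m = b" for m
    by (auto simp: balanced_def mon intro!: poly_mapping_eqI)
  \<comment> \<open>A monomial in unstarred variables is constant for the starred derivatives, so
    multiplication by it preserves divergences.\<close>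
  define h :: "('n, 'k) ratfun" where "h = of_mpol (Poly_Mapping.single (mon 0) 1)"
  have h: "of_mpol (Poly_Mapping.single (mon m) 1) = h * (\<Prod>i\<in>UNIV. zsvar i ^ Poly_Mapping.lookup m i)" for m
    by (simp add: h_def of_mpol_single mon)
  have h0: "zs_homogeneous 0 (Poly_Mapping.single (mon 0) (1::'k))"
    by (rule zs_homogeneous_single) (simp add: mon)
  have "pd (Zs i) h = 0" for i
    using zs_homogeneous_pderiv_Zs_0[OF h0] by (simp add: h_def pd_of_mpol)
  moreover have "h \<in> coeffs {} 0" using coeffs_of_mpol[OF h0] by (simp add: h_def)
  ultimately have hdiv: "h * dop P (inverse zzs ^ CARD('n)) \<in> divergences"
    by (intro divergences_mult div)
  have "\<forall>m. \<exists>a::'k. a \<noteq> 0 \<and> pd_monomial m (inverse zzs ^ CARD('n) :: ('n, 'k) ratfun) =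
    const a * (\<Prod>i\<in>UNIV. zsvar i ^ Poly_Mapping.lookup m i) * inverse zzs ^ (CARD('n) + deg m)"
    unfolding deg_def by (intro allI pd_monomial_inverse_zzs) simp
  from choice[OF this] obtain a :: "('n \<Rightarrow>\<^sub>0 nat) \<Rightarrow> 'k" where
    a': "\<forall>m. a m \<noteq> 0 \<and> pd_monomial m (inverse zzs ^ CARD('n) :: ('n, 'k) ratfun) =
    const (a m) * (\<Prod>i\<in>UNIV. zsvar i ^ Poly_Mapping.lookup m i) * inverse zzs ^ (CARD('n) + deg m)" ..
  note a = a'[rule_format, THEN conjunct1] a'[rule_format, THEN conjunct2]
  \<comment> \<open>The numerator over the common power n + D of \<open>zzs\<close>. The term at b
    has maximal degree and receives no factor \<open>zzp\<close>.\<close>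
  define q where "q = (\<Sum>m\<in>Poly_Mapping.keys P. Poly_Mapping.single 0 (Poly_Mapping.lookup P m * a m) *
      (zzp ^ (D - deg m) * Poly_Mapping.single (mon m) 1))"
  have mon_hom: "zs_homogeneous (deg m) (Poly_Mapping.single (mon m) (1::'k))" for m
    by (rule zs_homogeneous_single) (simp add: mon deg_def)
  have "h * dop P (inverse zzs ^ CARD('n)) = of_mpol q / zzs ^ (CARD('n) + D)"
  proof -
    have "h * (const (Poly_Mapping.lookup P m) * pd_monomial m (inverse zzs ^ CARD('n))) =
        of_mpol (Poly_Mapping.single 0 (Poly_Mapping.lookup P m * a m) *
          (zzp ^ (D - deg m) * Poly_Mapping.single (mon m) 1)) / zzs ^ (CARD('n) + D)"
      if "m \<in> Poly_Mapping.keys P" for m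
    proof -
      have D: "CARD('n) + D = (D - deg m) + (CARD('n) + deg m)" using degle[OF that] by simp
      show ?thesis unfolding D power_add[of zzs "D - deg m"] a(2)
        by (simp add: h const_mult const_def[symmetric] zzs_conv[symmetric] divide_inverse power_inverse mult_ac)
    qed
    then show ?thesis by (simp add: dop_def q_def sum_distrib_left of_mpol_sum sum_divide_distrib)
  qed
  moreover have "zs_homogeneous D q"
    unfolding q_def
  proof (rule zs_homogeneous_sum)
    fix m assume "m \<in> Poly_Mapping.keys P"
    then have "0 + ((D - deg m) * 1 + deg m) = D" using degle by simp
    moreover have "zs_homogeneous 0 (Poly_Mapping.single (0 :: 'n var \<Rightarrow>\<^sub>0 nat) (Poly_Mapping.lookup P m * a m))"
      by (rule zs_homogeneous_single) simp
    ultimately show "zs_homogeneous D (Poly_Mapping.single 0 (Poly_Mapping.lookup P m * a m) *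
      (zzp ^ (D - deg m) * Poly_Mapping.single (mon m) 1))"
      by (metis zs_homogeneous_mult zs_homogeneous_power zs_homogeneous_zzp mon_hom)
  qed
  ultimately have "residue q = 0" using hdiv by (intro residue_divergence) simp_all
  moreover have "residue q = (\<Sum>m\<in>Poly_Mapping.keys P. if m = b then zs_fact (mon b) * (Poly_Mapping.lookup P b * a b) else 0)"
    unfolding q_def residue_sum residue_const_mult residue_zzp_power[OF mon_hom] residue_single bal
    by (intro sum.cong refl) (simp add: b(2))
  ultimately have "zs_fact (mon b) * (Poly_Mapping.lookup P b * a b) = 0" using b(1) by simp
  with b(1) a(1) show False by (simp add: zs_fact_def in_keys_iff)
qed

section \<open>An explicit homotopy between \<open>\<Omega>\<close> and its residue\<close>

text \<open>
  The cochain below has as component over \<open>I\<close> a multiple of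
  \<open>\<iota>(\<Prod>\<^sub>j\<^sub>\<notin>\<^sub>I dz\<^sup>*\<^sub>j) / (\<Prod>\<^sub>i\<^sub>\<in>\<^sub>I z\<^sub>i \<cdot> (zz\<^sup>*)\<^sup>n\<^sup>-\<^sup>p)\<close>, where \<open>p\<close> is the size of \<open>I\<close> and \<open>\<iota>\<close> is the contraction.
  It interpolates between \<open>-\<Omega>\<close> for empty \<open>I\<close> and the inverse of the product of all \<open>z\<^sub>i\<close>.
\<close>

fun homotopy_coeff :: "nat \<Rightarrow> nat \<Rightarrow> 'k::field_char_0" where
  "homotopy_coeff n 0 = -1"
| "homotopy_coeff n (Suc p) = (-1) ^ Suc p * homotopy_coeff n p / of_nat (n - Suc p)"

text \<open>The recursion divides by the exponent of \<open>zzs\<close> over a set of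
  \<open>Suc p\<close> indices, which differentiation brings down, and records the sign in
  \<open>homotopy_relation\<close>. All divisors are positive below n. The start -1 makes the
  component at the empty set minus \<open>Omega\<close>.\<close>

lemma homotopy_coeff_nonzero: "p < n \<Longrightarrow> homotopy_coeff n p \<noteq> (0 :: 'k::field_char_0)"
proof (induction p)
  case (Suc p)
  then have "(of_nat (n - Suc p) :: 'k) \<noteq> 0" by (simp del: of_nat_diff)
  with Suc show ?case by (simp del: of_nat_diff)
qed simp

text \<open>The sign of i among all indices. It converts the sign of i relative to the complement of
  I, which exterior multiplication produces, into the sign relative to I in the Cech
  differential.\<close>

definition ind_sgn :: "'n::{finite,linorder} \<Rightarrow> 'k::field_char_0" where
  "ind_sgn i = sgn_before i UNIV 1"

definition homotopy :: "'n::{finite,linorder} set \<Rightarrow> ('n, 'k::field_char_0) form" where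
  "homotopy I = fscale (const (homotopy_coeff CARD('n) (card I) * (\<Prod>i\<in>I. ind_sgn i)) *
     inverse (\<Prod>i\<in>I. zvar i) * inverse zzs ^ (CARD('n) - card I)) (contraction (dzs (- I)))"

lemma ext_dzs:
  "ext i (dzs K) = (if i \<in> K then 0 else fscale (sgn_before i K 1) (dzs (insert i K) :: ('n::linorder, 'k::idom) form))"
proof (rule HOL.ext)
  fix J
  have "i \<in> J \<Longrightarrow> J - {i} = K \<longleftrightarrow> i \<notin> K \<and> J = insert i K" by auto
  moreover have "i \<notin> J \<Longrightarrow> J \<noteq> insert i K" by auto
  ultimately show "ext i (dzs K) J =
      (if i \<in> K then 0 else fscale (sgn_before i K 1) (dzs (insert i K) :: ('n, 'k) form)) J"
    by (auto simp: ext_def dzs_def fscale_def fun_apply)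
qed

lemma fpd_dzs [simp]: "fpd v (dzs K) = 0"
  by (auto simp: fpd_def dzs_def fun_eq_iff fun_apply)

lemma dbar_dzs [simp]: "dbar (dzs K) = 0"
  by (simp add: dbar_conv)

lemma dbar_contraction_dzs:
  "dbar (contraction (dzs K)) = fscale (of_nat (card K)) (dzs K :: ('n::{finite,linorder}, 'k::idom) form)"
proof -
  have "euler (dzs K J :: ('n, 'k) ratfun) = 0" for J by (simp add: euler_def dzs_def)
  then have "dbar (contraction (dzs K)) = (\<lambda>J. of_nat (card J) * (dzs K J :: ('n, 'k) ratfun))"
    using dbar_contraction[of "dzs K :: ('n, 'k) form"] by simp
  then show ?thesis by (auto simp: fscale_def dzs_def)
qed

lemma sgn_before_split: "sgn_before i UNIV x = sgn_before i I (sgn_before i (- I) x)"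
  for I :: "'n::{finite,linorder} set"
proof -
  have "{j \<in> UNIV. j < i} = {j \<in> I. j < i} \<union> {j \<in> - I. j < i}" by auto
  then have "card {j \<in> UNIV. j < i} = card {j \<in> I. j < i} + card {j \<in> - I. j < i}"
    by (simp only:) (rule card_Un_disjoint, auto)
  then show ?thesis by (simp add: sgn_before_def)
qed

lemma sgn_before_conv: "sgn_before i J x = const (sgn_before i J 1) * x"
  by (simp add: sgn_before_def)

lemma sgn_before_form: "sgn_before i J \<omega> = fscale (const (sgn_before i J 1)) \<omega>"
  by (simp add: sgn_before_def)

lemma pd_Zs_inverse_prod: "pd (Zs j) (inverse (\<Prod>i\<in>I. zvar i) :: ('n::linorder, 'k::idom) ratfun) = 0"
proof -
  have "pd (Zs j) (\<Prod>i\<in>I. zvar i :: ('n, 'k) ratfun) = 0"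
    by (induction I rule: infinite_finite_induct) (simp_all add: pd_mult pd_zvar)
  then show ?thesis by (simp add: pd_inverse)
qed

text \<open>By the Koszul identity, \<open>dbar\<close> of the inverse q-th power of
  \<open>zzs\<close> times the contraction of \<open>dzs (- I)\<close> is q times the inverse power
  of exponent q + 1, times the contraction of \<open>theta (dzs (- I))\<close>. Here
  \<open>theta\<close> adds an index i of I with a factor \<open>zvar i\<close>, which cancels one
  pole; this is the component over I without i.\<close>

lemma homotopy_relation:
  fixes I :: "'n::{finite,linorder} set"
  assumes "I \<noteq> UNIV"
  shows "cech_d homotopy I = (fscale (const ((-1) ^ card I)) (dbar (homotopy I)) :: ('n, 'k::field_char_0) form)"
proof -
  let ?n = "CARD('n)"
  have "card I < ?n" using assms by (metis finite psubsetI psubset_card_mono subset_UNIV)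
  \<comment> \<open>Both the exponent of \<open>zzs\<close> and the degree of
    \<open>dzs (- I)\<close>, so both terms of the derivative carry the factor q.\<close>
  define q where "q = ?n - card I"
  have q: "q = card (- I)" "q > 0"
    using \<open>card I < ?n\<close> by (simp_all add: q_def card_Diff_subset Compl_eq_Diff_UNIV)
  define k :: 'k where "k = homotopy_coeff ?n (card I) * (\<Prod>i\<in>I. ind_sgn i)"
  define C :: "('n, 'k) ratfun" where "C = const k * inverse (\<Prod>i\<in>I. zvar i)"
  have zzs_cancel: "zzs * (inverse zzs * x) = x" for x :: "('n, 'k) ratfun" by (simp flip: mult.assoc)
  have C: "pd (Zs i) C = 0" for i by (simp add: C_def pd_mult pd_Zs_inverse_prod)
  let ?\<omega> = "contraction (dzs (- I)) :: ('n, 'k) form"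
  have h: "homotopy I = fscale (C * inverse zzs ^ q) ?\<omega>"
    by (simp add: homotopy_def C_def k_def q_def)
  have "dbar (homotopy I) = fscale (C * inverse zzs ^ q * of_nat q) (dzs (- I)) +
      (\<Sum>i\<in>UNIV. fscale (C * (- of_nat q * zvar i * inverse zzs ^ Suc q)) (ext i ?\<omega>))"
    unfolding h dbar_fscale dbar_contraction_dzs
    by (simp add: pd_mult C pd_inverse_power pd_zzs q del: power_Suc)
  also have "(\<Sum>i\<in>UNIV. fscale (C * (- of_nat q * zvar i * inverse zzs ^ Suc q)) (ext i ?\<omega>)) =
      - fscale (C * of_nat q * inverse zzs ^ Suc q) (theta ?\<omega>)"
    by (simp add: theta_def fscale_sum mult_ac sum_negf del: power_Suc)
  \<comment> \<open>A factor \<open>zzs\<close> is split off so that the Koszul identity merges the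
    two terms into a contraction.\<close>
  also have "fscale (C * inverse zzs ^ q * of_nat q) (dzs (- I)) =
      fscale (C * of_nat q * inverse zzs ^ Suc q) (fscale zzs (dzs (- I)) :: ('n, 'k) form)"
    by (simp add: zzs_cancel mult_ac)
  also have "\<dots> + - fscale (C * of_nat q * inverse zzs ^ Suc q) (theta ?\<omega>) =
      fscale (C * of_nat q * inverse zzs ^ Suc q) (contraction (theta (dzs (- I))))"
    unfolding theta_contraction[symmetric] by (simp add: fscale_distribs)
  also have "contraction (theta (dzs (- I))) = (\<Sum>i\<in>I. fscale (zvar i * sgn_before i (- I) 1)
      (contraction (dzs (insert i (- I)))) :: ('n, 'k) form)"
    unfolding theta_def contraction_sum
    by (rule sum.mono_neutral_cong_right) (auto simp: ext_dzs contraction_fscale)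
  finally have d: "dbar (homotopy I) = (\<Sum>i\<in>I. fscale (C * of_nat q * inverse zzs ^ Suc q * (zvar i * sgn_before i (- I) 1))
      (contraction (dzs (insert i (- I)))))"
    by (simp add: fscale_sum del: power_Suc)
  have "sgn_before i I (homotopy (I - {i})) = fscale (const ((-1) ^ card I) * (C * of_nat q * inverse zzs ^ Suc q *
      (zvar i * sgn_before i (- I) 1))) (contraction (dzs (insert i (- I))) :: ('n, 'k) form)" if i: "i \<in> I" for i
  proof -
    define p where "p = card (I - {i})"
    have p: "card I = Suc p" unfolding p_def using i by (metis card.remove finite)
    have nq: "?n - p = Suc q" using \<open>card I < ?n\<close> by (simp add: q_def p)
    have compl: "- (I - {i}) = insert i (- I)" using i by auto
    have prodz: "(\<Prod>j\<in>I. zvar j) = zvar i * (\<Prod>j\<in>I - {i}. zvar j :: ('n, 'k) ratfun)"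
      and prods: "(\<Prod>j\<in>I. ind_sgn j) = ind_sgn i * (\<Prod>j\<in>I - {i}. ind_sgn j :: 'k)"
      using i by (simp_all add: prod.remove)
    have inv: "inverse (\<Prod>j\<in>I. zvar j) * zvar i = inverse (\<Prod>j\<in>I - {i}. zvar j :: ('n, 'k) ratfun)"
      unfolding prodz by simp
    have "q = ?n - Suc p" by (simp add: q_def p)
    then have "homotopy_coeff ?n (Suc p) * of_nat q = (-1) ^ Suc p * (homotopy_coeff ?n p :: 'k)"
      using q(2) by (simp add: \<open>q = ?n - Suc p\<close>[symmetric] del: of_nat_diff)
    then have "(-1) ^ Suc p * (homotopy_coeff ?n (Suc p) * of_nat q) = (homotopy_coeff ?n p :: 'k)"
      by (simp flip: mult.assoc power_mult_distrib)
    moreover have "ind_sgn i * sgn_before i (- I) 1 = (sgn_before i I 1 :: 'k)"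
      using sgn_before_split[of i "1::'k" I] by (simp add: ind_sgn_def sgn_before_def)
    moreover have "(-1) ^ Suc p * k * of_nat q * sgn_before i (- I) 1 =
        ((-1) ^ Suc p * (homotopy_coeff ?n (Suc p) * of_nat q)) * (ind_sgn i * sgn_before i (- I) 1) *
        (\<Prod>j\<in>I - {i}. ind_sgn j)"
      unfolding k_def p prods by (simp only: mult_ac)
    ultimately have k: "(-1) ^ Suc p * k * of_nat q * sgn_before i (- I) 1 =
        sgn_before i I 1 * (homotopy_coeff ?n p * (\<Prod>j\<in>I - {i}. ind_sgn j) :: 'k)"
      by (simp only: mult_ac)
    have "const ((-1) ^ card I) * (C * of_nat q * inverse zzs ^ Suc q * (zvar i * sgn_before i (- I) 1)) =
        const ((-1) ^ Suc p * k * of_nat q * sgn_before i (- I) 1) *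
          (inverse (\<Prod>j\<in>I. zvar j) * zvar i) * inverse zzs ^ Suc q"
      unfolding C_def p sgn_before_conv[of i "- I" 1]
      by (simp add: const_mult const_of_nat mult_ac del: power_Suc)
    also have "\<dots> = const (sgn_before i I 1) * (const (homotopy_coeff ?n p * (\<Prod>j\<in>I - {i}. ind_sgn j)) *
        inverse (\<Prod>j\<in>I - {i}. zvar j) * inverse zzs ^ Suc q)"
      unfolding k inv by (simp add: const_mult mult_ac del: power_Suc)
    finally show ?thesis
      by (simp only: homotopy_def compl nq sgn_before_form[of i I "fscale _ _"] p_def[symmetric] fscale_simps(6))
  qed
  then show ?thesis unfolding cech_d_apply d fscale_sum by (intro sum.cong refl) simp
qed

lemma homotopy_empty: "homotopy {} = - (Omega :: ('n::{finite,linorder}, 'k::field_char_0) form)"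
  by (simp add: homotopy_def Omega_conv tau_def)

lemma homotopy_UNIV: "homotopy UNIV = (0 :: ('n::{finite,linorder}, 'k::field_char_0) form)"
proof -
  have "intr i (dzs {}) = (0 :: ('n, 'k) form)" for i
    by (auto simp: intr_def dzs_def fun_eq_iff fun_apply)
  then show ?thesis by (simp add: homotopy_def contraction_conv)
qed

lemma contraction_dzs_single: "contraction (dzs {i}) = fscale (zsvar i) (dzs {} :: ('n::{finite,linorder}, 'k::idom) form)"
proof -
  have "intr j (dzs {i}) = (if j = i then dzs {} else 0 :: ('n, 'k) form)" for j
    by (auto simp: intr_def dzs_def fun_eq_iff fun_apply sgn_before_def)
  then show ?thesis by (simp add: contraction_conv if_distrib[of "fscale _"] cong: if_cong)
qed

text \<open>The component over the complement of i is, up to sign and constant,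
  \<open>zsvar i\<close> over \<open>zzs\<close> and all coordinates but the i-th. With all
  coordinates in the denominator the numerators become \<open>zvar i * zsvar i\<close> and add up to
  \<open>zzs\<close>.\<close>

lemma cech_d_homotopy_UNIV:
  "cech_d homotopy UNIV = fscale (const (homotopy_coeff CARD('n) (CARD('n) - 1) * (\<Prod>i\<in>(UNIV :: 'n set). ind_sgn i)) *
     inverse (\<Prod>i\<in>UNIV. zvar i)) (dzs {} :: ('n::{finite,linorder}, 'k::field_char_0) form)"
proof -
  let ?c = "const (homotopy_coeff CARD('n) (CARD('n) - 1) * (\<Prod>i\<in>(UNIV :: 'n set). ind_sgn i)) *
     inverse (\<Prod>i\<in>UNIV. zvar i) :: ('n, 'k) ratfun"
  have "sgn_before i UNIV (homotopy (UNIV - {i})) = fscale (?c * inverse zzs * (zvar i * zsvar i)) (dzs {} :: ('n, 'k) form)" for i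
  proof -
    have "- (UNIV - {i}) = {i}" "card (UNIV - {i}) = CARD('n) - 1" "CARD('n) - (CARD('n) - 1) = 1"
      by (auto simp: card_Diff_subset)
    then have h: "homotopy (UNIV - {i}) = fscale (const (homotopy_coeff CARD('n) (CARD('n) - 1) * (\<Prod>j\<in>UNIV - {i}. ind_sgn j)) *
       inverse (\<Prod>j\<in>UNIV - {i}. zvar j) * inverse zzs * zsvar i) (dzs {} :: ('n, 'k) form)"
      by (simp add: homotopy_def contraction_dzs_single)
    have s: "(\<Prod>j\<in>(UNIV :: 'n set). ind_sgn j) = sgn_before i UNIV 1 * (\<Prod>j\<in>UNIV - {i}. ind_sgn j :: 'k)"
      by (simp add: prod.remove[of UNIV i] ind_sgn_def)
    have z: "inverse (\<Prod>j\<in>UNIV. zvar j) * zvar i = inverse (\<Prod>j\<in>UNIV - {i}. zvar j :: ('n, 'k) ratfun)"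
      by (simp add: prod.remove[of UNIV i])
    have "?c * inverse zzs * (zvar i * zsvar i) = const (homotopy_coeff CARD('n) (CARD('n) - 1) * (\<Prod>i\<in>(UNIV :: 'n set). ind_sgn i)) *
        (inverse (\<Prod>j\<in>UNIV. zvar j) * zvar i) * inverse zzs * zsvar i" by (simp only: mult_ac)
    also have "\<dots> = const (sgn_before i UNIV 1) * (const (homotopy_coeff CARD('n) (CARD('n) - 1) * (\<Prod>j\<in>UNIV - {i}. ind_sgn j)) *
       inverse (\<Prod>j\<in>UNIV - {i}. zvar j) * inverse zzs * zsvar i)"
      unfolding z s by (simp add: const_mult mult_ac)
    finally show ?thesis by (simp only: h sgn_before_form[of i UNIV "fscale _ _"] fscale_simps(6))
  qed
  then have "cech_d homotopy UNIV = fscale (\<Sum>i\<in>UNIV. ?c * inverse zzs * (zvar i * zsvar i)) (dzs {} :: ('n, 'k) form)"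
    by (simp add: cech_d_apply fscale_sum_left)
  also have "(\<Sum>i\<in>UNIV. ?c * inverse zzs * (zvar i * zsvar i)) = ?c * inverse zzs * zzs"
    by (simp only: sum_distrib_left[symmetric] zzs_def)
  finally show ?thesis by (simp add: mult.assoc)
qed

lemma homotopy_A_loc:
  fixes I :: "'n::{finite,linorder} set"
  assumes "card I < CARD('n)"
  shows "homotopy I \<in> (A_loc I (CARD('n) - 1 - card I) :: ('n, 'k::field_char_0) form set)"
proof -
  have S: "Suc (CARD('n) - 1 - card I) = CARD('n) - card I" using assms by simp
  have c: "card (- I) = CARD('n) - card I" by (simp add: card_Diff_subset Compl_eq_Diff_UNIV)
  have "0 + 0 + - int (CARD('n) - card I) = - int (CARD('n) - card I)" by simp
  moreover have "inverse (\<Prod>i\<in>I. zvar i :: ('n, 'k) ratfun) \<in> coeffs I 0"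
    using coeffs_inverse_prod_zvar[of I I 1] by simp
  ultimately have f: "const k * inverse (\<Prod>i\<in>I. zvar i) * inverse zzs ^ (CARD('n) - card I) \<in>
      (coeffs I (- int (CARD('n) - card I)) :: ('n, 'k) ratfun set)" for k
    by (metis coeffs_mult coeffs_const coeffs_inverse_zzs_power)
  show ?thesis unfolding homotopy_def contraction_fscale[symmetric]
    by (rule contraction_A_loc; unfold S)
       (auto simp: fscale_def dzs_def f c)
qed

section \<open>The comparison relation\<close>

lemma tot_I:
  "(\<And>I. I \<noteq> {} \<Longrightarrow> card I \<le> Suc m \<Longrightarrow> c I \<in> A_loc I (Suc m - card I)) \<Longrightarrow>
   (\<And>I. \<not> (I \<noteq> {} \<and> card I \<le> Suc m) \<Longrightarrow> c I = 0) \<Longrightarrow> c \<in> tot m"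
  by (auto simp: tot_def)

lemma tot_D:
  "c \<in> tot m \<Longrightarrow> I \<noteq> {} \<Longrightarrow> card I \<le> Suc m \<Longrightarrow> c I \<in> A_loc I (Suc m - card I)"
  "c \<in> tot m \<Longrightarrow> \<not> (I \<noteq> {} \<and> card I \<le> Suc m) \<Longrightarrow> c I = 0"
  unfolding tot_def by (auto split: if_splits)

lemma tot_add: "c \<in> tot m \<Longrightarrow> d \<in> tot m \<Longrightarrow> c + d \<in> tot m"
  by (rule tot_I) (simp_all add: plus_fun_apply A_loc_add tot_D)

lemma tot_minus: "c \<in> tot m \<Longrightarrow> - c \<in> tot m"
  by (rule tot_I) (simp_all add: uminus_apply A_loc_minus tot_D)

text \<open>The relation inside \<open>comparison\<close> in degree n - 1, with the preceding degree
  n - 2 written out.\<close>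

definition comparable :: "('n::{finite,linorder}, 'k::idom) form \<Rightarrow> ('n set \<Rightarrow> ('n, 'k) ratfun) \<Rightarrow> bool" where
  "comparable \<omega> f \<longleftrightarrow> of_A \<omega> - of_cech f \<in> tot_d ` tot (CARD('n) - 2)"

lemma of_A_simps: "of_A (\<omega> + \<eta>) = of_A \<omega> + of_A \<eta>" "of_A (- \<omega>) = - of_A \<omega>" "of_A 0 = 0"
  by (auto simp: of_A_def fun_eq_iff fun_apply)

lemma of_cech_simps: "of_cech (f + g) = of_cech f + of_cech g" "of_cech (- f) = - of_cech f" "of_cech 0 = 0"
  by (auto simp: of_cech_def fun_eq_iff fun_apply)

lemma comparable_add: "comparable \<omega> f \<Longrightarrow> comparable \<eta> g \<Longrightarrow> comparable (\<omega> + \<eta>) (f + g)"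
proof -
  assume "comparable \<omega> f" "comparable \<eta> g"
  then obtain c d where "c \<in> tot (CARD('a) - 2)" "of_A \<omega> - of_cech f = tot_d c"
    "d \<in> tot (CARD('a) - 2)" "of_A \<eta> - of_cech g = tot_d d" by (auto simp: comparable_def)
  moreover from this have "of_A (\<omega> + \<eta>) - of_cech (f + g) = tot_d (c + d)"
    unfolding of_A_simps of_cech_simps tot_d_add by (metis add_diff_add)
  ultimately show ?thesis unfolding comparable_def by (metis image_eqI tot_add)
qed

lemma comparable_minus: "comparable \<omega> f \<Longrightarrow> comparable (- \<omega>) (- f)"
proof -
  assume "comparable \<omega> f"
  then obtain c where "c \<in> tot (CARD('a) - 2)" "of_A \<omega> - of_cech f = tot_d c" by (auto simp: comparable_def)
  moreover from this have "of_A (- \<omega>) - of_cech (- f) = tot_d (- c)"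
    unfolding of_A_simps of_cech_simps tot_d_minus by (metis minus_diff_eq minus_diff_commute diff_minus_eq_add uminus_add_conv_diff)
  ultimately show ?thesis unfolding comparable_def by (metis image_eqI tot_minus)
qed

lemma comparable_diff: "comparable \<omega> f \<Longrightarrow> comparable \<eta> g \<Longrightarrow> comparable (\<omega> - \<eta>) (f - g)"
  using comparable_add[of \<omega> f "- \<eta>" "- g"] comparable_minus[of \<eta> g] by simp

text \<open>Restriction to the open sets is the Cech differential of a cochain placed at the empty
  set. This makes it closed and lets it absorb the empty component of
  \<open>homotopy\<close>.\<close>

lemma of_A_conv_cech_d: "of_A \<alpha> = cech_d (\<lambda>I. if I = {} then \<alpha> else 0)"
proof (rule HOL.ext)
  fix I :: "'a set"
  show "of_A \<alpha> I = cech_d (\<lambda>I. if I = {} then \<alpha> else 0) I"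
  proof (cases "card I = 1")
    case True
    then obtain i where "I = {i}" by (auto simp: card_1_singleton_iff)
    then show ?thesis by (simp add: of_A_def cech_d_apply sgn_before_def[of i "{}"])
  next
    case False
    then have "I - {i} \<noteq> {}" if "i \<in> I" for i using that by (auto simp: card_1_singleton_iff)
    then show ?thesis using False by (simp add: of_A_def cech_d_apply)
  qed
qed

text \<open>The cochain \<open>of_A\<close> \<alpha> bounds: its Cech differential is zero, and sets
  of one element carry the positive sign of \<open>dbar\<close>.\<close>

lemma comparable_dbar:
  fixes \<alpha> :: "('n::{finite,linorder}, 'k::idom) form"
  assumes n: "CARD('n) > 1" and \<alpha>: "\<alpha> \<in> A_forms (CARD('n) - 2)"
  shows "comparable (dbar \<alpha>) 0"
proof -
  have "of_A \<alpha> \<in> tot (CARD('n) - 2)"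
    using n \<alpha> A_loc_mono[of "{}" _ \<alpha>] by (intro tot_I) (auto simp: of_A_def numeral_2_eq_2)
  moreover have "tot_d (of_A \<alpha>) = of_A (dbar \<alpha>)"
  proof (rule HOL.ext)
    fix I :: "'n set"
    have "cech_d (of_A \<alpha>) = 0" by (simp add: of_A_conv_cech_d)
    then show "tot_d (of_A \<alpha>) I = of_A (dbar \<alpha>) I"
      by (simp add: tot_d_apply fun_apply) (simp add: of_A_def)
  qed
  ultimately show ?thesis unfolding comparable_def of_cech_simps by (metis diff_zero image_eqI)
qed

lemma regular_coeffs: "f \<in> regular I \<Longrightarrow> f \<in> coeffs I 0"
  unfolding regular_def using coeffsI[of 0 _ 0 0 I] by fastforce

lemma pd_Zs_regular:
  fixes f :: "('n::{finite,linorder}, 'k::idom) ratfun"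
  assumes "f \<in> regular I"
  shows "pd (Zs j) f = 0"
proof -
  obtain p M where f: "f = of_mpol p / (\<Prod>i\<in>I. zvar i) ^ M" "zs_homogeneous 0 p"
    using assms unfolding regular_def by blast
  have "pd (Zs j) (inverse (\<Prod>i\<in>I. zvar i :: ('n, 'k) ratfun) ^ M) = 0"
    by (cases M) (simp_all add: pd_power_Suc pd_Zs_inverse_prod del: power_Suc)
  then show ?thesis using zs_homogeneous_pderiv_Zs_0[OF f(2)]
    by (simp add: f(1) divide_inverse power_inverse[symmetric] pd_mult pd_of_mpol del: power_inverse)
qed

lemma contraction_0_form:
  assumes "\<And>J. J \<noteq> {} \<Longrightarrow> \<omega> J = 0"
  shows "contraction \<omega> = (0 :: ('n::{finite,linorder}, 'k::idom) form)"
proof -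
  have "intr i \<omega> = 0" for i using assms by (auto simp: intr_def fun_eq_iff fun_apply)
  then show ?thesis by (simp add: contraction_conv)
qed

text \<open>Regular functions contain no starred variables, so as 0-forms they are closed and have
  zero contraction; the total differential of \<open>of_cech g\<close> is its Cech
  differential.\<close>

lemma comparable_cech_d:
  fixes g :: "'n::{finite,linorder} set \<Rightarrow> ('n, 'k::idom) ratfun"
  assumes n: "CARD('n) > 1" and g: "g \<in> cech (CARD('n) - 2)"
  shows "comparable 0 (cech_d g)"
proof -
  have g1: "g I \<in> regular I" if "card I = Suc (CARD('n) - 2)" for I using g that by (auto simp: cech_def)
  have g0: "g I = 0" if "card I \<noteq> Suc (CARD('n) - 2)" for I using g that by (auto simp: cech_def)
  have "of_cech g \<in> tot (CARD('n) - 2)"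
  proof (rule tot_I)
    fix I :: "'n set"
    assume I: "card I \<le> Suc (CARD('n) - 2)"
    show "of_cech g I \<in> A_loc I (Suc (CARD('n) - 2) - card I)"
    proof (cases "card I = Suc (CARD('n) - 2)")
      case True
      then show ?thesis using regular_coeffs[OF g1[OF True]]
        by (intro A_locI contraction_0_form) (auto simp: of_cech_def)
    next
      case False
      then have "of_cech g I = 0" using g0 by (auto simp: of_cech_def fun_eq_iff fun_apply)
      then show ?thesis by simp
    qed
  next
    fix I :: "'n set"
    assume "\<not> (I \<noteq> {} \<and> card I \<le> Suc (CARD('n) - 2))"
    then have "g I = 0" using g0 by force
    then show "of_cech g I = 0" by (auto simp: of_cech_def fun_eq_iff fun_apply)
  qed
  moreover have "tot_d (of_cech g) = of_cech (cech_d g)"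
  proof (rule HOL.ext)
    fix I :: "'n set"
    have "pd (Zs i) (g I) = 0" for i
      using g1[of I] g0[of I] pd_Zs_regular by (cases "card I = Suc (CARD('n) - 2)") auto
    then have "fpd (Zs i) (of_cech g I) = 0" for i
      by (auto simp: fpd_def of_cech_def fun_eq_iff fun_apply)
    then have "dbar (of_cech g I) = 0" by (simp add: dbar_conv)
    moreover have "cech_d (of_cech g) I = of_cech (cech_d g) I"
    proof -
      have "(\<lambda>J :: 'n set. if J = {} then x + y else 0) =
          (\<lambda>J. if J = {} then x else 0) + (\<lambda>J. if J = {} then y else 0)" for x y :: "('n, 'k) ratfun"
        by (auto simp: fun_eq_iff plus_fun_apply)
      from additive_cech_d[of "\<lambda>x J. if J = {} then x else 0", OF this, of g I]
      show ?thesis by (simp add: of_cech_def[abs_def])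
    qed
    ultimately show "tot_d (of_cech g) I = of_cech (cech_d g) I" by (simp add: tot_d_apply)
  qed
  ultimately show ?thesis unfolding comparable_def of_A_simps
    by (metis image_eqI tot_minus tot_d_minus diff_0)
qed

text \<open>The bounding cochain is \<open>homotopy\<close> without its component at the empty set.
  On proper nonempty sets the two differentials cancel by \<open>homotopy_relation\<close>, and the
  full index set contributes the inverse of the product of the coordinates.\<close>

lemma comparable_Omega:
  assumes n: "CARD('n::{finite,linorder}) > 1"
  shows "\<exists>c::'k::field_char_0. c \<noteq> 0 \<and> comparable (Omega :: ('n, 'k) form) (inv_z_cochain c)"
proof -
  let ?n = "CARD('n)"
  define a :: 'k where "a = homotopy_coeff ?n (?n - 1) * (\<Prod>i\<in>(UNIV :: 'n set). ind_sgn i)"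
  have "ind_sgn i \<noteq> (0::'k)" for i :: 'n by (simp add: ind_sgn_def sgn_before_def)
  moreover have "homotopy_coeff ?n (?n - 1) \<noteq> (0::'k)" using n by (intro homotopy_coeff_nonzero) simp
  ultimately have "a \<noteq> 0" by (simp add: a_def)
  define \<beta> where "\<beta> I = (if I = {} then 0 else homotopy I :: ('n, 'k) form)" for I
  have S: "Suc (?n - 2) = ?n - 1" using n by simp
  have "\<beta> \<in> tot (?n - 2)"
  proof (rule tot_I; unfold S)
    fix I :: "'n set"
    assume "I \<noteq> {}" "card I \<le> ?n - 1"
    then show "\<beta> I \<in> A_loc I (?n - 1 - card I)"
      using n homotopy_A_loc[of I, where 'k = 'k] by (simp add: \<beta>_def)
  next
    fix I :: "'n set"
    assume "\<not> (I \<noteq> {} \<and> card I \<le> ?n - 1)"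
    then have "I = {} \<or> card I \<ge> ?n" by auto
    then have "I = {} \<or> I = UNIV" by (metis card_seteq finite subset_UNIV)
    then show "\<beta> I = 0" by (auto simp: \<beta>_def homotopy_UNIV)
  qed
  moreover have "tot_d \<beta> = of_A Omega - of_cech (inv_z_cochain (- a))"
  proof (rule HOL.ext)
    fix I :: "'n set"
    \<comment> \<open>Removing the empty component means adding \<open>Omega\<close> there; the Cech
      differential turns this into \<open>of_A Omega\<close>.\<close>
    have \<beta>: "\<beta> = homotopy + (\<lambda>I. if I = {} then Omega else 0)"
      by (auto simp: \<beta>_def fun_eq_iff fun_apply homotopy_empty)
    then have c: "cech_d \<beta> I = cech_d homotopy I + of_A Omega I"
      by (simp add: of_A_conv_cech_d plus_fun_apply)
    have inv: "of_cech (inv_z_cochain (- a)) I = 0" if "I \<noteq> UNIV"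
      using that by (auto simp: of_cech_def inv_z_cochain_def fun_eq_iff fun_apply)
    have odd: "(if odd (card I) then x else - x) = - fscale (const ((-1) ^ card I)) x" for x :: "('n, 'k) form"
      by simp
    consider "I = {}" | "I = UNIV" "I \<noteq> {}" | "I \<noteq> {}" "I \<noteq> UNIV" by blast
    then show "tot_d \<beta> I = (of_A Omega - of_cech (inv_z_cochain (- a))) I"
    proof cases
      case 1
      then show ?thesis using inv by (simp add: tot_d_apply cech_d_apply \<beta>_def of_A_def minus_apply)
    next
      case 2
      have "(\<Prod>i\<in>UNIV. inverse (zvar i)) = inverse (\<Prod>i\<in>UNIV. zvar i :: ('n, 'k) ratfun)"
        by (simp add: o_def flip: prod_inversef)
      then have "of_cech (inv_z_cochain (- a)) I = - fscale (const a * inverse (\<Prod>i\<in>UNIV. zvar i)) (dzs {} :: ('n, 'k) form)"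
        using 2 by (auto simp: of_cech_def inv_z_cochain_def fscale_def dzs_def fun_eq_iff fun_apply)
      moreover have "cech_d homotopy I = fscale (const a * inverse (\<Prod>i\<in>UNIV. zvar i)) (dzs {} :: ('n, 'k) form)"
        unfolding 2(1) a_def by (rule cech_d_homotopy_UNIV)
      moreover have "\<beta> I = 0" using 2 by (simp add: \<beta>_def homotopy_UNIV)
      ultimately show ?thesis by (simp add: tot_d_apply c minus_apply)
    next
      case 3
      then have "\<beta> I = homotopy I" by (simp add: \<beta>_def)
      then show ?thesis unfolding tot_d_apply c odd homotopy_relation[OF 3(2)]
        using inv[OF 3(2)] by (simp add: minus_apply)
    qed
  qed
  ultimately have "comparable (Omega :: ('n, 'k) form) (inv_z_cochain (- a))"
    unfolding comparable_def by (metis image_eqI)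
  with \<open>a \<noteq> 0\<close> show ?thesis by (intro exI[of _ "- a"]) simp
qed

subsection \<open>Compatibility with differential operators\<close>

text \<open>Expresses \<open>diff_op\<close> by the operators \<open>fpd\<close> on whole forms, so
  that maps commuting with these and with constants commute with it.\<close>

lemma diff_op_conv_sum:
  fixes \<omega> :: "('n::{finite,linorder}, 'k::idom) form"
  shows "diff_op P \<omega> = (\<Sum>m\<in>Poly_Mapping.keys P. fscale (const (Poly_Mapping.lookup P m))
     (foldr (\<lambda>i. fpd (Z i) ^^ Poly_Mapping.lookup m i) (sorted_list_of_set UNIV) \<omega>))"
proof (rule HOL.ext)
  fix J
  have pw: "(fpd v ^^ k) \<omega> J = (pd v ^^ k) (\<omega> J)" for v k and \<omega> :: "('n, 'k) form"
    by (induction k) (simp_all add: fpd_def)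
  have "foldr (\<lambda>i. fpd (Z i) ^^ Poly_Mapping.lookup m i) xs \<omega> J =
      foldr (\<lambda>i. pd (Z i) ^^ Poly_Mapping.lookup m i) xs (\<omega> J)" for m xs
    by (induction xs) (simp_all add: pw)
  then show "diff_op P \<omega> J = (\<Sum>m\<in>Poly_Mapping.keys P. fscale (const (Poly_Mapping.lookup P m))
     (foldr (\<lambda>i. fpd (Z i) ^^ Poly_Mapping.lookup m i) (sorted_list_of_set UNIV) \<omega>)) J"
    by (simp add: diff_op_def sum_fun_apply fscale_def pd_monomial_def)
qed

lemma diff_op_commute:
  fixes T :: "('n::{finite,linorder}, 'k::idom) form \<Rightarrow> ('n, 'k) form"
  assumes add: "\<And>\<omega> \<eta>. T (\<omega> + \<eta>) = T \<omega> + T \<eta>" and "\<And>c \<omega>. T (fscale (const c) \<omega>) = fscale (const c) (T \<omega>)"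
    and T: "\<And>i \<omega>. T (fpd (Z i) \<omega>) = fpd (Z i) (T \<omega>)"
  shows "T (diff_op P \<omega>) = diff_op P (T \<omega>)"
proof -
  have pw: "T ((fpd (Z i) ^^ k) \<omega>) = (fpd (Z i) ^^ k) (T \<omega>)" for i k \<omega>
    by (induction k) (simp_all add: T)
  have "T (foldr (\<lambda>i. fpd (Z i) ^^ Poly_Mapping.lookup m i) xs \<omega>) =
      foldr (\<lambda>i. fpd (Z i) ^^ Poly_Mapping.lookup m i) xs (T \<omega>)" for m xs
    by (induction xs) (simp_all add: pw)
  then show ?thesis by (simp add: diff_op_conv_sum additive_sum[of T, OF add] assms(2))
qed

lemma dbar_diff_op: "dbar (diff_op P \<omega>) = diff_op P (dbar \<omega>)"
  by (rule diff_op_commute) (simp_all add: dbar_fpd dbar_fscale)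

lemma diff_op_A_loc:
  assumes "\<omega> \<in> A_loc I m"
  shows "diff_op P \<omega> \<in> A_loc I m"
proof -
  have pw: "(fpd (Z i) ^^ k) \<omega> \<in> A_loc I m" if "\<omega> \<in> A_loc I m" for i k \<omega>
    using that by (induction k) (simp_all add: A_loc_fpd)
  have "foldr (\<lambda>i. fpd (Z i) ^^ Poly_Mapping.lookup l i) xs \<omega> \<in> A_loc I m" for l xs
    by (induction xs) (simp_all add: pw assms)
  then show ?thesis unfolding diff_op_conv_sum by (intro A_loc_sum A_loc_fscale) simp_all
qed

lemma diff_op_add: "diff_op P (\<omega> + \<eta>) = diff_op P \<omega> + diff_op P \<eta>"
  by (auto simp: diff_op_conv dop_add fun_eq_iff plus_fun_apply)

lemma dop_0 [simp]: "dop P 0 = 0"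
  by (rule additive_0) (rule dop_add)

lemma diff_op_0 [simp]: "diff_op P 0 = 0"
  by (auto simp: diff_op_conv fun_eq_iff zero_fun_apply)

text \<open>The operator preserves each \<open>A_loc\<close> and commutes with both differentials,
  so it acts on the total complex and carries the bounding cochain along.\<close>

lemma comparable_diff_op:
  fixes \<omega> :: "('n::{finite,linorder}, 'k::idom) form"
  assumes "comparable \<omega> f"
  shows "comparable (diff_op P \<omega>) (\<lambda>I. dop P (f I))"
proof -
  obtain c where c: "c \<in> tot (CARD('n) - 2)" "of_A \<omega> - of_cech f = tot_d c"
    using assms by (auto simp: comparable_def)
  let ?D = "\<lambda>c I. diff_op P (c I)"
  have "?D c \<in> tot (CARD('n) - 2)"
    using c(1) by (intro tot_I) (simp_all add: tot_D diff_op_A_loc)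
  moreover have "tot_d (?D c) = ?D (tot_d c)"
  proof (rule HOL.ext)
    fix I
    have "diff_op P (cech_d c I) = cech_d (?D c) I"
      by (rule additive_cech_d[of "diff_op P"]) (rule diff_op_add)
    moreover have "diff_op P (- \<omega>) = - diff_op P \<omega>" for \<omega> :: "('n, 'k) form"
      by (rule additive_minus[of "diff_op P"]) (rule diff_op_add)
    ultimately show "tot_d (?D c) I = diff_op P (tot_d c I)"
      by (simp add: tot_d_apply dbar_diff_op diff_op_add)
  qed
  moreover have "?D (of_A \<omega> - of_cech f) = of_A (diff_op P \<omega>) - of_cech (\<lambda>I. dop P (f I))"
  proof (rule HOL.ext)
    fix I
    have "diff_op P (\<omega> - \<eta>) = diff_op P \<omega> - diff_op P \<eta>" for \<omega> \<eta> :: "('n, 'k) form"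
      using diff_op_add[of P "\<omega> - \<eta>" \<eta>] by simp
    moreover have "diff_op P (of_A \<omega> I) = of_A (diff_op P \<omega>) I" by (simp add: of_A_def)
    moreover have "diff_op P (of_cech f I) = of_cech (\<lambda>I. dop P (f I)) I"
      by (auto simp: of_cech_def diff_op_conv fun_eq_iff)
    ultimately show "diff_op P ((of_A \<omega> - of_cech f) I) = (of_A (diff_op P \<omega>) - of_cech (\<lambda>I. dop P (f I))) I"
      by (simp add: minus_apply)
  qed
  ultimately have "of_A (diff_op P \<omega>) - of_cech (\<lambda>I. dop P (f I)) = tot_d (?D c)" using c(2) by simp
  with \<open>?D c \<in> tot (CARD('n) - 2)\<close> show ?thesis unfolding comparable_def by blast
qed

section \<open>Top \v{C}ech cohomology\<close>

lemma cech_d_degree: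
  fixes g :: "'n::{finite,linorder} set \<Rightarrow> 'a::ab_group_add"
  assumes "\<And>I. card I \<noteq> p \<Longrightarrow> g I = 0" "card I \<noteq> Suc p"
  shows "cech_d g I = 0"
  unfolding cech_d_conv sum_fun_apply using assms by (intro sum.neutral ballI ext_degree) auto

section \<open>Regular functions and Cech cochains\<close>

lemma regular_add: "f \<in> regular I \<Longrightarrow> g \<in> regular I \<Longrightarrow> f + g \<in> regular I"
proof -
  assume "f \<in> regular I" "g \<in> regular I"
  then obtain p M p' M' where *: "f = of_mpol p / (\<Prod>i\<in>I. zvar i) ^ M" "zs_homogeneous 0 p"
    "g = of_mpol p' / (\<Prod>i\<in>I. zvar i) ^ M'" "zs_homogeneous 0 p'" unfolding regular_def by blast
  let ?r = "p * zpol I ^ M' + p' * zpol I ^ M"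
  have "f + g = of_mpol ?r / (\<Prod>i\<in>I. zvar i) ^ (M + M')"
    unfolding * by (simp add: of_mpol_zpol power_add divide_simps)
  moreover have "zs_homogeneous 0 ?r"
    using zs_homogeneous_mult[OF *(2) zs_homogeneous_power[OF zs_homogeneous_zpol[of I], of M']]
      zs_homogeneous_mult[OF *(4) zs_homogeneous_power[OF zs_homogeneous_zpol[of I], of M]]
    by (intro zs_homogeneous_add) simp_all
  ultimately show ?thesis unfolding regular_def by blast
qed

lemma regular_minus: "f \<in> regular I \<Longrightarrow> - f \<in> regular I"
proof -
  assume "f \<in> regular I"
  then obtain p M where "f = of_mpol p / (\<Prod>i\<in>I. zvar i) ^ M" "zs_homogeneous 0 p"
    unfolding regular_def by blast
  then have "- f = of_mpol (- p) / (\<Prod>i\<in>I. zvar i) ^ M" "zs_homogeneous 0 (- p)"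
    by (simp_all add: zs_homogeneous_minus)
  then show ?thesis unfolding regular_def by blast
qed

lemma regular_0 [simp]: "0 \<in> regular I"
  unfolding regular_def by (rule CollectI, intro exI[of _ 0]) simp

lemma cech_add: "f \<in> cech p \<Longrightarrow> g \<in> cech p \<Longrightarrow> f + g \<in> cech p"
  by (auto simp: cech_def plus_fun_apply regular_add split: if_splits)

lemma cech_minus: "f \<in> cech p \<Longrightarrow> - f \<in> cech p"
  by (auto simp: cech_def uminus_apply regular_minus split: if_splits)

lemma cech_0 [simp]: "0 \<in> cech p"
  by (auto simp: cech_def zero_fun_apply)

text \<open>The counterpart of \<open>multipole_exact\<close>: sections over the full intersection
  that are multipoles up to a Cech coboundary.\<close>

definition multipole_cech :: "('n::{finite,linorder}, 'k::field_char_0) ratfun set" where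
  "multipole_cech = {dop P (\<Prod>i\<in>UNIV. inverse (zvar i)) + cech_d g UNIV | P g. g \<in> cech (CARD('n) - 2)}"

lemma multipole_cech_add:
  "f \<in> multipole_cech \<Longrightarrow> g \<in> multipole_cech \<Longrightarrow> f + g \<in> multipole_cech"
proof -
  assume "f \<in> multipole_cech" "g \<in> multipole_cech"
  then obtain P f' Q g' where "f = dop P (\<Prod>i\<in>UNIV. inverse (zvar i)) + cech_d f' UNIV" "f' \<in> cech (CARD('a) - 2)"
    "g = dop Q (\<Prod>i\<in>UNIV. inverse (zvar i)) + cech_d g' UNIV" "g' \<in> cech (CARD('a) - 2)"
    unfolding multipole_cech_def by blast
  then show ?thesis unfolding multipole_cech_def
    by (intro CollectI exI[of _ "P + Q"] exI[of _ "f' + g'"]) (simp add: dop_add_left cech_add plus_fun_apply)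
qed

lemma multipole_cech_0 [simp]: "0 \<in> multipole_cech"
  unfolding multipole_cech_def by (rule CollectI, intro exI[of _ 0]) (simp add: zero_fun_apply)

lemma multipole_cech_sum:
  "(\<And>a. a \<in> A \<Longrightarrow> f a \<in> multipole_cech) \<Longrightarrow> sum f A \<in> multipole_cech"
  by (induction A rule: infinite_finite_induct) (simp_all add: multipole_cech_add)

text \<open>A section without a pole along the i-th hyperplane is the coboundary of a cochain
  supported on the complement of i, up to the sign built into g.\<close>

lemma multipole_cech_regular:
  fixes f :: "('n::{finite,linorder}, 'k::field_char_0) ratfun"
  assumes n: "CARD('n) > 1" and f: "f \<in> regular (UNIV - {i})"
  shows "f \<in> multipole_cech"
proof -
  define g where "g I = (if I = UNIV - {i} then sgn_before i UNIV f else 0)" for I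
  have "sgn_before i UNIV f \<in> regular (UNIV - {i})" using f by (simp add: sgn_before_def regular_minus)
  moreover have c: "card (UNIV - {i}) = Suc (CARD('n) - 2)" using n by (simp add: card_Diff_subset)
  ultimately have "g \<in> cech (CARD('n) - 2)"
    using c by (auto simp: cech_def g_def)
  moreover have "cech_d g UNIV = (\<Sum>j\<in>UNIV. if j = i then f else 0)"
    unfolding cech_d_apply by (intro sum.cong) (auto simp: g_def)
  ultimately show ?thesis unfolding multipole_cech_def
    by (intro CollectI exI[of _ 0] exI[of _ g]) simp
qed

text \<open>A Laurent monomial with some nonnegative exponent extends across a hyperplane and is a
  coboundary; with all exponents negative it is a derivative of the inverse of the product of the
  coordinates, up to a nonzero constant.\<close>

lemma regular_multipole_cech:
  fixes f :: "('n::{finite,linorder}, 'k::field_char_0) ratfun"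
  assumes n: "CARD('n) > 1" and f: "f \<in> regular UNIV"
  shows "f \<in> multipole_cech"
proof -
  let ?z = "\<Prod>i\<in>UNIV. zvar i :: ('n, 'k) ratfun"
  obtain p M where p: "f = of_mpol p / ?z ^ M" "zs_homogeneous 0 p"
    using f unfolding regular_def by blast
  have "of_mpol p / ?z ^ M = (\<Sum>m\<in>Poly_Mapping.keys p. of_mpol (Poly_Mapping.single m (Poly_Mapping.lookup p m)) / ?z ^ M)"
    by (subst mpol_sum_single) (simp add: of_mpol_sum sum_divide_distrib)
  moreover have "of_mpol (Poly_Mapping.single m c) / ?z ^ M \<in> multipole_cech"
    if m: "m \<in> Poly_Mapping.keys p" for m and c :: 'k
  proof -
    have zs0: "Poly_Mapping.lookup m (Zs i) = 0" for i using m p(2) by (simp add: zs_homogeneous_def)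
    show ?thesis
    proof (cases "\<exists>i. M \<le> Poly_Mapping.lookup m (Z i)")
      case True
      then obtain i where i: "M \<le> Poly_Mapping.lookup m (Z i)" by blast
      define m' where "m' = m - Poly_Mapping.single (Z i) M"
      have "Poly_Mapping.lookup m (Z j) = (if j = i then M else 0) + Poly_Mapping.lookup m' (Z j)" for j
        using i by (auto simp: m'_def lookup_minus lookup_single when_def)
      moreover have "(\<Prod>j\<in>UNIV. zvar j ^ (if j = i then M else 0)) = (zvar i ^ M :: ('n, 'k) ratfun)"
        by (simp add: if_distrib[of "\<lambda>k. _ ^ k"] cong: if_cong)
      moreover have zs0': "Poly_Mapping.lookup m' (Zs j) = 0" for j
        using zs0 by (simp add: m'_def lookup_minus)
      ultimately have "of_mpol (Poly_Mapping.single m c) = zvar i ^ M * of_mpol (Poly_Mapping.single m' c)"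
        by (simp add: of_mpol_single zs0 power_add prod.distrib)
      moreover have "?z = zvar i * (\<Prod>j\<in>UNIV - {i}. zvar j)" by (simp add: prod.remove)
      ultimately have "of_mpol (Poly_Mapping.single m c) / ?z ^ M =
          of_mpol (Poly_Mapping.single m' c) / (\<Prod>j\<in>UNIV - {i}. zvar j) ^ M"
        by (simp add: power_mult_distrib)
      moreover have "zs_homogeneous 0 (Poly_Mapping.single m' c)"
        by (rule zs_homogeneous_single) (simp add: zs0')
      ultimately show ?thesis by (intro multipole_cech_regular[OF n, of _ i]) (auto simp: regular_def)
    next
      case False
      then have lt: "Poly_Mapping.lookup m (Z i) < M" for i by (simp add: not_le)
      \<comment> \<open>The pole order along the i-th hyperplane is M minus the exponent of
        \<open>Z i\<close>; a simple pole reaches it after one derivative fewer.\<close>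
      obtain b where b: "Poly_Mapping.lookup b = (\<lambda>i. M - Suc (Poly_Mapping.lookup m (Z i)))"
        using ex_poly_mapping_lookup by blast
      obtain a :: 'k where a: "a \<noteq> 0" "pd_monomial b (\<Prod>i\<in>UNIV. inverse (zvar i) :: ('n, 'k) ratfun) =
        const a * (\<Prod>i\<in>UNIV. inverse (zvar i) ^ Suc (Poly_Mapping.lookup b i))"
        using pd_monomial_inverse_zvar by blast
      have "zvar i ^ Poly_Mapping.lookup m (Z i) / zvar i ^ M = (inverse (zvar i) ^ Suc (Poly_Mapping.lookup b i) :: ('n, 'k) ratfun)" for i
      proof -
        have "M = Suc (Poly_Mapping.lookup b i) + Poly_Mapping.lookup m (Z i)" using lt[of i] by (simp add: b)
        then have "zvar i ^ M = zvar i ^ Suc (Poly_Mapping.lookup b i) * (zvar i ^ Poly_Mapping.lookup m (Z i) :: ('n, 'k) ratfun)"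
          by (metis power_add)
        then show ?thesis by (simp add: divide_inverse power_inverse del: power_Suc)
      qed
      then have "(\<Prod>i\<in>UNIV. zvar i ^ Poly_Mapping.lookup m (Z i)) / ?z ^ M =
          (\<Prod>i\<in>UNIV. inverse (zvar i) ^ Suc (Poly_Mapping.lookup b i))"
        by (simp add: prod_dividef[symmetric] prod_power_distrib del: power_Suc)
      then have "of_mpol (Poly_Mapping.single m c) / ?z ^ M = const c * (\<Prod>i\<in>UNIV. inverse (zvar i) ^ Suc (Poly_Mapping.lookup b i))"
        by (simp add: of_mpol_single zs0 del: power_Suc flip: times_divide_eq_right)
      also have "\<dots> = const (c / a) * (const a * (\<Prod>i\<in>UNIV. inverse (zvar i) ^ Suc (Poly_Mapping.lookup b i)))"
        using a(1) by (simp add: const_divide del: power_Suc)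
      also have "\<dots> = dop (Poly_Mapping.single b (c / a)) (\<Prod>i\<in>UNIV. inverse (zvar i)) + cech_d 0 UNIV"
        unfolding dop_single a(2) by (simp add: zero_fun_apply)
      finally show ?thesis unfolding multipole_cech_def using cech_0 by blast
    qed
  qed
  ultimately show ?thesis unfolding p(1) by (simp only: multipole_cech_sum)
qed

section \<open>Exactness of the columns\<close>

text \<open>The exponent of the product of coordinates in one chosen denominator works for every i
  at once.\<close>

lemma coeffs_clear_zvar:
  fixes f :: "('n::{finite,linorder}, 'k::idom) ratfun"
  assumes "f \<in> coeffs I d"
  obtains M0 where "\<And>M i. M0 \<le> M \<Longrightarrow> zvar i ^ M * f \<in> coeffs (I - {i}) d"
proof -
  obtain p N M0 e where f: "f = of_mpol p / (zzs ^ N * (\<Prod>i\<in>I. zvar i) ^ M0)"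
    "zs_homogeneous e p" "int e = int N + d" using assms by (rule coeffsE)
  show thesis
  proof (rule that)
    fix M i assume "M0 \<le> M"
    then obtain k where M: "M = k + M0" using le_iff_add add.commute by metis
    show "zvar i ^ M * f \<in> coeffs (I - {i}) d"
    proof (cases "i \<in> I")
      case True
      have "zvar i ^ M * f = of_mpol (pvar (Z i) ^ k * p) / (zzs ^ N * (\<Prod>i\<in>I - {i}. zvar i) ^ M0)"
        unfolding f M prod.remove[OF finite True] by (simp add: zvar_def power_add power_mult_distrib)
      moreover have "zs_homogeneous e (pvar (Z i) ^ k * p)"
        using zs_homogeneous_mult[OF zs_homogeneous_power[OF zs_homogeneous_pvar(1)] f(2), of k i] by simp
      ultimately show ?thesis using f(3) by (simp only: coeffsI)
    next
      case False
      have "zvar i ^ M \<in> coeffs I 0"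
        by (induction M) (auto intro: coeffs_mult[of _ _ 0 _ 0, simplified] coeffs_zvar)
      with False show ?thesis using coeffs_mult[of _ I 0 f d] assms by simp
    qed
  qed
qed

text \<open>
  Each \<open>u\<^sub>i = z\<^sub>iz\<^sup>*\<^sub>i/(zz\<^sup>*)\<close> vanishes where \<open>z\<^sub>i = 0\<close>, and their sum is 1. Expanding a high power of
  this sum makes the order of vanishing arbitrarily large.
\<close>

lemma partition_of_unity:
  "\<exists>w. (\<forall>i. w i \<in> coeffs {} 0) \<and> (\<Sum>i\<in>UNIV. zvar i ^ M * w i) = (1 :: ('n::{finite,linorder}, 'k::idom) ratfun)"
proof -
  define X :: "('n, 'k) ratfun set" where
    "X = {\<Sum>i\<in>UNIV. zvar i ^ M * w i | w. \<forall>i. w i \<in> coeffs {} 0}"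
  define v :: "'n \<Rightarrow> ('n, 'k) ratfun" where "v i = zsvar i * inverse zzs" for i
  have v: "v i \<in> coeffs {} 0" for i
    using coeffs_mult[OF coeffs_zsvar coeffs_inverse_zzs_power[of 1], of i "{}"] by (simp add: v_def)
  have sum1: "(\<Sum>i\<in>UNIV. zvar i * v i) = 1"
  proof -
    have "(\<Sum>i\<in>UNIV. zvar i * v i) = zzs * inverse zzs"
      by (simp only: v_def zzs_def sum_distrib_right mult.assoc)
    then show ?thesis by simp
  qed
  have X_add: "f + g \<in> X" if "f \<in> X" "g \<in> X" for f g
  proof -
    obtain w where "f = (\<Sum>i\<in>UNIV. zvar i ^ M * w i)" "\<forall>i. w i \<in> coeffs {} 0"
      using \<open>f \<in> X\<close> unfolding X_def by blast
    moreover obtain w' where "g = (\<Sum>i\<in>UNIV. zvar i ^ M * w' i)" "\<forall>i. w' i \<in> coeffs {} 0"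
      using \<open>g \<in> X\<close> unfolding X_def by blast
    ultimately show ?thesis unfolding X_def
      by (intro CollectI exI[of _ "\<lambda>i. w i + w' i"]) (simp add: distrib_left sum.distrib coeffs_add)
  qed
  have X_0: "0 \<in> X" unfolding X_def by (intro CollectI exI[of _ "\<lambda>_. 0"]) simp
  have X_sum: "sum f A \<in> X" if "\<And>a. a \<in> A \<Longrightarrow> f a \<in> X" for f and A :: "'n set"
    using that by (induction A rule: infinite_finite_induct) (simp_all add: X_0 X_add)
  have vp: "(\<Prod>i\<in>A. v i ^ k i) * (\<Prod>i\<in>B. zvar i ^ k i) \<in> coeffs {} 0" for A B k
  proof -
    have "f ^ l \<in> coeffs {} 0" if "f \<in> coeffs {} 0" for f :: "('n, 'k) ratfun" and l
      using that by (induction l) (auto intro: coeffs_mult[of _ _ 0 _ 0, simplified])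
    moreover have "prod f C \<in> coeffs {} 0" if "\<And>i. f i \<in> coeffs {} 0" for f :: "'n \<Rightarrow> ('n, 'k) ratfun" and C
      using that by (induction C rule: infinite_finite_induct) (auto intro: coeffs_mult[of _ _ 0 _ 0, simplified])
    ultimately show ?thesis by (intro coeffs_mult[of _ _ 0 _ 0, simplified]) (simp_all add: v coeffs_zvar)
  qed
  \<comment> \<open>Induction on the total of the missing exponents. A product in which some
    exponent is M lies in X; any other is multiplied by the sum of all \<open>zvar i * v i\<close>,
    which is 1 and raises one exponent in each term.\<close>
  have "(\<Prod>i\<in>UNIV. (zvar i * v i) ^ k i) \<in> X" if "\<forall>i. k i \<le> M" for k
    using that
  proof (induction "\<Sum>i\<in>UNIV. M - k i" arbitrary: k rule: less_induct)
    case less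
    show ?case
    proof (cases "\<exists>i. k i = M")
      case True
      then obtain i where i: "k i = M" by blast
      define w where "w = (\<Prod>j\<in>UNIV. v j ^ k j) * (\<Prod>j\<in>UNIV - {i}. zvar j ^ k j)"
      have "(\<Prod>j\<in>UNIV. (zvar j * v j) ^ k j) = zvar i ^ M * w"
        using i by (simp add: w_def power_mult_distrib prod.distrib prod.remove[of UNIV i "\<lambda>j. zvar j ^ k j"] mult_ac)
      also have "\<dots> = (\<Sum>j\<in>UNIV. zvar j ^ M * (if j = i then w else 0))"
        by (simp add: if_distrib[of "\<lambda>x. _ * x"] cong: if_cong)
      finally show ?thesis unfolding X_def using vp
        by (intro CollectI exI[of _ "\<lambda>j. if j = i then w else 0"]) (simp add: w_def)
    next
      case False
      have "(\<Prod>j\<in>UNIV. (zvar j * v j) ^ k j) = (\<Sum>i\<in>UNIV. zvar i * v i) * (\<Prod>j\<in>UNIV. (zvar j * v j) ^ k j)"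
        by (simp add: sum1)
      also have "\<dots> = (\<Sum>i\<in>UNIV. \<Prod>j\<in>UNIV. (zvar j * v j) ^ (k(i := Suc (k i))) j)"
        unfolding sum_distrib_right
      proof (intro sum.cong refl)
        fix i
        have "(\<Prod>j\<in>UNIV - {i}. (zvar j * v j) ^ (k(i := Suc (k i))) j) = (\<Prod>j\<in>UNIV - {i}. (zvar j * v j) ^ k j)"
          by (intro prod.cong) auto
        moreover have "(\<Prod>j\<in>UNIV. (zvar j * v j) ^ (k(i := Suc (k i))) j) =
            (zvar i * v i) ^ Suc (k i) * (\<Prod>j\<in>UNIV - {i}. (zvar j * v j) ^ (k(i := Suc (k i))) j)"
          by (subst prod.remove[of UNIV i]) simp_all
        moreover have "(\<Prod>j\<in>UNIV. (zvar j * v j) ^ k j) =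
            (zvar i * v i) ^ k i * (\<Prod>j\<in>UNIV - {i}. (zvar j * v j) ^ k j)"
          by (subst prod.remove[of UNIV i]) simp_all
        ultimately show "zvar i * v i * (\<Prod>j\<in>UNIV. (zvar j * v j) ^ k j) =
            (\<Prod>j\<in>UNIV. (zvar j * v j) ^ (k(i := Suc (k i))) j)"
          by (simp only: power_Suc mult.assoc)
      qed
      also have "\<dots> \<in> X"
      proof (rule X_sum)
        fix i
        have lt: "k i < M" using False less.prems by (metis le_neq_implies_less)
        have "(\<Sum>j\<in>UNIV. M - (k(i := Suc (k i))) j) < (\<Sum>j\<in>UNIV. M - k j)"
          using lt by (intro sum_strict_mono_ex1) auto
        then show "(\<Prod>j\<in>UNIV. (zvar j * v j) ^ (k(i := Suc (k i))) j) \<in> X"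
          using lt less.prems by (intro less.hyps) auto
      qed
      finally show ?thesis .
    qed
  qed
  from this[of "\<lambda>_. 0"] have "1 \<in> X" by simp
  then obtain w where w: "(1 :: ('n, 'k) ratfun) = (\<Sum>i\<in>UNIV. zvar i ^ M * w i)" "\<forall>i. w i \<in> coeffs {} 0"
    unfolding X_def by blast
  show ?thesis by (intro exI[of _ w] conjI w(2) w(1)[symmetric])
qed

text \<open>Inserting a fixed index i is a contracting homotopy, but its value over I may still have
  poles in \<open>zvar i\<close>. The factor \<open>zvar i ^ M\<close> clears these poles, and
  weights from the partition of unity make the homotopies add up to the identity.\<close>

lemma columns_exact:
  fixes c :: "'n::{finite,linorder} set \<Rightarrow> ('n, 'k::idom) form"
  assumes c: "\<And>I. card I = Suc p \<Longrightarrow> c I \<in> A_loc I m" "\<And>I. card I \<noteq> Suc p \<Longrightarrow> c I = 0"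
    and closed: "cech_d c = 0"
  shows "\<exists>e. (\<forall>I. card I = p \<longrightarrow> e I \<in> A_loc I m) \<and> (\<forall>I. card I \<noteq> p \<longrightarrow> e I = 0) \<and> cech_d e = c"
proof -
  have "\<exists>M0. \<forall>M\<ge>M0. \<forall>i. zvar i ^ M * c I J \<in> coeffs (I - {i}) (- int m)" for I J
  proof -
    have "c I J \<in> coeffs I (- int m)"
      using A_loc_coeffs[OF c(1), of I] c(2)[of I] by (cases "card I = Suc p") (auto simp: zero_fun_apply)
    from coeffs_clear_zvar[OF this] show ?thesis by metis
  qed
  then obtain M0 where M0: "\<And>I J M i. M0 I J \<le> M \<Longrightarrow> zvar i ^ M * c I J \<in> coeffs (I - {i}) (- int m)"
    by metis
  \<comment> \<open>A sum of nonnegative bounds dominates each of them, so one exponent serves all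
    index sets and all coefficients.\<close>
  define M where "M = (\<Sum>I\<in>UNIV. \<Sum>J\<in>UNIV. M0 I J)"
  have "M0 I J \<le> M" for I J
  proof -
    have "M0 I J \<le> (\<Sum>J\<in>UNIV. M0 I J)" by (rule member_le_sum) simp_all
    also have "\<dots> \<le> M" unfolding M_def by (rule member_le_sum[of I UNIV "\<lambda>I. \<Sum>J\<in>UNIV. M0 I J"]) simp_all
    finally show ?thesis .
  qed
  then have M: "zvar i ^ M * c I J \<in> coeffs (I - {i}) (- int m)" for I J i using M0 by blast
  obtain w :: "'n \<Rightarrow> ('n, 'k) ratfun" where w: "\<And>i. w i \<in> coeffs {} 0" "(\<Sum>i\<in>UNIV. zvar i ^ M * w i) = 1"
    using partition_of_unity by blast
  define e where "e I = (\<Sum>i\<in>UNIV. fscale (zvar i ^ M * w i) (intr i c I))" for I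
  have mem: "fscale (zvar i ^ M * w i) (intr i c I) \<in> A_loc I m" if I: "card I = p" for i I
  proof (cases "i \<in> I")
    case True
    then show ?thesis by (simp add: intr_def)
  next
    case False
    then have "card (insert i I) = Suc p" using I by simp
    note A = c(1)[OF this]
    have "fscale (zvar i ^ M * w i) (c (insert i I)) \<in> A_loc I m"
    proof (rule A_locI)
      fix J :: "'n set"
      have "insert i I - {i} = I" using False by auto
      then have "zvar i ^ M * c (insert i I) J \<in> coeffs I (- int m)" using M[of i "insert i I" J] by simp
      then have "w i * (zvar i ^ M * c (insert i I) J) \<in> coeffs I (0 + - int m)"
        using coeffs_mono[OF empty_subsetI w(1)] by (intro coeffs_mult)
      then show "fscale (zvar i ^ M * w i) (c (insert i I)) J \<in> coeffs I (- int m)"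
        by (simp add: fscale_def mult_ac)
      show "fscale (zvar i ^ M * w i) (c (insert i I)) J = 0" if "card J \<noteq> m"
        using A_locD(2)[OF A that] by (simp add: fscale_def)
    qed (simp add: contraction_fscale A_locD(3)[OF A])
    then show ?thesis using False by (simp add: intr_def sgn_before_def A_loc_minus)
  qed
  show ?thesis
  proof (intro exI[of _ e] conjI allI impI)
    show "e I \<in> A_loc I m" if "card I = p" for I
      unfolding e_def using mem[OF that] by (intro A_loc_sum)
    show "e I = 0" if "card I \<noteq> p" for I
      unfolding e_def using intr_degree[of p c, OF c(2) that] by simp
    show "cech_d e = c"
    proof (rule HOL.ext)
      fix I
      have ext_e: "ext j e I = (\<Sum>i\<in>UNIV. fscale (zvar i ^ M * w i) (ext j (intr i c) I))" for j
        by (simp add: ext_def e_def additive_sum[of "sgn_before j I"] sgn_before_def sum_negf)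
      \<comment> \<open>For closed c the anticommutation relation, summed over j, leaves c
        alone.\<close>
      have K: "(\<Sum>j\<in>UNIV. ext j (intr i c) I) = c I" for i
      proof -
        have "(\<Sum>j\<in>UNIV. ext j (intr i c)) + intr i (cech_d c) = (\<Sum>j\<in>UNIV. intr i (ext j c) + ext j (intr i c))"
          by (simp add: cech_d_conv intr_sum sum.distrib add.commute)
        also have "\<dots> = c" by (simp add: intr_ext)
        finally have "(\<Sum>j\<in>UNIV. ext j (intr i c)) = c" using closed by simp
        then show ?thesis using sum_fun_apply[of "\<lambda>j. ext j (intr i c)" UNIV I] by simp
      qed
      have "cech_d e I = (\<Sum>i\<in>UNIV. fscale (zvar i ^ M * w i) (\<Sum>j\<in>UNIV. ext j (intr i c) I))"
        unfolding cech_d_conv sum_fun_apply[of _ _ I] ext_e by (subst sum.swap) (simp add: fscale_sum)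
      also have "\<dots> = (\<Sum>i\<in>UNIV. fscale (zvar i ^ M * w i) (c I))" unfolding K ..
      finally show "cech_d e I = c I" by (simp add: w(2) flip: fscale_sum_left)
    qed
  qed
qed

text \<open>Descent in the double complex: layers of c are removed from the largest index sets
  downwards, until c consists of restrictions of one global form, a \<open>dbar\<close> primitive of
  \<omega>.\<close>

lemma of_A_boundary:
  fixes \<omega> :: "('n::{finite,linorder}, 'k::idom) form"
  assumes n: "CARD('n) > 1" and p: "p \<le> CARD('n) - 1"
    and "\<And>I. I \<noteq> {} \<Longrightarrow> card I \<le> p \<Longrightarrow> c I \<in> A_loc I (CARD('n) - 1 - card I)"
    and "\<And>I. \<not> (I \<noteq> {} \<and> card I \<le> p) \<Longrightarrow> c I = 0" and "tot_d c = of_A \<omega>"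
  shows "\<omega> \<in> dbar ` A_forms (CARD('n) - 2)"
  using assms(2-)
proof (induction p arbitrary: c)
  case 0
  then have "c = 0" by (intro HOL.ext) (simp add: zero_fun_apply)
  obtain i :: 'n where True by blast
  have "of_A \<omega> {i} = 0" using 0(4) \<open>c = 0\<close> by (metis tot_d_0 zero_fun_apply)
  then have "\<omega> = dbar 0" by (simp add: of_A_def)
  then show ?case by (rule image_eqI[of _ dbar 0]) simp
next
  case (Suc p)
  \<comment> \<open>The layer of c with the most indices. Its Cech differential is the component of
    \<open>tot_d c\<close> one layer up, on sets of at least two elements, where \<open>of_A\<close>
    vanishes.\<close>
  define c1 where "c1 I = (if card I = Suc p then c I else 0)" for I
  have closed: "cech_d c1 = 0"
  proof (rule HOL.ext)
    fix I :: "'n set"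
    show "cech_d c1 I = 0 I"
    proof (cases "card I = Suc (Suc p)")
      case True
      then have "c I = 0" using Suc.prems(3) by auto
      then have "tot_d c I = cech_d c I" unfolding tot_d_apply by (simp only: dbar_simps) simp
      moreover have "tot_d c I = 0" using Suc.prems(4) True by (simp add: of_A_def)
      ultimately have "cech_d c I = 0" by simp
      moreover have "cech_d c1 I = cech_d c I"
        unfolding cech_d_apply
      proof (intro sum.cong refl)
        fix i assume "i \<in> I"
        then have "card (I - {i}) = Suc p" using True by (simp add: card_Diff_singleton)
        then show "sgn_before i I (c1 (I - {i})) = sgn_before i I (c (I - {i}))" by (simp only: c1_def refl if_True)
      qed
      ultimately show ?thesis by (simp add: zero_fun_apply)
    next
      case False
      then show ?thesis using cech_d_degree[of "Suc p" c1 I] by (simp add: c1_def zero_fun_apply)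
    qed
  qed
  have c1: "c1 I \<in> A_loc I (CARD('n) - 1 - Suc p)" if "card I = Suc p" for I
    using that Suc.prems(2)[of I] by (cases "I = {}") (auto simp: c1_def)
  have c1_0: "c1 I = 0" if "card I \<noteq> Suc p" for I using that by (simp add: c1_def)
  have "\<exists>e. (\<forall>I. card I = p \<longrightarrow> e I \<in> A_loc I (CARD('n) - 1 - Suc p)) \<and>
      (\<forall>I. card I \<noteq> p \<longrightarrow> e I = 0) \<and> cech_d e = c1"
    by (intro columns_exact c1 c1_0 closed)
  then obtain e where e: "\<And>I. card I = p \<Longrightarrow> e I \<in> A_loc I (CARD('n) - 1 - Suc p)"
    "\<And>I. card I \<noteq> p \<Longrightarrow> e I = 0" "cech_d e = c1"
    by blast
  show ?case
  \<comment> \<open>For p = 0 the remaining layer is the restriction of the global form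
    \<open>e {}\<close>. Otherwise subtracting \<open>tot_d e\<close> deletes the last layer and
    alters only the one below it.\<close>
  proof (cases "p = 0")
    case True
    obtain i :: 'n where True by blast
    have "c = c1"
    proof (rule HOL.ext)
      fix I :: "'n set"
      show "c I = c1 I" using Suc.prems(3)[of I] True by (auto simp: c1_def card_eq_0_iff le_Suc_eq)
    qed
    then have "cech_d c = 0" using \<open>cech_d c1 = 0\<close> by simp
    moreover have "c {i} = e {}"
    proof -
      have "c {i} = cech_d e {i}" using e(3) \<open>c = c1\<close> by simp
      then show ?thesis by (simp add: cech_d_apply sgn_before_def[of i "{}"])
    qed
    ultimately have "tot_d c {i} = dbar (e {})" by (simp add: tot_d_apply zero_fun_apply)
    then have "\<omega> = dbar (e {})" using Suc.prems(4) by (simp add: of_A_def)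
    moreover have "e {} \<in> A_forms (CARD('n) - 2)" using e(1)[of "{}"] True by (simp add: numeral_2_eq_2)
    ultimately show ?thesis by (rule image_eqI[of _ dbar "e {}"])
  next
    case False
    define c' where "c' = c - tot_d e"
    have c': "c' I = c I - (c1 I + (if odd (card I) then dbar (e I) else - dbar (e I)))" for I
      by (simp add: c'_def minus_apply tot_d_apply e(3))
    show ?thesis
    proof (rule Suc.IH)
      show "p \<le> CARD('n) - 1" using Suc.prems(1) by simp
      show "tot_d c' = of_A \<omega>" using Suc.prems(4) by (simp add: c'_def tot_d_diff)
      fix I :: "'n set"
      show "c' I \<in> A_loc I (CARD('n) - 1 - card I)" if I: "I \<noteq> {}" "card I \<le> p"
      proof -
        have cI: "c I \<in> A_loc I (CARD('n) - 1 - card I)" using Suc.prems(2) I by simp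
        show ?thesis
        proof (cases "card I = p")
          case True
          have "dbar (e I) \<in> A_loc I (Suc (CARD('n) - 1 - Suc p))" using e(1)[OF True] by (rule A_loc_dbar)
          moreover have "Suc (CARD('n) - 1 - Suc p) = CARD('n) - 1 - card I" using Suc.prems(1) True by simp
          ultimately show ?thesis using cI True
            by (simp only: c') (auto simp: c1_def intro!: A_loc_diff A_loc_minus A_loc_add)
        next
          case False
          then show ?thesis using cI I e(2) by (simp add: c' c1_def)
        qed
      qed
      show "c' I = 0" if "\<not> (I \<noteq> {} \<and> card I \<le> p)"
      proof -
        have "card I \<noteq> p" using that False by auto
        then have "c' I = c I - c1 I" using e(2) by (simp add: c')
        then show ?thesis using that Suc.prems(3)[of I] by (auto simp: c1_def)
      qed
    qed
  qed
qed

lemma comparable_0_imp_exact: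
  fixes \<omega> :: "('n::{finite,linorder}, 'k::idom) form"
  assumes n: "CARD('n) > 1" and "comparable \<omega> 0"
  shows "\<omega> \<in> dbar ` A_forms (CARD('n) - 2)"
proof -
  have S: "Suc (CARD('n) - 2) = CARD('n) - 1" using n by simp
  obtain c where c: "c \<in> tot (CARD('n) - 2)" "of_A \<omega> = tot_d c"
    using assms(2) by (auto simp: comparable_def of_cech_simps)
  show ?thesis
    by (rule of_A_boundary[OF n order_refl]) (use tot_D[OF c(1)] c(2) S in auto)
qed

section \<open>Substitution into polynomials\<close>

definition scalar_hom :: "('k::comm_ring_1 \<Rightarrow> 'r::comm_ring_1) \<Rightarrow> bool" where
  "scalar_hom h \<longleftrightarrow> h 0 = 0 \<and> h 1 = 1 \<and> (\<forall>a b. h (a + b) = h a + h b) \<and> (\<forall>a b. h (a * b) = h a * h b)"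

definition monomial_at :: "('v \<Rightarrow> 'r::comm_ring_1) \<Rightarrow> ('v \<Rightarrow>\<^sub>0 nat) \<Rightarrow> 'r" where
  "monomial_at \<sigma> m = (\<Prod>v\<in>Poly_Mapping.keys m. \<sigma> v ^ Poly_Mapping.lookup m v)"

text \<open>The coefficient map h is a parameter: it is used with constants into polynomials, with
  constants into univariate polynomials, and with the identity for evaluation.\<close>

definition insertion :: "('k::comm_ring_1 \<Rightarrow> 'r::comm_ring_1) \<Rightarrow> ('v \<Rightarrow> 'r) \<Rightarrow> ('v, 'k) mpol \<Rightarrow> 'r" where
  "insertion h \<sigma> p = (\<Sum>m\<in>Poly_Mapping.keys p. h (Poly_Mapping.lookup p m) * monomial_at \<sigma> m)"

lemma scalar_homD:
  assumes "scalar_hom h"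
  shows "h 0 = 0" "h 1 = 1" "h (a + b) = h a + h b" "h (a * b) = h a * h b"
  using assms by (auto simp: scalar_hom_def)

lemma scalar_hom_sum: "scalar_hom h \<Longrightarrow> h (sum f A) = (\<Sum>a\<in>A. h (f a))"
  by (induction A rule: infinite_finite_induct) (simp_all add: scalar_homD)

lemma scalar_hom_prod: "scalar_hom h \<Longrightarrow> h (prod f A) = (\<Prod>a\<in>A. h (f a))"
  by (induction A rule: infinite_finite_induct) (simp_all add: scalar_homD)

lemma scalar_hom_power: "scalar_hom h \<Longrightarrow> h (a ^ n) = h a ^ n"
  by (induction n) (simp_all add: scalar_homD)

lemma scalar_hom_single: "scalar_hom (Poly_Mapping.single (0 :: 'v \<Rightarrow>\<^sub>0 nat))"
  by (auto simp: scalar_hom_def single_add mult_single)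

lemma scalar_hom_of_mpol: "scalar_hom of_mpol"
  by (auto simp: scalar_hom_def)

lemma scalar_hom_id: "scalar_hom (\<lambda>x. x)"
  by (auto simp: scalar_hom_def)

lemma monomial_at_superset:
  assumes "finite S" "Poly_Mapping.keys m \<subseteq> S"
  shows "monomial_at \<sigma> m = (\<Prod>v\<in>S. \<sigma> v ^ Poly_Mapping.lookup m v)"
  unfolding monomial_at_def using assms by (intro prod.mono_neutral_left) (auto simp: in_keys_iff)

lemma monomial_at_0 [simp]: "monomial_at \<sigma> 0 = 1"
  by (simp add: monomial_at_def)

lemma monomial_at_add: "monomial_at \<sigma> (m + l) = monomial_at \<sigma> m * monomial_at \<sigma> l"
proof -
  let ?S = "Poly_Mapping.keys m \<union> Poly_Mapping.keys l"
  have "Poly_Mapping.keys (m + l) \<subseteq> ?S" by (rule Poly_Mapping.keys_add)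
  then show ?thesis
    by (simp add: monomial_at_superset[of ?S] lookup_add power_add prod.distrib)
qed

lemma monomial_at_single: "monomial_at \<sigma> (Poly_Mapping.single v k) = \<sigma> v ^ k"
  by (cases "k = 0") (simp_all add: monomial_at_def)

lemma insertion_superset:
  assumes "scalar_hom h" "finite S" "Poly_Mapping.keys p \<subseteq> S"
  shows "insertion h \<sigma> p = (\<Sum>m\<in>S. h (Poly_Mapping.lookup p m) * monomial_at \<sigma> m)"
  unfolding insertion_def using assms
  by (intro sum.mono_neutral_left) (auto simp: in_keys_iff scalar_homD)

lemma insertion_single: "scalar_hom h \<Longrightarrow> insertion h \<sigma> (Poly_Mapping.single m c) = h c * monomial_at \<sigma> m"
  by (cases "c = 0") (simp_all add: insertion_def scalar_homD)

lemma insertion_add: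
  assumes "scalar_hom h"
  shows "insertion h \<sigma> (p + q) = insertion h \<sigma> p + insertion h \<sigma> q"
proof -
  let ?S = "Poly_Mapping.keys p \<union> Poly_Mapping.keys q"
  have "Poly_Mapping.keys (p + q) \<subseteq> ?S" by (rule Poly_Mapping.keys_add)
  then show ?thesis
    by (simp add: insertion_superset[OF assms, of ?S] lookup_add scalar_homD[OF assms] distrib_right sum.distrib)
qed

lemma insertion_0 [simp]: "insertion h \<sigma> 0 = 0"
  by (simp add: insertion_def)

lemma insertion_mult:
  assumes "scalar_hom h"
  shows "insertion h \<sigma> (p * q) = insertion h \<sigma> p * insertion h \<sigma> q"
proof (induction p rule: mpol_induct)
  case (single m c)
  show ?case
  proof (induction q rule: mpol_induct)
    case (single l d)
    show ?case by (simp add: mult_single insertion_single[OF assms] monomial_at_add scalar_homD[OF assms] mult_ac)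
  qed (simp_all add: insertion_add[OF assms] distrib_left)
qed (simp_all add: insertion_add[OF assms] distrib_right)

lemma scalar_hom_insertion: "scalar_hom h \<Longrightarrow> scalar_hom (insertion h \<sigma>)"
proof -
  assume h: "scalar_hom h"
  show ?thesis unfolding scalar_hom_def[of "insertion h \<sigma>"]
    using insertion_single[OF h, of \<sigma> 0 1]
    by (simp add: insertion_add[OF h] insertion_mult[OF h] scalar_homD(2)[OF h])
qed

lemma insertion_pvar: "scalar_hom h \<Longrightarrow> insertion h \<sigma> (pvar v) = \<sigma> v"
  by (simp add: pvar_def insertion_single monomial_at_single scalar_homD(2))

lemma insertion_const: "scalar_hom h \<Longrightarrow> insertion h \<sigma> (Poly_Mapping.single 0 c) = h c"
  by (simp add: insertion_single)

lemma insertion_hom: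
  assumes "scalar_hom f"
  shows "f (insertion h \<sigma> p) = insertion (\<lambda>c. f (h c)) (\<lambda>v. f (\<sigma> v)) p"
  by (simp add: insertion_def monomial_at_def scalar_hom_sum[OF assms] scalar_homD[OF assms]
      scalar_hom_prod[OF assms] scalar_hom_power[OF assms])

lemma insertion_insertion:
  assumes "scalar_hom h"
  shows "insertion h \<tau> (insertion (Poly_Mapping.single 0) \<sigma> p) = insertion h (\<lambda>v. insertion h \<tau> (\<sigma> v)) p"
  by (simp add: insertion_hom[OF scalar_hom_insertion[OF assms]] insertion_const[OF assms])

lemma insertion_id: "insertion (Poly_Mapping.single 0) pvar p = p"
proof (induction p rule: mpol_induct)
  case (single m c)
  have "monomial_at pvar m = Poly_Mapping.single m (1::'b)"
  proof (induction m rule: update_induct)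
    case (update m v k)
    have u: "Poly_Mapping.update v k m = Poly_Mapping.single v k + m"
      using update by (intro poly_mapping_eqI)
        (auto simp: lookup_update lookup_add lookup_single when_def in_keys_iff)
    have "pvar v ^ k = Poly_Mapping.single (Poly_Mapping.single v k) (1::'b)"
    proof (induction k)
      case (Suc k)
      have "Poly_Mapping.single v (Suc k) = Poly_Mapping.single v 1 + Poly_Mapping.single v k"
        by (simp flip: single_add)
      with Suc show ?case by (simp add: pvar_def mult_single)
    qed simp
    then show ?case by (simp add: u monomial_at_add monomial_at_single update.IH mult_single)
  qed simp
  then show ?case by (simp add: insertion_single[OF scalar_hom_single] mult_single)
qed (simp_all add: insertion_add[OF scalar_hom_single])

text \<open>The weights work like digits in a positional system: the new weight B exceeds every
  weighted sum formed so far, so reduction modulo B recovers the old sum and then the new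
  exponent.\<close>

lemma separating_weights:
  fixes X :: "('v \<Rightarrow> nat) set"
  assumes "finite S" "finite X"
  shows "\<exists>w. \<forall>m\<in>X. \<forall>l\<in>X. (\<Sum>v\<in>S. w v * m v) = (\<Sum>v\<in>S. w v * l v) \<longrightarrow> (\<forall>v\<in>S. m v = l v)"
  using assms(1)
proof (induction S rule: finite_induct)
  case (insert a S)
  then obtain w where w: "\<And>m l. m \<in> X \<Longrightarrow> l \<in> X \<Longrightarrow> (\<Sum>v\<in>S. w v * m v) = (\<Sum>v\<in>S. w v * l v) \<Longrightarrow> \<forall>v\<in>S. m v = l v"
    by blast
  define B where "B = Suc (\<Sum>m\<in>X. \<Sum>v\<in>S. w v * m v)"
  have B: "(\<Sum>v\<in>S. w v * m v) < B" if "m \<in> X" for m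
    using member_le_sum[of m X "\<lambda>m. \<Sum>v\<in>S. w v * m v"] that assms(2) by (simp add: B_def)
  have sum: "(\<Sum>v\<in>insert a S. (w(a := B)) v * m v) = (\<Sum>v\<in>S. w v * m v) + B * m a" for m
  proof -
    have "(\<Sum>v\<in>S. (w(a := B)) v * m v) = (\<Sum>v\<in>S. w v * m v)"
      using insert.hyps by (intro sum.cong) auto
    then show ?thesis using insert.hyps by simp
  qed
  show ?case
  proof (intro exI[of _ "w(a := B)"] ballI impI)
    fix m l v
    assume ml: "m \<in> X" "l \<in> X" and eq: "(\<Sum>v\<in>insert a S. (w(a := B)) v * m v) = (\<Sum>v\<in>insert a S. (w(a := B)) v * l v)"
      and v: "v \<in> insert a S"
    have eq': "(\<Sum>v\<in>S. w v * m v) + B * m a = (\<Sum>v\<in>S. w v * l v) + B * l a" using eq unfolding sum .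
    from arg_cong[OF this, of "\<lambda>x. x mod B"] have S: "(\<Sum>v\<in>S. w v * m v) = (\<Sum>v\<in>S. w v * l v)"
      using B ml by simp
    have "B > 0" by (simp add: B_def)
    with eq' S have "m a = l a" by simp
    with w[OF ml S] v show "m v = l v" by auto
  qed
qed auto

text \<open>Kronecker substitution: powers of a single variable with separating weights keep the
  monomials of p distinct, and a nonzero univariate polynomial over an infinite field has a
  non-root.\<close>

lemma insertion_nonzero:
  fixes p :: "('v, 'k::field_char_0) mpol"
  assumes "finite (UNIV :: 'v set)" "p \<noteq> 0"
  shows "\<exists>\<sigma>. insertion (\<lambda>x. x) \<sigma> p \<noteq> 0"
proof -
  obtain w :: "'v \<Rightarrow> nat" where w: "\<And>m l. m \<in> Poly_Mapping.keys p \<Longrightarrow> l \<in> Poly_Mapping.keys p \<Longrightarrow>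
      (\<Sum>v\<in>UNIV. w v * Poly_Mapping.lookup m v) = (\<Sum>v\<in>UNIV. w v * Poly_Mapping.lookup l v) \<Longrightarrow> m = l"
    using separating_weights[OF assms(1), of "Poly_Mapping.lookup ` Poly_Mapping.keys p"]
    by (auto simp: poly_mapping_eq_iff fun_eq_iff)
  define q where "q = insertion (\<lambda>c. [:c:]) (\<lambda>v. monom (1::'k) (w v)) p"
  have hom: "scalar_hom (\<lambda>c::'k. [:c:])" by (auto simp: scalar_hom_def)
  have mon: "monomial_at (\<lambda>v. monom (1::'k) (w v)) m = monom 1 (\<Sum>v\<in>UNIV. w v * Poly_Mapping.lookup m v)" for m
  proof -
    have "(\<Prod>v\<in>A. monom (1::'k) (w v) ^ Poly_Mapping.lookup m v) = monom 1 (\<Sum>v\<in>A. w v * Poly_Mapping.lookup m v)" for A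
      by (induction A rule: infinite_finite_induct) (simp_all add: monom_power mult_monom mult.commute)
    then show ?thesis by (simp add: monomial_at_superset[OF assms(1)])
  qed
  obtain l where l: "l \<in> Poly_Mapping.keys p" using assms(2)
    by (metis poly_mapping_eqI in_keys_iff empty_iff lookup_zero ex_in_conv)
  have "coeff q (\<Sum>v\<in>UNIV. w v * Poly_Mapping.lookup l v) =
      (\<Sum>m\<in>Poly_Mapping.keys p. if m = l then Poly_Mapping.lookup p m else 0)"
    unfolding q_def insertion_def mon coeff_sum using w[OF _ l]
    by (intro sum.cong refl) (auto simp: smult_monom)
  also have "\<dots> \<noteq> 0" using l by (simp add: in_keys_iff)
  finally have "q \<noteq> 0" by auto
  then obtain a where a: "poly q a \<noteq> 0" using poly_all_0_iff_0 by blast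
  have "scalar_hom (\<lambda>q. poly q a)" by (simp add: scalar_hom_def)
  from insertion_hom[OF this, of "\<lambda>c. [:c:]" "\<lambda>v. monom 1 (w v)" p] have "poly q a = insertion (\<lambda>x. x) (\<lambda>v. a ^ w v) p"
    by (simp add: q_def poly_monom)
  with a show ?thesis by metis
qed

section \<open>The action of the general linear group on functions\<close>

definition gl_pvar :: "('k, 'n) sqmat \<Rightarrow> 'n::finite var \<Rightarrow> ('n var, 'k::field) mpol" where
  "gl_pvar g v = (case v of
      Z j \<Rightarrow> \<Sum>i\<in>UNIV. Poly_Mapping.single 0 (g $ i $ j) * pvar (Z i)
    | Zs j \<Rightarrow> \<Sum>i\<in>UNIV. Poly_Mapping.single 0 (matrix_inv g $ j $ i) * pvar (Zs i))"

text \<open>\<open>gl_mpol\<close> with values still in polynomials, where degrees and evaluation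
  make sense.\<close>

definition gl_sub :: "('k, 'n) sqmat \<Rightarrow> ('n::finite var, 'k::field) mpol \<Rightarrow> ('n var, 'k) mpol" where
  "gl_sub g p = insertion (Poly_Mapping.single 0) (gl_pvar g) p"

lemma gl_mpol_conv: "gl_mpol g p = of_mpol (gl_sub g p)"
proof -
  have "gl_var g v = of_mpol (gl_pvar g v)" for v
    by (cases v) (simp_all add: gl_var_def gl_pvar_def of_mpol_sum const_def zvar_def zsvar_def)
  then show ?thesis
    by (simp add: gl_sub_def insertion_hom[OF scalar_hom_of_mpol])
       (simp add: gl_mpol_def insertion_def monomial_at_def const_def)
qed

lemma scalar_hom_gl_sub: "scalar_hom (gl_sub g)"
  unfolding gl_sub_def by (rule scalar_hom_insertion[OF scalar_hom_single])

lemmas gl_sub_hom = scalar_homD[OF scalar_hom_gl_sub]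

lemma gl_sub_const [simp]: "gl_sub g (Poly_Mapping.single 0 c) = Poly_Mapping.single 0 c"
  by (simp add: gl_sub_def insertion_const[OF scalar_hom_single])

lemma gl_sub_pvar [simp]: "gl_sub g (pvar v) = gl_pvar g v"
  by (simp add: gl_sub_def insertion_pvar[OF scalar_hom_single])

lemma gl_sub_gl_pvar_Z: "gl_sub h (gl_pvar g (Z j)) = (\<Sum>l\<in>UNIV. Poly_Mapping.single 0 ((h ** g) $ l $ j) * pvar (Z l))"
proof -
  have "gl_sub h (gl_pvar g (Z j)) = (\<Sum>i\<in>UNIV. Poly_Mapping.single 0 (g $ i $ j) * gl_pvar h (Z i))"
    by (simp add: gl_pvar_def[of g] scalar_hom_sum[OF scalar_hom_gl_sub] gl_sub_hom)
  also have "\<dots> = (\<Sum>i\<in>UNIV. \<Sum>l\<in>UNIV. Poly_Mapping.single 0 (h $ l $ i * g $ i $ j) * pvar (Z l))"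
    by (simp add: gl_pvar_def sum_distrib_left scalar_homD[OF scalar_hom_single] mult_ac)
  also have "\<dots> = (\<Sum>l\<in>UNIV. \<Sum>i\<in>UNIV. Poly_Mapping.single 0 (h $ l $ i * g $ i $ j) * pvar (Z l))"
    by (rule sum.swap)
  finally show ?thesis
    by (simp add: matrix_matrix_mult_def scalar_hom_sum[OF scalar_hom_single] sum_distrib_right)
qed

lemma gl_sub_gl_pvar_Zs: "gl_sub h (gl_pvar g (Zs j)) =
  (\<Sum>l\<in>UNIV. Poly_Mapping.single 0 ((matrix_inv g ** matrix_inv h) $ j $ l) * pvar (Zs l))"
proof -
  have "gl_sub h (gl_pvar g (Zs j)) = (\<Sum>i\<in>UNIV. Poly_Mapping.single 0 (matrix_inv g $ j $ i) * gl_pvar h (Zs i))"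
    by (simp add: gl_pvar_def[of g] scalar_hom_sum[OF scalar_hom_gl_sub] gl_sub_hom)
  also have "\<dots> = (\<Sum>i\<in>UNIV. \<Sum>l\<in>UNIV. Poly_Mapping.single 0 (matrix_inv g $ j $ i * matrix_inv h $ i $ l) * pvar (Zs l))"
    by (simp add: gl_pvar_def sum_distrib_left scalar_homD[OF scalar_hom_single] mult_ac)
  also have "\<dots> = (\<Sum>l\<in>UNIV. \<Sum>i\<in>UNIV. Poly_Mapping.single 0 (matrix_inv g $ j $ i * matrix_inv h $ i $ l) * pvar (Zs l))"
    by (rule sum.swap)
  finally show ?thesis
    by (simp add: matrix_matrix_mult_def scalar_hom_sum[OF scalar_hom_single] sum_distrib_right)
qed

lemma matrix_inv_invertible:
  fixes g :: "'k::field^'n^'n"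
  assumes "invertible g"
  shows "g ** matrix_inv g = mat 1" "matrix_inv g ** g = mat 1"
  using someI_ex[OF assms[unfolded invertible_def]] by (simp_all add: matrix_inv_def)

lemma matrix_inv_eq:
  fixes g h :: "'k::field^'n^'n"
  assumes "g ** h = mat 1"
  shows "invertible g" "matrix_inv g = h"
proof -
  have "h ** g = mat 1" using assms by (simp add: matrix_left_right_inverse)
  with assms show "invertible g" by (auto simp: invertible_def)
  then have "matrix_inv g ** (g ** h) = h" by (simp add: matrix_mul_assoc matrix_inv_invertible)
  with assms show "matrix_inv g = h" by simp
qed

text \<open>Consecutive substitutions multiply the matrices, on the starred variables through the
  inverses; for mutually inverse matrices every variable returns to itself. Injectivity of
  \<open>gl_sub\<close> follows.\<close>

lemma gl_sub_inverse:
  fixes g h :: "('k::field, 'n::finite) sqmat"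
  assumes "g ** h = mat 1"
  shows "gl_sub h (gl_sub g p) = p"
proof -
  have hg: "h ** g = mat 1" using assms by (simp add: matrix_left_right_inverse)
  have inv: "matrix_inv g = h" "matrix_inv h = g" using matrix_inv_eq assms hg by auto
  have delta: "(\<Sum>l\<in>UNIV. Poly_Mapping.single 0 ((if l = j then 1 else 0) :: 'k) * f l) = f j" for f :: "'n \<Rightarrow> ('n var, 'k) mpol" and j
  proof -
    have "(\<Sum>l\<in>UNIV. Poly_Mapping.single 0 ((if l = j then 1 else 0) :: 'k) * f l) = (\<Sum>l\<in>UNIV. if l = j then f j else 0)"
      by (intro sum.cong) auto
    then show ?thesis by simp
  qed
  have "gl_sub h (gl_pvar g v) = pvar v" for v
  proof (cases v)
    case (Z j)
    then show ?thesis using delta[of j "\<lambda>l. pvar (Z l)"] by (simp add: gl_sub_gl_pvar_Z hg mat_def)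
  next
    case (Zs j)
    then show ?thesis using delta[of j "\<lambda>l. pvar (Zs l)"]
      by (simp add: gl_sub_gl_pvar_Zs inv hg mat_def eq_commute[of j])
  qed
  then have "insertion (Poly_Mapping.single 0) (\<lambda>v. gl_sub h (gl_pvar g v)) p = insertion (Poly_Mapping.single 0) pvar p"
    by simp
  then show ?thesis
    unfolding gl_sub_def insertion_insertion[OF scalar_hom_single] insertion_id .
qed

lemma gl_sub_eq_0_iff: "invertible g \<Longrightarrow> gl_sub g p = 0 \<longleftrightarrow> p = 0"
  by (metis gl_sub_hom(1) gl_sub_inverse matrix_inv_invertible(1))

text \<open>Two representations of a fraction agree after cross-multiplication; this survives the
  substitution, and injectivity keeps the denominators nonzero.\<close>

lemma gl_fun_quotient:
  fixes g :: "('k::field, 'n::{finite,linorder}) sqmat"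
  assumes g: "invertible g" and "q \<noteq> 0"
  shows "gl_fun g (of_mpol p / of_mpol q) = of_mpol (gl_sub g p) / of_mpol (gl_sub g q)"
  unfolding gl_fun_def
proof (rule the_equality)
  show "\<forall>p' q'. q' \<noteq> 0 \<longrightarrow> of_mpol p / of_mpol q = Fraction_Field.Fract p' q' \<longrightarrow>
      of_mpol (gl_sub g p) / of_mpol (gl_sub g q) = gl_mpol g p' / gl_mpol g q'"
  proof (intro allI impI)
    fix p' q' :: "('n var, 'k) mpol"
    assume "q' \<noteq> 0" and "of_mpol p / of_mpol q = Fraction_Field.Fract p' q'"
    then have "of_mpol (p * q') = (of_mpol (p' * q) :: ('n, 'k) ratfun)"
      using \<open>q \<noteq> 0\<close> by (simp add: Fract_conv_of_mpol frac_eq_eq)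
    then have "p * q' = p' * q" by (simp only: of_mpol_eq_iff)
    then have "gl_sub g p * gl_sub g q' = gl_sub g p' * gl_sub g q" by (metis gl_sub_hom(4))
    then have "of_mpol (gl_sub g p) * of_mpol (gl_sub g q') = (of_mpol (gl_sub g p') * of_mpol (gl_sub g q) :: ('n, 'k) ratfun)"
      by (metis of_mpol_simps(6))
    then show "of_mpol (gl_sub g p) / of_mpol (gl_sub g q) = gl_mpol g p' / (gl_mpol g q' :: ('n, 'k) ratfun)"
      using \<open>q \<noteq> 0\<close> \<open>q' \<noteq> 0\<close> g by (simp add: gl_mpol_conv frac_eq_eq gl_sub_eq_0_iff)
  qed
  fix y :: "('n, 'k) ratfun"
  assume "\<forall>p' q'. q' \<noteq> 0 \<longrightarrow> of_mpol p / of_mpol q = Fraction_Field.Fract p' q' \<longrightarrow> y = gl_mpol g p' / gl_mpol g q'"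
  then show "y = of_mpol (gl_sub g p) / of_mpol (gl_sub g q)"
    using \<open>q \<noteq> 0\<close> by (simp add: Fract_conv_of_mpol gl_mpol_conv)
qed

context
  fixes g :: "('k::field, 'n::{finite,linorder}) sqmat"
  assumes g: "invertible g"
begin

lemma gl_fun_of_mpol: "gl_fun g (of_mpol p) = of_mpol (gl_sub g p)"
  using gl_fun_quotient[OF g, of 1 p] by (simp add: gl_sub_hom(2))

lemma gl_fun_add: "gl_fun g (f + f') = gl_fun g f + gl_fun g f'"
proof -
  obtain p q where f: "f = of_mpol p / of_mpol q" "q \<noteq> 0" by (rule ratfun_cases)
  obtain r s where f': "f' = of_mpol r / of_mpol s" "s \<noteq> 0" by (rule ratfun_cases)
  have sum: "f + f' = of_mpol (p * s + r * q) / of_mpol (q * s)" using f f' by (simp add: field_simps)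
  have "q * s \<noteq> 0" using f f' by simp
  have "gl_fun g (f + f') = of_mpol (gl_sub g (p * s + r * q)) / of_mpol (gl_sub g (q * s))"
    unfolding sum by (rule gl_fun_quotient[OF g \<open>q * s \<noteq> 0\<close>])
  moreover have "gl_sub g q \<noteq> 0" "gl_sub g s \<noteq> 0" using f f' gl_sub_eq_0_iff[OF g] by auto
  ultimately show ?thesis
    unfolding f(1) f'(1) gl_fun_quotient[OF g f(2)] gl_fun_quotient[OF g f'(2)]
    by (simp add: gl_sub_hom divide_simps)
qed

lemma gl_fun_mult: "gl_fun g (f * f') = gl_fun g f * gl_fun g f'"
proof -
  obtain p q where f: "f = of_mpol p / of_mpol q" "q \<noteq> 0" by (rule ratfun_cases)
  obtain r s where f': "f' = of_mpol r / of_mpol s" "s \<noteq> 0" by (rule ratfun_cases)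
  have sum: "f * f' = of_mpol (p * r) / of_mpol (q * s)" using f f' by (simp add: field_simps)
  have "q * s \<noteq> 0" using f f' by simp
  have "gl_fun g (f * f') = of_mpol (gl_sub g (p * r)) / of_mpol (gl_sub g (q * s))"
    unfolding sum by (rule gl_fun_quotient[OF g \<open>q * s \<noteq> 0\<close>])
  moreover have "gl_sub g q \<noteq> 0" "gl_sub g s \<noteq> 0" using f f' gl_sub_eq_0_iff[OF g] by auto
  ultimately show ?thesis
    unfolding f(1) f'(1) gl_fun_quotient[OF g f(2)] gl_fun_quotient[OF g f'(2)]
    by (simp add: gl_sub_hom divide_simps)
qed

lemma gl_fun_const [simp]: "gl_fun g (const c) = const c"
  by (simp add: const_def gl_fun_of_mpol)

lemma gl_fun_0 [simp]: "gl_fun g 0 = 0"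
  using gl_fun_const[of 0] by simp

lemma gl_fun_1 [simp]: "gl_fun g 1 = 1"
  using gl_fun_const[of 1] by simp

lemma scalar_hom_gl_fun: "scalar_hom (gl_fun g)"
  by (simp add: scalar_hom_def gl_fun_add gl_fun_mult)

lemmas gl_fun_sum = scalar_hom_sum[OF scalar_hom_gl_fun]
  and gl_fun_prod = scalar_hom_prod[OF scalar_hom_gl_fun]
  and gl_fun_power = scalar_hom_power[OF scalar_hom_gl_fun]

lemma gl_fun_minus: "gl_fun g (- f) = - gl_fun g f"
  by (rule additive_minus) (rule gl_fun_add)

lemma gl_fun_inverse_fun: "gl_fun g (inverse f) = inverse (gl_fun g f)"
proof (cases "f = 0")
  case False
  then have "gl_fun g f * gl_fun g (inverse f) = 1" by (simp flip: gl_fun_mult)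
  then show ?thesis by (metis inverse_unique)
qed simp

lemma gl_fun_divide: "gl_fun g (f / f') = gl_fun g f / gl_fun g f'"
  by (simp add: divide_inverse gl_fun_mult gl_fun_inverse_fun)

lemma gl_fun_zvar: "gl_fun g (zvar j) = (\<Sum>i\<in>UNIV. const (g $ i $ j) * zvar i)"
  by (simp add: zvar_def gl_fun_of_mpol gl_pvar_def of_mpol_sum const_def)

lemma gl_fun_zsvar: "gl_fun g (zsvar j) = (\<Sum>i\<in>UNIV. const (matrix_inv g $ j $ i) * zsvar i)"
  by (simp add: zsvar_def gl_fun_of_mpol gl_pvar_def of_mpol_sum const_def)

text \<open>The pairing of V with its dual is invariant: the matrix and its inverse meet in the sum
  over j.\<close>

lemma gl_fun_zzs: "gl_fun g zzs = zzs"
proof -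
  have "gl_fun g zzs = (\<Sum>j\<in>UNIV. \<Sum>i\<in>UNIV. \<Sum>l\<in>UNIV. const (g $ i $ j * matrix_inv g $ j $ l) * (zvar i * zsvar l))"
    by (simp add: zzs_def gl_fun_sum gl_fun_mult gl_fun_zvar gl_fun_zsvar sum_product const_mult mult_ac)
  also have "\<dots> = (\<Sum>i\<in>UNIV. \<Sum>l\<in>UNIV. \<Sum>j\<in>UNIV. const (g $ i $ j * matrix_inv g $ j $ l) * (zvar i * zsvar l))"
    by (subst sum.swap) (intro sum.cong refl sum.swap)
  also have "\<dots> = (\<Sum>i\<in>UNIV. \<Sum>l\<in>UNIV. const ((g ** matrix_inv g) $ i $ l) * (zvar i * zsvar l))"
    by (simp add: matrix_matrix_mult_def const_sum sum_distrib_right)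
  also have "\<dots> = (\<Sum>i\<in>UNIV. \<Sum>l\<in>UNIV. if l = i then zvar i * zsvar i else 0)"
    unfolding matrix_inv_invertible(1)[OF g] by (intro sum.cong refl) (auto simp: mat_def)
  finally show ?thesis by (simp add: zzs_def)
qed

end

lemma gl_fun_gl_fun_inverse:
  fixes g h :: "('k::field, 'n::{finite,linorder}) sqmat"
  assumes "g ** h = mat 1"
  shows "gl_fun h (gl_fun g f) = f"
proof -
  have "h ** g = mat 1" using assms by (simp add: matrix_left_right_inverse)
  then have inv: "invertible g" "invertible h" using assms by (auto simp: invertible_def)
  obtain p q where f: "f = of_mpol p / of_mpol q" "q \<noteq> 0" by (rule ratfun_cases)
  then show ?thesis
    using inv by (simp add: gl_fun_quotient gl_sub_eq_0_iff gl_sub_inverse[OF assms])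
qed

section \<open>The action of the general linear group on forms\<close>

definition gl_wedge :: "('k, 'n) sqmat \<Rightarrow> 'n list \<Rightarrow> ('n::{finite,linorder}, 'k::field) form" where
  "gl_wedge g xs = foldr wedge (map (gl_dzs g) xs) (dzs {})"

text \<open>The image under g of the basis form \<open>dzs S\<close>.\<close>

definition gl_basis :: "('k, 'n) sqmat \<Rightarrow> 'n set \<Rightarrow> ('n::{finite,linorder}, 'k::field) form" where
  "gl_basis g S = gl_wedge g (sorted_list_of_set S)"

lemma wedge_add_left: "wedge (\<alpha> + \<beta>) \<omega> = wedge \<alpha> \<omega> + wedge \<beta> \<omega>"
  by (auto simp: wedge_def fun_eq_iff plus_fun_apply distrib_left distrib_right sum.distrib)

lemma wedge_scale_left: "wedge (scale c \<alpha>) \<omega> = fscale (const c) (wedge \<alpha> \<omega>)"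
  by (auto simp: wedge_def scale_def fscale_def fun_eq_iff sum_distrib_left mult_ac)

lemma gl_wedge_Cons:
  "gl_wedge g (j # xs) = (\<Sum>i\<in>UNIV. fscale (const (matrix_inv g $ j $ i)) (ext i (gl_wedge g xs)))"
  by (simp add: gl_wedge_def gl_dzs_def wedge_scale_left wedge_dzs_single
      additive_sum[of "\<lambda>\<alpha>. wedge \<alpha> _", OF wedge_add_left])

lemma gl_wedge_Nil [simp]: "gl_wedge g [] = dzs {}"
  by (simp add: gl_wedge_def)

lemma gl_basis_empty [simp]: "gl_basis g {} = dzs {}"
  by (simp add: gl_basis_def)

lemma gl_form_conv: "gl_form g \<omega> = (\<Sum>I\<in>UNIV. fscale (gl_fun g (\<omega> I)) (gl_basis g I))"
  by (simp add: gl_form_def gl_basis_def gl_wedge_def fscale_def)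

lemma gl_wedge_degree: "card J \<noteq> length xs \<Longrightarrow> gl_wedge g xs J = 0"
proof (induction xs arbitrary: J)
  case Nil
  then show ?case by (auto simp: dzs_def)
next
  case (Cons j xs)
  then show ?case unfolding gl_wedge_Cons sum_fun_apply fscale_def
    using ext_degree[of "length xs" "gl_wedge g xs" J] by (intro sum.neutral) simp
qed

lemma gl_wedge_const: "\<exists>c. gl_wedge g xs J = const c"
proof (induction xs arbitrary: J)
  case Nil
  show ?case by (cases "J = {}") (auto simp: dzs_def intro: exI[of _ 1] exI[of _ 0])
next
  case (Cons j xs)
  then obtain c where c: "\<And>J. gl_wedge g xs J = const (c J)" by metis
  have "gl_wedge g (j # xs) J = const (\<Sum>i\<in>UNIV. matrix_inv g $ j $ i * (if i \<in> J then sgn_before i J (c (J - {i})) else 0))"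
    unfolding gl_wedge_Cons sum_fun_apply fscale_def const_sum const_mult
    by (intro sum.cong refl) (simp add: ext_def c sgn_before_def)
  then show ?case ..
qed

text \<open>The scalar by which g acts on the top form, mathematically the determinant of the
  inverse of g. What is used are its nonvanishing and its values on torus and unipotent
  elements.\<close>

definition gl_det :: "('k::field, 'n::{finite,linorder}) sqmat \<Rightarrow> 'k" where
  "gl_det g = (SOME d. gl_basis g UNIV UNIV = const d)"

lemma gl_basis_UNIV:
  fixes g :: "('k::field, 'n::{finite,linorder}) sqmat"
  shows "gl_basis g UNIV = fscale (const (gl_det g)) (dzs UNIV)"
proof -
  have "gl_basis g UNIV = fscale (gl_basis g UNIV UNIV) (dzs UNIV)"
  proof (rule top_degree_form)
    fix J :: "'n set" assume "card J \<noteq> CARD('n)"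
    then show "gl_basis g UNIV J = 0" by (simp add: gl_basis_def gl_wedge_degree)
  qed
  moreover have "gl_basis g UNIV UNIV = const (gl_det g)"
    unfolding gl_det_def by (rule someI_ex) (simp add: gl_basis_def gl_wedge_const)
  ultimately show ?thesis by simp
qed

text \<open>Contraction with an arbitrary vector field: the coefficients \<open>zsvar\<close> give
  \<open>contraction\<close>, and the constant columns of g give the fields dual to the transformed
  differentials.\<close>

definition contr :: "('n \<Rightarrow> ('n, 'k) ratfun) \<Rightarrow> ('n::{finite,linorder}, 'k::idom) form \<Rightarrow> ('n, 'k) form" where
  "contr v \<omega> = (\<Sum>i\<in>UNIV. fscale (v i) (intr i \<omega>))"

lemma contr_0 [simp]: "contr v 0 = 0"
  by (simp add: contr_def)

lemma contr_gl_wedge_Cons: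
  "contr v (gl_wedge g (j # xs)) = fscale (\<Sum>i\<in>UNIV. const (matrix_inv g $ j $ i) * v i) (gl_wedge g xs) -
     (\<Sum>i\<in>UNIV. fscale (const (matrix_inv g $ j $ i)) (ext i (contr v (gl_wedge g xs))))"
proof -
  let ?a = "\<lambda>i. const (matrix_inv g $ j $ i)" and ?w = "gl_wedge g xs"
  have "contr v (gl_wedge g (j # xs)) = (\<Sum>l\<in>UNIV. \<Sum>i\<in>UNIV. fscale (?a i * v l) (intr l (ext i ?w)))"
    by (simp add: contr_def gl_wedge_Cons intr_sum intr_fscale fscale_sum mult.commute)
  also have "\<dots> = (\<Sum>l\<in>UNIV. \<Sum>i\<in>UNIV. fscale (?a i * v l) ((if l = i then ?w else 0) - ext i (intr l ?w)))"
    by (intro sum.cong refl arg_cong[of _ _ "fscale _"]) (simp only: eq_diff_eq intr_ext)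
  also have "\<dots> = (\<Sum>l\<in>UNIV. fscale (?a l * v l) ?w) - (\<Sum>l\<in>UNIV. \<Sum>i\<in>UNIV. fscale (?a i * v l) (ext i (intr l ?w)))"
    by (simp add: fscale_distribs sum_subtractf if_distrib[of "fscale _"] cong: if_cong)
  also have "(\<Sum>l\<in>UNIV. \<Sum>i\<in>UNIV. fscale (?a i * v l) (ext i (intr l ?w))) =
      (\<Sum>i\<in>UNIV. fscale (?a i) (ext i (contr v ?w)))"
    by (subst sum.swap) (simp add: contr_def ext_sum ext_fscale fscale_sum)
  finally show ?thesis by (simp only: fscale_sum_left)
qed

lemma sgn_before_min:
  assumes "\<And>i. i \<in> S \<Longrightarrow> j \<le> i"
  shows "sgn_before j S x = x"
proof -
  have "{i \<in> S. i < j} = {}" using assms by force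
  then show ?thesis by (simp only: sgn_before_def) simp
qed

text \<open>Contraction is an antiderivation. The j-th transformed differential pairs with v to the
  displayed sum, and in a sorted list the sign counts the factors in front of it.\<close>

lemma contr_gl_wedge:
  fixes g :: "('k::field, 'n::{finite,linorder}) sqmat"
  assumes "sorted xs" "distinct xs"
  shows "contr v (gl_wedge g xs) = (\<Sum>j\<in>set xs. fscale (sgn_before j (set xs) (\<Sum>i\<in>UNIV. const (matrix_inv g $ j $ i) * v i))
      (gl_wedge g (remove1 j xs)))"
  using assms
proof (induction xs)
  case Nil
  have "intr i (dzs {}) = (0 :: ('n, 'k) form)" for i
    by (auto simp: intr_def dzs_def fun_eq_iff fun_apply)
  then show ?case by (simp add: contr_def)
next
  case (Cons l xs)
  let ?p = "\<lambda>j. \<Sum>i\<in>UNIV. const (matrix_inv g $ j $ i) * v i"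
  have lmin: "l < j" if "j \<in> set xs" for j using Cons.prems that by (force simp: order_less_le)
  have IH: "contr v (gl_wedge g xs) = (\<Sum>j\<in>set xs. fscale (sgn_before j (set xs) (?p j)) (gl_wedge g (remove1 j xs)))"
    using Cons by simp
  have "(\<Sum>i\<in>UNIV. fscale (const (matrix_inv g $ l $ i)) (ext i (contr v (gl_wedge g xs)))) =
      (\<Sum>i\<in>UNIV. \<Sum>j\<in>set xs. fscale (sgn_before j (set xs) (?p j)) (fscale (const (matrix_inv g $ l $ i)) (ext i (gl_wedge g (remove1 j xs)))))"
    unfolding IH by (simp add: ext_sum ext_fscale fscale_sum mult.commute)
  also have "\<dots> = (\<Sum>j\<in>set xs. fscale (sgn_before j (set xs) (?p j)) (gl_wedge g (l # remove1 j xs)))"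
    by (subst sum.swap) (simp only: gl_wedge_Cons fscale_sum)
  also have "\<dots> = (\<Sum>j\<in>set xs. - fscale (sgn_before j (set (l # xs)) (?p j)) (gl_wedge g (remove1 j (l # xs))))"
  proof (intro sum.cong refl)
    fix j assume j: "j \<in> set xs"
    have "l \<notin> set xs" using Cons.prems by simp
    then have "sgn_before j (set (l # xs)) (?p j) = - sgn_before j (set xs) (?p j)"
      using sgn_before_insert[of l "set xs" j "?p j"] lmin[OF j] by auto
    then show "fscale (sgn_before j (set xs) (?p j)) (gl_wedge g (l # remove1 j xs)) =
        - fscale (sgn_before j (set (l # xs)) (?p j)) (gl_wedge g (remove1 j (l # xs)))"
      using lmin[OF j] by simp
  qed
  finally have *: "(\<Sum>i\<in>UNIV. fscale (const (matrix_inv g $ l $ i)) (ext i (contr v (gl_wedge g xs)))) =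
      - (\<Sum>j\<in>set xs. fscale (sgn_before j (set (l # xs)) (?p j)) (gl_wedge g (remove1 j (l # xs))))"
    by (simp only: sum_negf)
  have "sgn_before l (set (l # xs)) (?p l) = ?p l"
    using lmin by (intro sgn_before_min) (auto intro: less_imp_le)
  then show ?case unfolding contr_gl_wedge_Cons * using Cons.prems
    by (simp only: list.set sum.insert finite_set distinct.simps) simp
qed

lemma contr_gl_basis:
  fixes g :: "('k::field, 'n::{finite,linorder}) sqmat"
  shows "contr v (gl_basis g S) = (\<Sum>j\<in>S. fscale (sgn_before j S (\<Sum>i\<in>UNIV. const (matrix_inv g $ j $ i) * v i))
      (gl_basis g (S - {j})))"
  using contr_gl_wedge[of "sorted_list_of_set S" v g]
  by (simp add: gl_basis_def sorted_list_of_set_remove)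

text \<open>If the product of all transformed differentials were zero, contracting with the columns
  of g, which are dual to these differentials, would remove the factors one at a time and end with 1
  = 0.\<close>

lemma gl_det_nonzero:
  fixes g :: "('k::field, 'n::{finite,linorder}) sqmat"
  assumes g: "invertible g"
  shows "gl_det g \<noteq> 0"
proof
  assume "gl_det g = 0"
  have "gl_basis g (UNIV - A) = 0" if "finite A" for A :: "'n set"
    using that
  proof (induction A rule: finite_induct)
    case empty
    then show ?case using \<open>gl_det g = 0\<close> by (simp add: gl_basis_UNIV)
  next
    case (insert k A)
    let ?S = "UNIV - A"
    have dual: "(\<Sum>i\<in>UNIV. const (matrix_inv g $ j $ i) * const (g $ i $ k)) = (if j = k then 1 else 0 :: ('n, 'k) ratfun)" for j
    proof -
      have "(\<Sum>i\<in>UNIV. const (matrix_inv g $ j $ i) * const (g $ i $ k)) = (const ((matrix_inv g ** g) $ j $ k) :: ('n, 'k) ratfun)"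
        by (simp add: matrix_matrix_mult_def const_sum const_mult)
      then show ?thesis by (simp add: matrix_inv_invertible(2)[OF g] mat_def)
    qed
    have "0 = contr (\<lambda>i. const (g $ i $ k)) (gl_basis g ?S)" using insert.IH by simp
    also have "\<dots> = (\<Sum>j\<in>?S. if j = k then fscale (sgn_before k ?S 1) (gl_basis g (?S - {k})) else 0)"
      unfolding contr_gl_basis dual by (intro sum.cong) auto
    also have "\<dots> = fscale (sgn_before k ?S 1) (gl_basis g (?S - {k}))" using insert.hyps by simp
    finally have "gl_basis g (?S - {k}) = 0" by (auto simp: sgn_before_def split: if_splits)
    moreover have "?S - {k} = UNIV - insert k A" by auto
    ultimately show ?case by simp
  qed
  from this[of UNIV] have "dzs {} = (0 :: ('n, 'k) form)" by simp
  then have "dzs {} {} = (0 :: ('n, 'k) ratfun)" by (simp add: zero_fun_apply)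
  then show False by (simp add: dzs_def)
qed

lemma gl_form_add: "invertible g \<Longrightarrow> gl_form g (\<omega> + \<eta>) = gl_form g \<omega> + gl_form g \<eta>"
  by (simp add: gl_form_conv plus_fun_apply gl_fun_add fscale_distribs sum.distrib)

lemma scale_conv: "scale c \<omega> = fscale (const c) \<omega>"
  by (simp add: scale_def fscale_def)

lemma gl_form_scale: "invertible g \<Longrightarrow> gl_form g (scale c \<omega>) = scale c (gl_form g \<omega>)"
  unfolding scale_conv gl_form_conv by (simp add: fscale_def[of "const c" \<omega>] gl_fun_mult fscale_sum)

lemma gl_form_top:
  fixes g :: "('k::field, 'n::{finite,linorder}) sqmat"
  assumes g: "invertible g"
  shows "gl_form g (dzs UNIV) = scale (gl_det g) (dzs UNIV)"
proof -
  have "gl_form g (dzs UNIV) = (\<Sum>I\<in>UNIV. if I = (UNIV :: 'n set) then gl_basis g UNIV else 0)"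
    unfolding gl_form_conv by (rule sum.cong[OF refl]) (simp add: dzs_def g)
  then show ?thesis by (simp add: gl_basis_UNIV scale_def fscale_def)
qed

text \<open>Substitution commutes with the contraction, and \<open>tau\<close> is the contraction of a form of top degree.\<close>

lemma gl_form_tau:
  fixes g :: "('k::field, 'n::{finite,linorder}) sqmat"
  assumes g: "invertible g"
  shows "gl_form g (fscale f tau) = fscale (const (gl_det g) * gl_fun g f) tau"
proof -
  have inj: "inj (\<lambda>i :: 'n. - {i})" by (auto intro: injI)
  have "gl_form g (fscale f tau) = (\<Sum>I\<in>range (\<lambda>i :: 'n. - {i}). fscale (gl_fun g (f * tau I)) (gl_basis g I))"
    unfolding gl_form_conv
  proof (rule sum.mono_neutral_cong_right)
    show "\<forall>I\<in>UNIV - range (\<lambda>i :: 'n. - {i}). fscale (gl_fun g (fscale f tau I)) (gl_basis g I) = 0"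
    proof
      fix I :: "'n set" assume I: "I \<in> UNIV - range (\<lambda>i. - {i})"
      have "card I \<noteq> CARD('n) - 1"
      proof
        assume "card I = CARD('n) - 1"
        then have "card (- I) = 1" by (simp add: card_Diff_subset Compl_eq_Diff_UNIV)
        then obtain i where "- I = {i}" by (auto simp: card_1_singleton_iff)
        then have "I = - {i}" by auto
        with I show False by blast
      qed
      then show "fscale (gl_fun g (fscale f tau I)) (gl_basis g I) = 0"
        using g by (simp add: fscale_def[of f] tau_degree)
    qed
  qed (simp_all add: fscale_def[of f])
  also have "\<dots> = (\<Sum>i\<in>UNIV. fscale (gl_fun g (f * tau (- {i}))) (gl_basis g (- {i})))"
    by (simp add: sum.reindex[OF inj])
  also have "\<dots> = fscale (gl_fun g f) (contraction (gl_basis g UNIV))"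
  proof -
    \<comment> \<open>Expanding along the transformed differentials pairs each of them with the
      field \<open>zsvar\<close>; the results are exactly the transformed
      \<open>zsvar i\<close>.\<close>
    have "contraction (gl_basis g UNIV) = contr zsvar (gl_basis g UNIV)"
      by (simp add: contr_def contraction_conv)
    also have "\<dots> = (\<Sum>i\<in>UNIV. fscale (sgn_before i UNIV (gl_fun g (zsvar i))) (gl_basis g (- {i})))"
      by (simp add: contr_gl_basis gl_fun_zsvar[OF g] Compl_eq_Diff_UNIV)
    finally show ?thesis using g
      by (auto simp: fscale_sum gl_fun_mult tau_compl sgn_before_def gl_fun_minus intro!: sum.cong)
  qed
  also have "\<dots> = fscale (const (gl_det g) * gl_fun g f) tau"
    by (simp add: gl_basis_UNIV contraction_top mult.commute)
  finally show ?thesis .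
qed

lemma gl_det_eqI:
  fixes g :: "('k::field, 'n::{finite,linorder}) sqmat"
  assumes "gl_basis g UNIV = fscale (const d) (dzs UNIV)"
  shows "gl_det g = d"
proof -
  have "fscale (const (gl_det g)) (dzs UNIV) UNIV = fscale (const d) (dzs UNIV) (UNIV :: 'n set)"
    using assms by (simp add: gl_basis_UNIV)
  then show ?thesis by (simp add: fscale_def dzs_def)
qed

section \<open>Torus and unipotent matrices acting on top forms\<close>

lemma torus_mult:
  fixes t s :: "'n::finite \<Rightarrow> 'k::field"
  shows "torus t ** torus s = torus (\<lambda>i. t i * s i)"
  by (simp add: matrix_matrix_mult_def torus_def vec_eq_iff if_distrib[of "\<lambda>x. x * _"] cong: if_cong)

lemma torus_1: "torus (\<lambda>i. 1) = (mat 1 :: ('k::field, 'n::finite) sqmat)"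
  by (simp add: torus_def mat_def)

lemma torus_inverse:
  fixes t :: "'n::finite \<Rightarrow> 'k::field"
  assumes "\<And>i. t i \<noteq> 0"
  shows "torus t ** torus (\<lambda>i. inverse (t i)) = mat 1" "invertible (torus t)"
    "matrix_inv (torus t) = torus (\<lambda>i. inverse (t i))"
proof -
  show "torus t ** torus (\<lambda>i. inverse (t i)) = mat 1" by (simp add: torus_mult assms torus_1)
  from matrix_inv_eq[OF this] show "invertible (torus t)" "matrix_inv (torus t) = torus (\<lambda>i. inverse (t i))" .
qed

lemma gl_wedge_torus:
  fixes t :: "'n::{finite,linorder} \<Rightarrow> 'k::field"
  assumes t: "\<And>i. t i \<noteq> 0" and "sorted xs" "distinct xs"
  shows "gl_wedge (torus t) xs = fscale (const (\<Prod>i\<in>set xs. inverse (t i))) (dzs (set xs))"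
  using assms(2,3)
proof (induction xs)
  case (Cons j xs)
  then have jmin: "j \<notin> set xs" "sgn_before j (set xs) x = x" for x :: "('n, 'k) ratfun"
    by (auto intro: sgn_before_min)
  have "gl_wedge (torus t) (j # xs) = (\<Sum>i\<in>UNIV. if i = j then fscale (const (inverse (t j))) (ext j (gl_wedge (torus t) xs)) else 0)"
    unfolding gl_wedge_Cons torus_inverse(3)[OF t] by (intro sum.cong refl) (auto simp: torus_def)
  also have "\<dots> = fscale (const (inverse (t j))) (ext j (gl_wedge (torus t) xs))" by simp
  also have "\<dots> = fscale (const (\<Prod>i\<in>set (j # xs). inverse (t i))) (dzs (set (j # xs)))"
    using Cons jmin by (simp add: ext_fscale ext_dzs const_mult)
  finally show ?case .
qed simp

lemma gl_det_torus:
  fixes t :: "'n::{finite,linorder} \<Rightarrow> 'k::field"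
  assumes "\<And>i. t i \<noteq> 0"
  shows "gl_det (torus t) = (\<Prod>i\<in>UNIV. inverse (t i))"
  by (rule gl_det_eqI) (simp add: gl_basis_def gl_wedge_torus[OF assms])

text \<open>Back substitution: row i involves only the indices from i on, so the kernel and the
  entries of the inverse are determined from the largest index downwards.\<close>

lemma unipotent_upper_inverse:
  fixes u :: "('k::field, 'n::{finite,linorder}) sqmat"
  assumes u: "unipotent_upper u"
  shows "invertible u" "unipotent_upper (matrix_inv u)"
proof -
  have row: "(\<Sum>k\<in>UNIV. u $ i $ k * f k) = f i + (\<Sum>k\<in>{i<..}. u $ i $ k * f k)" for i and f :: "'n \<Rightarrow> 'k"
  proof -
    have "(\<Sum>k\<in>UNIV. u $ i $ k * f k) = (\<Sum>k\<in>insert i {i<..}. u $ i $ k * f k)"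
      using u by (intro sum.mono_neutral_right) (auto simp: unipotent_upper_def not_less)
    then show ?thesis using u by (simp add: unipotent_upper_def)
  qed
  have down: "P i" if "\<And>i. (\<And>k. i < k \<Longrightarrow> P k) \<Longrightarrow> P i" for P :: "'n \<Rightarrow> bool" and i
  proof (induction "card {i<..}" arbitrary: i rule: less_induct)
    case less
    show ?case
    proof (rule that)
      fix k assume "i < k"
      then have "{k<..} \<subset> {i<..}" by auto
      then show "P k" by (intro less psubset_card_mono) auto
    qed
  qed
  have ker: "x = 0" if "u *v x = 0" for x
  proof -
    have "x $ i = 0" for i
    proof (rule down[of "\<lambda>i. x $ i = 0"])
      fix i assume IH: "\<And>k. i < k \<Longrightarrow> x $ k = 0"
      have "0 = (u *v x) $ i" using that by simp
      also have "\<dots> = x $ i + (\<Sum>k\<in>{i<..}. u $ i $ k * x $ k)"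
        by (simp add: matrix_vector_mult_def row)
      finally show "x $ i = 0" using IH by simp
    qed
    then show ?thesis by (simp add: vec_eq_iff)
  qed
  then obtain B where "B ** u = mat 1" using matrix_left_invertible_ker[of u] by blast
  then have "u ** B = mat 1" by (simp add: matrix_left_right_inverse)
  from matrix_inv_eq[OF this] show inv: "invertible u" by simp
  let ?v = "matrix_inv u"
  have uv: "?v $ i $ j + (\<Sum>k\<in>{i<..}. u $ i $ k * ?v $ k $ j) = (if i = j then 1 else 0)" for i j
  proof -
    have "(u ** ?v) $ i $ j = (if i = j then 1 else 0)"
      by (simp add: matrix_inv_invertible(1)[OF inv] mat_def)
    then show ?thesis by (simp add: matrix_matrix_mult_def row)
  qed
  have lower: "j < i \<longrightarrow> ?v $ i $ j = 0" for i j
  proof (rule down[of "\<lambda>i. j < i \<longrightarrow> ?v $ i $ j = 0"], intro impI)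
    fix i assume IH: "\<And>k. i < k \<Longrightarrow> j < k \<longrightarrow> ?v $ k $ j = 0" and "j < i"
    then have "(\<Sum>k\<in>{i<..}. u $ i $ k * ?v $ k $ j) = 0" by (intro sum.neutral) auto
    then show "?v $ i $ j = 0" using uv[of i j] \<open>j < i\<close> by simp
  qed
  have "?v $ i $ i = 1" for i
  proof -
    have "(\<Sum>k\<in>{i<..}. u $ i $ k * ?v $ k $ i) = 0" using lower by (intro sum.neutral) auto
    then show ?thesis using uv[of i i] by simp
  qed
  with lower show "unipotent_upper ?v" by (auto simp: unipotent_upper_def)
qed

text \<open>The inverse of u adds to the j-th differential a combination of later ones. As the set
  is closed upwards, these already occur in the product and are killed.\<close>

lemma gl_wedge_unipotent:
  fixes u :: "('k::field, 'n::{finite,linorder}) sqmat"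
  assumes u: "unipotent_upper u" and "sorted xs" "distinct xs" "\<And>i k. i \<in> set xs \<Longrightarrow> i \<le> k \<Longrightarrow> k \<in> set xs"
  shows "gl_wedge u xs = dzs (set xs)"
  using assms(2-)
proof (induction xs)
  case (Cons j xs)
  then have jmin: "j \<notin> set xs" "sgn_before j (set xs) x = x" for x :: "('n, 'k) ratfun"
    by (auto intro: sgn_before_min)
  have gt: "j < i \<longleftrightarrow> i \<in> set xs" for i
    using Cons.prems(1,2) Cons.prems(3)[of j i] by (force simp: order_less_le)
  have "k \<in> set xs" if "i \<in> set xs" "i \<le> k" for i k
    using that gt[of i] gt[of k] by (meson order_less_le_trans)
  then have IH: "gl_wedge u xs = dzs (set xs)" using Cons by simp
  have v: "matrix_inv u $ j $ j = 1" "i < j \<Longrightarrow> matrix_inv u $ j $ i = 0" for i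
    using unipotent_upper_inverse(2)[OF u] by (auto simp: unipotent_upper_def)
  have "gl_wedge u (j # xs) = (\<Sum>i\<in>UNIV. if i = j then dzs (set (j # xs)) else 0)"
    unfolding gl_wedge_Cons IH
  proof (intro sum.cong refl)
    fix i
    consider "i < j" | "i = j" | "i \<in> set xs" "i \<noteq> j" using gt[of i] by force
    then show "fscale (const (matrix_inv u $ j $ i)) (ext i (dzs (set xs))) =
        (if i = j then dzs (set (j # xs)) else 0)"
      by cases (simp_all add: v ext_dzs jmin)
  qed
  then show ?case by simp
qed simp

lemma gl_det_unipotent:
  fixes u :: "('k::field, 'n::{finite,linorder}) sqmat"
  assumes "unipotent_upper u"
  shows "gl_det u = 1"
  by (rule gl_det_eqI) (simp add: gl_basis_def gl_wedge_unipotent[OF assms])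

section \<open>Semi-invariant polynomials\<close>

definition eval_at :: "'k^'n \<Rightarrow> 'k^'n \<Rightarrow> ('n::finite var, 'k::comm_ring_1) mpol \<Rightarrow> 'k" where
  "eval_at x y = insertion (\<lambda>c. c) (\<lambda>v. case v of Z i \<Rightarrow> x $ i | Zs i \<Rightarrow> y $ i)"

lemma scalar_hom_eval_at: "scalar_hom (eval_at x y)"
  unfolding eval_at_def by (rule scalar_hom_insertion[OF scalar_hom_id])

lemmas eval_at_hom = scalar_homD[OF scalar_hom_eval_at]

lemma eval_at_const [simp]: "eval_at x y (Poly_Mapping.single 0 c) = c"
  by (simp add: eval_at_def insertion_const[OF scalar_hom_id])

lemma eval_at_pvar [simp]: "eval_at x y (pvar (Z i)) = x $ i" "eval_at x y (pvar (Zs i)) = y $ i"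
  by (simp_all add: eval_at_def insertion_pvar[OF scalar_hom_id])

lemma eval_at_sum: "eval_at x y (sum f A) = (\<Sum>a\<in>A. eval_at x y (f a))"
  by (rule scalar_hom_sum[OF scalar_hom_eval_at])

lemma eval_at_power: "eval_at x y (p ^ k) = eval_at x y p ^ k"
  by (rule scalar_hom_power[OF scalar_hom_eval_at])

lemma eval_at_diff: "eval_at x y (p - q) = eval_at x y p - eval_at x y q"
  by (metis add_diff_cancel_right' diff_add_cancel eval_at_hom(3))

lemma eval_at_zzp: "eval_at x y zzp = (\<Sum>i\<in>UNIV. x $ i * y $ i)"
  by (simp add: zzp_def eval_at_sum eval_at_hom(4))

lemma eval_at_gl_sub: "eval_at x y (gl_sub g p) = eval_at (x v* g) (matrix_inv g *v y) p"
proof -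
  have "eval_at x y (gl_pvar g v) = (case v of Z i \<Rightarrow> (x v* g) $ i | Zs i \<Rightarrow> (matrix_inv g *v y) $ i)" for v
    by (cases v) (simp_all add: gl_pvar_def eval_at_sum eval_at_hom(4) vector_matrix_mult_def matrix_vector_mult_def mult.commute)
  then show ?thesis
    unfolding gl_sub_def eval_at_def[of x y] insertion_insertion[OF scalar_hom_id]
    by (simp add: eval_at_def)
qed

lemma eval_at_scale:
  assumes "zs_homogeneous N p"
  shows "eval_at x (s *s y) p = s ^ N * eval_at x y p"
proof -
  have "monomial_at (\<lambda>v. case v of Z i \<Rightarrow> x $ i | Zs i \<Rightarrow> (s *s y) $ i) m =
      s ^ N * monomial_at (\<lambda>v. case v of Z i \<Rightarrow> x $ i | Zs i \<Rightarrow> y $ i) m" if "m \<in> Poly_Mapping.keys p" for m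
  proof -
    let ?w = "\<lambda>v :: 'a var. (case v of Z i \<Rightarrow> 0 | Zs i \<Rightarrow> Poly_Mapping.lookup m v)"
    have "monomial_at (\<lambda>v. case v of Z i \<Rightarrow> x $ i | Zs i \<Rightarrow> (s *s y) $ i) m =
        (\<Prod>v\<in>UNIV. s ^ ?w v * (case v of Z i \<Rightarrow> x $ i | Zs i \<Rightarrow> y $ i) ^ Poly_Mapping.lookup m v)"
      unfolding monomial_at_superset[OF finite_UNIV_var subset_UNIV]
      by (intro prod.cong refl) (auto simp: power_mult_distrib split: var.splits)
    also have "\<dots> = s ^ (\<Sum>v\<in>UNIV. ?w v) * monomial_at (\<lambda>v. case v of Z i \<Rightarrow> x $ i | Zs i \<Rightarrow> y $ i) m"
      unfolding monomial_at_superset[OF finite_UNIV_var subset_UNIV] by (simp add: prod.distrib power_sum)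
    also have "(\<Sum>v\<in>UNIV. ?w v) = (\<Sum>v\<in>range (Zs :: 'a \<Rightarrow> 'a var). ?w v)"
      by (rule sum.mono_neutral_right[OF finite_UNIV_var]) (auto split: var.splits)
    also have "\<dots> = N"
      using assms that by (simp add: sum.reindex inj_def zs_homogeneous_def)
    finally show ?thesis .
  qed
  then show ?thesis
    by (simp add: eval_at_def insertion_def sum_distrib_left mult_ac)
qed

lemma eval_at_nonzero:
  fixes p :: "('n::finite var, 'k::field_char_0) mpol"
  assumes "p \<noteq> 0"
  shows "\<exists>x y. eval_at x y p \<noteq> 0"
proof -
  obtain \<sigma> where \<sigma>: "insertion (\<lambda>x. x) \<sigma> p \<noteq> 0"
    using insertion_nonzero[OF finite_UNIV_var assms] by blast
  have "(\<lambda>v. case v of Z i \<Rightarrow> (\<chi> i. \<sigma> (Z i)) $ i | Zs i \<Rightarrow> (\<chi> i. \<sigma> (Zs i)) $ i) = \<sigma>"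
    by (auto split: var.splits)
  with \<sigma> have "eval_at (\<chi> i. \<sigma> (Z i)) (\<chi> i. \<sigma> (Zs i)) p \<noteq> 0" by (simp add: eval_at_def)
  then show ?thesis by blast
qed

text \<open>For s vanishing at i0 these matrices are unipotent and multiply by adding s. With their
  transposes they bring a generic point to normal form.\<close>

definition row_unipotent :: "'n \<Rightarrow> 'k^'n \<Rightarrow> ('k::field, 'n::finite) sqmat" where
  "row_unipotent i0 s = (\<chi> i j. (if i = j then 1 else 0) + (if i = i0 then s $ j else 0))"

lemma row_unipotent_mult:
  assumes "s $ i0 = 0"
  shows "row_unipotent i0 s ** row_unipotent i0 r = row_unipotent i0 (s + r)"
proof -
  have "(row_unipotent i0 s ** row_unipotent i0 r) $ i $ j = row_unipotent i0 (s + r) $ i $ j" for i j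
  proof -
    have "(row_unipotent i0 s ** row_unipotent i0 r) $ i $ j =
        (\<Sum>k\<in>UNIV. (if k = i then (if k = j then 1 else 0) else 0) + (if k = i then (if k = i0 then r $ j else 0) else 0)
          + (if k = j then (if i = i0 then s $ j else 0) else 0) + (if k = i0 then (if i = i0 then s $ i0 * r $ j else 0) else 0))"
      unfolding matrix_matrix_mult_def row_unipotent_def vec_lambda_beta
      by (intro sum.cong refl) (auto simp: algebra_simps)
    then show ?thesis using assms by (simp add: sum.distrib row_unipotent_def)
  qed
  then show ?thesis by (simp add: vec_eq_iff)
qed

lemma row_unipotent_0: "row_unipotent i0 0 = mat 1"
  by (simp add: row_unipotent_def mat_def vec_eq_iff)

lemma row_unipotent_inverse:
  assumes "s $ i0 = 0"
  shows "row_unipotent i0 s ** row_unipotent i0 (- s) = mat 1"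
  by (simp add: row_unipotent_mult[OF assms] row_unipotent_0)

text \<open>The entry 2 at i0 makes conjugation double s, which is squaring in the group of these
  matrices.\<close>

lemma torus_row_unipotent:
  fixes s :: "'k::field^'n::finite"
  assumes "s $ i0 = 0"
  shows "torus (\<lambda>i. if i = i0 then 2 else 1) ** row_unipotent i0 s =
    row_unipotent i0 (s + s) ** torus (\<lambda>i. if i = i0 then 2 else 1)"
  using assms
  by (auto simp: matrix_matrix_mult_def torus_def row_unipotent_def vec_eq_iff algebra_simps sum.distrib
      if_distrib[of "\<lambda>x. x * _"] if_distrib[of "\<lambda>x. _ * x"] cong: if_cong)

lemma transpose_torus: "transpose (torus t) = torus t"
  by (auto simp: transpose_def torus_def vec_eq_iff)

text \<open>
  A point \<open>(x, y)\<close> with \<open>x\<^sub>i\<^sub>0 \<noteq> 0\<close> and \<open>xy \<noteq> 0\<close> can be moved to \<open>(e, (xy) e)\<close> by unipotent matrices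
  and a torus element. Unipotent matrices act trivially because a torus element conjugates each of
  them to its square; the torus element acts trivially because it is conjugate to one that fixes the
  point \<open>(e, (xy) e)\<close>.
\<close>

lemma semi_invariant:
  fixes p :: "('n::{finite,linorder} var, 'k::field_char_0) mpol"
  assumes n: "CARD('n) > 1" and hom: "zs_homogeneous N p"
    and "\<And>g. invertible g \<Longrightarrow> \<exists>c. gl_sub g p = Poly_Mapping.single 0 c * p"
  shows "\<exists>c. p = Poly_Mapping.single 0 c * zzp ^ N"
proof (cases "p = 0")
  case True
  then show ?thesis by (intro exI[of _ 0]) simp
next
  case False
  obtain i0 i1 :: 'n where i01: "i0 \<noteq> i1"
    using n by (metis One_nat_def card_le_Suc0_iff_eq finite linorder_not_less UNIV_I)
  obtain ch where ch: "\<And>g. invertible g \<Longrightarrow> gl_sub g p = Poly_Mapping.single 0 (ch g) * p"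
    using assms(3) by metis
  define \<phi> where "\<phi> x y = eval_at x y p" for x y
  have act: "\<phi> (x v* g) (h *v y) = ch g * \<phi> x y" if "g ** h = mat 1" for x y g h
    using eval_at_gl_sub[of x y g p] ch[OF matrix_inv_eq(1)[OF that]] matrix_inv_eq(2)[OF that]
    by (simp add: \<phi>_def eval_at_hom(4))
  define xy :: "('k, 'n) vec \<Rightarrow> ('k, 'n) vec \<Rightarrow> 'k" where "xy x y = (\<Sum>i\<in>UNIV. x $ i * y $ i)" for x y
  \<comment> \<open>A nonzero polynomial stays nonzero after multiplication by the i0-th coordinate
    and by the pairing, so it has a nonzero value at some generic point.\<close>
  have good: "\<exists>x y. eval_at x y q \<noteq> 0 \<and> x $ i0 \<noteq> 0 \<and> xy x y \<noteq> 0" if "q \<noteq> 0" for q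
  proof -
    obtain x y where "eval_at x y (q * pvar (Z i0) * zzp) \<noteq> 0"
      using eval_at_nonzero[of "q * pvar (Z i0) * zzp"] \<open>q \<noteq> 0\<close> by auto
    then show ?thesis by (auto simp: eval_at_hom(4) eval_at_zzp xy_def)
  qed
  obtain x0 y0 where pt: "\<phi> x0 y0 \<noteq> 0" "x0 $ i0 \<noteq> 0" "xy x0 y0 \<noteq> 0"
    using good[OF False] unfolding \<phi>_def by blast
  \<comment> \<open>The factors of semi-invariance form a character, as is seen at a point where p
    does not vanish.\<close>
  have ch_mult: "ch (g1 ** g2) = ch g1 * ch g2" if "g1 ** h1 = mat 1" "g2 ** h2 = mat 1" for g1 g2 h1 h2
  proof -
    have "(g1 ** g2) ** (h2 ** h1) = g1 ** (g2 ** h2) ** h1" by (simp add: matrix_mul_assoc)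
    then have inv: "(g1 ** g2) ** (h2 ** h1) = mat 1" using that by simp
    have "ch (g1 ** g2) * \<phi> x0 y0 = \<phi> (x0 v* (g1 ** g2)) ((h2 ** h1) *v y0)" using act[OF inv] by simp
    also have "\<dots> = \<phi> ((x0 v* g1) v* g2) (h2 *v (h1 *v y0))"
      by (simp add: vector_matrix_mul_assoc matrix_vector_mul_assoc)
    also have "\<dots> = ch g1 * ch g2 * \<phi> x0 y0" by (simp add: act that)
    finally show ?thesis using pt(1) by simp
  qed
  have ch_1: "ch (mat 1) = 1" using act[of "mat 1" "mat 1" x0 y0] pt(1) by simp
  have ch_nz: "ch g \<noteq> 0" if "g ** h = mat 1" for g h
  proof -
    have "h ** g = mat 1" using that by (simp add: matrix_left_right_inverse)
    then have "ch g * ch h = 1" using ch_mult[OF that, of h g] that ch_1 by simp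
    then show ?thesis by auto
  qed
  define D :: "('k, 'n) sqmat" where "D = torus (\<lambda>i. if i = i0 then 2 else 1)"
  obtain D' where D': "D ** D' = mat 1"
    by (rule that, unfold D_def, rule torus_inverse(1)) simp
  have U: "ch (row_unipotent i0 s) = 1" if s: "s $ i0 = 0" for s
  proof -
    let ?U = "row_unipotent i0 s"
    note inv = row_unipotent_inverse[OF s]
    have "(row_unipotent i0 (s + s)) ** row_unipotent i0 (- (s + s)) = mat 1"
      using s by (intro row_unipotent_inverse) simp
    then have "ch D * ch ?U = ch (row_unipotent i0 (s + s)) * ch D"
      using ch_mult[OF D' inv] ch_mult[OF _ D'] torus_row_unipotent[OF s] unfolding D_def[symmetric] by metis
    moreover have "ch (row_unipotent i0 (s + s)) = ch ?U * ch ?U"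
      using ch_mult[OF inv inv] row_unipotent_mult[OF s] by simp
    ultimately show ?thesis using ch_nz[OF D'] ch_nz[OF inv] by simp
  qed
  have L: "ch (transpose (row_unipotent i0 s)) = 1" if s: "s $ i0 = 0" for s
  proof -
    let ?L = "\<lambda>s. transpose (row_unipotent i0 s)"
    have inv: "?L s ** ?L (- s) = mat 1" if "s $ i0 = 0" for s
      using row_unipotent_inverse[of "- s" i0] that by (simp add: matrix_transpose_mul[symmetric] transpose_mat)
    have "?L s ** D = D ** ?L (s + s)"
      using arg_cong[OF torus_row_unipotent[OF s], of transpose]
      by (simp add: matrix_transpose_mul transpose_torus D_def)
    moreover have "?L (s + s) ** ?L (- (s + s)) = mat 1" using s by (intro inv) simp
    ultimately have "ch (?L s) * ch D = ch D * ch (?L (s + s))"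
      using ch_mult[OF inv[OF s] D'] ch_mult[OF D'] by metis
    moreover have "ch (?L (s + s)) = ch (?L s) * ch (?L s)"
      using ch_mult[OF inv[OF s] inv[OF s]] row_unipotent_mult[OF s, of s] by (simp add: matrix_transpose_mul[symmetric])
    ultimately show ?thesis using ch_nz[OF D'] ch_nz[OF inv[OF s]] by simp
  qed
  define e :: "('k, 'n) vec" where "e = axis i0 1"
  have e: "e $ i = (if i = i0 then 1 else 0)" for i by (simp add: e_def axis_def)
  have move: "\<phi> x y = \<phi> (x $ i0 *s e) ((xy x y / x $ i0) *s e)" if x: "x $ i0 \<noteq> 0" and b: "xy x y \<noteq> 0" for x y
  proof -
    \<comment> \<open>The row operation by s clears all coordinates of x except i0. The pairing is
      invariant, so the i0-th coordinate of y becomes \<open>b'\<close>. The transposed operation by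
      r then clears the rest of y and fixes the multiple of e.\<close>
    define s :: "('k, 'n) vec" where "s = (\<chi> j. if j = i0 then 0 else - x $ j / x $ i0)"
    define b' where "b' = xy x y / x $ i0"
    define r :: "('k, 'n) vec" where "r = (\<chi> j. if j = i0 then 0 else - y $ j / b')"
    have s0: "s $ i0 = 0" "r $ i0 = 0" by (simp_all add: s_def r_def)
    have b'0: "b' \<noteq> 0" using x b by (simp add: b'_def)
    have x1: "x v* row_unipotent i0 s = x $ i0 *s e"
      using x by (auto simp: vec_eq_iff vector_matrix_mult_def row_unipotent_def e s_def algebra_simps
          sum.distrib if_distrib[of "\<lambda>c. c * _"] if_distrib[of "\<lambda>c. _ * c"] cong: if_cong)
    have y1: "(row_unipotent i0 (- s) *v y) $ i = (if i = i0 then b' else y $ i)" for i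
    proof -
      have "(row_unipotent i0 (- s) *v y) $ i = y $ i + (if i = i0 then \<Sum>j\<in>UNIV. - s $ j * y $ j else 0)"
        by (simp add: matrix_vector_mult_def row_unipotent_def algebra_simps sum.distrib sum_negf
            if_distrib[of "\<lambda>c. c * _"] if_distrib[of "\<lambda>c. _ * c"] cong: if_cong)
      moreover have "y $ i0 + (\<Sum>j\<in>UNIV. - s $ j * y $ j) = b'"
      proof -
        have "x $ i0 * (\<Sum>j\<in>UNIV. - s $ j * y $ j) = (\<Sum>j\<in>UNIV - {i0}. x $ j * y $ j)"
          unfolding sum_distrib_left using x
          by (rule_tac sum.mono_neutral_cong_right) (auto simp: s_def)
        then have "x $ i0 * (y $ i0 + (\<Sum>j\<in>UNIV. - s $ j * y $ j)) = xy x y"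
          by (simp add: xy_def sum.remove[of UNIV i0] distrib_left)
        then show ?thesis using x by (simp add: b'_def field_simps)
      qed
      ultimately show ?thesis by simp
    qed
    let ?y = "row_unipotent i0 (- s) *v y"
    have inv: "transpose (row_unipotent i0 (- r)) ** transpose (row_unipotent i0 r) = mat 1"
      using row_unipotent_inverse[OF s0(2)] by (simp add: matrix_transpose_mul[symmetric] transpose_mat)
    have x2: "(x $ i0 *s e) v* transpose (row_unipotent i0 (- r)) = x $ i0 *s e"
      using s0(2) by (auto simp: vec_eq_iff vector_matrix_mult_def transpose_def row_unipotent_def e algebra_simps
          sum.distrib if_distrib[of "\<lambda>c. c * _"] if_distrib[of "\<lambda>c. _ * c"] cong: if_cong)
    have "(transpose (row_unipotent i0 r) *v v) $ i = v $ i + r $ i * v $ i0" for v i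
      by (simp add: matrix_vector_mult_def transpose_def row_unipotent_def algebra_simps sum.distrib
          if_distrib[of "\<lambda>c. c * _"] if_distrib[of "\<lambda>c. _ * c"] cong: if_cong)
    then have y2: "transpose (row_unipotent i0 r) *v ?y = b' *s e"
      using b'0 by (auto simp: vec_eq_iff y1 e r_def)
    have "\<phi> x y = \<phi> (x $ i0 *s e) ?y"
      using act[OF row_unipotent_inverse[OF s0(1)], of x y] by (simp add: U[OF s0(1)] x1)
    also have "\<dots> = \<phi> (x $ i0 *s e) (b' *s e)"
    proof -
      have "ch (transpose (row_unipotent i0 (- r))) = 1" using s0(2) by (intro L) simp
      with act[OF inv, of "x $ i0 *s e" ?y, unfolded x2 y2] show ?thesis by (simp only: mult_1_left)
    qed
    finally show ?thesis by (simp add: b'_def)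
  qed
  define T where "T i a = (torus (\<lambda>j. if j = i then a else 1) :: ('k, 'n) sqmat)" for i a
  have T_inv: "T i a ** T i (inverse a) = mat 1" if "a \<noteq> 0" for i a
    using torus_inverse(1)[of "\<lambda>j. if j = i then a else 1"] that
    by (simp add: T_def if_distrib[of inverse] cong: if_cong)
  have T_vec: "(x v* T i a) $ j = (if j = i then a else 1) * x $ j" "(T i a *v x) $ j = (if j = i then a else 1) * x $ j" for i a x j
    by (simp_all add: T_def torus_def vector_matrix_mult_def matrix_vector_mult_def
        if_distrib[of "\<lambda>c. c * _"] if_distrib[of "\<lambda>c. _ * c"] cong: if_cong)
  \<comment> \<open>The normal form is supported at i0, so scaling at i1 fixes it, and p does not
    vanish there.\<close>
  have T1: "ch (T i1 a) = 1" if "a \<noteq> 0" for a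
  proof -
    let ?x = "x0 $ i0 *s e" and ?y = "(xy x0 y0 / x0 $ i0) *s e"
    have "?x v* T i1 a = ?x" "T i1 (inverse a) *v ?y = ?y" using i01 by (auto simp: vec_eq_iff T_vec e)
    then have "\<phi> ?x ?y = ch (T i1 a) * \<phi> ?x ?y" using act[OF T_inv[OF that, of i1], of ?x ?y] by simp
    moreover have "\<phi> ?x ?y \<noteq> 0" using move[OF pt(2,3)] pt(1) by simp
    ultimately show ?thesis by simp
  qed
  \<comment> \<open>The transposition of i0 and i1 conjugates scaling at one index into scaling at
    the other.\<close>
  have T0: "ch (T i0 a) = 1" if a: "a \<noteq> 0" for a
  proof -
    define sw where "sw j = (if j = i0 then i1 else if j = i1 then i0 else j)" for j
    define S :: "('k, 'n) sqmat" where "S = (\<chi> i j. if i = sw j then 1 else 0)"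
    have "sw (sw j) = j" for j by (auto simp: sw_def)
    then have SS: "S ** S = mat 1"
      by (auto simp: S_def matrix_matrix_mult_def mat_def vec_eq_iff if_distrib[of "\<lambda>c. _ * c"] cong: if_cong)
    have "S ** T i1 a = T i0 a ** S"
      using i01 by (auto simp: S_def T_def torus_def matrix_matrix_mult_def vec_eq_iff sw_def
          if_distrib[of "\<lambda>c. _ * c"] if_distrib[of "\<lambda>c. c * _"] cong: if_cong)
    then have "ch S * ch (T i1 a) = ch (T i0 a) * ch S"
      using ch_mult[OF SS T_inv[OF a]] ch_mult[OF T_inv[OF a] SS] by metis
    then show ?thesis using T1[OF a] ch_nz[OF SS] by simp
  qed
  \<comment> \<open>A torus element scales x to e and moves the factor into y; homogeneity in y then
    extracts the N-th power of the pairing.\<close>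
  have val: "\<phi> x y = xy x y ^ N * \<phi> e e" if x: "x $ i0 \<noteq> 0" and b: "xy x y \<noteq> 0" for x y
  proof -
    have "(x $ i0 *s e) v* T i0 (inverse (x $ i0)) = e" "T i0 (x $ i0) *v ((xy x y / x $ i0) *s e) = xy x y *s e"
      using x by (auto simp: vec_eq_iff T_vec e)
    moreover have "T i0 (inverse (x $ i0)) ** T i0 (x $ i0) = mat 1"
      using T_inv[of "inverse (x $ i0)" i0] x by simp
    ultimately have "\<phi> e (xy x y *s e) = ch (T i0 (inverse (x $ i0))) * \<phi> (x $ i0 *s e) ((xy x y / x $ i0) *s e)"
      using act[of "T i0 (inverse (x $ i0))" "T i0 (x $ i0)" "x $ i0 *s e" "(xy x y / x $ i0) *s e"] by simp
    then have "\<phi> x y = \<phi> e (xy x y *s e)" using T0[of "inverse (x $ i0)"] x move[OF x b] by simp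
    then show ?thesis using eval_at_scale[OF hom] by (simp add: \<phi>_def)
  qed
  \<comment> \<open>The difference vanishes at all generic points, hence is the zero
    polynomial.\<close>
  have "p - Poly_Mapping.single 0 (\<phi> e e) * zzp ^ N = 0"
  proof (rule ccontr)
    assume "p - Poly_Mapping.single 0 (\<phi> e e) * zzp ^ N \<noteq> 0"
    from good[OF this] obtain x y where *: "eval_at x y (p - Poly_Mapping.single 0 (\<phi> e e) * zzp ^ N) \<noteq> 0"
      "x $ i0 \<noteq> 0" "xy x y \<noteq> 0" by blast
    then show False using val[OF *(2,3)]
      by (simp add: eval_at_diff eval_at_hom(4) eval_at_power eval_at_zzp \<phi>_def xy_def)
  qed
  then show ?thesis by (intro exI[of _ "\<phi> e e"]) simp
qed

section \<open>The torus action on functions\<close>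

lemma zs_homogeneous_const: "zs_homogeneous 0 (Poly_Mapping.single 0 c)"
  by (rule zs_homogeneous_single) simp

text \<open>Building polynomials one variable factor at a time fits identities proved by the product
  rule.\<close>

lemma mpol_pvar_induct [case_names const pvar add]:
  fixes p :: "('v, 'k::comm_ring_1) mpol"
  assumes "\<And>c. P (Poly_Mapping.single 0 c)" "\<And>v p. P p \<Longrightarrow> P (pvar v * p)" "\<And>p q. P p \<Longrightarrow> P q \<Longrightarrow> P (p + q)"
  shows "P p"
proof (induction p rule: mpol_induct)
  case (single m c)
  show ?case
  proof (induction m rule: update_induct)
    case (update m v k)
    have "P (Poly_Mapping.single (Poly_Mapping.single v k + m) c)"
    proof (induction k)
      case (Suc k)
      have "Poly_Mapping.single v (Suc k) + m = Poly_Mapping.single v 1 + (Poly_Mapping.single v k + m)"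
        by (simp add: add.assoc[symmetric] flip: single_add)
      then have "Poly_Mapping.single (Poly_Mapping.single v (Suc k) + m) c =
          pvar v * Poly_Mapping.single (Poly_Mapping.single v k + m) c"
        by (simp add: pvar_def mult_single)
      with Suc show ?case using assms(2) by simp
    qed (simp add: update.IH)
    moreover have "Poly_Mapping.update v k m = Poly_Mapping.single v k + m"
      using update by (intro poly_mapping_eqI)
        (auto simp: lookup_update lookup_add lookup_single when_def in_keys_iff)
    ultimately show ?case by simp
  qed (rule assms(1))
qed (use assms(1)[of 0] assms(3) in auto)

lemma zs_homogeneous_gl_sub:
  fixes p :: "('n::finite var, 'k::field) mpol"
  assumes "zs_homogeneous e p"
  shows "zs_homogeneous e (gl_sub g p)"
proof -
  let ?d = "\<lambda>v :: 'n var. (case v of Z i \<Rightarrow> 0 | Zs i \<Rightarrow> (1::nat))"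
  have pv: "zs_homogeneous (?d v) (gl_pvar g v)" for v
    using zs_homogeneous_mult[OF zs_homogeneous_const zs_homogeneous_pvar(1)]
      zs_homogeneous_mult[OF zs_homogeneous_const zs_homogeneous_pvar(2)]
    by (cases v) (auto simp: gl_pvar_def intro!: zs_homogeneous_sum)
  have "zs_homogeneous (\<Sum>v\<in>A. ?d v * Poly_Mapping.lookup m v) (\<Prod>v\<in>A. gl_pvar g v ^ Poly_Mapping.lookup m v)" for A m
    by (induction A rule: infinite_finite_induct)
       (auto intro!: zs_homogeneous_mult simp: mult.commute zs_homogeneous_power[OF pv])
  then have mon: "zs_homogeneous (\<Sum>v\<in>UNIV. ?d v * Poly_Mapping.lookup m v) (monomial_at (gl_pvar g) m)" for m
    by (simp add: monomial_at_superset[OF finite_UNIV_var subset_UNIV])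
  have "(\<Sum>v\<in>UNIV. ?d v * Poly_Mapping.lookup m v) = e" if "m \<in> Poly_Mapping.keys p" for m
  proof -
    have "(\<Sum>v\<in>UNIV. ?d v * Poly_Mapping.lookup m v) = (\<Sum>v\<in>range (Zs :: 'n \<Rightarrow> 'n var). ?d v * Poly_Mapping.lookup m v)"
      by (rule sum.mono_neutral_right[OF finite_UNIV_var]) (auto split: var.splits)
    also have "\<dots> = e" using assms that by (simp add: sum.reindex inj_def zs_homogeneous_def)
    finally show ?thesis .
  qed
  with mon show ?thesis unfolding gl_sub_def insertion_def
    by (metis (no_types, lifting) zs_homogeneous_sum zs_homogeneous_mult[OF zs_homogeneous_const] add_0)
qed

lemma gl_fun_coeffs:
  fixes f :: "('n::{finite,linorder}, 'k::field) ratfun"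
  assumes g: "invertible g" and "f \<in> coeffs {} d"
  shows "gl_fun g f \<in> coeffs {} d"
proof -
  obtain p N M e where f: "f = of_mpol p / (zzs ^ N * (\<Prod>i\<in>{}. zvar i) ^ M)" "zs_homogeneous e p" "int e = int N + d"
    using assms(2) by (rule coeffsE)
  have "gl_fun g f = of_mpol (gl_sub g p) / (zzs ^ N * (\<Prod>i\<in>{}. zvar i) ^ M)"
    by (simp add: f(1) gl_fun_divide[OF g] gl_fun_power[OF g] gl_fun_zzs[OF g] gl_fun_of_mpol[OF g])
  then show ?thesis using coeffsI[OF zs_homogeneous_gl_sub[OF f(2)] f(3)] by metis
qed

context
  fixes t :: "'n::{finite,linorder} \<Rightarrow> 'k::field"
  assumes t: "\<And>i. t i \<noteq> 0"
begin

lemma gl_pvar_torus: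
  "gl_pvar (torus t) (Z j) = Poly_Mapping.single 0 (t j) * pvar (Z j)"
  "gl_pvar (torus t) (Zs j) = Poly_Mapping.single 0 (inverse (t j)) * pvar (Zs j)"
proof -
  have "(\<Sum>i\<in>UNIV. Poly_Mapping.single 0 (if i = j then t j else 0) * pvar (Z i)) =
      (\<Sum>i\<in>UNIV. if i = j then Poly_Mapping.single 0 (t j) * pvar (Z j) else (0 :: ('n var, 'k) mpol))"
    by (intro sum.cong) auto
  moreover have "torus t $ i $ j = (if i = j then t j else 0)" for i by (auto simp: torus_def)
  ultimately show "gl_pvar (torus t) (Z j) = Poly_Mapping.single 0 (t j) * pvar (Z j)"
    by (simp add: gl_pvar_def)
  have "(\<Sum>i\<in>UNIV. Poly_Mapping.single 0 (if i = j then inverse (t j) else 0) * pvar (Zs i)) =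
      (\<Sum>i\<in>UNIV. if i = j then Poly_Mapping.single 0 (inverse (t j)) * pvar (Zs j) else (0 :: ('n var, 'k) mpol))"
    by (intro sum.cong) auto
  moreover have "torus (\<lambda>i. inverse (t i)) $ j $ i = (if i = j then inverse (t j) else 0)" for i by (auto simp: torus_def)
  ultimately show "gl_pvar (torus t) (Zs j) = Poly_Mapping.single 0 (inverse (t j)) * pvar (Zs j)"
    by (simp add: gl_pvar_def torus_inverse(3)[OF t])
qed

lemma pderiv_gl_sub_torus:
  "pderiv_mpol (Zs i) (gl_sub (torus t) p) = Poly_Mapping.single 0 (inverse (t i)) * gl_sub (torus t) (pderiv_mpol (Zs i) p)"
proof (induction p rule: mpol_pvar_induct)
  case (const c)
  then show ?case by (simp add: pderiv_mpol_single gl_sub_hom)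
next
  case (pvar v p)
  have "pderiv_mpol (Zs i) (gl_pvar (torus t) v) = (if v = Zs i then Poly_Mapping.single 0 (inverse (t i)) else 0)"
    by (cases v) (simp_all add: gl_pvar_torus pderiv_mpol_mult pderiv_mpol_pvar pderiv_mpol_single)
  then show ?case
    by (simp add: gl_sub_hom pderiv_mpol_mult pvar pderiv_mpol_pvar algebra_simps)
next
  case (add p q)
  then show ?case by (simp add: gl_sub_hom pderiv_mpol_add distrib_left)
qed

text \<open>The chain rule: the substitution multiplies the i-th starred variable by the inverse of
  \<open>t i\<close>. From polynomials it passes to a fraction by differentiating the product with
  the denominator.\<close>

lemma pd_gl_fun_torus: "pd (Zs i) (gl_fun (torus t) f) = const (inverse (t i)) * gl_fun (torus t) (pd (Zs i) f)"
proof -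
  note T = torus_inverse(2)[OF t]
  let ?c = "const (inverse (t i))" and ?g = "gl_fun (torus t)"
  obtain p q where f: "f = of_mpol p / of_mpol q" "q \<noteq> 0" by (rule ratfun_cases)
  have pol: "pd (Zs i) (?g (of_mpol r)) = ?c * ?g (pd (Zs i) (of_mpol r))" for r
    by (simp add: gl_fun_of_mpol[OF T] pd_of_mpol pderiv_gl_sub_torus const_def)
  have fq: "f * of_mpol q = of_mpol p" using f by simp
  have "pd (Zs i) (?g f) * ?g (of_mpol q) + ?g f * pd (Zs i) (?g (of_mpol q)) = pd (Zs i) (?g (f * of_mpol q))"
    by (simp add: gl_fun_mult[OF T] pd_mult)
  also have "\<dots> = ?c * ?g (pd (Zs i) (f * of_mpol q))" unfolding fq by (rule pol)
  also have "\<dots> = ?c * ?g (pd (Zs i) f) * ?g (of_mpol q) + ?g f * pd (Zs i) (?g (of_mpol q))"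
    unfolding pol by (simp add: pd_mult gl_fun_add[OF T] gl_fun_mult[OF T] algebra_simps)
  finally have "pd (Zs i) (?g f) * ?g (of_mpol q) = ?c * ?g (pd (Zs i) f) * ?g (of_mpol q)" by simp
  moreover have "?g (of_mpol q) \<noteq> 0" using f(2) by (simp add: gl_fun_of_mpol[OF T] gl_sub_eq_0_iff[OF T])
  ultimately show ?thesis by simp
qed

lemma gl_fun_torus_divergences:
  assumes "f \<in> divergences"
  shows "gl_fun (torus t) f \<in> divergences"
proof -
  note T = torus_inverse(2)[OF t]
  obtain g where g: "f = (\<Sum>i\<in>UNIV. pd (Zs i) (g i))" "\<And>i. g i \<in> coeffs {} (1 - int CARD('n))"
    using assms unfolding divergences_def by blast
  \<comment> \<open>The factor \<open>t i\<close> compensates the inverse from the chain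
    rule.\<close>
  have "gl_fun (torus t) f = (\<Sum>i\<in>UNIV. pd (Zs i) (const (t i) * gl_fun (torus t) (g i)))"
    unfolding g(1) gl_fun_sum[OF T]
    by (intro sum.cong refl) (simp add: pd_const_mult pd_gl_fun_torus t mult.assoc[symmetric] flip: const_mult)
  moreover have "const (t i) * gl_fun (torus t) (g i) \<in> coeffs {} (1 - int CARD('n))" for i
    by (intro coeffs_const_mult gl_fun_coeffs[OF T] g(2))
  ultimately show ?thesis unfolding divergences_def
    by (intro CollectI exI[of _ "\<lambda>i. const (t i) * gl_fun (torus t) (g i)"]) simp
qed

lemma gl_fun_torus_zvar: "gl_fun (torus t) (zvar i) = const (t i) * zvar i"
  by (simp add: zvar_def gl_fun_of_mpol[OF torus_inverse(2)[OF t]] gl_pvar_torus const_def)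

lemma gl_fun_torus_regular:
  assumes "f \<in> regular I"
  shows "gl_fun (torus t) f \<in> regular I"
proof -
  note T = torus_inverse(2)[OF t]
  obtain p M where f: "f = of_mpol p / (\<Prod>i\<in>I. zvar i) ^ M" "zs_homogeneous 0 p"
    using assms unfolding regular_def by blast
  define c where "c = (\<Prod>i\<in>I. t i) ^ M"
  have "c \<noteq> 0" using t by (simp add: c_def)
  have "gl_fun (torus t) f = of_mpol (gl_sub (torus t) p) / (const c * (\<Prod>i\<in>I. zvar i) ^ M)"
    by (simp add: f(1) gl_fun_divide[OF T] gl_fun_power[OF T] gl_fun_prod[OF T] gl_fun_of_mpol[OF T]
        gl_fun_torus_zvar prod.distrib power_mult_distrib c_def const_power const_prod)
  also have "\<dots> = of_mpol (Poly_Mapping.single 0 (inverse c) * gl_sub (torus t) p) / (\<Prod>i\<in>I. zvar i) ^ M"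
    by (simp add: const_def[symmetric] const_inverse divide_inverse mult_ac)
  finally show ?thesis
    using zs_homogeneous_mult[OF zs_homogeneous_const zs_homogeneous_gl_sub[OF f(2)], of "inverse c" "torus t"]
    unfolding regular_def
    by (intro CollectI exI[of _ "Poly_Mapping.single 0 (inverse c) * gl_sub (torus t) p"] exI[of _ M] conjI) simp_all
qed

end

section \<open>Correspondences between quotient groups\<close>

lemma coset_eq_iff:
  fixes B :: "'a::ab_group_add set"
  assumes "0 \<in> B" "\<And>x y. x \<in> B \<Longrightarrow> y \<in> B \<Longrightarrow> x - y \<in> B"
  shows "coset B x = coset B y \<longleftrightarrow> x - y \<in> B"
proof
  assume "coset B x = coset B y"
  moreover have "x \<in> coset B x" using assms(1) by (force simp: coset_def)
  ultimately have "x \<in> coset B y" by simp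
  then show "x - y \<in> B" by (auto simp: coset_def)
next
  assume xy: "x - y \<in> B"
  have neg: "- b \<in> B" if "b \<in> B" for b using assms(2)[OF assms(1) that] by simp
  have sub: "coset B x \<subseteq> coset B y" if xy: "x - y \<in> B" for x y
  proof
    fix z assume "z \<in> coset B x"
    then obtain b where b: "z = x + b" "b \<in> B" by (auto simp: coset_def)
    have "(x - y) - (- b) \<in> B" using xy neg[OF b(2)] by (rule assms(2))
    moreover have "z = y + ((x - y) - (- b))" using b(1) by simp
    ultimately show "z \<in> coset B y" unfolding coset_def by blast
  qed
  have "y - x \<in> B" using neg[OF xy] by simp
  then show "coset B x = coset B y" using sub[OF xy] sub[of y x] by blast
qed

text \<open>R is a subgroup of pairs with the given kernels. Elements related to members of one
  coset differ by elements related to 0, so they fill exactly one coset on the other side.\<close>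

lemma correspondence_coset:
  fixes BA A :: "'a::ab_group_add set" and BC C :: "'b::ab_group_add set" and R :: "'a \<Rightarrow> 'b \<Rightarrow> bool"
  assumes R: "\<And>x y u v. R x u \<Longrightarrow> R y v \<Longrightarrow> R (x - y) (u - v)"
    and BA: "\<And>x. x \<in> A \<Longrightarrow> R x 0 \<longleftrightarrow> x \<in> BA" and BC: "\<And>u. u \<in> C \<Longrightarrow> R 0 u \<longleftrightarrow> u \<in> BC"
    and A: "BA \<subseteq> A" "0 \<in> A" and C: "BC \<subseteq> C" "\<And>u v. u \<in> C \<Longrightarrow> v \<in> C \<Longrightarrow> u - v \<in> C"
    and xu: "x \<in> A" "u \<in> C" "R x u"
  shows "{v \<in> C. \<exists>y\<in>coset BA x. R y v} = coset BC u"
proof -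
  have R0: "R 0 0" using R[OF xu(3) xu(3)] by simp
  then have "0 \<in> BA" "0 \<in> BC" using BA[OF A(2)] BC[of 0] C(2)[OF xu(2) xu(2)] by auto
  have "v \<in> coset BC u" if "v \<in> C" "y \<in> coset BA x" "R y v" for v y
  proof -
    obtain b where b: "y = x + b" "b \<in> BA" using \<open>y \<in> coset BA x\<close> by (auto simp: coset_def)
    have "R b 0" using BA b(2) A(1) by auto
    have "R (y - x) (v - u)" by (rule R[OF \<open>R y v\<close> xu(3)])
    then have "R (y - x - b) (v - u - 0)" using \<open>R b 0\<close> by (rule R)
    then have "R 0 (v - u)" using b(1) by simp
    then have "v - u \<in> BC" using BC C(2)[OF \<open>v \<in> C\<close> xu(2)] by blast
    moreover have "v = u + (v - u)" by simp
    ultimately show ?thesis unfolding coset_def by blast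
  qed
  moreover have "v \<in> C \<and> (\<exists>y\<in>coset BA x. R y v)" if "v \<in> coset BC u" for v
  proof -
    obtain b where b: "v = u + b" "b \<in> BC" using \<open>v \<in> coset BC u\<close> by (auto simp: coset_def)
    have bC: "b \<in> C" "0 \<in> C" using b(2) C(1) \<open>0 \<in> BC\<close> by auto
    then have "u - (0 - b) \<in> C" using C(2) xu(2) by blast
    then have "v \<in> C" using b(1) by simp
    moreover have "R 0 b" using BC[OF bC(1)] b(2) by simp
    have "R (x - (0 - 0)) (u - (0 - b))" using R[OF xu(3) R[OF R0 \<open>R 0 b\<close>]] .
    then have "R x v" using b(1) by simp
    moreover have "x \<in> coset BA x" using \<open>0 \<in> BA\<close> by (force simp: coset_def)
    ultimately show ?thesis by blast
  qed
  ultimately show ?thesis by blast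
qed

text \<open>Goursat's principle: a subgroup of a product that projects onto both factors is the
  graph of an isomorphism between the quotients by its two kernels.\<close>

lemma correspondence_bij:
  fixes BA A :: "'a::ab_group_add set" and BC C :: "'b::ab_group_add set" and R :: "'a \<Rightarrow> 'b \<Rightarrow> bool"
  assumes R: "\<And>x y u v. R x u \<Longrightarrow> R y v \<Longrightarrow> R (x - y) (u - v)"
    and BA: "\<And>x. x \<in> A \<Longrightarrow> R x 0 \<longleftrightarrow> x \<in> BA" and BC: "\<And>u. u \<in> C \<Longrightarrow> R 0 u \<longleftrightarrow> u \<in> BC"
    and A: "BA \<subseteq> A" "0 \<in> A" "\<And>x y. x \<in> A \<Longrightarrow> y \<in> A \<Longrightarrow> x - y \<in> A"
    and C: "BC \<subseteq> C" "0 \<in> C" "\<And>u v. u \<in> C \<Longrightarrow> v \<in> C \<Longrightarrow> u - v \<in> C"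
    and lt: "\<And>x. x \<in> A \<Longrightarrow> \<exists>u\<in>C. R x u" and rt: "\<And>u. u \<in> C \<Longrightarrow> \<exists>x\<in>A. R x u"
  shows "bij_betw (\<lambda>h. {v \<in> C. \<exists>y\<in>h. R y v}) (coset BA ` A) (coset BC ` C)"
proof -
  let ?F = "\<lambda>h. {v \<in> C. \<exists>y\<in>h. R y v}"
  have F: "?F (coset BA x) = coset BC u" if "x \<in> A" "u \<in> C" "R x u" for x u
    using that by (intro correspondence_coset[of R A BA C BC, OF R BA BC A(1,2) C(1,3)])
  obtain u0 where "u0 \<in> C" "R 0 u0" using lt[OF A(2)] by blast
  then have R0: "R 0 0" using R[of 0 u0 0 u0] by simp
  have subA: "x - y \<in> BA" if "x \<in> BA" "y \<in> BA" for x y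
    using R0 BA A that R[of x 0 y 0] by (auto simp: subset_iff)
  have subC: "x - y \<in> BC" if "x \<in> BC" "y \<in> BC" for x y
    using R0 BC C that R[of 0 x 0 y] by (auto simp: subset_iff)
  have "0 \<in> BA" "0 \<in> BC" using R0 BA BC A C by auto
  show ?thesis
  proof (rule bij_betw_imageI)
    show "inj_on ?F (coset BA ` A)"
    proof (rule inj_onI)
      fix h k assume h: "h \<in> coset BA ` A" and k: "k \<in> coset BA ` A" and eq: "?F h = ?F k"
      obtain x y where x: "h = coset BA x" "x \<in> A" and y: "k = coset BA y" "y \<in> A" using h k by blast
      obtain u v where u: "u \<in> C" "R x u" and v: "v \<in> C" "R y v" using lt x(2) y(2) by blast
      have "coset BC u = coset BC v" using eq F[OF x(2) u] F[OF y(2) v] x y by simp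
      then have "u - v \<in> BC" using coset_eq_iff[of BC u v] \<open>0 \<in> BC\<close> subC by blast
      then have "R 0 (u - v)" using BC C by auto
      then have "R (x - y - 0) (u - v - (u - v))" using R[OF R[OF u(2) v(2)]] by blast
      then have "x - y \<in> BA" using BA A(3)[OF x(2) y(2)] by simp
      then show "h = k" unfolding x y using coset_eq_iff[of BA x y] \<open>0 \<in> BA\<close> subA by blast
    qed
    show "?F ` coset BA ` A = coset BC ` C"
    proof
      show "?F ` coset BA ` A \<subseteq> coset BC ` C"
      proof (clarify del: equalityI)
        fix x assume "x \<in> A"
        then obtain u where u: "u \<in> C" "R x u" using lt by blast
        show "?F (coset BA x) \<in> coset BC ` C" unfolding F[OF \<open>x \<in> A\<close> u] using u(1) by (rule imageI)
      qed
      show "coset BC ` C \<subseteq> ?F ` coset BA ` A"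
      proof
        fix k assume "k \<in> coset BC ` C"
        then obtain u where u: "k = coset BC u" "u \<in> C" by blast
        then obtain x where x: "x \<in> A" "R x u" using rt by blast
        show "k \<in> ?F ` coset BA ` A"
          unfolding u(1) F[OF x(1) u(2) x(2), symmetric] by (intro imageI x(1))
      qed
    qed
  qed
qed

section \<open>The comparison isomorphism\<close>

lemma regular_pd_Z:
  fixes f :: "('n::{finite,linorder}, 'k::idom) ratfun"
  assumes "f \<in> regular I"
  shows "pd (Z i) f \<in> regular I"
proof -
  obtain p M where f: "f = of_mpol p / (\<Prod>i\<in>I. zvar i) ^ M" "zs_homogeneous 0 p"
    using assms unfolding regular_def by blast
  define q :: "('n var, 'k) mpol" where "q = zpol I ^ M"
  have q: "q \<noteq> 0" "zs_homogeneous 0 q"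
    using zs_homogeneous_power[OF zs_homogeneous_zpol[of I], of M] by (simp_all add: q_def)
  have "f = of_mpol p / of_mpol q" by (simp add: f(1) q_def of_mpol_zpol)
  then have pd: "pd (Z i) f = of_mpol (pderiv_mpol (Z i) p * q - p * pderiv_mpol (Z i) q) / of_mpol (q * q)"
    by (simp only: pd_quotient[OF q(1)])
  have "of_mpol (q * q) = (\<Prod>i\<in>I. zvar i) ^ (M + M)" by (simp add: q_def of_mpol_zpol power_add)
  moreover have "zs_homogeneous 0 (pderiv_mpol (Z i) p * q - p * pderiv_mpol (Z i) q)"
    unfolding diff_conv_add_uminus using q(2) f(2)
    by (intro zs_homogeneous_add zs_homogeneous_minus zs_homogeneous_mult[of 0 _ 0, simplified] zs_homogeneous_pderiv_Z)
  ultimately show ?thesis unfolding pd regular_def by (simp only:) blast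
qed

lemma regular_const_mult:
  assumes "f \<in> regular I"
  shows "const c * f \<in> regular I"
proof -
  obtain p M where f: "f = of_mpol p / (\<Prod>i\<in>I. zvar i) ^ M" "zs_homogeneous 0 p"
    using assms unfolding regular_def by blast
  have "const c * f = of_mpol (Poly_Mapping.single 0 c * p) / (\<Prod>i\<in>I. zvar i) ^ M"
    by (simp add: f(1) const_def)
  moreover have "zs_homogeneous 0 (Poly_Mapping.single 0 c * p)"
    using zs_homogeneous_mult[OF zs_homogeneous_const f(2)] by simp
  ultimately show ?thesis unfolding regular_def by blast
qed

lemma regular_sum: "(\<And>a. a \<in> A \<Longrightarrow> f a \<in> regular I) \<Longrightarrow> sum f A \<in> regular I"
  by (induction A rule: infinite_finite_induct) (simp_all add: regular_add)

lemma regular_dop: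
  assumes "f \<in> regular I"
  shows "dop P f \<in> regular I"
  unfolding dop_def pd_monomial_def
  by (intro regular_sum regular_const_mult foldr_pd_induct[of "\<lambda>f. f \<in> regular I"] assms regular_pd_Z)

lemma regular_mono:
  fixes f :: "('n::{finite,linorder}, 'k::idom) ratfun"
  assumes "I \<subseteq> I'" "f \<in> regular I"
  shows "f \<in> regular I'"
proof -
  obtain p M where f: "f = of_mpol p / (\<Prod>i\<in>I. zvar i) ^ M" "zs_homogeneous 0 p"
    using assms(2) unfolding regular_def by blast
  have "(\<Prod>i\<in>I'. zvar i) = of_mpol (zpol (I' - I)) * (\<Prod>i\<in>I. zvar i :: ('n, 'k) ratfun)"
    by (simp add: of_mpol_zpol prod.subset_diff[OF assms(1)])
  then have "f = of_mpol (zpol (I' - I) ^ M * p) / (\<Prod>i\<in>I'. zvar i) ^ M"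
    by (simp add: f(1) power_mult_distrib)
  moreover have "zs_homogeneous 0 (zpol (I' - I) ^ M * p)"
    using zs_homogeneous_mult[OF zs_homogeneous_power[OF zs_homogeneous_zpol] f(2)] by simp
  ultimately show ?thesis unfolding regular_def by blast
qed

lemma inv_z_regular: "const c * (\<Prod>i\<in>UNIV. inverse (zvar i)) \<in> (regular UNIV :: ('n::{finite,linorder}, 'k::idom) ratfun set)"
proof -
  have "const c * (\<Prod>i\<in>UNIV. inverse (zvar i)) = of_mpol (Poly_Mapping.single 0 c) / (\<Prod>i\<in>UNIV. zvar i :: ('n, 'k) ratfun) ^ 1"
    using prod_inversef[of "zvar :: 'n \<Rightarrow> ('n, 'k) ratfun" UNIV] by (simp add: const_def divide_inverse o_def)
  then show ?thesis unfolding regular_def using zs_homogeneous_const by blast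
qed

text \<open>The parameter \<open>ty\<close> only fixes the types.\<close>

context
  fixes ty :: "('n::{finite,linorder} \<times> 'k::field_char_0) itself"
  assumes n: "CARD('n) > 1"
begin

lemma card_pred: "CARD('n) - 1 = Suc (CARD('n) - 2)"
  using n by simp

lemma coboundaries_A:
  "coboundaries dbar A_forms (CARD('n) - 1) = (\<lambda>f. fscale f tau :: ('n, 'k) form) ` divergences"
  unfolding card_pred using dbar_A_forms[OF n] by simp

lemma coboundaries_cech:
  "coboundaries cech_d cech (CARD('n) - 1) = cech_d ` (cech (CARD('n) - 2) :: ('n set \<Rightarrow> ('n, 'k) ratfun) set)"
  unfolding card_pred by simp

text \<open>There are no nonzero forms of degree n in A, so closedness is automatic in degree n -
  1.\<close>

lemma cocycles_A: "cocycles dbar A_forms (CARD('n) - 1) = (A_forms (CARD('n) - 1) :: ('n, 'k) form set)"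
  by (auto simp: cocycles_def dbar_top)

lemma cech_top: "f \<in> cech (CARD('n) - 1) \<longleftrightarrow> f UNIV \<in> regular UNIV \<and> (\<forall>I. I \<noteq> UNIV \<longrightarrow> f I = 0)"
  for f :: "'n set \<Rightarrow> ('n, 'k) ratfun"
proof -
  have "card I = Suc (CARD('n) - 1) \<longleftrightarrow> I = UNIV" for I :: "'n set"
    using n card_eq_UNIV_imp_eq_UNIV[of I] by auto
  then show ?thesis by (auto simp: cech_def)
qed

lemma cocycles_cech: "cocycles cech_d cech (CARD('n) - 1) = (cech (CARD('n) - 1) :: ('n set \<Rightarrow> ('n, 'k) ratfun) set)"
proof -
  have "cech_d f = 0" if "f \<in> cech (CARD('n) - 1)" for f :: "'n set \<Rightarrow> ('n, 'k) ratfun"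
  proof (rule HOL.ext)
    fix I :: "'n set"
    have "I - {i} \<noteq> UNIV" for i by auto
    then show "cech_d f I = 0 I" using that unfolding cech_top by (simp add: cech_d_apply zero_fun_apply)
  qed
  then show ?thesis by (auto simp: cocycles_def)
qed

lemma coboundary_cech_top:
  fixes g :: "'n set \<Rightarrow> ('n, 'k) ratfun"
  assumes "g \<in> cech (CARD('n) - 2)"
  shows "cech_d g \<in> cech (CARD('n) - 1)"
  unfolding cech_top
proof (intro conjI allI impI)
  have g: "g I \<in> regular I" for I
    using assms by (cases "card I = Suc (CARD('n) - 2)") (auto simp: cech_def)
  show "cech_d g UNIV \<in> regular UNIV"
    unfolding cech_d_apply using regular_mono[OF _ g]
    by (intro regular_sum) (auto simp: sgn_before_def intro!: regular_minus)
  show "cech_d g I = 0" if "I \<noteq> UNIV" for I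
  proof (rule cech_d_degree[of "Suc (CARD('n) - 2)"])
    have "card I \<noteq> CARD('n)" using that card_eq_UNIV_imp_eq_UNIV[of I] by auto
    then show "card I \<noteq> Suc (Suc (CARD('n) - 2))" using n by linarith
  qed (use assms in \<open>auto simp: cech_def\<close>)
qed

lemma inv_z_cochain_cech: "inv_z_cochain c \<in> (cech (CARD('n) - 1) :: ('n set \<Rightarrow> ('n, 'k) ratfun) set)"
  unfolding cech_top using inv_z_regular[of c] by (simp add: inv_z_cochain_def)

lemma diff_op_Omega: "diff_op P Omega = (fscale (dop P (inverse zzs ^ CARD('n))) tau :: ('n, 'k) form)"
  by (simp add: Omega_conv diff_op_fscale_tau)

lemma Omega_A_forms: "(Omega :: ('n, 'k) form) \<in> A_forms (CARD('n) - 1)"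
  unfolding Omega_conv by (intro fscale_tau_A_loc coeffs_inverse_zzs_power)

lemma diff_op_Omega_A_forms: "diff_op P (Omega :: ('n, 'k) form) \<in> A_forms (CARD('n) - 1)"
  by (rule diff_op_A_loc[OF Omega_A_forms])

lemma A_forms_multipole:
  assumes "(\<omega> :: ('n, 'k) form) \<in> A_forms (CARD('n) - 1)"
  obtains P \<alpha> where "\<alpha> \<in> A_forms (CARD('n) - 2)" "\<omega> = diff_op P Omega + dbar \<alpha>"
proof -
  obtain f where f: "f \<in> coeffs {} (- int CARD('n))" "\<omega> = fscale f tau" using A_loc_top[OF assms] .
  obtain P g where Pg: "f = dop P (inverse zzs ^ CARD('n)) + g" "g \<in> divergences"
    using coeffs_multipole_exact[OF n f(1)] unfolding multipole_exact_def by blast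
  have "fscale g tau \<in> dbar ` A_forms (CARD('n) - 2)" using dbar_A_forms[OF n] Pg(2) by blast
  then obtain \<alpha> where "\<alpha> \<in> A_forms (CARD('n) - 2)" "fscale g tau = dbar \<alpha>" by blast
  then show thesis using that[of \<alpha> P] by (simp add: f(2) Pg(1) diff_op_Omega fscale_distribs)
qed

lemma diff_op_Omega_exact:
  assumes "diff_op P (Omega :: ('n, 'k) form) \<in> dbar ` A_forms (CARD('n) - 2)"
  shows "P = 0"
proof -
  obtain g where g: "g \<in> divergences" "fscale (dop P (inverse zzs ^ CARD('n))) tau = (fscale g tau :: ('n, 'k) form)"
    using assms unfolding dbar_A_forms[OF n] diff_op_Omega by blast
  then show ?thesis using multipole_unique fscale_tau_inj by metis
qed

text \<open>The constant c from the comparison of \<open>Omega\<close> is only known to be nonzero;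
  it is absorbed into the operator.\<close>

lemma dop_inv_z_cochain:
  assumes "(c :: 'k) \<noteq> 0"
  shows "(\<lambda>I. dop P (inv_z_cochain 1 I)) = (\<lambda>I. dop (Poly_Mapping.single 0 (inverse c) * P) (inv_z_cochain c I :: ('n, 'k) ratfun))"
proof
  fix I
  have c: "inv_z_cochain c I = (inv_z_cochain 1 I :: ('n, 'k) ratfun) * const c"
    by (simp add: inv_z_cochain_def mult.commute)
  have "const (inverse c) * const c = (1 :: ('n, 'k) ratfun)" using assms by (simp flip: const_mult)
  then show "dop P (inv_z_cochain 1 I) = dop (Poly_Mapping.single 0 (inverse c) * P) (inv_z_cochain c I :: ('n, 'k) ratfun)"
    unfolding c dop_const_mult[symmetric] by (simp add: dop_mult mult.left_commute mult.commute[of "const c"])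
qed

lemma cech_multipole:
  fixes f :: "'n set \<Rightarrow> ('n, 'k) ratfun"
  assumes "f \<in> cech (CARD('n) - 1)" "(c :: 'k) \<noteq> 0"
  obtains P g where "g \<in> cech (CARD('n) - 2)" "f = (\<lambda>I. dop P (inv_z_cochain c I)) + cech_d g"
proof -
  have f: "f UNIV \<in> regular UNIV" "\<And>I. I \<noteq> UNIV \<Longrightarrow> f I = 0" using assms(1) unfolding cech_top by auto
  have "f UNIV \<in> multipole_cech" using f(1) by (intro regular_multipole_cech[OF n]) (simp only: cech_top)
  then obtain P g where Pg: "f UNIV = dop P (\<Prod>i\<in>UNIV. inverse (zvar i)) + cech_d g UNIV" "g \<in> cech (CARD('n) - 2)"
    unfolding multipole_cech_def by blast
  have "f = (\<lambda>I. dop P (inv_z_cochain 1 I)) + cech_d g"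
  proof (rule HOL.ext)
    fix I
    show "f I = ((\<lambda>I. dop P (inv_z_cochain 1 I)) + cech_d g) I"
    proof (cases "I = UNIV")
      case True
      then show ?thesis using Pg(1) by (simp add: plus_fun_apply inv_z_cochain_def)
    next
      case False
      then have "cech_d g I = 0" using coboundary_cech_top[OF Pg(2)] unfolding cech_top by blast
      then show ?thesis using f(2) False by (simp add: plus_fun_apply inv_z_cochain_def)
    qed
  qed
  then show thesis using that Pg(2) dop_inv_z_cochain[OF assms(2)] by metis
qed

lemma multipole_in_cech: "(\<lambda>I. dop P (inv_z_cochain c I)) \<in> (cech (CARD('n) - 1) :: ('n set \<Rightarrow> ('n, 'k) ratfun) set)"
  using inv_z_cochain_cech[of c] regular_dop unfolding cech_top by auto

lemma comparable_0_right_iff: "comparable \<omega> 0 \<longleftrightarrow> \<omega> \<in> dbar ` A_forms (CARD('n) - 2)" for \<omega> :: "('n, 'k) form"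
  using comparable_0_imp_exact[OF n] comparable_dbar[OF n] by blast

lemma ex_comparable_right:
  assumes "(\<omega> :: ('n, 'k) form) \<in> A_forms (CARD('n) - 1)"
  shows "\<exists>f\<in>cech (CARD('n) - 1). comparable \<omega> f"
proof -
  obtain c :: 'k where c: "comparable (Omega :: ('n, 'k) form) (inv_z_cochain c)"
    using comparable_Omega[OF n] by blast
  obtain P \<alpha> where \<alpha>: "\<alpha> \<in> A_forms (CARD('n) - 2)" "\<omega> = diff_op P Omega + dbar \<alpha>"
    using A_forms_multipole[OF assms] .
  have "comparable \<omega> ((\<lambda>I. dop P (inv_z_cochain c I)) + 0)"
    unfolding \<alpha>(2) by (intro comparable_add comparable_diff_op c comparable_dbar[OF n \<alpha>(1)])
  then have "comparable \<omega> (\<lambda>I. dop P (inv_z_cochain c I))" by simp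
  then show ?thesis using multipole_in_cech by (rule bexI)
qed

lemma ex_comparable_left:
  fixes f :: "'n set \<Rightarrow> ('n, 'k) ratfun"
  assumes "f \<in> cech (CARD('n) - 1)"
  shows "\<exists>\<omega>\<in>A_forms (CARD('n) - 1). comparable \<omega> f"
proof -
  obtain c :: 'k where c: "c \<noteq> 0" "comparable (Omega :: ('n, 'k) form) (inv_z_cochain c)"
    using comparable_Omega[OF n] by blast
  obtain P g where g: "g \<in> cech (CARD('n) - 2)" "f = (\<lambda>I. dop P (inv_z_cochain c I)) + cech_d g"
    using cech_multipole[OF assms c(1)] .
  have "comparable (diff_op P Omega + 0) f"
    unfolding g(2) by (intro comparable_add comparable_diff_op c comparable_cech_d[OF n g(1)])
  then have "comparable (diff_op P Omega) f" by simp
  then show ?thesis using diff_op_Omega_A_forms by (rule bexI)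
qed

text \<open>Up to a coboundary f is a multipole of the residue cochain. The same operator applied to
  \<open>Omega\<close> is then related to 0, hence gives an exact form, and uniqueness of multipoles
  makes the operator zero.\<close>

lemma comparable_0_left_iff:
  fixes f :: "'n set \<Rightarrow> ('n, 'k) ratfun"
  assumes "f \<in> cech (CARD('n) - 1)"
  shows "comparable 0 f \<longleftrightarrow> f \<in> cech_d ` cech (CARD('n) - 2)"
proof
  assume cf: "comparable 0 f"
  obtain c :: 'k where c: "c \<noteq> 0" "comparable (Omega :: ('n, 'k) form) (inv_z_cochain c)"
    using comparable_Omega[OF n] by blast
  obtain P g where g: "g \<in> cech (CARD('n) - 2)" "f = (\<lambda>I. dop P (inv_z_cochain c I)) + cech_d g"
    using cech_multipole[OF assms c(1)] .
  have "comparable (diff_op P Omega - (0 - 0)) ((\<lambda>I. dop P (inv_z_cochain c I)) - (f - cech_d g))"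
    by (intro comparable_diff comparable_diff_op c cf comparable_cech_d[OF n g(1)])
  then have "comparable (diff_op P (Omega :: ('n, 'k) form)) 0" by (simp add: g(2))
  then have "P = 0" using comparable_0_right_iff diff_op_Omega_exact by blast
  then have "f = cech_d g" by (auto simp: g(2) fun_eq_iff plus_fun_apply)
  then show "f \<in> cech_d ` cech (CARD('n) - 2)" using g(1) by blast
next
  assume "f \<in> cech_d ` cech (CARD('n) - 2)"
  then show "comparable 0 f" using comparable_cech_d[OF n] by blast
qed

lemma comparison_conv: "comparison (CARD('n) - 1) h = {f \<in> cech (CARD('n) - 1). \<exists>\<omega>\<in>h. comparable \<omega> f}"
  for h :: "('n, 'k) form set"
  unfolding comparison_def cocycles_cech comparable_def unfolding card_pred by simp

lemma A_coboundaries_subset: "dbar ` A_forms (CARD('n) - 2) \<subseteq> (A_forms (CARD('n) - 1) :: ('n, 'k) form set)"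
  using A_loc_dbar[of _ "{}" "CARD('n) - 2"] unfolding card_pred by auto

lemma cech_coboundaries_subset: "cech_d ` cech (CARD('n) - 2) \<subseteq> (cech (CARD('n) - 1) :: ('n set \<Rightarrow> ('n, 'k) ratfun) set)"
  using coboundary_cech_top by blast

lemma cech_diff: "f \<in> cech p \<Longrightarrow> g \<in> cech p \<Longrightarrow> f - g \<in> cech p"
  using cech_add[of f p "- g"] cech_minus[of g p] by simp

lemma comparison_bij:
  "bij_betw (comparison (CARD('n) - 1))
     (cohomology dbar A_forms (CARD('n) - 1) :: ('n, 'k) form set set) (cohomology cech_d cech (CARD('n) - 1))"
proof -
  have "bij_betw (\<lambda>h. {f \<in> cech (CARD('n) - 1). \<exists>\<omega>\<in>h. comparable \<omega> f})
      (coset (dbar ` A_forms (CARD('n) - 2)) ` (A_forms (CARD('n) - 1) :: ('n, 'k) form set))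
      (coset (cech_d ` cech (CARD('n) - 2)) ` cech (CARD('n) - 1))"
    by (rule correspondence_bij[where R = comparable])
      (rule comparable_diff comparable_0_right_iff comparable_0_left_iff A_coboundaries_subset cech_coboundaries_subset
         A_loc_0 A_loc_diff cech_0 cech_diff ex_comparable_right ex_comparable_left | assumption)+
  then show ?thesis
    unfolding cohomology_def cocycles_A cocycles_cech comparison_conv[abs_def] unfolding card_pred by simp
qed

lemma comparison_Omega:
  "\<exists>c::'k. c \<noteq> 0 \<and> comparison (CARD('n) - 1) (A_class (CARD('n) - 1) (Omega :: ('n, 'k) form)) =
     cech_class (CARD('n) - 1) (inv_z_cochain c)"
proof -
  obtain c :: 'k where c: "c \<noteq> 0" "comparable (Omega :: ('n, 'k) form) (inv_z_cochain c)"
    using comparable_Omega[OF n] by blast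
  have "{f \<in> cech (CARD('n) - 1). \<exists>\<omega>\<in>coset (dbar ` A_forms (CARD('n) - 2)) (Omega :: ('n, 'k) form). comparable \<omega> f} =
      coset (cech_d ` cech (CARD('n) - 2)) (inv_z_cochain c)"
    by (rule correspondence_coset[where R = comparable and A = "A_forms (CARD('n) - 1)" and C = "cech (CARD('n) - 1)"])
      (rule comparable_diff comparable_0_right_iff comparable_0_left_iff A_coboundaries_subset cech_coboundaries_subset
         A_loc_0 cech_diff Omega_A_forms inv_z_cochain_cech c(2) | assumption)+
  then have "comparison (CARD('n) - 1) (A_class (CARD('n) - 1) (Omega :: ('n, 'k) form)) = cech_class (CARD('n) - 1) (inv_z_cochain c)"
    unfolding comparison_conv unfolding card_pred by simp
  with c(1) show ?thesis by blast
qed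

text \<open>Otherwise \<open>Omega\<close> itself would be related to 0, hence exact, and the
  constant operator 1 would be zero by uniqueness of multipoles.\<close>

lemma inv_z_cochain_not_exact: "(inv_z_cochain 1 :: 'n set \<Rightarrow> ('n, 'k) ratfun) \<notin> cech_d ` cech (CARD('n) - 2)"
proof
  assume "(inv_z_cochain 1 :: 'n set \<Rightarrow> ('n, 'k) ratfun) \<in> cech_d ` cech (CARD('n) - 2)"
  then have R0: "comparable 0 (inv_z_cochain 1 :: 'n set \<Rightarrow> ('n, 'k) ratfun)" using comparable_cech_d[OF n] by auto
  obtain c :: 'k where c: "c \<noteq> 0" "comparable (Omega :: ('n, 'k) form) (inv_z_cochain c)"
    using comparable_Omega[OF n] by blast
  have "pd_monomial 0 f = f" for f :: "('n, 'k) ratfun"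
  proof -
    have "foldr (\<lambda>i. pd (Z i) ^^ Poly_Mapping.lookup 0 i) xs f = f" for xs by (induction xs) simp_all
    then show ?thesis by (simp add: pd_monomial_def)
  qed
  then have dop: "dop (Poly_Mapping.single 0 a) f = const a * f" for a and f :: "('n, 'k) ratfun" by (simp add: dop_single)
  have "comparable (diff_op (Poly_Mapping.single 0 c) 0) (\<lambda>I. dop (Poly_Mapping.single 0 c) (inv_z_cochain 1 I) :: ('n, 'k) ratfun)"
    by (rule comparable_diff_op[OF R0])
  moreover have "(\<lambda>I. dop (Poly_Mapping.single 0 c) (inv_z_cochain 1 I)) = (inv_z_cochain c :: 'n set \<Rightarrow> ('n, 'k) ratfun)"
    by (auto simp: dop inv_z_cochain_def)
  ultimately have "comparable 0 (inv_z_cochain c :: 'n set \<Rightarrow> ('n, 'k) ratfun)" by simp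
  from comparable_diff[OF c(2) this] have "comparable (Omega :: ('n, 'k) form) 0" by simp
  then have "(Omega :: ('n, 'k) form) \<in> dbar ` A_forms (CARD('n) - 2)" by (rule comparable_0_imp_exact[OF n])
  moreover have "diff_op (Poly_Mapping.single 0 1) Omega = (Omega :: ('n, 'k) form)"
    by (simp add: diff_op_conv dop fun_eq_iff del: single_one)
  ultimately have "Poly_Mapping.single 0 (1::'k) = (0 :: ('n, 'k) mpol)" using diff_op_Omega_exact by metis
  then show False by (metis lookup_single_eq lookup_zero one_neq_zero)
qed

end

section \<open>The torus action on the classes\<close>

text \<open>The map h' provides preimages inside B, so h maps B onto itself.\<close>

lemma image_coset:
  fixes h :: "'a::ab_group_add \<Rightarrow> 'a"
  assumes "\<And>x y. h (x + y) = h x + h y" "h ` B \<subseteq> B" "h' ` B \<subseteq> B" "\<And>b. b \<in> B \<Longrightarrow> h (h' b) = b"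
  shows "h ` coset B x = coset B (h x)"
proof -
  have "B \<subseteq> h ` B"
  proof
    fix b assume "b \<in> B"
    then have "h' b \<in> B" "b = h (h' b)" using assms(3,4) by auto
    then show "b \<in> h ` B" by blast
  qed
  then have "h ` B = B" using assms(2) by blast
  moreover have "h ` coset B x = coset (h ` B) (h x)" by (simp add: coset_def image_image assms(1))
  ultimately show ?thesis by simp
qed

lemma coset_0: "coset B (0 :: 'a::ab_group_add) = B"
  by (auto simp: coset_def)

context
  fixes t :: "'n::{finite,linorder} \<Rightarrow> 'k::field_char_0"
  assumes n: "CARD('n) > 1" and t: "\<And>i. t i \<noteq> 0"
begin

lemma gl_fun_torus_inverse:
  "gl_fun (torus t) (gl_fun (torus (\<lambda>i. inverse (t i))) f) = f"
  using gl_fun_gl_fun_inverse[OF torus_inverse(1)[of "\<lambda>i. inverse (t i)"]] t by simp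

lemma gl_form_torus_coboundaries:
  "gl_form (torus t) ` coboundaries dbar A_forms (CARD('n) - 1) \<subseteq> (coboundaries dbar A_forms (CARD('n) - 1) :: ('n, 'k) form set)"
  unfolding coboundaries_A[OF n]
proof clarify
  fix f :: "('n, 'k) ratfun" assume "f \<in> divergences"
  then have "const (gl_det (torus t)) * gl_fun (torus t) f \<in> divergences"
    by (intro divergences_mult gl_fun_torus_divergences[OF t]) (simp_all add: coeffs_const)
  then show "gl_form (torus t) (fscale f tau) \<in> (\<lambda>f. fscale f tau) ` divergences"
    unfolding gl_form_tau[OF torus_inverse(2)[of t, OF t]] by (rule imageI)
qed

lemma gl_fun_torus_cech:
  assumes "f \<in> cech p"
  shows "(\<lambda>I. gl_fun (torus t) (f I) :: ('n, 'k) ratfun) \<in> cech p"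
  unfolding cech_def mem_Collect_eq
proof
  fix I :: "'n set"
  show "if card I = Suc p then gl_fun (torus t) (f I) \<in> regular I else gl_fun (torus t) (f I) = 0"
    using assms gl_fun_torus_regular[OF t, of "f I" I] gl_fun_0[OF torus_inverse(2)[of t, OF t]]
    by (auto simp: cech_def dest: spec[of _ I] split: if_splits)
qed

lemma gl_fun_torus_coboundaries:
  "(\<lambda>f I. gl_fun (torus t) (f I)) ` coboundaries cech_d cech (CARD('n) - 1) \<subseteq>
    (coboundaries cech_d cech (CARD('n) - 1) :: ('n set \<Rightarrow> ('n, 'k) ratfun) set)"
  unfolding coboundaries_cech[OF n]
proof clarify
  fix f :: "'n set \<Rightarrow> ('n, 'k) ratfun" assume f: "f \<in> cech (CARD('n) - 2)"
  have "(\<lambda>I. gl_fun (torus t) (cech_d f I)) = cech_d (\<lambda>I. gl_fun (torus t) (f I))"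
    by (intro HOL.ext additive_cech_d gl_fun_add torus_inverse(2) t)
  then show "(\<lambda>I. gl_fun (torus t) (cech_d f I)) \<in> cech_d ` cech (CARD('n) - 2)"
    using gl_fun_torus_cech[OF f] by simp
qed

end

lemma gl_form_Omega:
  fixes g :: "('k::field_char_0, 'n::{finite,linorder}) sqmat"
  assumes "invertible g"
  shows "gl_form g Omega = scale (gl_det g) Omega"
  by (simp add: Omega_conv gl_form_tau assms scale_conv gl_fun_power gl_fun_inverse_fun gl_fun_zzs)

lemma torus_A_class_Omega:
  fixes t :: "'n::{finite,linorder} \<Rightarrow> 'k::field_char_0"
  assumes n: "CARD('n) > 1" and t: "\<And>i. t i \<noteq> 0"
  shows "gl_form (torus t) ` A_class (CARD('n) - 1) Omega =
    A_class (CARD('n) - 1) (scale (\<Prod>i\<in>UNIV. t i powi (-1)) Omega)"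
proof -
  let ?s = "\<lambda>i. inverse (t i)"
  have T: "invertible (torus t)" "invertible (torus ?s)" using t by (intro torus_inverse(2); simp)+
  have det: "gl_det (torus t) * gl_det (torus ?s) = 1"
    using t by (simp add: gl_det_torus prod.distrib[symmetric])
  have "gl_form (torus t) (gl_form (torus ?s) b) = b" if "b \<in> coboundaries dbar A_forms (CARD('n) - 1)" for b :: "('n, 'k) form"
  proof -
    obtain f where f: "b = fscale f tau" using \<open>b \<in> _\<close> unfolding coboundaries_A[OF n] by blast
    have "const (gl_det (torus t)) * (const (gl_det (torus ?s)) * f) = f"
      by (simp add: det mult.assoc[symmetric] const_mult[symmetric])
    then show ?thesis
      unfolding f gl_form_tau[OF T(1)] gl_form_tau[OF T(2)] gl_fun_mult[OF T(1)] gl_fun_const[OF T(1)]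
        gl_fun_torus_inverse[OF n t] by (rule arg_cong)
  qed
  moreover have "gl_form (torus ?s) ` coboundaries dbar A_forms (CARD('n) - 1) \<subseteq> (coboundaries dbar A_forms (CARD('n) - 1) :: ('n, 'k) form set)"
    using t by (intro gl_form_torus_coboundaries n) simp
  moreover have "gl_form (torus t) Omega = scale (\<Prod>i\<in>UNIV. t i powi (-1)) Omega"
    using t by (simp add: gl_form_Omega T gl_det_torus)
  ultimately show ?thesis
    using image_coset[OF gl_form_add[OF T(1)] gl_form_torus_coboundaries[OF n t]] by metis
qed

lemma torus_cech_class_inv_z:
  fixes t :: "'n::{finite,linorder} \<Rightarrow> 'k::field_char_0"
  assumes n: "CARD('n) > 1" and t: "\<And>i. t i \<noteq> 0"
  shows "(\<lambda>f I. gl_fun (torus t) (f I)) ` cech_class (CARD('n) - 1) (inv_z_cochain 1) =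
    cech_class (CARD('n) - 1) (inv_z_cochain (\<Prod>i\<in>UNIV. t i powi (-1)))"
proof -
  let ?s = "\<lambda>i. inverse (t i)" and ?h = "\<lambda>t f I. gl_fun (torus t) (f I) :: ('n, 'k) ratfun"
  let ?B = "coboundaries cech_d cech (CARD('n) - 1) :: ('n set \<Rightarrow> ('n, 'k) ratfun) set"
  note T = torus_inverse(2)[of t, OF t]
  have "?h t (inv_z_cochain 1) = inv_z_cochain (\<Prod>i\<in>UNIV. t i powi (-1))"
    by (auto simp: inv_z_cochain_def fun_eq_iff gl_fun_mult T gl_fun_prod gl_fun_inverse_fun gl_fun_torus_zvar t
        const_prod const_inverse prod.distrib[symmetric])
  moreover have "?h t ` coset ?B (inv_z_cochain 1) = coset ?B (?h t (inv_z_cochain 1))"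
  proof (rule image_coset)
    show "?h t (x + y) = ?h t x + ?h t y" for x y
      by (simp add: fun_eq_iff plus_fun_apply gl_fun_add T)
    show "?h t ` ?B \<subseteq> ?B" by (rule gl_fun_torus_coboundaries[OF n t])
    show "?h ?s ` ?B \<subseteq> ?B" using t by (intro gl_fun_torus_coboundaries n) simp
    show "?h t (?h ?s b) = b" for b by (simp add: gl_fun_torus_inverse[OF n t])
  qed
  ultimately show ?thesis by simp
qed

section \<open>One-dimensional representations of top degree\<close>

lemma span_line: "form.span {v} = {scale c v | c. True}"
  by (auto simp: form.span_singleton)

lemma gl_irreducible_line:
  fixes v :: "('n::{finite,linorder}, 'k::field) form"
  assumes "v \<noteq> 0" "\<And>g. invertible g \<Longrightarrow> \<exists>c. gl_form g v = scale c v"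
  shows "gl_irreducible (form.span {v})"
  unfolding gl_irreducible_def
proof (intro conjI allI impI)
  show "gl_subrep (form.span {v})"
    unfolding gl_subrep_def
  proof (intro conjI allI impI form.subspace_span)
    fix g :: "('k, 'n) sqmat" and \<omega> assume g: "invertible g" and "\<omega> \<in> form.span {v}"
    then obtain a where "\<omega> = scale a v" by (auto simp: span_line)
    then show "gl_form g \<omega> \<in> form.span {v}"
      using assms(2)[OF g] by (auto simp: gl_form_scale[OF g] span_line)
  qed
  show "form.span {v} \<noteq> {0}" using assms(1) form.span_base[of v "{v}"] by auto
  fix U assume U: "gl_subrep U" "U \<subseteq> form.span {v}"
  then have sub: "form.subspace U" by (simp add: gl_subrep_def)
  show "U = {0} \<or> U = form.span {v}"
  proof (cases "U \<subseteq> {0}")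
    case True
    then show ?thesis using form.subspace_0[OF sub] by auto
  next
    case False
    then obtain u where u: "u \<in> U" "u \<noteq> 0" by auto
    then obtain a where a: "u = scale a v" using U(2) by (auto simp: span_line)
    then have "a \<noteq> 0" using u(2) by auto
    then have "scale (inverse a) u = v" by (simp add: a)
    then have "v \<in> U" using form.subspace_scale[OF sub u(1)] by metis
    then show ?thesis using form.span_minimal[of "{v}" U] sub U(2) by auto
  qed
qed

lemma dim_1_imp_line:
  assumes "form.dim L = 1" "form.subspace L"
  obtains v where "v \<noteq> 0" "L = form.span {v}"
proof -
  obtain B where B: "B \<subseteq> L" "form.independent B" "L \<subseteq> form.span B" "card B = form.dim L"
    by (rule form.basis_exists)
  then obtain v where v: "B = {v}" using assms(1) by (metis card_1_singletonE)
  have "v \<noteq> 0" using B(2) form.dependent_zero[of B] by (auto simp: v)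
  moreover have "form.span {v} \<subseteq> L" using form.span_minimal[OF B(1) assms(2)] by (simp add: v)
  ultimately show thesis using that[of v] B(3) by (auto simp: v)
qed

lemma Omega_nonzero: "(Omega :: ('n::{finite,linorder}, 'k::field_char_0) form) \<noteq> 0"
proof
  assume "(Omega :: ('n, 'k) form) = 0"
  then have "inverse zzs ^ CARD('n) = (0 :: ('n, 'k) ratfun)" unfolding Omega_conv by (rule fscale_tau_eq_0)
  then show False by simp
qed

text \<open>Group elements multiply \<open>tau\<close> by a scalar and fix \<open>zzs\<close>, so
  the numerator p of the coefficient is semi-invariant and therefore a multiple of a power of
  \<open>zzp\<close>.\<close>

lemma gl_stable_line_eq_Omega:
  fixes v :: "('n::{finite,linorder}, 'k::field_char_0) form"
  assumes n: "CARD('n) > 1" and v: "v \<in> A_forms (CARD('n) - 1)"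
    and line: "\<And>g. invertible g \<Longrightarrow> \<exists>c. gl_form g v = scale c v"
  shows "\<exists>c. v = scale c Omega"
proof -
  obtain f where f: "f \<in> coeffs {} (- int CARD('n))" "v = fscale f tau" using A_loc_top[OF v] .
  obtain p N e where p: "f = of_mpol p / zzs ^ N" "zs_homogeneous e p" "int e = int N + - int CARD('n)"
    using coeffsE[OF f(1)] by (metis mult.right_neutral power_one prod.empty)
  have "\<exists>c. gl_sub g p = Poly_Mapping.single 0 c * p" if g: "invertible g" for g
  proof -
    obtain c where "gl_form g v = scale c v" using line[OF g] ..
    then have "const (gl_det g) * gl_fun g f = const c * f"
      unfolding f(2) gl_form_tau[OF g] scale_conv by (simp add: fscale_tau_inj)
    then have "const (gl_det g) * of_mpol (gl_sub g p) = const c * of_mpol p"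
      by (simp add: p(1) gl_fun_divide gl_fun_of_mpol gl_fun_power gl_fun_zzs g)
    then have "of_mpol (gl_sub g p) = const (c / gl_det g) * of_mpol p"
      using gl_det_nonzero[OF g] by (simp add: const_divide field_simps)
    also have "\<dots> = of_mpol (Poly_Mapping.single 0 (c / gl_det g) * p)" by (simp add: const_def)
    finally show ?thesis unfolding of_mpol_eq_iff by blast
  qed
  from semi_invariant[OF n p(2) this] obtain c where c: "p = Poly_Mapping.single 0 c * zzp ^ e" by blast
  \<comment> \<open>The degree -n forces this relation, so exactly n powers of \<open>zzs\<close>
    remain in the denominator.\<close>
  have "N = e + CARD('n)" using p(3) by simp
  then have "f = const c * inverse zzs ^ CARD('n)"
    by (simp add: p(1) c const_def zzs_conv[symmetric] power_add field_simps)
  then show ?thesis by (auto simp: f(2) Omega_conv scale_conv)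
qed

lemma gl_line_Omega_iff:
  fixes L :: "('n::{finite,linorder}, 'k::field_char_0) form set"
  assumes n: "CARD('n) > 1"
  shows "L \<subseteq> A_forms (CARD('n) - 1) \<and> form.dim L = 1 \<and> gl_irreducible L \<longleftrightarrow> L = form.span {Omega}"
proof
  assume L: "L \<subseteq> A_forms (CARD('n) - 1) \<and> form.dim L = 1 \<and> gl_irreducible L"
  then have rep: "gl_subrep L" by (simp add: gl_irreducible_def)
  then obtain v where v: "v \<noteq> 0" "L = form.span {v}" using L dim_1_imp_line gl_subrep_def by metis
  have vL: "v \<in> L" using form.span_base[of v "{v}"] v(2) by simp
  have "\<exists>c. gl_form g v = scale c v" if "invertible g" for g
    using rep vL that unfolding gl_subrep_def v(2) span_line by blast
  then obtain c where c: "v = scale c Omega" using gl_stable_line_eq_Omega[OF n] L vL by blast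
  then have "c \<noteq> 0" using v(1) by auto
  have "v \<in> form.span {Omega}" unfolding c span_line by blast
  moreover have "Omega = scale (inverse c) v" using \<open>c \<noteq> 0\<close> by (simp add: c)
  then have "Omega \<in> form.span {v}" unfolding span_line by blast
  ultimately have "form.span {v} = form.span {Omega}" by (simp add: form.span_eq)
  then show "L = form.span {Omega}" using v(2) by simp
next
  assume L: "L = form.span {Omega}"
  have "scale c Omega \<in> (A_forms (CARD('n) - 1) :: ('n, 'k) form set)" for c
    unfolding scale_conv by (intro A_loc_fscale Omega_A_forms n) simp_all
  then have "L \<subseteq> A_forms (CARD('n) - 1)" by (auto simp: L span_line)
  moreover have "form.dim L = 1"
    unfolding L form.dim_span using Omega_nonzero form.dim_eq_card_independent[of "{Omega :: ('n, 'k) form}"] by simp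
  moreover have "gl_irreducible L"
    unfolding L using gl_form_Omega Omega_nonzero by (intro gl_irreducible_line) auto
  ultimately show "L \<subseteq> A_forms (CARD('n) - 1) \<and> form.dim L = 1 \<and> gl_irreducible L" by blast
qed

lemma is_Sigma_Omega:
  assumes "CARD('n::{finite,linorder}) > 1"
  shows "is_Sigma (\<lambda>_. -1) (form.span {Omega :: ('n, 'k::field_char_0) form})"
  unfolding is_Sigma_def
proof (intro conjI bexI[of _ Omega] allI impI)
  show "gl_irreducible (form.span {Omega :: ('n, 'k) form})" using gl_line_Omega_iff[OF assms] by blast
  show "gl_form u Omega = (Omega :: ('n, 'k) form)" if "unipotent_upper u" for u
    using that by (simp add: gl_form_Omega unipotent_upper_inverse(1) gl_det_unipotent)
  show "gl_form (torus t) Omega = scale (\<Prod>i\<in>UNIV. t i powi (-1)) (Omega :: ('n, 'k) form)"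
    if "\<forall>i. t i \<noteq> 0" for t
    using that by (simp add: gl_form_Omega torus_inverse(2) gl_det_torus)
qed (simp_all add: Omega_nonzero form.span_base)

lemma gl_isomorphic_lines:
  fixes v w :: "('n::{finite,linorder}, 'k::field) form"
  assumes "v \<noteq> 0" "w \<noteq> 0" and v: "\<And>g. invertible g \<Longrightarrow> gl_form g v = scale (\<kappa> g) v"
    and w: "\<And>g. invertible g \<Longrightarrow> gl_form g w = scale (\<kappa> g) w"
  shows "gl_isomorphic (form.span {v}) (form.span {w})"
proof -
  have inj: "scale a v = scale b v \<longleftrightarrow> a = b" "scale a w = scale b w \<longleftrightarrow> a = b" for a b
    using assms(1,2) by (auto simp: form.scale_cancel_right)
  \<comment> \<open>The coefficient along v is unique because v is nonzero, so the description is
    determined on the line.\<close>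
  define \<phi> where "\<phi> x = scale (THE c. x = scale c v) w" for x
  have \<phi>: "\<phi> (scale c v) = scale c w" for c by (simp only: \<phi>_def inj the_eq_trivial the_sym_eq_trivial)
  have "bij_betw \<phi> (form.span {v}) (form.span {w})"
  proof (rule bij_betw_imageI)
    show "inj_on \<phi> (form.span {v})"
      unfolding span_line by (rule inj_onI) (clarsimp simp only: mem_Collect_eq \<phi> inj)
    have "\<phi> ` range (\<lambda>c. scale c v) = range (\<lambda>c. scale c w)" unfolding image_image \<phi> ..
    then show "\<phi> ` form.span {v} = form.span {w}" unfolding form.span_singleton .
  qed
  moreover have "\<phi> (x + y) = \<phi> x + \<phi> y" if "x \<in> form.span {v}" "y \<in> form.span {v}" for x y
    using that by (auto simp: span_line \<phi> form.scale_left_distrib[symmetric] simp del: form.scale_left_distrib)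
  moreover have "\<phi> (scale c x) = scale c (\<phi> x)" if "x \<in> form.span {v}" for c x
    using that by (auto simp: span_line \<phi>)
  moreover have "\<phi> (gl_form g x) = gl_form g (\<phi> x)" if "x \<in> form.span {v}" "invertible g" for g x
    using that by (auto simp: span_line \<phi> gl_form_scale v w)
  ultimately show ?thesis unfolding gl_isomorphic_def by blast
qed

lemma gl_isomorphic_Omega:
  "gl_isomorphic (form.span {Omega :: ('n::{finite,linorder}, 'k::field_char_0) form}) top_ext_dual"
  unfolding top_ext_dual_def
proof (rule gl_isomorphic_lines[of _ _ gl_det])
  have "dzs UNIV UNIV = (1 :: ('n, 'k) ratfun)" by (simp add: dzs_def)
  then show "dzs UNIV \<noteq> (0 :: ('n, 'k) form)" by (metis zero_fun_apply zero_neq_one)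
qed (simp_all add: Omega_nonzero gl_form_Omega gl_form_top)

section \<open>Classes of multipoles\<close>

lemma A_coboundaries_diff:
  fixes \<alpha> \<beta> :: "('n::{finite,linorder}, 'k::field_char_0) form"
  assumes "CARD('n) > 1" "\<alpha> \<in> coboundaries dbar A_forms (CARD('n) - 1)" "\<beta> \<in> coboundaries dbar A_forms (CARD('n) - 1)"
  shows "\<alpha> - \<beta> \<in> coboundaries dbar A_forms (CARD('n) - 1)"
proof -
  obtain f g where f: "\<alpha> = fscale f tau" "f \<in> divergences" and g: "\<beta> = fscale g tau" "g \<in> divergences"
    using assms(2,3) unfolding coboundaries_A[OF assms(1)] by blast
  have "const (- 1) * g \<in> divergences"
    by (rule divergences_mult[OF g(2) pd_const coeffs_const])
  with f(2) have "f + const (- 1) * g \<in> divergences" by (rule divergences_add)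
  moreover have "\<alpha> - \<beta> = fscale (f + const (- 1) * g) tau" by (simp add: f g fscale_distribs)
  ultimately show ?thesis unfolding coboundaries_A[OF assms(1)] by blast
qed

lemma A_class_eq_iff:
  fixes \<alpha> \<beta> :: "('n::{finite,linorder}, 'k::field_char_0) form"
  assumes "CARD('n) > 1"
  shows "A_class (CARD('n) - 1) \<alpha> = A_class (CARD('n) - 1) \<beta> \<longleftrightarrow> \<alpha> - \<beta> \<in> coboundaries dbar A_forms (CARD('n) - 1)"
proof (rule coset_eq_iff[OF _ A_coboundaries_diff[OF assms]])
  have "(0 :: ('n, 'k) form) = fscale 0 tau" by simp
  then show "(0 :: ('n, 'k) form) \<in> coboundaries dbar A_forms (CARD('n) - 1)"
    unfolding coboundaries_A[OF assms] using divergences_0 by blast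
qed

text \<open>The difference of two multipoles is the multipole of the difference of the polynomials,
  which is exact only if that difference is zero.\<close>

lemma A_class_multipole_unique:
  assumes n: "CARD('n::{finite,linorder}) > 1"
    and h: "h \<in> (cohomology dbar A_forms (CARD('n) - 1) :: ('n, 'k::field_char_0) form set set)"
  shows "\<exists>!P. h = A_class (CARD('n) - 1) (diff_op P Omega)"
proof -
  have B: "coboundaries dbar A_forms (CARD('n) - 1) = (dbar ` A_forms (CARD('n) - 2) :: ('n, 'k) form set)"
    unfolding card_pred[OF n] by simp
  obtain \<omega> where \<omega>: "h = A_class (CARD('n) - 1) \<omega>" "\<omega> \<in> A_forms (CARD('n) - 1)"
    using h unfolding cohomology_def cocycles_A[OF n] by blast
  obtain P \<alpha> where P: "\<alpha> \<in> A_forms (CARD('n) - 2)" "\<omega> = diff_op P Omega + dbar \<alpha>"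
    using A_forms_multipole[OF n \<omega>(2)] .
  show ?thesis
  proof (rule ex1I)
    show "h = A_class (CARD('n) - 1) (diff_op P Omega)"
      unfolding \<omega>(1) A_class_eq_iff[OF n] unfolding B using P by simp
    fix Q assume "h = A_class (CARD('n) - 1) (diff_op Q Omega)"
    then have "A_class (CARD('n) - 1) (diff_op Q Omega) = A_class (CARD('n) - 1) (diff_op P (Omega :: ('n, 'k) form))"
      using \<open>h = A_class (CARD('n) - 1) (diff_op P Omega)\<close> by simp
    then have "diff_op Q Omega - diff_op P Omega \<in> (dbar ` A_forms (CARD('n) - 2) :: ('n, 'k) form set)"
      unfolding A_class_eq_iff[OF n] unfolding B .
    moreover have "diff_op Q Omega - diff_op P Omega = diff_op (Q - P) (Omega :: ('n, 'k) form)"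
      by (simp add: diff_op_conv dop_diff_left fun_eq_iff minus_apply)
    ultimately have "diff_op (Q - P) Omega \<in> (dbar ` A_forms (CARD('n) - 2) :: ('n, 'k) form set)" by simp
    then have "Q - P = 0" by (rule diff_op_Omega_exact[OF n])
    then show "Q = P" by simp
  qed
qed

lemma inv_z_class_nonzero:
  assumes n: "CARD('n::{finite,linorder}) > 1"
  shows "cech_class (CARD('n) - 1) (inv_z_cochain 1 :: 'n set \<Rightarrow> ('n, 'k::field_char_0) ratfun) \<noteq>
    cech_class (CARD('n) - 1) 0"
proof
  let ?B = "cech_d ` cech (CARD('n) - 2) :: ('n set \<Rightarrow> ('n, 'k) ratfun) set"
  assume "cech_class (CARD('n) - 1) (inv_z_cochain 1 :: 'n set \<Rightarrow> ('n, 'k) ratfun) = cech_class (CARD('n) - 1) 0"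
  then have eq: "coset ?B (inv_z_cochain 1) = coset ?B 0" unfolding coboundaries_cech[OF n] .
  have "cech_d 0 = (0 :: 'n set \<Rightarrow> ('n, 'k) ratfun)"
    by (auto simp: cech_d_def fun_eq_iff zero_fun_apply intro!: sum.neutral)
  then have "0 \<in> ?B" using cech_0 by (metis imageI)
  then have "inv_z_cochain 1 \<in> coset ?B (inv_z_cochain 1)" unfolding coset_def by force
  then have "inv_z_cochain 1 \<in> ?B" unfolding eq coset_0 .
  then show False using inv_z_cochain_not_exact[OF n] by blast
qed

theorem proposition1p4p7:
  assumes "CARD('n::{finite,linorder}) > 1"
  shows
    "((Omega :: ('n, 'k::field_char_0) form) \<in> cocycles dbar A_forms (CARD('n) - 1) \<and>
      bij_betw (comparison (CARD('n) - 1))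
        (cohomology dbar A_forms (CARD('n) - 1) :: ('n, 'k) form set set)
        (cohomology cech_d cech (CARD('n) - 1)) \<and>
      (\<exists>c::'k. c \<noteq> 0 \<and>
        comparison (CARD('n) - 1) (A_class (CARD('n) - 1) (Omega :: ('n, 'k) form)) =
          cech_class (CARD('n) - 1) (inv_z_cochain c)) \<and>
      cech_class (CARD('n) - 1) (inv_z_cochain 1 :: 'n set \<Rightarrow> ('n, 'k) ratfun) \<noteq>
        cech_class (CARD('n) - 1) 0 \<and>
      (\<forall>t :: 'n \<Rightarrow> 'k. (\<forall>i. t i \<noteq> 0) \<longrightarrow>
        gl_form (torus t) ` A_class (CARD('n) - 1) Omega =
          A_class (CARD('n) - 1) (scale (\<Prod>i\<in>UNIV. t i powi (-1)) Omega) \<and>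
        (\<lambda>f I. gl_fun (torus t) (f I)) ` cech_class (CARD('n) - 1) (inv_z_cochain 1) =
          cech_class (CARD('n) - 1) (inv_z_cochain (\<Prod>i\<in>UNIV. t i powi (-1))))) \<and>
     ((\<exists>!L :: ('n, 'k) form set.
        L \<subseteq> A_forms (CARD('n) - 1) \<and> form.dim L = 1 \<and> gl_irreducible L) \<and>
      (\<forall>L :: ('n, 'k) form set.
        L \<subseteq> A_forms (CARD('n) - 1) \<and> form.dim L = 1 \<and> gl_irreducible L \<longrightarrow>
          is_Sigma (\<lambda>_. -1) L \<and> gl_isomorphic L top_ext_dual \<and> L = form.span {Omega})) \<and>
     (\<forall>h \<in> (cohomology dbar A_forms (CARD('n) - 1) :: ('n, 'k) form set set).
        \<exists>!P :: ('n, 'k) mpol. h = A_class (CARD('n) - 1) (diff_op P Omega))"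
  \<comment> \<open>All statements about stable lines become statements about the single line
    spanned by \<open>Omega\<close>, and unique existence is immediate.\<close>
  unfolding gl_line_Omega_iff[OF assms]
proof (intro conjI allI ballI impI)
  show "(Omega :: ('n, 'k) form) \<in> cocycles dbar A_forms (CARD('n) - 1)"
    unfolding cocycles_A[OF assms] by (rule Omega_A_forms[OF assms])
  show "is_Sigma (\<lambda>_. -1) L" if "L = form.span {Omega}" for L :: "('n, 'k) form set"
    unfolding that by (rule is_Sigma_Omega[OF assms])
  show "gl_isomorphic L top_ext_dual" if "L = form.span {Omega}" for L :: "('n, 'k) form set"
    unfolding that by (rule gl_isomorphic_Omega)
qed (use assms in \<open>simp_all add: comparison_bij comparison_Omega inv_z_class_nonzero
  torus_A_class_Omega torus_cech_class_inv_z A_class_multipole_unique del: One_nat_def\<close>)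

end
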